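(* The satisfiability problem for the $\mathbf{F},\mathbf{G}$-fragment of PCTL (given a formula of the fragment, decide whether it holds in some state of some Markov chain with finitely or countably infinitely many states) is $\Sigma_1^1$-hard, and the finite satisfiability problem for the $\mathbf{F},\mathbf{G}$-fragment of PCTL (the same question restricted to finite Markov chains) is $\Sigma_1^0$-hard.
   Context: Let $\mathit{AP}$ be a set of atomic propositions. A Markov chain is a triple $M = (S,\mathit{Prob},v)$ with $S$ a finite or countably infinite set of states, $\mathit{Prob}: S\times S \to [0,1]$ a stochastic matrix (rows sum to $1$), and $v: S \to 2^{\mathit{AP}}$ a valuation. A run is an infinite sequence $\pi = s_0 s_1 \ldots$ with $\mathit{Prob}(s_i,s_{i+1}) > 0$ for all $i$; each state $s$ induces the standard probability measure $\mathbb{P}_s$ on runs starting in $s$ (generated by cylinder sets). Formulae of the $\mathbf{F},\mathbf{G}$-fragment of PCTL are given by $\varphi ::= a \mid \neg\varphi \mid \varphi_1 \wedge \varphi_2 \mid \mathbf{F}_{\bowtie r}\varphi \mid \mathbf{G}_{\bowtie r}\varphi$ with $a \in \mathit{AP}$, ${\bowtie} \in \{\geq,>,\leq,<,=,\neq\}$, and $r \in [0,1]$ rational. Semantics: $s \models a$ iff $a \in v(s)$; Boolean connectives as usual; $s \models \mathbf{F}_{\bowtie r}\varphi$ iff $\mathbb{P}_s(\{\pi : \pi(i) \models \varphi \text{ for some } i \geq 0\}) \bowtie r$; $s \models \mathbf{G}_{\bowtie r}\varphi$ iff $\mathbb{P}_s(\{\pi : \pi(i) \models \varphi \text{ for all }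 i \geq 0\}) \bowtie r$. $M$ is a model of $\varphi$ if $s \models \varphi$ for some state $s$ of $M$. $\Sigma_1^0$ and $\Sigma_1^1$ denote the first levels of the arithmetical and analytical hierarchies; hardness is with respect to many-one reductions. *)

theory Defs
  imports "HOL-Probability.Probability" "HOL-Library.Nat_Bijection"
begin

section \<open>Markov chains\<close>

record ('s, 'p) mc =
  states :: "'s set"
  Prob :: "'s \<Rightarrow> 's \<Rightarrow> real"
  val :: "'s \<Rightarrow> 'p set"

definition markov_chain :: "('s, 'p) mc \<Rightarrow> bool" where
  "markov_chain M \<longleftrightarrow>
     countable (states M) \<and>
     (\<forall>s\<in>states M. \<forall>t\<in>states M. 0 \<le> Prob M s t \<and> Prob M s t \<le> 1) \<and>
     (\<forall>s\<in>states M. (Prob M s has_sum 1) (states M))"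

definition runs :: "('s, 'p) mc \<Rightarrow> 's \<Rightarrow> (nat \<Rightarrow> 's) set" where
  "runs M s = {\<pi>. \<pi> 0 = s \<and> (\<forall>i. \<pi> i \<in> states M) \<and> (\<forall>i. Prob M (\<pi> i) (\<pi> (Suc i)) > 0)}"

definition finite_paths :: "('s, 'p) mc \<Rightarrow> 's \<Rightarrow> 's list set" where
  "finite_paths M s = {w. w \<noteq> [] \<and> hd w = s \<and> set w \<subseteq> states M \<and>
     (\<forall>i. Suc i < length w \<longrightarrow> Prob M (w ! i) (w ! Suc i) > 0)}"

definition cylinder :: "('s, 'p) mc \<Rightarrow> 's \<Rightarrow> 's list \<Rightarrow> (nat \<Rightarrow> 's) set" where
  "cylinder M s w = {\<pi> \<in> runs M s. \<forall>i<length w. \<pi> i = w ! i}"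

definition path_weight :: "('s, 'p) mc \<Rightarrow> 's list \<Rightarrow> real" where
  "path_weight M w = (\<Prod>i<length w - 1. Prob M (w ! i) (w ! Suc i))"

text \<open>
  The probability measure on the runs from \<open>s\<close> is the extension of the weights of the cylinders
  to the \<open>\<sigma>\<close>-algebra that they generate; \<open>emeasure_run_measure_cylinder\<close> below shows that the
  extension exists, so that the \<open>extend_measure\<close> does not fall back to its default.
\<close>

definition run_measure :: "('s, 'p) mc \<Rightarrow> 's \<Rightarrow> (nat \<Rightarrow> 's) measure" where
  "run_measure M s =
     extend_measure (runs M s) (finite_paths M s) (cylinder M s) (\<lambda>w. ennreal (path_weight M w))"

lemma cylinder_Pow: "cylinder M s ` finite_paths M s \<subseteq> Pow (runs M s)"
  by (auto simp: cylinder_def)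

lemma space_run_measure [simp]: "space (run_measure M s) = runs M s"
  unfolding run_measure_def by (rule space_extend_measure[OF cylinder_Pow])

lemma sets_run_measure:
  "sets (run_measure M s) = sigma_sets (runs M s) (cylinder M s ` finite_paths M s)"
  unfolding run_measure_def by (rule sets_extend_measure[OF cylinder_Pow])

primrec follow :: "'s \<Rightarrow> (nat \<times> 's \<Rightarrow> 's) \<Rightarrow> nat \<Rightarrow> 's" where
  "follow s \<omega> 0 = s"
| "follow s \<omega> (Suc i) = \<omega> (i, follow s \<omega> i)"

lemma prob_space_step:
  assumes M: "markov_chain M" and t: "t \<in> states M"
  shows "prob_space (density (count_space (states M)) (\<lambda>u. ennreal (Prob M t u)))"
proof (rule prob_spaceI)
  let ?S = "states M"
  have nn: "0 \<le> Prob M t u" if "u \<in> ?S" for u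
    using M t that by (auto simp: markov_chain_def)
  have hs: "(Prob M t has_sum 1) ?S"
    using M t by (auto simp: markov_chain_def)
  have "Infinite_Sum.abs_summable_on (Prob M t) ?S"
    using has_sum_imp_summable[OF hs] nn by (simp cong: summable_on_cong)
  then have abs: "Infinite_Set_Sum.abs_summable_on (Prob M t) ?S"
    using abs_summable_equivalent by blast
  have "(\<integral>\<^sup>+u. ennreal (Prob M t u) \<partial>count_space ?S) = 1"
    using nn_integral_conv_infsetsum[OF abs nn] infsetsum_infsum[OF abs] infsumI[OF hs] by simp
  then show "emeasure (density (count_space ?S) (\<lambda>u. ennreal (Prob M t u)))
      (space (density (count_space ?S) (\<lambda>u. ennreal (Prob M t u)))) = 1"
    by (simp add: emeasure_density cong: nn_integral_cong_simp)
qed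

lemma emeasure_run_measure_cylinder:
  assumes M: "markov_chain M" and s: "s \<in> states M" and w: "w \<in> finite_paths M s"
  shows "emeasure (run_measure M s) (cylinder M s w) = ennreal (path_weight M w)"
proof -
  let ?S = "states M" and ?R = "runs M s" and ?G = "cylinder M s ` finite_paths M s"
  define K where "K t = density (count_space ?S) (\<lambda>u. ennreal (Prob M t u))" for t
  define L where "L j = K (if snd j \<in> ?S then snd j else s)" for j :: "nat \<times> 'a"
  have countS: "countable ?S" using M by (simp add: markov_chain_def)
  have prob_L: "prob_space (L j)" for j
    using prob_space_step[OF M] s by (simp add: L_def K_def)
  interpret L: product_prob_space L UNIV
    by (intro product_prob_space.intro product_sigma_finite.intro product_prob_space_axioms.intro
        prob_space_imp_sigma_finite prob_L)
  define P where "P = Pi\<^sub>M UNIV L"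
  interpret P: prob_space P unfolding P_def by (rule L.P.prob_space_axioms)
  have sets_L: "sets (L j) = sets (count_space ?S)" for j by (simp add: L_def K_def)
  have space_L: "space (L j) = ?S" for j by (simp add: L_def K_def)
  have in_S: "\<omega> j \<in> ?S" if "\<omega> \<in> space P" for \<omega> j
    using that by (cases j) (simp add: P_def space_PiM PiE_def Pi_def space_L)
  have follow_S: "follow s \<omega> i \<in> ?S" if "\<omega> \<in> space P" for \<omega> i
    using in_S[OF that] s by (cases i) auto
  have comp_meas: "(\<lambda>\<omega>. \<omega> j) \<in> measurable P (count_space ?S)" for j
    using measurable_component_singleton[of j UNIV L]
    unfolding P_def measurable_cong_sets[OF refl sets_L] by simp
  have follow_meas: "(\<lambda>\<omega>. follow s \<omega> i) \<in> measurable P (count_space ?S)" for i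
  proof (induction i)
    case 0
    then show ?case using s by simp
  next
    case (Suc i)
    have "(\<lambda>\<omega>. \<omega> (i, follow s \<omega> i)) \<in> measurable P (count_space ?S)"
      by (rule measurable_compose_countable'[OF _ Suc countS]) (rule comp_meas)
    then show ?case by simp
  qed
  have follow_set: "{\<omega>\<in>space P. Q (follow s \<omega> i) (follow s \<omega> j)} \<in> sets P" for Q i j
  proof -
    have "{\<omega>\<in>space P. Q (follow s \<omega> i) (follow s \<omega> j)} =
       (\<Union>t\<in>?S. \<Union>u\<in>{u\<in>?S. Q t u}. ((\<lambda>\<omega>. follow s \<omega> i) -` {t} \<inter> space P) \<inter>
          ((\<lambda>\<omega>. follow s \<omega> j) -` {u} \<inter> space P))"
      using follow_S by auto
    also have "\<dots> \<in> sets P"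
    proof (intro sets.countable_UN'' countS)
      fix t u assume "t \<in> ?S" "u \<in> {u\<in>?S. Q t u}"
      then show "((\<lambda>\<omega>. follow s \<omega> i) -` {t} \<inter> space P) \<inter> ((\<lambda>\<omega>. follow s \<omega> j) -` {u} \<inter> space P)
          \<in> sets P"
        by (intro sets.Int measurable_sets[OF follow_meas]) auto
    qed (use countS in auto)
    finally show ?thesis .
  qed
  define X where "X = {\<omega>\<in>space P. follow s \<omega> \<in> ?R}"
  have X_eq: "X = {\<omega>\<in>space P. \<forall>i. Prob M (follow s \<omega> i) (follow s \<omega> (Suc i)) > 0}"
    using follow_S by (auto simp: X_def runs_def)
  have X_sets: "X \<in> sets P"
    unfolding X_eq
    by (intro sets.sets_Collect_countable_All follow_set)
  have "AE \<omega> in P. \<forall>i. \<forall>t\<in>?S. \<forall>u\<in>?S. Prob M t u = 0 \<longrightarrow> \<omega> (i, t) \<noteq> u"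
    unfolding AE_all_countable AE_ball_countable[OF countS]
  proof (intro allI ballI)
    fix i :: nat and t u assume t: "t \<in> ?S" and u: "u \<in> ?S"
    show "AE \<omega> in P. Prob M t u = 0 \<longrightarrow> \<omega> (i, t) \<noteq> u"
    proof (cases "Prob M t u = 0")
      case True
      have "emeasure P {\<omega>\<in>space P. \<omega> (i, t) \<in> {u}} = emeasure (L (i, t)) {u}"
        unfolding P_def using u by (intro L.emeasure_PiM_Collect_single) (auto simp: sets_L)
      also have "\<dots> = 0"
        using t u True by (simp add: L_def K_def emeasure_density)
      finally have "emeasure P {\<omega>\<in>space P. \<not> (\<omega> (i, t) \<noteq> u)} = 0" by simp
      moreover have "{\<omega>\<in>space P. \<not> (\<omega> (i, t) \<noteq> u)} \<in> sets P"
        using measurable_sets[OF comp_meas, of "{u}" "(i, t)"] u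
        by (auto simp: vimage_def Int_def conj_commute)
      ultimately have "AE \<omega> in P. \<omega> (i, t) \<noteq> u"
        by (subst AE_iff_measurable[OF _ refl]) auto
      then show ?thesis by simp
    qed auto
  qed
  then have AE_X: "AE \<omega> in P. \<omega> \<in> X"
  proof (rule AE_mp, intro AE_I2 impI)
    fix \<omega> assume \<omega>: "\<omega> \<in> space P"
      and *: "\<forall>i. \<forall>t\<in>?S. \<forall>u\<in>?S. Prob M t u = 0 \<longrightarrow> \<omega> (i, t) \<noteq> u"
    have "Prob M (follow s \<omega> i) (follow s \<omega> (Suc i)) > 0" for i
    proof -
      have "follow s \<omega> i \<in> ?S" "follow s \<omega> (Suc i) \<in> ?S" by (rule follow_S[OF \<omega>])+
      moreover from this * have "Prob M (follow s \<omega> i) (follow s \<omega> (Suc i)) \<noteq> 0" by auto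
      ultimately show ?thesis
        using M by (auto simp: markov_chain_def less_le)
    qed
    then show "\<omega> \<in> X" using \<omega> by (auto simp: X_eq)
  qed
  have cyl_pre: "{\<omega>\<in>space P. \<forall>i<length v. follow s \<omega> i = v ! i} \<in> sets P" for v
    using follow_set[of "\<lambda>a _. i < length v \<longrightarrow> a = v ! i" i i for i]
    by (intro sets.sets_Collect_countable_All)
  define N where "N = restrict_space P X"
  have N_meas: "follow s \<in> measurable N (sigma ?R ?G)"
  proof (rule measurable_sigma_sets[OF sets_measure_of[OF cylinder_Pow] cylinder_Pow])
    show "follow s \<in> space N \<rightarrow> ?R"
      by (auto simp: N_def space_restrict_space X_def)
    fix Y assume "Y \<in> ?G"
    then obtain v where v: "v \<in> finite_paths M s" and Y: "Y = cylinder M s v" by auto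
    have "follow s -` Y \<inter> space N = X \<inter> {\<omega>\<in>space P. \<forall>i<length v. follow s \<omega> i = v ! i}"
      by (auto simp: N_def space_restrict_space X_def Y cylinder_def)
    also have "\<dots> \<in> sets N"
      unfolding N_def sets_restrict_space by (rule imageI[OF cyl_pre])
    finally show "follow s -` Y \<inter> space N \<in> sets N" .
  qed
  define D where "D = distr N (sigma ?R ?G) (follow s)"
  have D_cyl: "emeasure D (cylinder M s v) = ennreal (path_weight M v)"
    if v: "v \<in> finite_paths M s" for v
  proof -
    define n where "n = length v - 1"
    have v': "v \<noteq> []" "v ! 0 = s" "\<And>i. i < length v \<Longrightarrow> v ! i \<in> ?S"
      using v by (auto simp: finite_paths_def hd_conv_nth)
    have n: "length v = Suc n" using v' by (simp add: n_def)
    let ?J = "(\<lambda>i. (i, v ! i)) ` {..<n}"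
    have "emeasure D (cylinder M s v) = emeasure N (follow s -` cylinder M s v \<inter> space N)"
      unfolding D_def by (rule emeasure_distr[OF N_meas]) (use v in \<open>simp add: sets_measure_of[OF cylinder_Pow]\<close>)
    also have "follow s -` cylinder M s v \<inter> space N =
        X \<inter> {\<omega>\<in>space P. \<forall>i<length v. follow s \<omega> i = v ! i}"
      by (auto simp: N_def space_restrict_space X_def cylinder_def)
    also have "emeasure N \<dots> = emeasure P \<dots>"
      unfolding N_def using X_sets by (intro emeasure_restrict_space) (auto)
    also have "\<dots> = emeasure P {\<omega>\<in>space P. \<forall>i<length v. follow s \<omega> i = v ! i}"
      using AE_X
      by (intro emeasure_eq_AE sets.Int X_sets cyl_pre) (elim AE_mp, simp)
    also have "{\<omega>\<in>space P. \<forall>i<length v. follow s \<omega> i = v ! i} =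
        {\<omega>\<in>space P. \<forall>j\<in>?J. \<omega> j \<in> {v ! Suc (fst j)}}"
    proof (intro Collect_cong conj_cong refl)
      fix \<omega>
      show "(\<forall>i<length v. follow s \<omega> i = v ! i) \<longleftrightarrow> (\<forall>j\<in>?J. \<omega> j \<in> {v ! Suc (fst j)})"
      proof
        assume *: "\<forall>i<length v. follow s \<omega> i = v ! i"
        show "\<forall>j\<in>?J. \<omega> j \<in> {v ! Suc (fst j)}"
        proof
          fix j assume "j \<in> ?J"
          then obtain i where i: "i < n" and j: "j = (i, v ! i)"
            by (elim imageE) simp
          have "follow s \<omega> i = v ! i" "follow s \<omega> (Suc i) = v ! Suc i"
            by (rule *[rule_format], use i n in simp)+
          then show "\<omega> j \<in> {v ! Suc (fst j)}" by (simp add: j)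
        qed
      next
        assume *: "\<forall>j\<in>?J. \<omega> j \<in> {v ! Suc (fst j)}"
        have "follow s \<omega> i = v ! i" if "i < length v" for i
          using that
        proof (induction i)
          case 0
          then show ?case using v'(2) by simp
        next
          case (Suc i)
          have "(i, v ! i) \<in> ?J" using Suc.prems n by simp
          with * have "\<omega> (i, v ! i) = v ! Suc i" by fastforce
          with Suc show ?case by simp
        qed
        then show "\<forall>i<length v. follow s \<omega> i = v ! i" by blast
      qed
    qed
    also have "emeasure P \<dots> = (\<Prod>j\<in>?J. emeasure (L j) {v ! Suc (fst j)})"
      unfolding P_def by (rule L.emeasure_PiM_Collect) (use v' n in \<open>auto simp: sets_L\<close>)
    also have "\<dots> = (\<Prod>i<n. emeasure (L (i, v ! i)) {v ! Suc i})"
      by (subst prod.reindex) (auto simp: inj_on_def)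
    also have "\<dots> = (\<Prod>i<n. ennreal (Prob M (v ! i) (v ! Suc i)))"
      using v' n by (intro prod.cong) (auto simp: L_def K_def emeasure_density)
    also have "\<dots> = ennreal (path_weight M v)"
      unfolding path_weight_def n_def[symmetric]
      using M v' n by (intro prod_ennreal) (auto simp: markov_chain_def)
    finally show ?thesis .
  qed
  have sets_D: "sets D = sets (run_measure M s)"
    by (simp add: D_def sets_run_measure cylinder_Pow)
  show ?thesis
  proof (rule emeasure_extend_measure[OF run_measure_def _ cylinder_Pow _ _ w, where \<mu>' = "emeasure D"])
    show "positive (sets (run_measure M s)) (emeasure D)"
      using emeasure_positive[of D] by (simp add: sets_D)
    show "countably_additive (sets (run_measure M s)) (emeasure D)"
      using emeasure_countably_additive[of D] by (simp add: sets_D)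
  qed (rule D_cyl)
qed

lemma prob_space_run_measure:
  assumes M: "markov_chain M" and s: "s \<in> states M"
  shows "prob_space (run_measure M s)"
proof
  have "[s] \<in> finite_paths M s" using s by (simp add: finite_paths_def)
  from emeasure_run_measure_cylinder[OF M s this]
  show "emeasure (run_measure M s) (space (run_measure M s)) = 1"
    by (simp add: path_weight_def cylinder_def runs_def cong: conj_cong)
qed


section \<open>The F,G-fragment of PCTL\<close>

datatype cmp = CGe | CGt | CLe | CLt | CEq | CNe

primrec cmp_holds :: "cmp \<Rightarrow> real \<Rightarrow> real \<Rightarrow> bool" where
  "cmp_holds CGe x y \<longleftrightarrow> x \<ge> y"
| "cmp_holds CGt x y \<longleftrightarrow> x > y"
| "cmp_holds CLe x y \<longleftrightarrow> x \<le> y"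
| "cmp_holds CLt x y \<longleftrightarrow> x < y"
| "cmp_holds CEq x y \<longleftrightarrow> x = y"
| "cmp_holds CNe x y \<longleftrightarrow> x \<noteq> y"

datatype 'p pctl =
    Atom 'p
  | Not "'p pctl"
  | And "'p pctl" "'p pctl"
  | Finally cmp rat "'p pctl"
  | Globally cmp rat "'p pctl"

primrec fg_formula :: "'p pctl \<Rightarrow> bool" where
  "fg_formula (Atom a) \<longleftrightarrow> True"
| "fg_formula (Not \<phi>) \<longleftrightarrow> fg_formula \<phi>"
| "fg_formula (And \<phi> \<psi>) \<longleftrightarrow> fg_formula \<phi> \<and> fg_formula \<psi>"
| "fg_formula (Finally c r \<phi>) \<longleftrightarrow> 0 \<le> r \<and> r \<le> 1 \<and> fg_formula \<phi>"
| "fg_formula (Globally c r \<phi>) \<longleftrightarrow> 0 \<le> r \<and> r \<le> 1 \<and> fg_formula \<phi>"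

primrec sat :: "('s, 'p) mc \<Rightarrow> 'p pctl \<Rightarrow> 's \<Rightarrow> bool" where
  "sat M (Atom a) s \<longleftrightarrow> a \<in> val M s"
| "sat M (Not \<phi>) s \<longleftrightarrow> \<not> sat M \<phi> s"
| "sat M (And \<phi> \<psi>) s \<longleftrightarrow> sat M \<phi> s \<and> sat M \<psi> s"
| "sat M (Finally c r \<phi>) s \<longleftrightarrow>
     cmp_holds c (measure (run_measure M s) {\<pi> \<in> runs M s. \<exists>i. sat M \<phi> (\<pi> i)}) (of_rat r)"
| "sat M (Globally c r \<phi>) s \<longleftrightarrow>
     cmp_holds c (measure (run_measure M s) {\<pi> \<in> runs M s. \<forall>i. sat M \<phi> (\<pi> i)}) (of_rat r)"

definition is_model :: "('s, 'p) mc \<Rightarrow> 'p pctl \<Rightarrow> bool" where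
  "is_model M \<phi> \<longleftrightarrow> markov_chain M \<and> (\<exists>s\<in>states M. sat M \<phi> s)"

text \<open>
  HOL cannot quantify over the type of states inside a formula. As every finite or countably
  infinite set is in bijection with a set of natural numbers, and satisfaction is invariant under
  renaming of states, it suffices to range over the chains whose state set is a set of naturals;
  see \<open>satisfiableI\<close> and \<open>finitely_satisfiableI\<close> below, where the type of states is arbitrary.
\<close>

definition satisfiable :: "'p pctl \<Rightarrow> bool" where
  "satisfiable \<phi> \<longleftrightarrow> (\<exists>M :: (nat, 'p) mc. is_model M \<phi>)"

definition finitely_satisfiable :: "'p pctl \<Rightarrow> bool" where
  "finitely_satisfiable \<phi> \<longleftrightarrow> (\<exists>M :: (nat, 'p) mc. finite (states M) \<and> is_model M \<phi>)"

lemma position_sets: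
  assumes M: "markov_chain M"
  shows "{\<pi> \<in> runs M s. Q (\<pi> i)} \<in> sets (run_measure M s)"
proof -
  let ?W = "{w \<in> finite_paths M s. length w = Suc i \<and> Q (w ! i)}"
  have "{\<pi> \<in> runs M s. Q (\<pi> i)} = (\<Union>w\<in>?W. cylinder M s w)"
  proof safe
    fix \<pi> assume \<pi>: "\<pi> \<in> runs M s" "Q (\<pi> i)"
    let ?w = "map \<pi> [0..<Suc i]"
    have nth: "?w ! j = \<pi> j" if "j < Suc i" for j
      using that by (metis add_0 nth_map_upt minus_nat.diff_0)
    have "?w \<in> finite_paths M s"
      using \<pi>(1) nth unfolding finite_paths_def runs_def
      by (auto simp: hd_conv_nth simp del: upt_Suc)
    with \<pi> nth show "\<pi> \<in> (\<Union>w\<in>?W. cylinder M s w)"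
      by (intro UN_I[of ?w]) (auto simp: cylinder_def simp del: upt_Suc)
  qed (auto simp: cylinder_def)
  moreover have "countable ?W"
  proof (rule countable_subset)
    show "?W \<subseteq> lists (states M)" by (auto simp: finite_paths_def)
    show "countable (lists (states M))" using M by (simp add: markov_chain_def)
  qed
  moreover have "cylinder M s w \<in> sets (run_measure M s)" if "w \<in> ?W" for w
    using that by (auto simp: sets_run_measure)
  ultimately show ?thesis by auto
qed

lemma Int_stable_cylinders: "Int_stable (insert {} (cylinder M s ` finite_paths M s))"
proof (rule Int_stableI)
  have *: "cylinder M s v \<inter> cylinder M s w \<in> insert {} (cylinder M s ` finite_paths M s)"
    if "v \<in> finite_paths M s" "w \<in> finite_paths M s" "length v \<le> length w" for v w
  proof (cases "\<forall>i<length v. v ! i = w ! i")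
    case True
    then have "cylinder M s v \<inter> cylinder M s w = cylinder M s w"
      using that by (auto simp: cylinder_def)
    then show ?thesis using that by auto
  next
    case False
    then have "cylinder M s v \<inter> cylinder M s w = {}"
      using that by (fastforce simp: cylinder_def)
    then show ?thesis by auto
  qed
  fix A B assume "A \<in> insert {} (cylinder M s ` finite_paths M s)"
    "B \<in> insert {} (cylinder M s ` finite_paths M s)"
  then consider "A = {} \<or> B = {}" | v w where "v \<in> finite_paths M s" "w \<in> finite_paths M s"
    "A = cylinder M s v" "B = cylinder M s w" by blast
  then show "A \<inter> B \<in> insert {} (cylinder M s ` finite_paths M s)"
  proof cases
    case 2
    then show ?thesis
      using *[of v w] *[of w v] by (cases "length v \<le> length w") (simp_all add: Int_commute)
  qed auto
qed

locale mc_iso =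
  fixes M :: "('s, 'p) mc" and M' :: "('t, 'p) mc" and g :: "'s \<Rightarrow> 't"
  assumes M: "markov_chain M" and M': "markov_chain M'"
    and bij: "bij_betw g (states M) (states M')"
    and Prob_eq: "\<And>s t. s \<in> states M \<Longrightarrow> t \<in> states M \<Longrightarrow> Prob M' (g s) (g t) = Prob M s t"
    and val_eq: "\<And>s. s \<in> states M \<Longrightarrow> val M' (g s) = val M s"
begin

lemma g_in: "s \<in> states M \<Longrightarrow> g s \<in> states M'"
  using bij by (auto simp: bij_betw_def)

lemma g_eq: "s \<in> states M \<Longrightarrow> t \<in> states M \<Longrightarrow> g s = g t \<longleftrightarrow> s = t"
  using bij by (auto simp: bij_betw_def inj_on_def)

lemma runs_map: "\<pi> \<in> runs M s \<Longrightarrow> g \<circ> \<pi> \<in> runs M' (g s)"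
  by (auto simp: runs_def g_in Prob_eq)

lemma path_map:
  assumes "w' \<in> finite_paths M' (g s)" "s \<in> states M"
  obtains w where "w \<in> finite_paths M s" "w' = map g w"
proof -
  have "set w' \<subseteq> g ` states M" using assms bij by (auto simp: finite_paths_def bij_betw_def)
  then have "w' \<in> map g ` lists (states M)"
    by (simp add: lists_image[symmetric] in_lists_conv_set subset_iff)
  then obtain w where w: "set w \<subseteq> states M" "w' = map g w"
    by auto
  have "w \<noteq> []" "hd w \<in> states M" using w assms by (auto simp: finite_paths_def)
  with w assms have "w \<in> finite_paths M s"
    by (auto simp: finite_paths_def hd_map g_eq Prob_eq subset_iff)
  with w that show thesis by blast
qed

lemma cylinder_map:
  assumes "w \<in> finite_paths M s"
  shows "(\<lambda>\<pi>. g \<circ> \<pi>) -` cylinder M' (g s) (map g w) \<inter> runs M s = cylinder M s w"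
proof -
  have "w ! i \<in> states M" if "i < length w" for i
    using assms that by (auto simp: finite_paths_def)
  then show ?thesis
    using runs_map by (auto simp: cylinder_def g_eq runs_def)
qed

lemma path_weight_map:
  assumes "w \<in> finite_paths M s"
  shows "path_weight M' (map g w) = path_weight M w"
  unfolding path_weight_def
  using assms by (auto simp: finite_paths_def intro!: prod.cong Prob_eq)

lemma run_measure_map:
  assumes s: "s \<in> states M"
  shows "(\<lambda>\<pi>. g \<circ> \<pi>) \<in> measurable (run_measure M s) (run_measure M' (g s))"
    and "distr (run_measure M s) (run_measure M' (g s)) (\<lambda>\<pi>. g \<circ> \<pi>) = run_measure M' (g s)"
proof -
  let ?h = "\<lambda>\<pi>. g \<circ> \<pi>" and ?G = "cylinder M' (g s) ` finite_paths M' (g s)"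
  show meas: "?h \<in> measurable (run_measure M s) (run_measure M' (g s))"
  proof (rule measurable_sigma_sets[OF sets_run_measure cylinder_Pow])
    fix Y assume "Y \<in> ?G"
    then obtain w where w: "w \<in> finite_paths M s" "Y = cylinder M' (g s) (map g w)"
      using path_map[OF _ s] by blast
    then show "?h -` Y \<inter> space (run_measure M s) \<in> sets (run_measure M s)"
      by (auto simp: cylinder_map sets_run_measure)
  qed (auto simp: runs_map)
  interpret P': prob_space "run_measure M' (g s)"
    by (rule prob_space_run_measure[OF M' g_in[OF s]])
  interpret P: prob_space "run_measure M s"
    by (rule prob_space_run_measure[OF M s])
  have sets_eq: "sigma_sets (runs M' (g s)) (insert {} ?G) = sets (run_measure M' (g s))"
    unfolding sets_run_measure
    by (rule sigma_sets_eqI) (auto intro: sigma_sets.intros)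
  have top: "[g s] \<in> finite_paths M' (g s)" "cylinder M' (g s) [g s] = runs M' (g s)"
    using g_in[OF s] by (auto simp: finite_paths_def cylinder_def runs_def)
  show "distr (run_measure M s) (run_measure M' (g s)) ?h = run_measure M' (g s)"
  proof (rule measure_eqI_generator_eq[where E = "insert {} ?G" and \<Omega> = "runs M' (g s)"
        and A = "\<lambda>_. runs M' (g s)", OF Int_stable_cylinders])
    show "insert {} ?G \<subseteq> Pow (runs M' (g s))" using cylinder_Pow[of M' "g s"] by auto
    show "range (\<lambda>_. runs M' (g s)) \<subseteq> insert {} ?G" using top by force
    fix X assume "X \<in> insert {} ?G"
    then consider "X = {}" | w where "w \<in> finite_paths M s" "map g w \<in> finite_paths M' (g s)"
      "X = cylinder M' (g s) (map g w)"
      using path_map[OF _ s] by blast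
    then show "emeasure (distr (run_measure M s) (run_measure M' (g s)) ?h) X =
        emeasure (run_measure M' (g s)) X"
    proof cases
      case 2
      then have "X \<in> sets (run_measure M' (g s))" by (auto simp: sets_run_measure)
      with 2 show ?thesis
        by (simp add: emeasure_distr[OF meas] cylinder_map emeasure_run_measure_cylinder
            M M' s g_in path_weight_map)
    qed simp
  next
    show "emeasure (distr (run_measure M s) (run_measure M' (g s)) ?h) (runs M' (g s)) \<noteq> \<infinity>"
      using prob_space.emeasure_space_1[OF P.prob_space_distr[OF meas]] by simp
  qed (auto simp: sets_eq)
qed

lemma sat_iff: "s \<in> states M \<Longrightarrow> sat M' \<phi> (g s) \<longleftrightarrow> sat M \<phi> s"
proof (induction \<phi> arbitrary: s)
  case (Finally c r \<phi>)
  let ?A = "{\<pi> \<in> runs M' (g s). \<exists>i. sat M' \<phi> (\<pi> i)}"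
  have "?A \<in> sets (run_measure M' (g s))"
    using sets.sets_Collect_countable_Ex[of "run_measure M' (g s)" "\<lambda>i \<pi>. sat M' \<phi> (\<pi> i)"]
      position_sets[OF M'] by simp
  then have "measure (run_measure M' (g s)) ?A =
      measure (run_measure M s) ((\<lambda>\<pi>. g \<circ> \<pi>) -` ?A \<inter> runs M s)"
    using measure_distr[OF run_measure_map(1)[OF Finally.prems]]
    by (simp add: run_measure_map(2)[OF Finally.prems])
  also have "(\<lambda>\<pi>. g \<circ> \<pi>) -` ?A \<inter> runs M s = {\<pi> \<in> runs M s. \<exists>i. sat M \<phi> (\<pi> i)}"
    using runs_map Finally.IH by (auto simp: runs_def)
  finally show ?case by simp
next
  case (Globally c r \<phi>)
  let ?A = "{\<pi> \<in> runs M' (g s). \<forall>i. sat M' \<phi> (\<pi> i)}"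
  have "?A \<in> sets (run_measure M' (g s))"
    using sets.sets_Collect_countable_All[of "run_measure M' (g s)" "\<lambda>i \<pi>. sat M' \<phi> (\<pi> i)"]
      position_sets[OF M'] by simp
  then have "measure (run_measure M' (g s)) ?A =
      measure (run_measure M s) ((\<lambda>\<pi>. g \<circ> \<pi>) -` ?A \<inter> runs M s)"
    using measure_distr[OF run_measure_map(1)[OF Globally.prems]]
    by (simp add: run_measure_map(2)[OF Globally.prems])
  also have "(\<lambda>\<pi>. g \<circ> \<pi>) -` ?A \<inter> runs M s = {\<pi> \<in> runs M s. \<forall>i. sat M \<phi> (\<pi> i)}"
    using runs_map Globally.IH by (auto simp: runs_def)
  finally show ?case by simp
qed (auto simp: val_eq)

end

lemma model_on_naturals:
  fixes M :: "('s, 'p) mc"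
  assumes model: "is_model M \<phi>"
  obtains N :: "(nat, 'p) mc" where "is_model N \<phi>" "finite (states N) \<longleftrightarrow> finite (states M)"
proof -
  let ?S = "states M" and ?g = "to_nat_on (states M)"
  let ?h = "inv_into ?S ?g"
  have M: "markov_chain M" using model by (simp add: is_model_def)
  have inj: "inj_on ?g ?S" using M by (intro inj_on_to_nat_on) (simp add: markov_chain_def)
  define N :: "(nat, 'p) mc" where
    "N = \<lparr>states = ?g ` ?S, Prob = (\<lambda>a b. Prob M (?h a) (?h b)), val = (\<lambda>a. val M (?h a))\<rparr>"
  have h: "?h (?g s) = s" if "s \<in> ?S" for s using inj that by simp
  have sums: "((\<lambda>b. Prob M s (?h b)) has_sum 1) (?g ` ?S)" if "s \<in> ?S" for s
    unfolding has_sum_reindex[OF inj]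
    by (rule has_sum_cong[THEN iffD1, of ?S "Prob M s"])
      (use M that h in \<open>auto simp: markov_chain_def\<close>)
  have N: "markov_chain N"
    using M h sums by (auto simp: markov_chain_def N_def)
  interpret mc_iso M N ?g
    by standard (use M N inj h in \<open>auto simp: N_def bij_betw_def\<close>)
  show thesis
  proof
    show "is_model N \<phi>"
      using model sat_iff[of _ \<phi>] g_in N by (auto simp: is_model_def)
    show "finite (states N) \<longleftrightarrow> finite ?S"
      using inj by (simp add: N_def finite_image_iff)
  qed
qed

corollary satisfiableI: "is_model (M :: ('s, 'p) mc) \<phi> \<Longrightarrow> satisfiable \<phi>"
  using model_on_naturals unfolding satisfiable_def by blast

corollary finitely_satisfiableI:
  "is_model (M :: ('s, 'p) mc) \<phi> \<Longrightarrow> finite (states M) \<Longrightarrow> finitely_satisfiable \<phi>"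
  using model_on_naturals unfolding finitely_satisfiable_def by blast


section \<open>The decision problems as sets of natural numbers\<close>

primrec cmp_code :: "cmp \<Rightarrow> nat" where
  "cmp_code CGe = 0"
| "cmp_code CGt = 1"
| "cmp_code CLe = 2"
| "cmp_code CLt = 3"
| "cmp_code CEq = 4"
| "cmp_code CNe = 5"

definition rat_code :: "rat \<Rightarrow> nat" where
  "rat_code r = prod_encode (int_encode (fst (quotient_of r)), int_encode (snd (quotient_of r)))"

primrec pctl_code :: "nat pctl \<Rightarrow> nat" where
  "pctl_code (Atom a) = prod_encode (0, a)"
| "pctl_code (Not \<phi>) = prod_encode (1, pctl_code \<phi>)"
| "pctl_code (And \<phi> \<psi>) = prod_encode (2, prod_encode (pctl_code \<phi>, pctl_code \<psi>))"
| "pctl_code (Finally c r \<phi>) =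
     prod_encode (3, prod_encode (cmp_code c, prod_encode (rat_code r, pctl_code \<phi>)))"
| "pctl_code (Globally c r \<phi>) =
     prod_encode (4, prod_encode (cmp_code c, prod_encode (rat_code r, pctl_code \<phi>)))"

lemma inj_cmp_code: "cmp_code c = cmp_code d \<longleftrightarrow> c = d"
  by (cases c; cases d) auto

lemma inj_rat_code: "rat_code r = rat_code q \<longleftrightarrow> r = q"
  by (auto simp: rat_code_def prod_encode_eq int_encode_eq prod_eq_iff[symmetric] quotient_of_inject_eq)

lemma inj_pctl_code: "pctl_code \<phi> = pctl_code \<psi> \<longleftrightarrow> \<phi> = \<psi>"
proof (induction \<phi> arbitrary: \<psi>)
qed (case_tac \<psi>; auto simp: prod_encode_eq inj_cmp_code inj_rat_code)+

definition FG_SAT :: "nat set" where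
  "FG_SAT = {pctl_code \<phi> | \<phi>. fg_formula \<phi> \<and> satisfiable \<phi>}"

definition FG_FINSAT :: "nat set" where
  "FG_FINSAT = {pctl_code \<phi> | \<phi>. fg_formula \<phi> \<and> finitely_satisfiable \<phi>}"


section \<open>Computable functions and many-one reductions\<close>

datatype recf =
    Zero
  | Succ
  | Proj nat
  | Comp recf "recf list"
  | PrimRec recf recf
  | Mu recf

text \<open>
  \<open>computes f xs y\<close>: the \<open>\<mu>\<close>-recursive function with description \<open>f\<close> is defined on the argument
  tuple \<open>xs\<close> and has value \<open>y\<close>. The recursion and search variables come first.
\<close>

inductive computes :: "recf \<Rightarrow> nat list \<Rightarrow> nat \<Rightarrow> bool" where
  "computes Zero xs 0"
| "computes Succ [x] (Suc x)"
| "i < length xs \<Longrightarrow> computes (Proj i) xs (xs ! i)"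
| "list_all2 (\<lambda>g y. computes g xs y) gs ys \<Longrightarrow> computes f ys z \<Longrightarrow> computes (Comp f gs) xs z"
| "computes f xs y \<Longrightarrow> computes (PrimRec f g) (0 # xs) y"
| "computes (PrimRec f g) (n # xs) y \<Longrightarrow> computes g (n # y # xs) z \<Longrightarrow>
     computes (PrimRec f g) (Suc n # xs) z"
| "computes f (n # xs) 0 \<Longrightarrow> (\<forall>m<n. \<exists>y>0. computes f (m # xs) y) \<Longrightarrow> computes (Mu f) xs n"

inductive_cases computes_elims:
  "computes Zero xs z"
  "computes Succ xs z"
  "computes (Proj i) xs z"
  "computes (PrimRec f g) (0 # xs) z"
  "computes (PrimRec f g) (Suc n # xs) z"
  "computes (Comp f gs) xs z"
  "computes (Mu f) xs z"

lemma computes_deterministic: "computes f xs y \<Longrightarrow> computes f xs z \<Longrightarrow> y = z"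
proof (induction arbitrary: z rule: computes.induct)
  case (4 xs gs ys f y)
  from \<open>computes (Comp f gs) xs z\<close> obtain zs where
    zs: "list_all2 (\<lambda>g y. computes g xs y) gs zs" "computes f zs z"
    by (blast elim: computes_elims)
  have "ys = zs"
  proof (rule nth_equalityI)
    show "length ys = length zs" using 4 zs by (auto dest!: list_all2_lengthD)
    show "ys ! i = zs ! i" if "i < length ys" for i
      using 4 zs that by (auto simp: list_all2_conv_all_nth)
  qed
  with zs 4 show ?case by simp
next
  case (7 f n xs)
  from \<open>computes (Mu f) xs z\<close> have z: "computes f (z # xs) 0" "\<forall>m<z. \<exists>y>0. computes f (m # xs) y"
    by (elim computes_elims(7), simp)+
  have "\<not> n < z" using z 7 by fastforce
  moreover have "\<not> z < n" using z 7 by fastforce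
  ultimately show ?case by simp
next
  case (1 xs)
  then show ?case by (elim computes_elims(1)) simp
next
  case (2 x)
  then show ?case by (elim computes_elims(2)) simp
next
  case (3 i xs)
  from 3(2) show ?case by (elim computes_elims(3)) simp
next
  case (5 f xs y g)
  from 5(3) show ?case by (elim computes_elims(4)) (rule 5(2))
next
  case (6 f g n xs y u)
  from 6(5) obtain y' where y': "computes (PrimRec f g) (n # xs) y'" "computes g (n # y' # xs) z"
    by (elim computes_elims(5))
  from 6(3)[OF y'(1)] y'(2) have "computes g (n # y # xs) z" by simp
  then show ?case by (rule 6(4))
qed

definition total_computable :: "(nat \<Rightarrow> nat) \<Rightarrow> bool" where
  "total_computable f \<longleftrightarrow> (\<exists>c. \<forall>n. computes c [n] (f n))"

definition many_one_reducible :: "nat set \<Rightarrow> nat set \<Rightarrow> bool" where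
  "many_one_reducible A B \<longleftrightarrow> (\<exists>f. total_computable f \<and> (\<forall>n. n \<in> A \<longleftrightarrow> f n \<in> B))"

definition hard_for :: "nat set set \<Rightarrow> nat set \<Rightarrow> bool" where
  "hard_for \<C> B \<longleftrightarrow> (\<forall>A\<in>\<C>. many_one_reducible A B)"


section \<open>The classes \<open>\<Sigma>\<^sup>0\<^sub>1\<close> and \<open>\<Sigma>\<^sup>1\<^sub>1\<close>\<close>

datatype tm = TVar nat | TZero | TSuc tm | TAdd tm tm | TMul tm tm

primrec tm_vars :: "tm \<Rightarrow> nat set" where
  "tm_vars (TVar x) = {x}"
| "tm_vars TZero = {}"
| "tm_vars (TSuc t) = tm_vars t"
| "tm_vars (TAdd t u) = tm_vars t \<union> tm_vars u"
| "tm_vars (TMul t u) = tm_vars t \<union> tm_vars u"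

primrec tm_val :: "(nat \<Rightarrow> nat) \<Rightarrow> tm \<Rightarrow> nat" where
  "tm_val e (TVar x) = e x"
| "tm_val e TZero = 0"
| "tm_val e (TSuc t) = Suc (tm_val e t)"
| "tm_val e (TAdd t u) = tm_val e t + tm_val e u"
| "tm_val e (TMul t u) = tm_val e t * tm_val e u"

text \<open>Formulae of second-order arithmetic; number and set variables are two separate sorts.\<close>

datatype so_fm =
    FEq tm tm
  | FLess tm tm
  | FIn tm nat
  | FNot so_fm
  | FAnd so_fm so_fm
  | FExN nat so_fm
  | FExS nat so_fm

primrec num_fv :: "so_fm \<Rightarrow> nat set" where
  "num_fv (FEq t u) = tm_vars t \<union> tm_vars u"
| "num_fv (FLess t u) = tm_vars t \<union> tm_vars u"
| "num_fv (FIn t X) = tm_vars t"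
| "num_fv (FNot \<phi>) = num_fv \<phi>"
| "num_fv (FAnd \<phi> \<psi>) = num_fv \<phi> \<union> num_fv \<psi>"
| "num_fv (FExN x \<phi>) = num_fv \<phi> - {x}"
| "num_fv (FExS X \<phi>) = num_fv \<phi>"

primrec set_fv :: "so_fm \<Rightarrow> nat set" where
  "set_fv (FEq t u) = {}"
| "set_fv (FLess t u) = {}"
| "set_fv (FIn t X) = {X}"
| "set_fv (FNot \<phi>) = set_fv \<phi>"
| "set_fv (FAnd \<phi> \<psi>) = set_fv \<phi> \<union> set_fv \<psi>"
| "set_fv (FExN x \<phi>) = set_fv \<phi>"
| "set_fv (FExS X \<phi>) = set_fv \<phi> - {X}"

primrec holds :: "so_fm \<Rightarrow> (nat \<Rightarrow> nat) \<Rightarrow> (nat \<Rightarrow> nat set) \<Rightarrow> bool" where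
  "holds (FEq t u) e E \<longleftrightarrow> tm_val e t = tm_val e u"
| "holds (FLess t u) e E \<longleftrightarrow> tm_val e t < tm_val e u"
| "holds (FIn t X) e E \<longleftrightarrow> tm_val e t \<in> E X"
| "holds (FNot \<phi>) e E \<longleftrightarrow> \<not> holds \<phi> e E"
| "holds (FAnd \<phi> \<psi>) e E \<longleftrightarrow> holds \<phi> e E \<and> holds \<psi> e E"
| "holds (FExN x \<phi>) e E \<longleftrightarrow> (\<exists>n. holds \<phi> (e(x := n)) E)"
| "holds (FExS X \<phi>) e E \<longleftrightarrow> (\<exists>A. holds \<phi> e (E(X := A)))"

inductive bounded_fm :: "so_fm \<Rightarrow> bool" where
  "bounded_fm (FEq t u)"
| "bounded_fm (FLess t u)"
| "bounded_fm (FIn t X)"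
| "bounded_fm \<phi> \<Longrightarrow> bounded_fm (FNot \<phi>)"
| "bounded_fm \<phi> \<Longrightarrow> bounded_fm \<psi> \<Longrightarrow> bounded_fm (FAnd \<phi> \<psi>)"
| "bounded_fm \<phi> \<Longrightarrow> x \<notin> tm_vars t \<Longrightarrow> bounded_fm (FExN x (FAnd (FLess (TVar x) t) \<phi>))"

inductive Sigma01_fm :: "so_fm \<Rightarrow> bool" where
  "bounded_fm \<phi> \<Longrightarrow> Sigma01_fm \<phi>"
| "Sigma01_fm \<phi> \<Longrightarrow> Sigma01_fm (FExN x \<phi>)"

inductive arithmetical_fm :: "so_fm \<Rightarrow> bool" where
  "arithmetical_fm (FEq t u)"
| "arithmetical_fm (FLess t u)"
| "arithmetical_fm (FIn t X)"
| "arithmetical_fm \<phi> \<Longrightarrow> arithmetical_fm (FNot \<phi>)"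
| "arithmetical_fm \<phi> \<Longrightarrow> arithmetical_fm \<psi> \<Longrightarrow> arithmetical_fm (FAnd \<phi> \<psi>)"
| "arithmetical_fm \<phi> \<Longrightarrow> arithmetical_fm (FExN x \<phi>)"

inductive Sigma11_fm :: "so_fm \<Rightarrow> bool" where
  "arithmetical_fm \<phi> \<Longrightarrow> Sigma11_fm \<phi>"
| "Sigma11_fm \<phi> \<Longrightarrow> Sigma11_fm (FExS X \<phi>)"

text \<open>
  The set defined by \<open>\<phi>\<close>. The formula has no free variable but the number variable \<open>0\<close>, so the
  values assigned to all other variables are irrelevant; in particular there are no set
  parameters, that is, the classes below are the lightface ones.
\<close>

definition definable_by :: "so_fm \<Rightarrow> nat set \<Rightarrow> bool" where
  "definable_by \<phi> A \<longleftrightarrow> num_fv \<phi> \<subseteq> {0} \<and> set_fv \<phi> = {} \<and> A = {n. holds \<phi> (\<lambda>_. n) (\<lambda>_. {})}"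

definition Sigma01 :: "nat set set" where
  "Sigma01 = {A. \<exists>\<phi>. Sigma01_fm \<phi> \<and> definable_by \<phi> A}"

definition Sigma11 :: "nat set set" where
  "Sigma11 = {A. \<exists>\<phi>. Sigma11_fm \<phi> \<and> definable_by \<phi> A}"

end

theory Submission
  imports Defs
begin

text \<open>
  Membership in a \<open>\<Sigma>\<^sup>1\<^sub>1\<close> set is the existence of a strategy, possibly infinite, in an alternating
  register program without a bound on the length of runs; for a \<open>\<Sigma>\<^sup>0\<^sub>1\<close> set, the strategy
  can be chosen finite. Existential moves correspond to guesses and choices,
  universal ones to checks of several continuations.

  A strategy is represented by a Markov chain in which each state stands for a configuration and
  moves with a small probability to the configurations that follow it, and otherwise to one of
  finitely many absorbing exits. A register with value \<open>n\<close> is represented by exits of probabilities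
  proportional to \<open>1/2^n\<close> and \<open>1/4^n\<close>. The formula mainly consists of equations for the
  probabilities of reaching sets of exits, which force the mean over the successors of a state of a
  representation to be the required linear function of the representation at the state. The means
  alone do not determine the values at the successors. But \<open>y \<ge> x\<^sup>2\<close> holds for the two components
  \<open>x\<close> and \<open>y\<close> of a register everywhere, since a universal move may start to
  decrement all registers, which would make a negative defect \<open>y - x\<^sup>2\<close> unboundedly negative. So by
  Jensen's inequality, \<open>y = x\<^sup>2\<close> for the means makes both components constant on the
  successors. Successive configurations have alternating phases, so that exits of the present
  configuration can be told apart from those of the next one although \<open>F\<close> sees all later exits:
  the later contributions form a geometric series with known sum. Only two rational constants of
  the formula depend on the input, namely the initial value of register 0.
\<close>

section \<open>Hitting probabilities in Markov chains\<close>

text \<open>\<open>F\<close> only adds up probabilities of exits: it can neither scale nor subtract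
  them. A coefficient is therefore a number of equally likely copies of a letter
  (\<open>LN kk\<close>, \<open>LG kk\<close>), and the mean over the successors enters through its
  complement, so that "the present value is a multiple of the mean" becomes "certain exit
  probabilities have a constant sum". The copies of \<open>LG\<close> pad these sums so that one
  constant serves all options. No operator of the fragment speaks of the next state, and a model may
  dwell in states that look alike; so a move is the first passage to another label, and all
  equations concern averages over such passages. Moves have total probability
  \<open>q = 3 * p\<close>: directions 0 and 1 serve the universal branching of the program, and
  direction 2 tests the registers in \<open>ver\<close>. The linear equations do not prevent a guess
  from going on forever in an infinite model. This is excluded by asking for a positive probability
  of the exits that record the choice to stop: a hitting probability that is merely inherited from
  the successors shrinks by the factor \<open>q\<close> in each move, and so would have to be
  0.\<close>

definition hit :: "('s, 'p) mc \<Rightarrow> ('s \<Rightarrow> bool) \<Rightarrow> 's \<Rightarrow> real" where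
  "hit M Q s = measure (run_measure M s) {\<pi> \<in> runs M s. \<exists>i. Q (\<pi> i)}"

lemma sat_Finally_hit: "sat M (Finally c r \<phi>) s \<longleftrightarrow> cmp_holds c (hit M (sat M \<phi>) s) (of_rat r)"
  by (simp add: hit_def)

lemma hits_sets:
  assumes "markov_chain M"
  shows "{\<pi> \<in> runs M s. \<exists>i. Q (\<pi> i)} \<in> sets (run_measure M s)"
    and "{\<pi> \<in> runs M s. \<forall>i. Q (\<pi> i)} \<in> sets (run_measure M s)"
  using sets.sets_Collect_countable_Ex[of "run_measure M s" "\<lambda>i \<pi>. Q (\<pi> i)"]
    sets.sets_Collect_countable_All[of "run_measure M s" "\<lambda>i \<pi>. Q (\<pi> i)"]
    position_sets[OF assms] by simp_all

section \<open>Path weights and the Markov property\<close>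

lemma finite_pathsD:
  assumes "w \<in> finite_paths M s"
  shows "w \<noteq> []" "w ! 0 = s" "\<And>i. i < length w \<Longrightarrow> w ! i \<in> states M" "s \<in> states M"
    "last w \<in> states M" "\<And>i. Suc i < length w \<Longrightarrow> Prob M (w ! i) (w ! Suc i) > 0"
  using assms by (auto simp: finite_paths_def hd_conv_nth)

lemma path_weight_pos: "w \<in> finite_paths M s \<Longrightarrow> path_weight M w > 0"
  unfolding path_weight_def by (intro prod_pos) (simp add: finite_paths_def)

lemma prod_lessThan_add: "(\<Prod>i<a + b. f i) = (\<Prod>i<a. f i) * (\<Prod>i<b. f (a + i :: nat) :: 'a::comm_monoid_mult)"
  by (induction b) (auto simp: mult.assoc)

lemma nth_append_tl:
  assumes "w \<noteq> []" "v \<noteq> []" "hd v = last w" "i < length v"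
  shows "(w @ tl v) ! (length w - 1 + i) = v ! i"
proof (cases i)
  case 0
  then show ?thesis using assms by (simp add: nth_append last_conv_nth hd_conv_nth)
next
  case (Suc j)
  then have "length w - 1 + i = length w + j" using assms by (cases w) auto
  then have "(w @ tl v) ! (length w - 1 + i) = tl v ! j" by (simp only: nth_append_length_plus)
  then show ?thesis using assms Suc by (simp add: nth_tl)
qed

lemma path_weight_append:
  assumes "w \<noteq> []" "v \<noteq> []" "hd v = last w"
  shows "path_weight M (w @ tl v) = path_weight M w * path_weight M v"
proof -
  let ?n = "length w - 1" and ?m = "length v - 1"
  have len: "length (w @ tl v) - 1 = ?n + ?m" using assms by (cases w) auto
  have "?n < length w" using assms by simp
  then have 1: "(w @ tl v) ! i = w ! i" if "i \<le> ?n" for i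
    using le_less_trans[OF that] by (simp add: nth_append)
  have 2: "(w @ tl v) ! (?n + i) = v ! i" if "i \<le> ?m" for i
    using nth_append_tl[OF assms, of i] that assms by (cases v) auto
  have "(\<Prod>i<?n. Prob M ((w @ tl v) ! i) ((w @ tl v) ! Suc i)) = (\<Prod>i<?n. Prob M (w ! i) (w ! Suc i))"
    by (intro prod.cong refl) (simp add: 1)
  moreover have "(\<Prod>i<?m. Prob M ((w @ tl v) ! (?n + i)) ((w @ tl v) ! Suc (?n + i))) =
      (\<Prod>i<?m. Prob M (v ! i) (v ! Suc i))"
    by (intro prod.cong refl) (use 2 in \<open>simp flip: add_Suc_right\<close>)
  ultimately show ?thesis
    unfolding path_weight_def len prod_lessThan_add by simp
qed

lemma finite_paths_append:
  assumes w: "w \<in> finite_paths M s" and v: "v \<in> finite_paths M (last w)"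
  shows "w @ tl v \<in> finite_paths M s" "last (w @ tl v) = last v"
proof -
  let ?n = "length w - 1"
  have ne: "w \<noteq> []" "v \<noteq> []" "hd v = last w"
    using w v by (auto simp: finite_paths_def)
  have "Prob M ((w @ tl v) ! i) ((w @ tl v) ! Suc i) > 0" if i: "Suc i < length (w @ tl v)" for i
  proof (cases "i < ?n")
    case True
    then have "i < length w" "Suc i < length w" by linarith+
    then show ?thesis using finite_pathsD(6)[OF w, of i] by (simp add: nth_append)
  next
    case False
    define j where "j = i - ?n"
    have "i = ?n + j" "Suc j < length v" using False i ne by (cases w; cases v; auto simp: j_def)+
    then show ?thesis
      using nth_append_tl[OF ne, of j] nth_append_tl[OF ne, of "Suc j"] finite_pathsD(6)[OF v, of j] by simp
  qed
  moreover have "set (w @ tl v) \<subseteq> states M"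
    using w v ne by (auto simp: finite_paths_def dest: list.set_sel(2))
  ultimately show "w @ tl v \<in> finite_paths M s"
    using w ne by (auto simp: finite_paths_def)
  show "last (w @ tl v) = last v"
    using ne by (cases v) (auto simp: last_append)
qed

definition shift :: "nat \<Rightarrow> (nat \<Rightarrow> 's) \<Rightarrow> nat \<Rightarrow> 's" where
  "shift n \<pi> i = \<pi> (n + i)"

lemma cylinder_append:
  assumes w: "w \<in> finite_paths M s" and v: "v \<in> finite_paths M (last w)"
  shows "{\<pi> \<in> cylinder M s w. shift (length w - 1) \<pi> \<in> cylinder M (last w) v} = cylinder M s (w @ tl v)"
    (is "?L = ?R")
proof -
  let ?n = "length w - 1"
  have ne: "w \<noteq> []" "v \<noteq> []" "hd v = last w"
    using w v by (auto simp: finite_paths_def)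
  note nth = nth_append_tl[OF ne]
  have nth': "(w @ tl v) ! i = w ! i" if "i < length w" for i
    using that by (simp add: nth_append)
  show ?thesis
  proof (intro equalityI subsetI)
    fix \<pi> assume \<pi>: "\<pi> \<in> ?L"
    have "\<pi> i = (w @ tl v) ! i" if i: "i < length (w @ tl v)" for i
    proof (cases "i < length w")
      case True
      then show ?thesis using \<pi> nth' by (auto simp: cylinder_def)
    next
      case False
      define j where "j = i - ?n"
      have "i = ?n + j" "j < length v" using False i ne by (cases w; cases v; auto simp: j_def)+
      then show ?thesis using nth[of j] \<pi> by (auto simp: cylinder_def shift_def)
    qed
    then show "\<pi> \<in> ?R" using \<pi> by (auto simp: cylinder_def)
  next
    fix \<pi> assume \<pi>: "\<pi> \<in> ?R"
    have *: "?n + j < length (w @ tl v)" if "j < length v" for j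
      using that ne by (cases w; cases v; auto)
    have "shift ?n \<pi> i = v ! i" if "i < length v" for i
      using nth[of i] that \<pi> *[of i] by (auto simp: cylinder_def shift_def)
    moreover from this[of 0] have "\<pi> ?n = last w" using ne by (simp add: shift_def hd_conv_nth)
    moreover have "\<pi> i = w ! i" if "i < length w" for i
      using \<pi> that nth'[of i] by (auto simp: cylinder_def)
    ultimately show "\<pi> \<in> ?L" using \<pi> by (auto simp: cylinder_def runs_def shift_def)
  qed
qed

text \<open>As functions of \<open>E\<close>, both sides are measures. On a cylinder they agree
  since weights multiply under concatenation of paths, and the cylinders together with the empty set
  are closed under intersection and generate the sets.\<close>

lemma markov_property:
  assumes M: "markov_chain M" and w: "w \<in> finite_paths M s" and E: "E \<in> sets (run_measure M (last w))"
  shows "{\<pi> \<in> cylinder M s w. shift (length w - 1) \<pi> \<in> E} \<in> sets (run_measure M s)"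
    and "emeasure (run_measure M s) {\<pi> \<in> cylinder M s w. shift (length w - 1) \<pi> \<in> E} =
      ennreal (path_weight M w) * emeasure (run_measure M (last w)) E"
proof -
  let ?t = "last w" and ?h = "shift (length w - 1)"
  let ?G = "cylinder M ?t ` finite_paths M ?t"
  let ?C = "cylinder M s w"
  have s: "s \<in> states M" and t: "?t \<in> states M"
    using finite_pathsD(4,5)[OF w] by simp_all
  have C: "?C \<in> sets (run_measure M s)" using w by (auto simp: sets_run_measure)
  have "?C \<inter> space (run_measure M s) = ?C" by (auto simp: cylinder_def)
  with C have C': "?C \<inter> space (run_measure M s) \<in> sets (run_measure M s)" by (simp only:)
  define N where "N = restrict_space (run_measure M s) ?C"
  have space_N: "space N = ?C" by (auto simp: N_def space_restrict_space cylinder_def)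
  have h_runs: "?h \<pi> \<in> runs M ?t" if "\<pi> \<in> ?C" for \<pi>
  proof -
    have "\<pi> (length w - 1) = last w"
      using that finite_pathsD(1)[OF w] by (simp add: cylinder_def last_conv_nth)
    then show ?thesis using that by (simp add: cylinder_def runs_def shift_def)
  qed
  have meas: "?h \<in> measurable N (run_measure M ?t)"
  proof (rule measurable_sigma_sets[OF sets_run_measure cylinder_Pow])
    show "?h \<in> space N \<rightarrow> runs M ?t"
      using h_runs unfolding space_N by (rule funcsetI)
    fix Y assume "Y \<in> ?G"
    then obtain v where v: "v \<in> finite_paths M ?t" "Y = cylinder M ?t v" by auto
    have "?h -` Y \<inter> space N = cylinder M s (w @ tl v)"
      using cylinder_append[OF w v(1)] by (auto simp: space_N v)
    moreover have "cylinder M s (w @ tl v) \<in> sets (run_measure M s)"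
      using finite_paths_append[OF w v(1)] by (auto simp: sets_run_measure)
    moreover have "cylinder M s (w @ tl v) \<subseteq> ?C"
      using cylinder_append[OF w v(1)] by auto
    ultimately show "?h -` Y \<inter> space N \<in> sets N"
      unfolding N_def by (simp add: sets_restrict_space_iff[OF C'])
  qed
  have eq: "{\<pi> \<in> ?C. ?h \<pi> \<in> E} = ?h -` E \<inter> space N" by (auto simp: space_N)
  have "?h -` E \<inter> space N \<in> sets N" using meas E by (rule measurable_sets)
  then show S: "{\<pi> \<in> ?C. ?h \<pi> \<in> E} \<in> sets (run_measure M s)"
    unfolding eq by (simp add: N_def sets_restrict_space_iff[OF C'])
  have em: "emeasure (distr N (run_measure M ?t) ?h) E' = emeasure (run_measure M s) {\<pi> \<in> ?C. ?h \<pi> \<in> E'}"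
    if E': "E' \<in> sets (run_measure M ?t)" for E'
  proof -
    have eq: "{\<pi> \<in> ?C. ?h \<pi> \<in> E'} = ?h -` E' \<inter> space N" by (auto simp: space_N)
    show ?thesis
      unfolding eq emeasure_distr[OF meas E'] unfolding N_def
      by (rule emeasure_restrict_space[OF C'])
        (auto simp: space_restrict_space)
  qed
  have sets_eq: "sigma_sets (runs M ?t) (insert {} ?G) = sets (run_measure M ?t)"
    unfolding sets_run_measure by (rule sigma_sets_eqI) (auto intro: sigma_sets.intros)
  have top: "[?t] \<in> finite_paths M ?t" "cylinder M ?t [?t] = runs M ?t"
    using t by (auto simp: finite_paths_def cylinder_def runs_def)
  interpret P': prob_space "run_measure M s" by (rule prob_space_run_measure[OF M s])
  have "distr N (run_measure M ?t) ?h = scale_measure (ennreal (path_weight M w)) (run_measure M ?t)"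
  proof (rule measure_eqI_generator_eq[where E = "insert {} ?G" and \<Omega> = "runs M ?t"
        and A = "\<lambda>_. runs M ?t", OF Int_stable_cylinders])
    show "insert {} ?G \<subseteq> Pow (runs M ?t)" using cylinder_Pow[of M ?t] by auto
    show "range (\<lambda>_. runs M ?t) \<subseteq> insert {} ?G" using top by force
    fix X assume "X \<in> insert {} ?G"
    then consider "X = {}" | v where "v \<in> finite_paths M ?t" "X = cylinder M ?t v" by blast
    then show "emeasure (distr N (run_measure M ?t) ?h) X =
        emeasure (scale_measure (ennreal (path_weight M w)) (run_measure M ?t)) X"
    proof cases
      case 2
      have X: "X \<in> sets (run_measure M ?t)" using 2 by (auto simp: sets_run_measure)
      have nn: "0 \<le> path_weight M w" "0 \<le> path_weight M v"
        using path_weight_pos[OF w] path_weight_pos[OF 2(1)] by auto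
      have ne: "w \<noteq> []" "v \<noteq> []" "hd v = last w"
        using w 2 by (auto simp: finite_paths_def)
      show ?thesis
        using 2 em[OF X] cylinder_append[OF w 2(1)] finite_paths_append[OF w 2(1)]
        by (simp add: emeasure_run_measure_cylinder M s t path_weight_append[OF ne] ennreal_mult nn)
    qed simp
  next
    show "emeasure (distr N (run_measure M ?t) ?h) (runs M ?t) \<noteq> \<infinity>"
      using em[of "runs M ?t"] sets.top[of "run_measure M ?t"] P'.emeasure_finite by simp
  qed (auto simp: sets_eq)
  then show "emeasure (run_measure M s) {\<pi> \<in> ?C. ?h \<pi> \<in> E} =
      ennreal (path_weight M w) * emeasure (run_measure M ?t) E"
    using em[OF E] by simp
qed

lemma countable_finite_paths: "markov_chain M \<Longrightarrow> countable (finite_paths M s)"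
  by (rule countable_subset[of _ "lists (states M)"]) (auto simp: finite_paths_def markov_chain_def)

text \<open>The runs that meet \<open>Q\<close> are sorted by the member of \<open>FP\<close> they
  start with. As \<open>Q\<close> fails strictly before the end of that path, whether
  \<open>Q\<close> is met depends on the shifted run only, and the Markov property applies. The
  family is left general: it is used for first passages to another label and for single
  transitions.\<close>

lemma hit_decomposition:
  assumes M: "markov_chain M" and FP: "FP \<subseteq> finite_paths M s" and s: "s \<in> states M"
    and disj: "disjoint_family_on (cylinder M s) FP"
    and cover: "\<And>\<pi> i. \<pi> \<in> runs M s \<Longrightarrow> Q (\<pi> i) \<Longrightarrow> \<exists>w\<in>FP. \<pi> \<in> cylinder M s w"
    and before: "\<And>w i. w \<in> FP \<Longrightarrow> i < length w - 1 \<Longrightarrow> \<not> Q (w ! i)"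
  shows "ennreal (hit M Q s) =
    (\<integral>\<^sup>+w. ennreal (path_weight M w) * ennreal (hit M Q (last w)) \<partial>count_space FP)"
proof -
  let ?H = "\<lambda>t. {\<pi> \<in> runs M t. \<exists>i. Q (\<pi> i)}"
  let ?X = "\<lambda>w. {\<pi> \<in> cylinder M s w. shift (length w - 1) \<pi> \<in> ?H (last w)}"
  note H = hits_sets(1)[OF M, of _ Q]
  have "?H s = (\<Union>w\<in>FP. ?X w)"
  proof (intro equalityI subsetI)
    fix \<pi> assume "\<pi> \<in> ?H s"
    then obtain i where i: "\<pi> \<in> runs M s" "Q (\<pi> i)" by auto
    from cover[OF i] obtain w where w: "w \<in> FP" "\<pi> \<in> cylinder M s w" by (elim bexE)
    have ne: "w \<noteq> []" by (rule finite_pathsD(1)[OF subsetD[OF FP w(1)]])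
    have "length w - 1 \<le> i"
    proof (rule ccontr)
      assume "\<not> length w - 1 \<le> i"
      then have "i < length w - 1" by simp
      then have "\<pi> i = w ! i" using w(2) by (simp add: cylinder_def)
      with before[OF w(1) \<open>i < length w - 1\<close>] i show False by simp
    qed
    then have "Q (shift (length w - 1) \<pi> (i - (length w - 1)))" using i by (simp add: shift_def)
    moreover have "\<pi> (length w - 1) = last w"
      using w(2) ne by (simp add: cylinder_def last_conv_nth)
    then have "shift (length w - 1) \<pi> \<in> runs M (last w)"
      using i(1) by (simp add: runs_def shift_def)
    ultimately have "\<pi> \<in> ?X w" using w(2) by (intro CollectI conjI exI)
    with w(1) show "\<pi> \<in> (\<Union>w\<in>FP. ?X w)" by (rule UN_I)
  next
    fix \<pi> assume "\<pi> \<in> (\<Union>w\<in>FP. ?X w)"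
    then obtain w i where "\<pi> \<in> cylinder M s w" "Q (shift (length w - 1) \<pi> i)"
      by (elim UN_E CollectE conjE exE)
    then show "\<pi> \<in> ?H s" by (simp add: cylinder_def shift_def) blast
  qed
  moreover have "emeasure (run_measure M s) (\<Union>w\<in>FP. ?X w) =
      (\<integral>\<^sup>+w. emeasure (run_measure M s) (?X w) \<partial>count_space FP)"
  proof (rule emeasure_UN_countable)
    show "countable FP" using FP countable_finite_paths[OF M] countable_subset by blast
    show "disjoint_family_on ?X FP"
      using disj by (rule disjoint_family_on_bisimulation) auto
    show "?X w \<in> sets (run_measure M s)" if "w \<in> FP" for w
      using that FP markov_property(1)[OF M _ H] by blast
  qed
  moreover have "emeasure (run_measure M s) (?X w) = ennreal (path_weight M w) * ennreal (hit M Q (last w))"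
    if "w \<in> FP" for w
  proof -
    have w: "w \<in> finite_paths M s" using that FP by blast
    interpret P: prob_space "run_measure M (last w)"
      by (rule prob_space_run_measure[OF M finite_pathsD(5)[OF w]])
    show ?thesis
      unfolding markov_property(2)[OF M w H] hit_def by (simp add: P.emeasure_eq_measure)
  qed
  moreover have "emeasure (run_measure M s) (?H s) = ennreal (hit M Q s)"
  proof -
    interpret P: prob_space "run_measure M s" by (rule prob_space_run_measure[OF M s])
    show ?thesis by (simp add: P.emeasure_eq_measure hit_def)
  qed
  ultimately show ?thesis by (simp cong: nn_integral_cong_simp)
qed

section \<open>Hitting probabilities and reachability\<close>

lemma hit_nonneg [simp]: "0 \<le> hit M Q s" by (simp add: hit_def)

lemma hit_le_1: "markov_chain M \<Longrightarrow> s \<in> states M \<Longrightarrow> hit M Q s \<le> 1"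
  unfolding hit_def by (rule prob_space.prob_le_1) (rule prob_space_run_measure)

lemma prob_space_runs:
  assumes "markov_chain M" "s \<in> states M"
  shows "measure (run_measure M s) (runs M s) = 1"
  using prob_space.prob_space[OF prob_space_run_measure[OF assms]] by simp

lemma hit_now: "markov_chain M \<Longrightarrow> s \<in> states M \<Longrightarrow> Q s \<Longrightarrow> hit M Q s = 1"
proof -
  assume *: "markov_chain M" "s \<in> states M" "Q s"
  have "{\<pi> \<in> runs M s. \<exists>i. Q (\<pi> i)} = runs M s"
    using * by (auto simp: runs_def intro!: exI[of _ 0])
  then show ?thesis using prob_space_runs[OF *(1,2)] by (simp add: hit_def)
qed

definition reach :: "('s, 'p) mc \<Rightarrow> 's \<Rightarrow> 's \<Rightarrow> bool" where
  "reach M s t \<longleftrightarrow> (\<exists>w\<in>finite_paths M s. last w = t)"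

lemma reach_refl: "s \<in> states M \<Longrightarrow> reach M s s"
  unfolding reach_def by (rule bexI[of _ "[s]"]) (auto simp: finite_paths_def)

lemma reach_trans: "reach M s t \<Longrightarrow> reach M t u \<Longrightarrow> reach M s u"
  unfolding reach_def by (metis finite_paths_append)

lemma reach_step: "s \<in> states M \<Longrightarrow> t \<in> states M \<Longrightarrow> Prob M s t > 0 \<Longrightarrow> reach M s t"
  unfolding reach_def by (rule bexI[of _ "[s, t]"]) (auto simp: finite_paths_def nth_Cons')

lemma reach_states: "reach M s t \<Longrightarrow> t \<in> states M"
  unfolding reach_def by (auto dest: finite_pathsD(5))

lemma reach_run: "\<pi> \<in> runs M s \<Longrightarrow> reach M s (\<pi> i)"
proof (induction i)
  case 0
  then show ?case using reach_refl[of s M] by (auto simp: runs_def)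
next
  case (Suc i)
  then have "Prob M (\<pi> i) (\<pi> (Suc i)) > 0" "\<pi> i \<in> states M" "\<pi> (Suc i) \<in> states M"
    by (auto simp: runs_def)
  with Suc show ?case by (blast intro: reach_trans reach_step)
qed

lemma hit_pos:
  assumes M: "markov_chain M" and t: "reach M s t" "Q t"
  shows "hit M Q s > 0"
proof -
  from t obtain w where w: "w \<in> finite_paths M s" "last w = t" by (auto simp: reach_def)
  have s: "s \<in> states M" using finite_pathsD(4)[OF w(1)] .
  interpret P: prob_space "run_measure M s" by (rule prob_space_run_measure[OF M s])
  have "cylinder M s w \<subseteq> {\<pi> \<in> runs M s. \<exists>i. Q (\<pi> i)}"
    using w t finite_pathsD(1)[OF w(1)]
    by (auto simp: cylinder_def last_conv_nth intro!: exI[of _ "length w - 1"])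
  then have "measure (run_measure M s) (cylinder M s w) \<le> hit M Q s"
    unfolding hit_def by (rule P.finite_measure_mono) (rule hits_sets(1)[OF M])
  moreover have "measure (run_measure M s) (cylinder M s w) = path_weight M w"
    using emeasure_run_measure_cylinder[OF M s w(1)] path_weight_pos[OF w(1)]
    by (simp add: measure_def)
  ultimately show ?thesis using path_weight_pos[OF w(1)] by simp
qed

lemma hit_eq_0_iff:
  assumes M: "markov_chain M" and s: "s \<in> states M"
  shows "hit M Q s = 0 \<longleftrightarrow> (\<forall>t. reach M s t \<longrightarrow> \<not> Q t)"
proof
  assume "hit M Q s = 0"
  then show "\<forall>t. reach M s t \<longrightarrow> \<not> Q t" using hit_pos[OF M, of s _ Q] by fastforce
next
  assume "\<forall>t. reach M s t \<longrightarrow> \<not> Q t"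
  then have "{\<pi> \<in> runs M s. \<exists>i. Q (\<pi> i)} = {}" by (auto dest: reach_run)
  then show "hit M Q s = 0" unfolding hit_def by (simp only: measure_empty)
qed

text \<open>Every reachable state ends a path whose cylinder has positive weight, so a single
  reachable violation already costs probability. Thus \<open>Globally CEq 1\<close> is an exact
  "always" over the reachable states and not just an almost sure one.\<close>

lemma sat_AG:
  assumes M: "markov_chain M" and s: "s \<in> states M"
  shows "sat M (Globally CEq 1 \<phi>) s \<longleftrightarrow> (\<forall>t. reach M s t \<longrightarrow> sat M \<phi> t)"
proof -
  interpret P: prob_space "run_measure M s" by (rule prob_space_run_measure[OF M s])
  have "{\<pi> \<in> runs M s. \<forall>i. sat M \<phi> (\<pi> i)} = space (run_measure M s) - {\<pi> \<in> runs M s. \<exists>i. \<not> sat M \<phi> (\<pi> i)}"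
    by auto
  then have "measure (run_measure M s) {\<pi> \<in> runs M s. \<forall>i. sat M \<phi> (\<pi> i)} = 1 - hit M (\<lambda>t. \<not> sat M \<phi> t) s"
    using P.prob_compl[OF hits_sets(1)[OF M, of s "\<lambda>t. \<not> sat M \<phi> t"]] by (simp add: hit_def)
  then show ?thesis using hit_eq_0_iff[OF M s, of "\<lambda>t. \<not> sat M \<phi> t"] by auto
qed

section \<open>Register games and their formulae\<close>

text \<open>The order in which \<open>S\<close> is listed is left open, as it affects neither truth
  nor membership in the fragment. The list ends with a formula that holds everywhere, probabilities
  being nonnegative.\<close>

definition Conj :: "'p pctl set \<Rightarrow> 'p pctl" where
  "Conj S = foldr And (SOME xs. set xs = S) (Globally CGe 0 (Atom undefined))"

definition Disj :: "'p pctl set \<Rightarrow> 'p pctl" where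
  "Disj S = Not (Conj (Not ` S))"

definition Imp :: "'p pctl \<Rightarrow> 'p pctl \<Rightarrow> 'p pctl" where
  "Imp \<phi> \<psi> = Not (And \<phi> (Not \<psi>))"

lemma sat_Conj [simp]: "finite S \<Longrightarrow> sat M (Conj S) t \<longleftrightarrow> (\<forall>\<phi>\<in>S. sat M \<phi> t)"
proof -
  assume "finite S"
  then have S: "set (SOME xs. set xs = S) = S"
    by (intro someI_ex[of "\<lambda>xs. set xs = S"] finite_list)
  have "sat M (foldr And xs (Globally CGe 0 (Atom undefined))) t \<longleftrightarrow> (\<forall>\<phi>\<in>set xs. sat M \<phi> t)" for xs
    by (induction xs) (auto simp: sat.simps)
  then show ?thesis unfolding Conj_def by (simp only: S)
qed

lemma sat_Disj [simp]: "finite S \<Longrightarrow> sat M (Disj S) t \<longleftrightarrow> (\<exists>\<phi>\<in>S. sat M \<phi> t)"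
  by (simp add: Disj_def)

lemma sat_Imp [simp]: "sat M (Imp \<phi> \<psi>) t \<longleftrightarrow> (sat M \<phi> t \<longrightarrow> sat M \<psi> t)"
  by (simp add: Imp_def)

lemma fg_Conj [simp]: "finite (S :: 'p pctl set) \<Longrightarrow> fg_formula (Conj S) \<longleftrightarrow> (\<forall>\<phi>\<in>S. fg_formula \<phi>)"
proof -
  assume "finite S"
  then have S: "set (SOME xs. set xs = S) = S"
    by (intro someI_ex[of "\<lambda>xs. set xs = S"] finite_list)
  have "fg_formula (foldr And xs (Globally CGe 0 (Atom undefined))) \<longleftrightarrow> (\<forall>\<phi>\<in>set xs. fg_formula \<phi>)"
    for xs :: "'p pctl list"
    by (induction xs) auto
  then show ?thesis unfolding Conj_def by (simp only: S)
qed

lemma fg_Disj [simp]: "finite S \<Longrightarrow> fg_formula (Disj S) \<longleftrightarrow> (\<forall>\<phi>\<in>S. fg_formula \<phi>)"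
  by (simp add: Disj_def)

lemma fg_Imp [simp]: "fg_formula (Imp \<phi> \<psi>) \<longleftrightarrow> fg_formula \<phi> \<and> fg_formula \<psi>"
  by (simp add: Imp_def)

datatype src = Keep nat | Inc nat | Dec nat | Zr

primrec sreg :: "src \<Rightarrow> nat" where
  "sreg (Keep j) = j" | "sreg (Inc j) = j" | "sreg (Dec j) = j" | "sreg Zr = 0"

primrec sval :: "src \<Rightarrow> (nat \<Rightarrow> nat) \<Rightarrow> nat" where
  "sval (Keep j) r = r j" | "sval (Inc j) r = Suc (r j)" | "sval (Dec j) r = r j - 1" | "sval Zr r = 0"

text \<open>In \<open>(d, l, c)\<close>, \<open>d\<close> is the direction in which the
  configuration was entered, \<open>l\<close> its location and \<open>c\<close> the choice made
  there. The direction is included because the exits of a configuration have to tell which kind of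
  successor of the previous one it is.\<close>

type_synonym 'l opt = "nat \<times> 'l \<times> nat"

text \<open>
  A register with value \<open>n\<close> is represented by the pair \<open>(1/2^n, 1/4^n)\<close>; its two components are
  told apart by a Boolean.
\<close>

type_synonym vt = "bool \<times> nat"

definition vv :: "bool \<Rightarrow> nat \<Rightarrow> real" where
  "vv b n = (if b then 1 / 2 ^ n else 1 / 4 ^ n)"

text \<open>
  Exit letters. \<open>LB\<close> carries the present value of a register. \<open>LN\<close> carries the complement of the
  mean value of a register over the successors in a given direction, \<open>LO\<close> and \<open>LK\<close> the complement
  of the probability that the next option or location is the given one. \<open>LG\<close> has constant
  probability and \<open>LR\<close> absorbs the rest.
\<close>

datatype 'l letter =
  LB vt | LN nat nat vt | LG nat | LO "'l opt" | LK nat 'l | LR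

datatype 'l label = Cf bool | Ex bool "'l opt" "'l letter"

datatype 'l con = CE bool | CN nat nat vt | CO "'l opt" | CK nat 'l | CG nat | CR nat vt | CZ vt

declare sat.simps(4,5) [simp del]

text \<open>\<open>dir2\<close> and \<open>ver\<close> set up the test of the registers: from every
  other location, direction 2 enters \<open>ver\<close> with the registers unchanged, and in
  \<open>ver\<close> each register is either claimed to be zero by a guard or decremented. No move
  enters \<open>ini\<close>, so this location marks the first configuration.\<close>

locale game =
  fixes Loc :: "'l set" and nch :: "'l \<Rightarrow> nat" and k :: nat and ini ver :: 'l
    and tg :: "'l \<Rightarrow> nat \<Rightarrow> nat \<Rightarrow> 'l" and sr :: "'l \<Rightarrow> nat \<Rightarrow> nat \<Rightarrow> nat \<Rightarrow> src"
    and gd :: "'l \<Rightarrow> nat \<Rightarrow> nat set" and live :: "'l \<Rightarrow> bool"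
  assumes finite_Loc: "finite Loc" and ini: "ini \<in> Loc" "nch ini = 1" "gd ini 0 = {1..<k}" "ini \<noteq> ver"
    and k: "0 < k"
    and tg: "\<And>l c e. l \<in> Loc \<Longrightarrow> c < nch l \<Longrightarrow> e < 3 \<Longrightarrow> tg l c e \<in> Loc - {ini}"
    and sr: "\<And>l c e i. l \<in> Loc \<Longrightarrow> c < nch l \<Longrightarrow> e < 3 \<Longrightarrow> i < k \<Longrightarrow> sreg (sr l c e i) < k"
    and gd: "\<And>l c. l \<in> Loc \<Longrightarrow> c < nch l \<Longrightarrow> gd l c \<subseteq> {..<k}"
    and dir2: "\<And>l c i. l \<in> Loc \<Longrightarrow> c < nch l \<Longrightarrow> l \<noteq> ver \<Longrightarrow> tg l c 2 = ver \<and> sr l c 2 i = Keep i"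
    and ver: "\<And>c e i. c < nch ver \<Longrightarrow> e < 3 \<Longrightarrow> i < k \<Longrightarrow>
      tg ver c e = ver \<and> (i \<in> gd ver c \<or> sr ver c e i = Dec i)"
begin

definition "Opt = {(d, l, c) | d l c. d < (3::nat) \<and> l \<in> Loc \<and> c < nch l}"

text \<open>Bounds the probability spent by one configuration in units of \<open>p\<close>:
  \<open>2 * k\<close> for \<open>LB\<close>, \<open>24 * k\<close> for \<open>LN\<close>, 4 for
  \<open>LG\<close>, 3 for each option (\<open>LO\<close>), 3 for each location (\<open>LK\<close>)
  and 3 for the moves. Since \<open>Mx \<le> 2 ^ Mx\<close>, all of this fits into total probability
  1.\<close>

definition "Mx = 26 * k + 7 + 3 * card Opt + 3 * card Loc"

text \<open>\<open>KK * p = 4\<close> is the largest coefficient that occurs, namely for the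
  component \<open>1 / 4 ^ n\<close> of an incremented register.\<close>

definition "KK = (2::nat) ^ (Mx + 2)"

definition "pr = (1 / 2 ^ Mx :: rat)"
definition "qr = 3 * pr"
definition "p = (1 / 2 ^ Mx :: real)"
definition "q = 3 * p"

definition Vt :: "vt set" where "Vt = UNIV \<times> {..<k}"

text \<open>\<open>cm b x * p\<close> is the quotient of the present component of the source
  register and the next value: 1 for \<open>Keep\<close>, 2 or 4 for \<open>Inc\<close>, 1/2 or 1/4
  for \<open>Dec\<close>. The number itself counts the copies of \<open>LN\<close> that realise this
  coefficient.\<close>

primrec cm :: "bool \<Rightarrow> src \<Rightarrow> nat" where
  "cm b (Keep j) = 2 ^ Mx"
| "cm b (Inc j) = (if b then 2 ^ (Mx + 1) else 2 ^ (Mx + 2))"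
| "cm b (Dec j) = (if b then 2 ^ (Mx - 1) else 2 ^ (Mx - 2))"
| "cm b Zr = 0"

text \<open>Two kinds of letters are withheld from an option. Without \<open>LN\<close>, the
  complement of the mean is 0, so a cleared register has mean 1, the code of the value 0. Without
  \<open>LK e (tg l c e)\<close>, the successors in direction \<open>e\<close> must themselves
  supply all of the probability required for that location.\<close>

fun Alw :: "'l opt \<Rightarrow> 'l letter set" where
  "Alw (d, l, c) = LB ` Vt \<union>
     {LN kk e v | kk e v. kk < KK \<and> e < 3 \<and> v \<in> Vt \<and> sr l c e (snd v) \<noteq> Zr} \<union>
     LG ` {..<KK} \<union> LO ` Opt \<union>
     {LK e l' | e l'. e < 3 \<and> l' \<in> Loc \<and> l' \<noteq> tg l c e} \<union> {LR}"

declare Alw.simps [simp del]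

definition "Lset = range Cf \<union> {Ex \<phi> w a | \<phi> w a. w \<in> Opt \<and> a \<in> Alw w}"

text \<open>\<open>inA\<close> selects what is counted in the phase of the configuration at hand,
  \<open>inB\<close> what is counted in the other phase. In \<open>CN\<close>, \<open>CO\<close> and
  \<open>CK\<close>, a slack letter of the present is balanced against exits of the successors.
  \<open>CG\<close>, \<open>CR\<close> and \<open>CZ\<close> count the same letters in both phases,
  so they constrain every configuration separately.\<close>

primrec inA :: "'l con \<Rightarrow> 'l opt \<Rightarrow> 'l letter \<Rightarrow> bool" where
  "inA (CE b) w a \<longleftrightarrow> b"
| "inA (CN kk e v) w a \<longleftrightarrow> a = LN kk e v"
| "inA (CO u) w a \<longleftrightarrow> a = LO u"
| "inA (CK e l) w a \<longleftrightarrow> a = LK e l"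
| "inA (CG kk) w a \<longleftrightarrow> a = LG kk"
| "inA (CR e v) w a \<longleftrightarrow> (case w of (d, l, c) \<Rightarrow> let s = sr l c e (snd v); m = cm (fst v) s in
     (\<exists>kk<m. a = LN kk e v) \<or> (s \<noteq> Zr \<and> a = LB (fst v, sreg s)) \<or> (\<exists>kk<KK - m. a = LG kk))"
| "inA (CZ v) w a \<longleftrightarrow> (case w of (d, l, c) \<Rightarrow>
     if snd v \<in> gd l c then a = LB v else (\<exists>kk<2 ^ Mx. a = LG kk))"

primrec inB :: "'l con \<Rightarrow> 'l opt \<Rightarrow> 'l letter \<Rightarrow> bool" where
  "inB (CE b) w a \<longleftrightarrow> \<not> b"
| "inB (CN kk e v) w a \<longleftrightarrow> fst w = e \<and> a = LB v"
| "inB (CO u) w a \<longleftrightarrow> w = u"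
| "inB (CK e l) w a \<longleftrightarrow> fst w = e \<and> fst (snd w) = l"
| "inB (CG kk) w a \<longleftrightarrow> inA (CG kk) w a"
| "inB (CR e v) w a \<longleftrightarrow> inA (CR e v) w a"
| "inB (CZ v) w a \<longleftrightarrow> inA (CZ v) w a"

text \<open>
  Every constraint says that from each configuration of phase \<open>\<phi>\<close> the exits in \<open>lam x \<phi>\<close> are reached
  with probability \<open>cst x\<close>. Contributions of later steps add up to a geometric series with ratio
  \<open>q\<^sup>2\<close> (or \<open>q\<close>, if both phases contribute alike), so a constraint determines the joint
  contribution of one step and its successors.
\<close>

definition lam :: "'l con \<Rightarrow> bool \<Rightarrow> 'l label set" where
  "lam x \<phi> = {Ex \<psi> w a | \<psi> w a. w \<in> Opt \<and> a \<in> Alw w \<and> (if \<psi> = \<phi> then inA x w a else inB x w a)}"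

primrec cst :: "'l con \<Rightarrow> rat" where
  "cst (CE b) = (if b then 1 / (1 + qr) else qr / (1 + qr))"
| "cst (CN kk e v) = pr\<^sup>2 / (1 - qr\<^sup>2)"
| "cst (CO u) = qr / (1 + qr)"
| "cst (CK e l) = pr / (1 + qr)"
| "cst (CG kk) = pr\<^sup>2 / (1 - qr)"
| "cst (CR e v) = 4 * pr / (1 - qr)"
| "cst (CZ v) = pr / (1 - qr)"

definition "Cns = range CE \<union> {CN kk e v | kk e v. kk < KK \<and> e < 3 \<and> v \<in> Vt} \<union> CO ` Opt \<union>
  {CK e l | e l. e < 3 \<and> l \<in> Loc} \<union> CG ` {..<KK} \<union> {CR e v | e v. e < 3 \<and> v \<in> Vt} \<union> CZ ` Vt"

definition atm :: "'l label \<Rightarrow> nat" where "atm = to_nat_on Lset"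

definition LF :: "'l label set \<Rightarrow> nat pctl" where "LF \<Lambda> = Disj ((\<lambda>L. Atom (atm L)) ` \<Lambda>)"

definition Only :: "'l label \<Rightarrow> nat pctl" where
  "Only L = And (Atom (atm L)) (Conj ((\<lambda>L'. Not (Atom (atm L'))) ` (Lset - {L})))"

text \<open>By \<open>CO w\<close>, the successors contribute a known amount to the exits counted
  here. What remains for the configuration at hand is \<open>1 - q\<close>, all of its exit
  probability, so the equation says that it plays option \<open>w\<close>.\<close>

definition Pur :: "bool \<Rightarrow> 'l opt \<Rightarrow> nat pctl" where
  "Pur \<phi> w = Finally CEq (1 / (1 + qr)) (LF (lam (CO w) (\<not> \<phi>)))"

definition stops :: "'l \<Rightarrow> 'l label set" where
  "stops l = {Ex \<phi> w a | \<phi> w a. w \<in> Opt \<and> a \<in> Alw w \<and> snd w = (l, 0)}"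

definition xin :: "bool \<Rightarrow> 'l label" where "xin b = Ex False (0, ini, 0) (LB (b, 0))"

text \<open>The first two groups make labels unique and exits permanent. The condition for live
  locations refers to choice 0, which stands for ending a guess. The last group makes the exits
  \<open>xin\<close> unreachable from phase \<open>True\<close>, so that their probability in the
  first configuration, which has phase \<open>False\<close>, is due to that configuration
  alone.\<close>

definition Theta :: "nat pctl" where
  "Theta = Conj
    ({Disj (Only ` Lset)} \<union>
     (\<lambda>L. Imp (Atom (atm L)) (Globally CEq 1 (Atom (atm L)))) ` (Lset - range Cf) \<union>
     (\<lambda>\<phi>. Imp (Atom (atm (Cf \<phi>))) (Finally CEq qr (Atom (atm (Cf (\<not> \<phi>)))))) ` UNIV \<union>
     (\<lambda>(\<phi>, x). Imp (Atom (atm (Cf \<phi>))) (Finally CEq (cst x) (LF (lam x \<phi>)))) ` (UNIV \<times> Cns) \<union>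
     (\<lambda>\<phi>. Imp (Atom (atm (Cf \<phi>))) (Disj (Pur \<phi> ` Opt))) ` UNIV \<union>
     (\<lambda>(\<phi>, w). Imp (And (Atom (atm (Cf \<phi>))) (Pur \<phi> w)) (Finally CGt 0 (LF (stops (fst (snd w))))))
       ` (UNIV \<times> {w \<in> Opt. live (fst (snd w))}) \<union>
     (\<lambda>b. Imp (Atom (atm (Cf True))) (Finally CEq 0 (Atom (atm (xin b))))) ` UNIV)"

definition base :: "nat pctl" where
  "base = And (Globally CEq 1 Theta) (And (Atom (atm (Cf False))) (Pur False (0, ini, 0)))"

definition formula :: "nat \<Rightarrow> nat pctl" where
  "formula n = And base
     (And (Finally CEq (1 / 2 ^ (Mx + n)) (Atom (atm (xin True))))
          (Finally CEq (1 / 2 ^ (Mx + 2 * n)) (Atom (atm (xin False)))))"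

section \<open>Finiteness and meaning of the formula\<close>

lemma finite_Opt: "finite Opt"
proof -
  have "Opt = {..<3} \<times> (SIGMA l:Loc. {..<nch l})" by (auto simp: Opt_def)
  then show ?thesis using finite_Loc by simp
qed

lemma finite_Vt: "finite Vt" by (simp add: Vt_def)

lemma finite_Alw: "finite (Alw w)"
proof -
  obtain d l c where w: "w = (d, l, c)" by (cases w)
  have 1: "finite {LN kk e v | kk e v. kk < KK \<and> e < 3 \<and> v \<in> Vt \<and> sr l c e (snd v) \<noteq> Zr}"
    by (rule finite_subset[of _ "(\<lambda>(kk, e, v). LN kk e v) ` ({..<KK} \<times> {..<3} \<times> Vt)"])
      (force, simp add: finite_Vt)
  have 2: "finite {LK e l' | e l'. e < 3 \<and> l' \<in> Loc \<and> l' \<noteq> tg l c e}"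
    by (rule finite_subset[of _ "(\<lambda>(e, l'). LK e l') ` ({..<3} \<times> Loc)"])
      (force, simp add: finite_Loc)
  show ?thesis unfolding w Alw.simps
    by (intro finite_UnI 1 2 finite_imageI finite_Vt finite_Opt) simp_all
qed

lemma finite_exits: "finite {Ex \<phi> w a | \<phi> w a. w \<in> Opt \<and> a \<in> Alw w}"
proof -
  have "{Ex \<phi> w a | \<phi> w a. w \<in> Opt \<and> a \<in> Alw w} = (\<Union>\<phi>. \<Union>w\<in>Opt. Ex \<phi> w ` Alw w)" by blast
  then show ?thesis using finite_Opt finite_Alw by simp
qed

lemma finite_Lset: "finite Lset"
  unfolding Lset_def by (intro finite_UnI finite_exits) simp

lemma lam_subset: "lam x \<phi> \<subseteq> Lset" unfolding lam_def Lset_def by blast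

lemma stops_subset: "stops l \<subseteq> Lset" unfolding stops_def Lset_def by blast

lemma finite_Cns: "finite Cns"
proof -
  have 1: "finite {CN kk e v | kk e v. kk < KK \<and> e < 3 \<and> v \<in> Vt}"
    by (rule finite_subset[of _ "(\<lambda>(kk, e, v). CN kk e v) ` ({..<KK} \<times> {..<3} \<times> Vt)"])
      (force, simp add: finite_Vt)
  have 2: "finite {CK e l | e l. e < 3 \<and> l \<in> Loc}"
    by (rule finite_subset[of _ "(\<lambda>(e, l). CK e l) ` ({..<3} \<times> Loc)"])
      (force, simp add: finite_Loc)
  have 3: "finite {CR e v | e v. e < 3 \<and> v \<in> Vt}"
    by (rule finite_subset[of _ "(\<lambda>(e, v). CR e v) ` ({..<3} \<times> Vt)"])
      (force, simp add: finite_Vt)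
  show ?thesis unfolding Cns_def
    by (intro finite_UnI 1 2 3 finite_imageI finite_Vt finite_Opt) simp_all
qed

lemma atm_inj: "L \<in> Lset \<Longrightarrow> L' \<in> Lset \<Longrightarrow> atm L = atm L' \<longleftrightarrow> L = L'"
  unfolding atm_def using inj_on_to_nat_on[OF countable_finite[OF finite_Lset]]
  by (auto simp: inj_on_def)

definition hp :: "('s, nat) mc \<Rightarrow> 'l label set \<Rightarrow> 's \<Rightarrow> real" where
  "hp M \<Lambda> = hit M (\<lambda>t. \<exists>L\<in>\<Lambda>. atm L \<in> val M t)"

lemma sat_LF: "\<Lambda> \<subseteq> Lset \<Longrightarrow> sat M (LF \<Lambda>) t \<longleftrightarrow> (\<exists>L\<in>\<Lambda>. atm L \<in> val M t)"
  using finite_subset[OF _ finite_Lset, of \<Lambda>] by (simp add: LF_def)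

lemma sat_Finally_LF: "\<Lambda> \<subseteq> Lset \<Longrightarrow>
    sat M (Finally c r (LF \<Lambda>)) t \<longleftrightarrow> cmp_holds c (hp M \<Lambda> t) (of_rat r)"
  unfolding sat_Finally_hit hp_def using sat_LF[of \<Lambda> M] by presburger

lemma sat_Finally_Atom:
    "sat M (Finally c r (Atom (atm L))) t \<longleftrightarrow> cmp_holds c (hp M {L} t) (of_rat r)"
proof -
  have "sat M (Atom (atm L)) = (\<lambda>t. \<exists>L'\<in>{L}. atm L' \<in> val M t)" by (rule ext) simp
  then show ?thesis unfolding sat_Finally_hit hp_def by simp
qed

lemma p_bounds: "0 < p" "p * (26 * k + 7 + 3 * card Opt + 3 * card Loc) \<le> 1" "7 * p \<le> 1" "q < 1" "0 < q"
proof -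
  show p: "0 < p" by (simp add: p_def)
  have "real Mx \<le> 2 ^ Mx" using of_nat_less_two_power[of Mx, where 'a = real] by simp
  then show *: "p * (26 * k + 7 + 3 * card Opt + 3 * card Loc) \<le> 1"
    unfolding Mx_def[symmetric] by (simp add: p_def)
  have "p * 7 \<le> p * (26 * k + 7 + 3 * card Opt + 3 * card Loc)"
    using p by (intro mult_left_mono) auto
  with * show "7 * p \<le> 1" by simp
  with p show "q < 1" "0 < q" by (simp_all add: q_def)
qed

lemma of_rat_pq: "of_rat pr = p" "of_rat qr = q"
  by (simp_all add: pr_def p_def qr_def q_def of_rat_divide of_rat_power of_rat_mult)

lemma of_rat_cst:
  "of_rat (cst (CE b)) = (if b then 1 / (1 + q) else q / (1 + q))"
  "of_rat (cst (CN kk e v)) = p\<^sup>2 / (1 - q\<^sup>2)"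
  "of_rat (cst (CO u)) = q / (1 + q)"
  "of_rat (cst (CK e l)) = p / (1 + q)"
  "of_rat (cst (CG kk)) = p\<^sup>2 / (1 - q)"
  "of_rat (cst (CR e v)) = 4 * p / (1 - q)"
  "of_rat (cst (CZ v)) = p / (1 - q)"
  by (simp_all add: of_rat_divide of_rat_add of_rat_diff of_rat_power of_rat_mult of_rat_pq)

lemma sat_Pur: "sat M (Pur \<phi> w) t \<longleftrightarrow> hp M (lam (CO w) (\<not> \<phi>)) t = 1 / (1 + q)"
  unfolding Pur_def by (simp add: sat_Finally_LF[OF lam_subset] of_rat_divide of_rat_add of_rat_pq)

definition config_ok :: "('s, nat) mc \<Rightarrow> bool \<Rightarrow> 's \<Rightarrow> bool" where
  "config_ok M \<phi> t \<longleftrightarrow> hp M {Cf (\<not> \<phi>)} t = q \<and> (\<forall>x\<in>Cns. hp M (lam x \<phi>) t = of_rat (cst x)) \<and>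
     (\<exists>w\<in>Opt. hp M (lam (CO w) (\<not> \<phi>)) t = 1 / (1 + q)) \<and>
     (\<forall>w\<in>Opt. live (fst (snd w)) \<longrightarrow> hp M (lam (CO w) (\<not> \<phi>)) t = 1 / (1 + q) \<longrightarrow>
        hp M (stops (fst (snd w))) t > 0) \<and>
     (\<phi> \<longrightarrow> (\<forall>b. hp M {xin b} t = 0))"

lemma sat_Only: "L \<in> Lset \<Longrightarrow>
    sat M (Only L) t \<longleftrightarrow> atm L \<in> val M t \<and> (\<forall>L'\<in>Lset. atm L' \<in> val M t \<longrightarrow> L' = L)"
  using finite_Lset by (auto simp: Only_def)

lemma sat_Theta:
  assumes M: "markov_chain M" and t: "t \<in> states M"
  shows "sat M Theta t \<longleftrightarrow> (\<exists>L\<in>Lset. atm L \<in> val M t \<and> (\<forall>L'\<in>Lset. atm L' \<in> val M t \<longrightarrow> L' = L)) \<and>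
     (\<forall>L\<in>Lset - range Cf. atm L \<in> val M t \<longrightarrow> (\<forall>u. reach M t u \<longrightarrow> atm L \<in> val M u)) \<and>
     (\<forall>\<phi>. atm (Cf \<phi>) \<in> val M t \<longrightarrow> config_ok M \<phi> t)"
proof -
  have fin: "finite ((UNIV :: bool set) \<times> Cns)" "finite ((UNIV :: bool set) \<times> {w \<in> Opt. live (fst (snd w))})"
    "finite (Lset - range Cf)"
    using finite_Cns finite_Opt finite_Lset by auto
  have 1: "sat M (Disj (Only ` Lset)) t \<longleftrightarrow>
      (\<exists>L\<in>Lset. atm L \<in> val M t \<and> (\<forall>L'\<in>Lset. atm L' \<in> val M t \<longrightarrow> L' = L))"
    using finite_Lset by (simp add: sat_Only cong: bex_cong)
  have 2: "sat M (Disj (Pur \<phi> ` Opt)) t \<longleftrightarrow> (\<exists>w\<in>Opt. hp M (lam (CO w) (\<not> \<phi>)) t = 1 / (1 + q))" for \<phi>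
    using finite_Opt by (simp add: sat_Pur)
  have 3: "sat M (Globally CEq 1 (Atom (atm L))) t \<longleftrightarrow> (\<forall>u. reach M t u \<longrightarrow> atm L \<in> val M u)" for L
    unfolding sat_AG[OF M t] by simp
  have 4: "sat M (And \<phi> \<psi>) t \<longleftrightarrow> sat M \<phi> t \<and> sat M \<psi> t" "sat M (Atom a) t \<longleftrightarrow> a \<in> val M t" for \<phi> \<psi> a
    by simp_all
  have 5: "(\<forall>\<psi>\<in>f ` A. sat M \<psi> t) \<longleftrightarrow> (\<forall>x\<in>A. sat M (f x) t)" for f :: "'z \<Rightarrow> nat pctl" and A
    by simp
  have 6: "(\<forall>\<psi>\<in>{\<gamma>}. sat M \<psi> t) \<longleftrightarrow> sat M \<gamma> t" for \<gamma> by simp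
  have "sat M Theta t \<longleftrightarrow>
     (\<exists>L\<in>Lset. atm L \<in> val M t \<and> (\<forall>L'\<in>Lset. atm L' \<in> val M t \<longrightarrow> L' = L)) \<and>
     (\<forall>L\<in>Lset - range Cf. atm L \<in> val M t \<longrightarrow> (\<forall>u. reach M t u \<longrightarrow> atm L \<in> val M u)) \<and>
     (\<forall>\<phi>. atm (Cf \<phi>) \<in> val M t \<longrightarrow> hp M {Cf (\<not> \<phi>)} t = q) \<and>
     (\<forall>z\<in>UNIV \<times> Cns. atm (Cf (fst z)) \<in> val M t \<longrightarrow> hp M (lam (snd z) (fst z)) t = of_rat (cst (snd z))) \<and>
     (\<forall>\<phi>. atm (Cf \<phi>) \<in> val M t \<longrightarrow> (\<exists>w\<in>Opt. hp M (lam (CO w) (\<not> \<phi>)) t = 1 / (1 + q))) \<and>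
     (\<forall>z\<in>UNIV \<times> {w \<in> Opt. live (fst (snd w))}.
        atm (Cf (fst z)) \<in> val M t \<and> hp M (lam (CO (snd z)) (\<not> fst z)) t = 1 / (1 + q) \<longrightarrow>
        hp M (stops (fst (snd (snd z)))) t > 0) \<and>
     (\<forall>b. atm (Cf True) \<in> val M t \<longrightarrow> hp M {xin b} t = 0)"
    unfolding Theta_def
    by (simp only: sat_Conj finite_UnI finite_imageI finite.insertI finite.emptyI finite fin ball_Un
        5 6 1 2 3 sat_Imp sat_Pur sat_Finally_LF[OF lam_subset] sat_Finally_LF[OF stops_subset]
        sat_Finally_Atom 4 cmp_holds.simps of_rat_pq of_rat_0 split_beta conj_assoc ball_UNIV)
  also have "(\<forall>z\<in>UNIV \<times> Cns. atm (Cf (fst z)) \<in> val M t \<longrightarrow> hp M (lam (snd z) (fst z)) t = of_rat (cst (snd z))) \<longleftrightarrow>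
      (\<forall>\<phi>. \<forall>x\<in>Cns. atm (Cf \<phi>) \<in> val M t \<longrightarrow> hp M (lam x \<phi>) t = of_rat (cst x))"
    by auto
  also have "(\<forall>z\<in>UNIV \<times> {w \<in> Opt. live (fst (snd w))}.
        atm (Cf (fst z)) \<in> val M t \<and> hp M (lam (CO (snd z)) (\<not> fst z)) t = 1 / (1 + q) \<longrightarrow>
        hp M (stops (fst (snd (snd z)))) t > 0) \<longleftrightarrow>
      (\<forall>\<phi>. \<forall>w\<in>Opt. atm (Cf \<phi>) \<in> val M t \<longrightarrow> live (fst (snd w)) \<longrightarrow>
        hp M (lam (CO w) (\<not> \<phi>)) t = 1 / (1 + q) \<longrightarrow> hp M (stops (fst (snd w))) t > 0)"
    by (simp only: Ball_def mem_Times_iff split_paired_All fst_conv snd_conv mem_Collect_eq UNIV_I simp_thms) blast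
  also have "(\<forall>b. atm (Cf True) \<in> val M t \<longrightarrow> hp M {xin b} t = 0) \<longleftrightarrow>
      (\<forall>\<phi>. atm (Cf \<phi>) \<in> val M t \<longrightarrow> \<phi> \<longrightarrow> (\<forall>b. hp M {xin b} t = 0))"
    by (auto simp: all_bool_eq)
  finally show ?thesis
    unfolding config_ok_def by blast
qed

lemma fg_LF: "\<Lambda> \<subseteq> Lset \<Longrightarrow> fg_formula (LF \<Lambda>)"
  using finite_subset[OF _ finite_Lset, of \<Lambda>] by (auto simp: LF_def)

lemma pr_bounds: "0 < pr" "7 * pr \<le> 1"
proof -
  show "0 < pr" by (simp add: pr_def)
  have "of_rat (7 * pr) \<le> (of_rat 1 :: real)" using p_bounds(3) by (simp add: of_rat_mult of_rat_pq)
  then show "7 * pr \<le> 1" unfolding of_rat_less_eq .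
qed

lemma cst_bounds: "0 \<le> cst x" "cst x \<le> 1"
proof -
  have *: "0 < pr" "7 * pr \<le> 1" "0 < qr" "qr < 1" using pr_bounds by (auto simp: qr_def)
  have sq: "pr\<^sup>2 \<le> pr * 1" "qr\<^sup>2 \<le> qr * 1"
    unfolding power2_eq_square using * by (auto intro!: mult_left_mono)
  have *: "0 < pr" "7 * pr \<le> 1" "0 < qr" "qr < 1" "qr = 3 * pr" "pr\<^sup>2 \<le> pr" "qr\<^sup>2 \<le> qr"
    using * sq by (simp_all add: qr_def)
  have "qr\<^sup>2 < 1" using * by linarith
  then show "0 \<le> cst x" using * by (cases x) auto
  show "cst x \<le> 1" using * \<open>qr\<^sup>2 < 1\<close> by (cases x) (auto simp: divide_le_eq)
qed

lemma fg_base: "fg_formula (formula n)"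
proof -
  have q: "0 \<le> qr" "qr \<le> 1" "0 \<le> 1 / (1 + qr)" "1 / (1 + qr) \<le> 1"
    using pr_bounds by (auto simp: qr_def)
  have Pur: "fg_formula (Pur \<phi> w)" for \<phi> w
    using fg_LF[OF lam_subset] q by (simp add: Pur_def)
  have fin: "finite ((UNIV :: bool set) \<times> Cns)" "finite ((UNIV :: bool set) \<times> {w \<in> Opt. live (fst (snd w))})"
    "finite (Lset - range Cf)"
    using finite_Cns finite_Opt finite_Lset by auto
  have Only: "fg_formula (Only L)" for L using finite_Lset by (auto simp: Only_def)
  have "fg_formula Theta"
    unfolding Theta_def using fin finite_Lset finite_Opt
    by (auto simp: Pur Only fg_LF[OF lam_subset] fg_LF[OF stops_subset] q cst_bounds)
  moreover have "1 / 2 ^ m \<le> (1::rat)" for m :: nat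
    by (simp add: divide_le_eq)
  ultimately show ?thesis by (simp add: formula_def base_def Pur)
qed

end

section \<open>From models to winning strategies\<close>

lemma hit_cong:
  assumes "\<And>u. reach M s u \<Longrightarrow> Q u \<longleftrightarrow> Q' u"
  shows "hit M Q s = hit M Q' s"
proof -
  have "{\<pi> \<in> runs M s. \<exists>i. Q (\<pi> i)} = {\<pi> \<in> runs M s. \<exists>i. Q' (\<pi> i)}"
    using reach_run[of _ M s] assms by blast
  then show ?thesis by (simp add: hit_def)
qed

locale game_model = game Loc nch k ini ver tg sr gd live
  for Loc :: "'l set" and nch k ini ver tg sr gd live +
  fixes M :: "('s, nat) mc" and s0 :: 's and n :: nat
  assumes M: "markov_chain M" and s0: "s0 \<in> states M" and model: "sat M (formula n) s0"
begin

definition R :: "'s \<Rightarrow> bool" where "R t \<longleftrightarrow> reach M s0 t"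

lemma R_states: "R t \<Longrightarrow> t \<in> states M"
  unfolding R_def by (rule reach_states)

lemma R_reach: "R t \<Longrightarrow> reach M t u \<Longrightarrow> R u"
  unfolding R_def by (rule reach_trans)

lemma R_s0: "R s0" unfolding R_def using s0 by (rule reach_refl)

lemma R_Theta: "R t \<Longrightarrow> sat M Theta t"
  using model sat_AG[OF M s0, of Theta] by (simp add: formula_def base_def R_def)

definition lab :: "'s \<Rightarrow> 'l label" where "lab t = (THE L. L \<in> Lset \<and> atm L \<in> val M t)"

lemma lab:
  assumes "R t"
  shows "lab t \<in> Lset" "L \<in> Lset \<Longrightarrow> atm L \<in> val M t \<longleftrightarrow> L = lab t"
proof -
  obtain L0 where L0: "L0 \<in> Lset" "atm L0 \<in> val M t" "\<forall>L'\<in>Lset. atm L' \<in> val M t \<longrightarrow> L' = L0"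
    using R_Theta[OF assms] unfolding sat_Theta[OF M R_states[OF assms]] by blast
  then have "(THE L. L \<in> Lset \<and> atm L \<in> val M t) = L0" by (intro the_equality) metis+
  then have "lab t = L0" unfolding lab_def .
  then show "lab t \<in> Lset" "L \<in> Lset \<Longrightarrow> atm L \<in> val M t \<longleftrightarrow> L = lab t"
    using L0 by metis+
qed

definition h :: "'l label set \<Rightarrow> 's \<Rightarrow> real" where "h \<Lambda> = hit M (\<lambda>u. lab u \<in> \<Lambda>)"

lemma hp_h: "R t \<Longrightarrow> \<Lambda> \<subseteq> Lset \<Longrightarrow> hp M \<Lambda> t = h \<Lambda> t"
  unfolding hp_def h_def by (rule hit_cong) (use lab R_reach in blast)

lemma exit_stays:
  assumes t: "R t" and L: "lab t \<notin> range Cf" and u: "reach M t u"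
  shows "lab u = lab t"
proof -
  have "lab t \<in> Lset - range Cf" using lab(1)[OF t] L by blast
  moreover have "atm (lab t) \<in> val M t" using lab[OF t] by blast
  ultimately have "atm (lab t) \<in> val M u"
    using R_Theta[OF t] u unfolding sat_Theta[OF M R_states[OF t]] by blast
  then show ?thesis using lab(2)[OF R_reach[OF t u] lab(1)[OF t]] by simp
qed

lemma h_now: "R t \<Longrightarrow> lab t \<in> \<Lambda> \<Longrightarrow> h \<Lambda> t = 1"
  unfolding h_def by (intro hit_now M R_states)

lemma h_exit:
  assumes "R t" "lab t \<notin> range Cf" "lab t \<notin> \<Lambda>"
  shows "h \<Lambda> t = 0"
  unfolding h_def using exit_stays[OF assms(1,2)] assms(3)
  by (subst hit_eq_0_iff[OF M R_states[OF assms(1)]]) simp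

lemma h_bounds: "0 \<le> h \<Lambda> t" "R t \<Longrightarrow> h \<Lambda> t \<le> 1"
  unfolding h_def by (auto intro: hit_le_1 M R_states)

definition node :: "bool \<Rightarrow> 's \<Rightarrow> bool" where "node \<phi> t \<longleftrightarrow> R t \<and> lab t = Cf \<phi>"

lemma node_R: "node \<phi> t \<Longrightarrow> R t" by (simp add: node_def)

lemma Cf_in: "Cf \<phi> \<in> Lset" by (simp add: Lset_def)

lemma node_config: "node \<phi> t \<Longrightarrow> config_ok M \<phi> t"
  using R_Theta lab Cf_in unfolding node_def by (metis sat_Theta[OF M R_states])

subsection \<open>First passage to the next phase\<close>

text \<open>States with the label of \<open>s\<close> may follow each other for any number of steps,
  and \<open>F\<close> does not notice. A passage ends at the first different label, which is an
  exit or a configuration of the other phase. Runs that never change the label are not covered, so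
  the measure \<open>D\<close> on passages is bounded by 1 but need not be a probability.\<close>

definition FP :: "'s \<Rightarrow> 's list set" where
  "FP s = {w \<in> finite_paths M s. (\<forall>i<length w - 1. lab (w ! i) = lab s) \<and> lab (last w) \<noteq> lab s}"

definition D :: "'s \<Rightarrow> 's list measure" where
  "D s = density (count_space (FP s)) (\<lambda>w. ennreal (path_weight M w))"

lemma space_D [simp]: "space (D s) = FP s" and sets_D [simp]: "sets (D s) = Pow (FP s)"
  by (simp_all add: D_def)

lemma measurable_D [measurable]: "f \<in> borel_measurable (D s)"
  by (simp add: D_def)

lemma FP_last: "R s \<Longrightarrow> w \<in> FP s \<Longrightarrow> R (last w)"
  unfolding FP_def by (rule R_reach[of s]) (auto simp: reach_def)

lemma disjoint_FP: "disjoint_family_on (cylinder M s) (FP s)"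
proof -
  have *: "v = w" if vw: "v \<in> FP s" "w \<in> FP s" "length v \<le> length w"
    and \<pi>: "\<pi> \<in> cylinder M s v" "\<pi> \<in> cylinder M s w" for v w \<pi>
  proof -
    have eq: "v ! i = w ! i" if "i < length v" for i
      using \<pi> vw(3) that by (auto simp: cylinder_def)
    have ne: "v \<noteq> []" using vw(1) by (auto simp: FP_def finite_paths_def)
    have "length v = length w"
    proof (rule ccontr)
      assume "length v \<noteq> length w"
      then have "length v - 1 < length w - 1" using vw(3) ne by (cases v) auto
      then have "lab (w ! (length v - 1)) = lab s" using vw(2) by (simp add: FP_def)
      moreover have "w ! (length v - 1) = last v" using eq[of "length v - 1"] ne by (simp add: last_conv_nth)
      ultimately show False using vw(1) by (simp add: FP_def)
    qed
    then show "v = w" using eq by (intro nth_equalityI) auto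
  qed
  show ?thesis
    unfolding disjoint_family_on_def
  proof (intro ballI impI)
    fix v w assume vw: "v \<in> FP s" "w \<in> FP s" "v \<noteq> w"
    show "cylinder M s v \<inter> cylinder M s w = {}"
      using *[OF vw(1,2)] *[OF vw(2,1)] vw(3) nat_le_linear[of "length v" "length w"] by blast
  qed
qed

lemma h_decomposition:
  assumes s: "R s" "lab s \<notin> \<Lambda>"
  shows "ennreal (h \<Lambda> s) = (\<integral>\<^sup>+w. ennreal (h \<Lambda> (last w)) \<partial>D s)"
proof -
  have "ennreal (h \<Lambda> s) = (\<integral>\<^sup>+w. ennreal (path_weight M w) * ennreal (h \<Lambda> (last w)) \<partial>count_space (FP s))"
    unfolding h_def
  proof (rule hit_decomposition[OF M _ R_states[OF s(1)] disjoint_FP])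
    show "FP s \<subseteq> finite_paths M s" by (auto simp: FP_def)
    fix \<pi> i assume \<pi>: "\<pi> \<in> runs M s" and i: "lab (\<pi> i) \<in> \<Lambda>"
    define j where "j = (LEAST j. lab (\<pi> j) \<noteq> lab s)"
    have j: "lab (\<pi> j) \<noteq> lab s" unfolding j_def
      by (rule LeastI[of _ i]) (use i s in metis)
    have less: "lab (\<pi> i) = lab s" if "i < j" for i
      using not_less_Least[of i "\<lambda>j. lab (\<pi> j) \<noteq> lab s"] that unfolding j_def by blast
    let ?w = "map \<pi> [0..<Suc j]"
    have nth: "?w ! i = \<pi> i" if "i < Suc j" for i
      using that by (metis add_0 nth_map_upt minus_nat.diff_0)
    have last: "last ?w = \<pi> j" by simp
    have "?w \<in> finite_paths M s"
      using \<pi> nth unfolding finite_paths_def runs_def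
      by (auto simp: hd_conv_nth simp del: upt_Suc)
    moreover have "lab (?w ! i) = lab s" if "i < length ?w - 1" for i
    proof -
      have "i < j" using that by simp
      then show ?thesis using nth[of i] less by simp
    qed
    ultimately have "?w \<in> FP s" unfolding FP_def using j last by (intro CollectI conjI allI impI) simp_all
    moreover have "\<pi> \<in> cylinder M s ?w"
      using \<pi> nth by (simp add: cylinder_def del: upt_Suc)
    ultimately show "\<exists>w\<in>FP s. \<pi> \<in> cylinder M s w" by (intro bexI)
  next
    fix w i assume "w \<in> FP s" "i < length w - 1"
    then have "lab (w ! i) = lab s" by (simp add: FP_def)
    then show "lab (w ! i) \<notin> \<Lambda>" using s by simp
  qed
  then show ?thesis
    unfolding D_def by (subst nn_integral_density) simp_all
qed

lemma D_finite: "R s \<Longrightarrow> emeasure (D s) (FP s) \<le> 1"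
proof -
  assume s: "R s"
  have "emeasure (D s) (FP s) = (\<integral>\<^sup>+w. 1 \<partial>D s)"
    using nn_integral_const[of "D s" 1] by simp
  \<comment> \<open>The total mass is the probability of ever leaving the label of \<open>s\<close>,
    since each passage ends in another label.\<close>
  also have "\<dots> = (\<integral>\<^sup>+w. ennreal (h (- {lab s}) (last w)) \<partial>D s)"
    by (rule nn_integral_cong) (use FP_last[OF s] in \<open>simp add: h_now FP_def\<close>)
  also have "\<dots> = ennreal (h (- {lab s}) s)" by (rule h_decomposition[symmetric]) (use s in auto)
  also have "\<dots> \<le> 1" using h_bounds(2)[OF s] by simp
  finally show ?thesis .
qed

lemma finite_measure_D: "R s \<Longrightarrow> finite_measure (D s)"
  using D_finite[of s] by (intro finite_measureI) (auto simp: top_unique)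

definition Nx :: "'s \<Rightarrow> 's list set" where "Nx s = {w \<in> FP s. lab (last w) \<in> range Cf}"

definition m :: "'s \<Rightarrow> 'l label set \<Rightarrow> real" where
  "m s \<Lambda> = measure (D s) {w \<in> FP s. lab (last w) \<in> \<Lambda>}"

definition E :: "'s \<Rightarrow> ('s \<Rightarrow> real) \<Rightarrow> real" where
  "E s g = (\<integral>w. indicator (Nx s) w * g (last w) \<partial>D s)"

lemma Nx_node: "node \<phi> s \<Longrightarrow> w \<in> Nx s \<Longrightarrow> node (\<not> \<phi>) (last w)"
  using FP_last by (auto simp: Nx_def FP_def node_def)

text \<open>Boundedness on the nodes of a phase ensures that the integral \<open>E g\<close> is not a junk value.\<close>

definition bdd :: "bool \<Rightarrow> ('s \<Rightarrow> real) \<Rightarrow> bool" where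
  "bdd \<phi> g \<longleftrightarrow> (\<exists>B. \<forall>t. node \<phi> t \<longrightarrow> \<bar>g t\<bar> \<le> B)"

lemma bddI: "(\<And>t. node \<phi> t \<Longrightarrow> \<bar>g t\<bar> \<le> B) \<Longrightarrow> bdd \<phi> g"
  by (auto simp: bdd_def)

lemma bdd_const [simp]: "bdd \<phi> (\<lambda>_. c)" by (rule bddI[of _ _ "\<bar>c\<bar>"]) simp

lemma bdd_add [intro]: "bdd \<phi> f \<Longrightarrow> bdd \<phi> g \<Longrightarrow> bdd \<phi> (\<lambda>t. f t + g t)"
proof -
  assume "bdd \<phi> f" "bdd \<phi> g"
  then obtain B C where "\<forall>t. node \<phi> t \<longrightarrow> \<bar>f t\<bar> \<le> B" "\<forall>t. node \<phi> t \<longrightarrow> \<bar>g t\<bar> \<le> C"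
    by (auto simp: bdd_def)
  then show ?thesis by (intro bddI[of _ _ "B + C"]) (fastforce intro: order_trans[OF abs_triangle_ineq] add_mono)
qed

lemma bdd_mult [intro]: "bdd \<phi> f \<Longrightarrow> bdd \<phi> g \<Longrightarrow> bdd \<phi> (\<lambda>t. f t * g t)"
proof -
  assume "bdd \<phi> f" "bdd \<phi> g"
  then obtain B C where B: "\<forall>t. node \<phi> t \<longrightarrow> \<bar>f t\<bar> \<le> B" and C: "\<forall>t. node \<phi> t \<longrightarrow> \<bar>g t\<bar> \<le> C"
    by (auto simp: bdd_def)
  show ?thesis
  proof (rule bddI)
    fix t assume t: "node \<phi> t"
    have "0 \<le> \<bar>B\<bar>" "\<bar>f t\<bar> \<le> \<bar>B\<bar>" "\<bar>g t\<bar> \<le> \<bar>C\<bar>" using B C t by force+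
    then show "\<bar>f t * g t\<bar> \<le> \<bar>B\<bar> * \<bar>C\<bar>" unfolding abs_mult by (intro mult_mono) auto
  qed
qed

lemma bdd_diff [intro]: "bdd \<phi> f \<Longrightarrow> bdd \<phi> g \<Longrightarrow> bdd \<phi> (\<lambda>t. f t - g t)"
  using bdd_add[of \<phi> f "\<lambda>t. (- 1) * g t"] bdd_mult[OF bdd_const, of \<phi> g "- 1"] by simp

lemma bdd_if [intro]: "bdd \<phi> f \<Longrightarrow> bdd \<phi> (\<lambda>t. if P t then f t else 0)"
proof -
  assume "bdd \<phi> f"
  then obtain B where B: "\<forall>t. node \<phi> t \<longrightarrow> \<bar>f t\<bar> \<le> B" by (auto simp: bdd_def)
  show ?thesis
  proof (rule bddI)
    fix t assume "node \<phi> t"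
    then have "\<bar>f t\<bar> \<le> B" using B by blast
    then show "\<bar>if P t then f t else 0\<bar> \<le> B" by auto
  qed
qed

lemma E_integrable:
  assumes s: "node \<phi> s" and g: "bdd (\<not> \<phi>) g"
  shows "integrable (D s) (\<lambda>w. indicator (Nx s) w * g (last w))"
proof -
  interpret finite_measure "D s" by (rule finite_measure_D[OF node_R[OF s]])
  obtain B where B: "\<And>t. node (\<not> \<phi>) t \<Longrightarrow> \<bar>g t\<bar> \<le> B" using g by (auto simp: bdd_def)
  show ?thesis
  proof (rule integrable_const_bound[of _ "\<bar>B\<bar>"])
    show "AE w in D s. norm (indicator (Nx s) w * g (last w)) \<le> \<bar>B\<bar>"
    proof (rule AE_I2)
      fix w
      show "norm (indicator (Nx s) w * g (last w)) \<le> \<bar>B\<bar>"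
        using B[OF Nx_node[OF s, of w]] by (auto simp: indicator_def)
    qed
  qed simp
qed

lemma E_add:
  assumes "node \<phi> s" "bdd (\<not> \<phi>) f" "bdd (\<not> \<phi>) g"
  shows "E s (\<lambda>t. f t + g t) = E s f + E s g"
  using Bochner_Integration.integral_add[OF E_integrable[OF assms(1,2)] E_integrable[OF assms(1,3)]]
  by (simp add: E_def distrib_left)

lemma E_cmult: "E s (\<lambda>t. c * g t) = c * E s g"
  unfolding E_def by (subst integral_mult_right_zero[symmetric]) (simp add: mult.left_commute)

lemma E_diff:
  assumes "node \<phi> s" "bdd (\<not> \<phi>) f" "bdd (\<not> \<phi>) g"
  shows "E s (\<lambda>t. f t - g t) = E s f - E s g"
  using Bochner_Integration.integral_diff[OF E_integrable[OF assms(1,2)] E_integrable[OF assms(1,3)]]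
  by (simp add: E_def right_diff_distrib)

lemma E_cong:
  assumes "node \<phi> s" "\<And>t. node (\<not> \<phi>) t \<Longrightarrow> reach M s t \<Longrightarrow> f t = g t"
  shows "E s f = E s g"
  unfolding E_def
proof (rule Bochner_Integration.integral_cong[OF refl])
  fix w
  have "w \<in> Nx s \<Longrightarrow> reach M s (last w)" by (auto simp: Nx_def FP_def reach_def)
  then show "indicator (Nx s) w * f (last w) = indicator (Nx s) w * g (last w)"
    using assms(2)[OF Nx_node[OF assms(1)]] by (cases "w \<in> Nx s") auto
qed

lemma E_mono:
  assumes s: "node \<phi> s" and "bdd (\<not> \<phi>) f" "bdd (\<not> \<phi>) g"
    and le: "\<And>w. w \<in> Nx s \<Longrightarrow> f (last w) \<le> g (last w)"
  shows "E s f \<le> E s g"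
  unfolding E_def
  by (rule integral_mono[OF E_integrable E_integrable]) (use assms in \<open>auto simp: indicator_def\<close>)

text \<open>Each passage is a path of positive weight, so a nonnegative function of mean 0 vanishes
  at every single successor and not just at almost all of them. This is how equations between means
  become statements about each configuration.\<close>

lemma E_zero:
  assumes s: "node \<phi> s" and g: "bdd (\<not> \<phi>) g" and nn: "\<And>t. node (\<not> \<phi>) t \<Longrightarrow> 0 \<le> g t"
    and 0: "E s g = 0" and w: "w \<in> Nx s"
  shows "g (last w) = 0"
proof -
  have "AE w in D s. indicator (Nx s) w * g (last w) = 0"
    using 0 unfolding E_def
    by (subst (asm) integral_nonneg_eq_0_iff_AE[OF E_integrable[OF s g]])
      (use nn[OF Nx_node[OF s]] in \<open>auto simp: indicator_def\<close>)
  then have "\<forall>w\<in>FP s. path_weight M w > 0 \<longrightarrow> indicator (Nx s) w * g (last w) = 0"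
    unfolding D_def by (subst (asm) AE_density) (auto simp: AE_count_space)
  moreover have "w \<in> FP s" "path_weight M w > 0"
    using w by (auto simp: Nx_def FP_def intro: path_weight_pos)
  ultimately show ?thesis using w by (auto simp: indicator_def)
qed

lemma h_integral:
  assumes s: "R s" "lab s \<notin> \<Lambda>"
  shows "h \<Lambda> s = (\<integral>w. h \<Lambda> (last w) \<partial>D s)"
proof -
  have "(\<integral>w. h \<Lambda> (last w) \<partial>D s) = enn2real (\<integral>\<^sup>+w. ennreal (h \<Lambda> (last w)) \<partial>D s)"
    by (rule integral_eq_nn_integral) (auto simp: h_bounds)
  then show ?thesis
    unfolding h_decomposition[OF s, symmetric] by (simp add: h_bounds)
qed

text \<open>A passage ends either in an exit, whose permanent label decides at once whether
  \<open>\<Lambda>\<close> is met, or in a configuration of the other phase.\<close>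

lemma h_split:
  assumes s: "node \<phi> s" and \<Lambda>: "\<Lambda> \<inter> range Cf = {}"
  shows "h \<Lambda> s = m s \<Lambda> + E s (h \<Lambda>)"
proof -
  interpret finite_measure "D s" by (rule finite_measure_D[OF node_R[OF s]])
  let ?A = "{w \<in> FP s. lab (last w) \<in> \<Lambda>}"
  have "lab s \<notin> \<Lambda>" using s \<Lambda> by (auto simp: node_def)
  then have "h \<Lambda> s = (\<integral>w. h \<Lambda> (last w) \<partial>D s)" by (rule h_integral[OF node_R[OF s]])
  also have "\<dots> = (\<integral>w. indicator ?A w + indicator (Nx s) w * h \<Lambda> (last w) \<partial>D s)"
  proof (rule Bochner_Integration.integral_cong[OF refl])
    fix w assume "w \<in> space (D s)"
    then have w: "w \<in> FP s" by simp
    note R = FP_last[OF node_R[OF s] w]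
    consider "lab (last w) \<in> range Cf" | "lab (last w) \<notin> range Cf" "lab (last w) \<in> \<Lambda>"
      | "lab (last w) \<notin> range Cf" "lab (last w) \<notin> \<Lambda>" by blast
    then show "h \<Lambda> (last w) = indicator ?A w + indicator (Nx s) w * h \<Lambda> (last w)"
    proof cases
      case 1
      then have "w \<in> Nx s" "w \<notin> ?A" using w \<Lambda> by (auto simp: Nx_def)
      then show ?thesis by simp
    next
      case 2
      then have "w \<notin> Nx s" "w \<in> ?A" using w by (auto simp: Nx_def)
      then show ?thesis using h_now[OF R 2(2)] by simp
    next
      case 3
      then have "w \<notin> Nx s" "w \<notin> ?A" using w by (auto simp: Nx_def)
      then show ?thesis using h_exit[OF R 3] by simp
    qed
  qed
  also have "\<dots> = (\<integral>w. indicator ?A w \<partial>D s) + (\<integral>w. indicator (Nx s) w * h \<Lambda> (last w) \<partial>D s)"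
  proof (rule Bochner_Integration.integral_add)
    show "integrable (D s) (indicat_real ?A)"
      by (intro integrable_real_indicator) (auto simp: less_top[symmetric])
    show "integrable (D s) (\<lambda>w. indicator (Nx s) w * h \<Lambda> (last w))"
      by (rule E_integrable[OF s]) (auto intro!: bddI[of _ _ 1] simp: h_bounds node_def)
  qed
  also have "(\<integral>w. indicator ?A w \<partial>D s) = m s \<Lambda>" 
  proof -
    have "?A \<inter> space (D s) = ?A" by auto
    then show ?thesis by (simp only: m_def Bochner_Integration.integral_indicator)
  qed
  finally show ?thesis by (simp add: E_def)
qed

lemma E_one:
  assumes s: "node \<phi> s"
  shows "E s (\<lambda>_. 1) = q"
proof -
  interpret finite_measure "D s" by (rule finite_measure_D[OF node_R[OF s]])
  have "lab s \<notin> {Cf (\<not> \<phi>)}" using s by (auto simp: node_def)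
  then have "h {Cf (\<not> \<phi>)} s = (\<integral>w. h {Cf (\<not> \<phi>)} (last w) \<partial>D s)" by (rule h_integral[OF node_R[OF s]])
  also have "\<dots> = (\<integral>w. indicator (Nx s) w \<partial>D s)"
  proof (rule Bochner_Integration.integral_cong[OF refl])
    fix w assume "w \<in> space (D s)"
    then have w: "w \<in> FP s" by simp
    note R = FP_last[OF node_R[OF s] w]
    show "h {Cf (\<not> \<phi>)} (last w) = indicator (Nx s) w"
    proof (cases "w \<in> Nx s")
      case True
      then have "lab (last w) \<in> {Cf (\<not> \<phi>)}" using Nx_node[OF s True] by (simp add: node_def)
      then show ?thesis using True h_now[OF R] by simp
    next
      case False
      then have L: "lab (last w) \<notin> range Cf" using w by (auto simp: Nx_def)
      then have "lab (last w) \<notin> {Cf (\<not> \<phi>)}" by blast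
      then show ?thesis using False h_exit[OF R L] by simp
    qed
  qed
  finally have "h {Cf (\<not> \<phi>)} s = E s (\<lambda>_. 1)" by (simp add: E_def)
  moreover have "hp M {Cf (\<not> \<phi>)} s = q" using node_config[OF s] by (simp add: config_ok_def)
  ultimately show ?thesis using hp_h[OF node_R[OF s], of "{Cf (\<not> \<phi>)}"] Cf_in by simp
qed

lemma E_const: "node \<phi> s \<Longrightarrow> E s (\<lambda>_. c) = c * q"
  using E_cmult[of s c "\<lambda>_. 1"] E_one[of \<phi> s] by simp

lemma m_nonneg: "0 \<le> m s \<Lambda>" by (simp add: m_def)

lemma m_Un: "R s \<Longrightarrow> \<Lambda> \<inter> \<Gamma> = {} \<Longrightarrow> m s (\<Lambda> \<union> \<Gamma>) = m s \<Lambda> + m s \<Gamma>"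
proof -
  assume s: "R s" and d: "\<Lambda> \<inter> \<Gamma> = {}"
  interpret finite_measure "D s" by (rule finite_measure_D[OF s])
  have "{w \<in> FP s. lab (last w) \<in> \<Lambda> \<union> \<Gamma>} = {w \<in> FP s. lab (last w) \<in> \<Lambda>} \<union> {w \<in> FP s. lab (last w) \<in> \<Gamma>}"
    by auto
  then show ?thesis unfolding m_def using d by (simp only:) (intro finite_measure_Union; auto)
qed

lemma m_mono: "R s \<Longrightarrow> \<Lambda> \<subseteq> \<Gamma> \<Longrightarrow> m s \<Lambda> \<le> m s \<Gamma>"
  unfolding m_def by (intro finite_measure.finite_measure_mono finite_measure_D) auto

lemma m_Lset: "R s \<Longrightarrow> m s (\<Lambda> \<inter> Lset) = m s \<Lambda>"
proof -
  assume "R s"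
  then have "{w \<in> FP s. lab (last w) \<in> \<Lambda> \<inter> Lset} = {w \<in> FP s. lab (last w) \<in> \<Lambda>}"
    using lab(1) FP_last by blast
  then show ?thesis by (simp only: m_def)
qed

lemma m_exits: "node \<phi> s \<Longrightarrow> m s (- range Cf) \<le> 1 - q"
proof -
  assume s: "node \<phi> s"
  interpret finite_measure "D s" by (rule finite_measure_D[OF node_R[OF s]])
  have "m s (- range Cf) + measure (D s) (Nx s) = measure (D s) (FP s)"
    unfolding m_def by (subst finite_measure_Union[symmetric]) (auto simp: Nx_def intro!: arg_cong[of _ _ "measure (D s)"])
  moreover have "measure (D s) (Nx s) = q"
    using E_one[OF s] by (simp add: E_def Int_absorb2 Nx_def)
  moreover have "measure (D s) (FP s) \<le> 1"
    using D_finite[OF node_R[OF s]] by (simp add: emeasure_eq_measure)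
  ultimately show ?thesis by simp
qed

end

section \<open>What the constraints say about a single configuration\<close>

lemma (in game) lam_iff [simp]:
  "Ex \<psi> w a \<in> lam x \<phi> \<longleftrightarrow> w \<in> Opt \<and> a \<in> Alw w \<and> (if \<psi> = \<phi> then inA x w a else inB x w a)"
  "Cf \<psi> \<notin> lam x \<phi>"
  unfolding lam_def by blast+

lemma (in game) lam_exits: "lam x \<phi> \<inter> range Cf = {}"
  by (auto simp del: lam_iff(1))

lemma (in game) lam_CE: "lam (CE False) \<phi> = lam (CE True) (\<not> \<phi>)"
proof (rule set_eqI)
  fix L show "L \<in> lam (CE False) \<phi> \<longleftrightarrow> L \<in> lam (CE True) (\<not> \<phi>)" by (cases L) auto
qed

lemma (in game) lam_same:
  assumes "\<And>w a. inB x w a = inA x w a"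
  shows "lam x (\<not> \<phi>) = lam x \<phi>"
proof (rule set_eqI)
  fix L show "L \<in> lam x (\<not> \<phi>) \<longleftrightarrow> L \<in> lam x \<phi>" using assms by (cases L) simp_all
qed

lemma (in game) q2: "q\<^sup>2 < 1" "1 + q > 0" "1 - q > 0"
  using p_bounds(4,5) by (simp_all add: abs_square_less_1)

lemma (in game) p_eqs: "real (2 ^ Mx) * p = 1" "real KK * p = 4" "Mx \<ge> 7" "2 ^ Mx \<le> KK"
  by (simp_all add: p_def KK_def power_add Mx_def)

lemma (in game) Mx_split: obtains r where "Mx = r + 2"
  using p_eqs(3) by (intro that[of "Mx - 2"]) simp

lemma (in game) cm_le: "cm b x \<le> KK"
proof -
  obtain r where r: "Mx = r + 2" by (rule Mx_split)
  show ?thesis by (cases x) (simp_all add: KK_def r power_add)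
qed

lemma (in game) cm_p: "cm b (Keep j) * p = 1" "cm b (Inc j) * p = (if b then 2 else 4)"
  "cm b (Dec j) * p = (if b then 1 / 2 else 1 / 4)"
proof -
  obtain r where r: "Mx = r + 2" by (rule Mx_split)
  show "cm b (Keep j) * p = 1" "cm b (Inc j) * p = (if b then 2 else 4)"
    "cm b (Dec j) * p = (if b then 1 / 2 else 1 / 4)"
    by (simp_all add: p_def r power_add)
qed

context game_model
begin

lemma h_lam: "node \<phi> s \<Longrightarrow> x \<in> Cns \<Longrightarrow> h (lam x \<phi>) s = of_rat (cst x)"
  using node_config[of \<phi> s] hp_h[OF node_R lam_subset] by (simp add: config_ok_def)

lemma bdd_h: "bdd \<phi> (h \<Lambda>)"
  by (rule bddI[of _ _ 1]) (simp add: h_bounds node_R)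

lemma m_le_1: "R s \<Longrightarrow> m s \<Lambda> \<le> 1"
proof -
  assume s: "R s"
  interpret finite_measure "D s" by (rule finite_measure_D[OF s])
  have "m s \<Lambda> \<le> measure (D s) (FP s)" unfolding m_def by (intro finite_measure_mono) auto
  also have "\<dots> \<le> 1" using D_finite[OF s] by (simp add: emeasure_eq_measure)
  finally show ?thesis .
qed

lemma bdd_m: "bdd \<phi> (\<lambda>t. m t \<Lambda>)"
  by (rule bddI[of _ _ 1]) (simp add: m_nonneg m_le_1 node_R)

text \<open>Two moves later the phase is the same again and the constraint holds there with the same
  value, so the tail of the series is \<open>q\<^sup>2\<close> times the whole.\<close>

lemma con_two_step:
  assumes s: "node \<phi> s" and x: "x \<in> Cns"
  shows "m s (lam x \<phi>) + E s (\<lambda>t. m t (lam x \<phi>)) = (1 - q\<^sup>2) * of_rat (cst x)"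
proof -
  let ?T = "of_rat (cst x) :: real"
  have "E s (h (lam x \<phi>)) = E s (\<lambda>t. m t (lam x \<phi>) + ?T * q)"
  proof (rule E_cong[OF s])
    fix t assume t: "node (\<not> \<phi>) t"
    have "E t (h (lam x \<phi>)) = E t (\<lambda>_. ?T)"
      by (rule E_cong[OF t]) (use h_lam[OF _ x] in simp)
    then show "h (lam x \<phi>) t = m t (lam x \<phi>) + ?T * q"
      using h_split[OF t lam_exits] E_const[OF t] by simp
  qed
  also have "\<dots> = E s (\<lambda>t. m t (lam x \<phi>)) + ?T * q * q"
    using E_add[OF s bdd_m bdd_const] E_const[OF s] by simp
  finally show ?thesis
    using h_split[OF s lam_exits, of x] h_lam[OF s x] by (simp add: algebra_simps power2_eq_square)
qed

lemma con_same:
  assumes s: "node \<phi> s" and x: "x \<in> Cns" and eq: "\<And>w a. inB x w a = inA x w a"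
  shows "m s (lam x \<phi>) = (1 - q) * of_rat (cst x)"
proof -
  have "E s (h (lam x \<phi>)) = E s (\<lambda>t. of_rat (cst x))"
    by (rule E_cong[OF s]) (use h_lam[OF _ x] lam_same[OF eq, of \<phi>] in metis)
  then show ?thesis
    using h_split[OF s lam_exits, of x] h_lam[OF s x] E_const[OF s] by (simp add: algebra_simps)
qed

lemma CE_in: "CE b \<in> Cns" and CO_in: "w \<in> Opt \<Longrightarrow> CO w \<in> Cns"
  by (auto simp: Cns_def)

text \<open>Exits of the other phase have probability \<open>1 / (1 + q)\<close> from each
  successor. Weighted with \<open>q\<close>, this already exhausts the constant of
  \<open>CE False\<close>.\<close>

lemma wrong_phase: "node \<phi> s \<Longrightarrow> m s (lam (CE True) (\<not> \<phi>)) = 0"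
proof -
  assume s: "node \<phi> s"
  have "E s (h (lam (CE False) \<phi>)) = E s (\<lambda>_. 1 / (1 + q))"
    by (rule E_cong[OF s]) (use h_lam[OF _ CE_in, of "\<not> \<phi>" _ True] in \<open>simp add: lam_CE of_rat_cst del: cst.simps\<close>)
  then show ?thesis
    using h_split[OF s lam_exits, of "CE False"] h_lam[OF s CE_in, of False] E_const[OF s]
    by (simp add: of_rat_cst lam_CE del: cst.simps)
qed

definition op :: "'s \<Rightarrow> 'l opt" where
  "op s = (SOME w. w \<in> Opt \<and> h (lam (CO w) (lab s \<noteq> Cf True)) s = 1 / (1 + q))"

definition S :: "bool \<Rightarrow> 'l opt \<Rightarrow> 'l label set" where "S \<phi> w = {Ex \<phi> w a | a. a \<in> Alw w}"

lemma S_exits: "S \<phi> w \<subseteq> - range Cf" by (auto simp: S_def)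

text \<open>The successors contribute \<open>q * (q / (1 + q))\<close>, which leaves
  \<open>1 - q\<close> for exits of the configuration itself. Exits with the wrong phase have mass
  0, and \<open>1 - q\<close> is all the exit mass there is.\<close>

lemma purity:
  assumes s: "node \<phi> s" and w: "w \<in> Opt" and h: "h (lam (CO w) (\<not> \<phi>)) s = 1 / (1 + q)"
  shows "m s (S \<phi> w) = 1 - q"
proof (rule antisym)
  have "E s (h (lam (CO w) (\<not> \<phi>))) = E s (\<lambda>_. q / (1 + q))"
    by (rule E_cong[OF s]) (use h_lam[OF _ CO_in[OF w], of "\<not> \<phi>"] in \<open>simp add: of_rat_cst del: cst.simps\<close>)
  then have "m s (lam (CO w) (\<not> \<phi>)) = 1 / (1 + q) - q / (1 + q) * q"
    using h_split[OF s lam_exits, of "CO w" "\<not> \<phi>"] h E_const[OF s] by simp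
  also have "\<dots> = 1 - q" using q2 by (simp add: field_simps)
  finally have "1 - q = m s (lam (CO w) (\<not> \<phi>))" ..
  also have "\<dots> \<le> m s (S \<phi> w \<union> (lam (CE True) (\<not> \<phi>) - S \<phi> w))"
  proof (rule m_mono[OF node_R[OF s]], rule subsetI)
    fix L assume "L \<in> lam (CO w) (\<not> \<phi>)"
    then show "L \<in> S \<phi> w \<union> (lam (CE True) (\<not> \<phi>) - S \<phi> w)" by (cases L) (auto simp: S_def)
  qed
  also have "\<dots> = m s (S \<phi> w) + m s (lam (CE True) (\<not> \<phi>) - S \<phi> w)"
    by (rule m_Un[OF node_R[OF s]]) auto
  also have "m s (lam (CE True) (\<not> \<phi>) - S \<phi> w) \<le> m s (lam (CE True) (\<not> \<phi>))"
    by (rule m_mono[OF node_R[OF s]]) auto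
  also have "\<dots> = 0" by (rule wrong_phase[OF s])
  finally show "1 - q \<le> m s (S \<phi> w)" by simp
next
  show "m s (S \<phi> w) \<le> 1 - q"
    using m_mono[OF node_R[OF s], of "S \<phi> w" "- range Cf"] m_exits[OF s] S_exits
    by (meson order_trans)
qed

lemma op: assumes s: "node \<phi> s"
  shows "op s \<in> Opt" "h (lam (CO (op s)) (\<not> \<phi>)) s = 1 / (1 + q)"
proof -
  have \<phi>: "(lab s \<noteq> Cf True) = (\<not> \<phi>)" using s by (auto simp: node_def)
  obtain w where "w \<in> Opt" "hp M (lam (CO w) (\<not> \<phi>)) s = 1 / (1 + q)"
    using node_config[OF s] by (auto simp: config_ok_def)
  then have "w \<in> Opt \<and> h (lam (CO w) (\<not> \<phi>)) s = 1 / (1 + q)"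
    using hp_h[OF node_R[OF s] lam_subset] by simp
  then have "\<exists>w. w \<in> Opt \<and> h (lam (CO w) (lab s \<noteq> Cf True)) s = 1 / (1 + q)"
    unfolding \<phi> by (rule exI)
  from someI_ex[OF this] show "op s \<in> Opt" "h (lam (CO (op s)) (\<not> \<phi>)) s = 1 / (1 + q)"
    unfolding op_def[symmetric] unfolding \<phi> by auto
qed

lemma m_S: "node \<phi> s \<Longrightarrow> m s (S \<phi> (op s)) = 1 - q"
  using purity op by blast

text \<open>Two different options would each take exit mass \<open>1 - q\<close>.\<close>

lemma op_eq:
  assumes s: "node \<phi> s" and w: "w \<in> Opt" and h: "h (lam (CO w) (\<not> \<phi>)) s = 1 / (1 + q)"
  shows "op s = w"
proof (rule ccontr)
  assume "op s \<noteq> w"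
  then have "S \<phi> (op s) \<inter> S \<phi> w = {}" by (auto simp: S_def)
  then have "m s (S \<phi> (op s) \<union> S \<phi> w) = (1 - q) + (1 - q)"
    using m_Un[OF node_R[OF s]] m_S[OF s] purity[OF s w h] by simp
  moreover have "m s (S \<phi> (op s) \<union> S \<phi> w) \<le> 1 - q"
    using m_mono[OF node_R[OF s], of "S \<phi> (op s) \<union> S \<phi> w" "- range Cf"] m_exits[OF s] S_exits by simp
  ultimately show False using q2 by simp
qed

lemma m_pure:
  assumes s: "node \<phi> s" and \<Lambda>: "\<Lambda> \<inter> range Cf = {}"
  shows "m s \<Lambda> = m s (\<Lambda> \<inter> S \<phi> (op s))"
proof -
  let ?S = "S \<phi> (op s)"
  have "(\<Lambda> - ?S) \<union> ?S \<subseteq> - range Cf" using S_exits[of \<phi> "op s"] \<Lambda> by blast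
  then have "m s ((\<Lambda> - ?S) \<union> ?S) \<le> 1 - q"
    using m_mono[OF node_R[OF s], of "(\<Lambda> - ?S) \<union> ?S" "- range Cf"] m_exits[OF s] by linarith
  moreover have "m s ((\<Lambda> - ?S) \<union> ?S) = m s (\<Lambda> - ?S) + m s ?S" by (rule m_Un[OF node_R[OF s]]) auto
  ultimately have "m s (\<Lambda> - ?S) = 0" using m_S[OF s] m_nonneg[of s "\<Lambda> - ?S"] by simp
  moreover have "m s ((\<Lambda> \<inter> ?S) \<union> (\<Lambda> - ?S)) = m s (\<Lambda> \<inter> ?S) + m s (\<Lambda> - ?S)"
    by (rule m_Un[OF node_R[OF s]]) auto
  moreover have "(\<Lambda> \<inter> ?S) \<union> (\<Lambda> - ?S) = \<Lambda>" by auto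
  ultimately show ?thesis by simp
qed

definition \<mu> :: "'s \<Rightarrow> 'l letter \<Rightarrow> real" where "\<mu> s a = m s {Ex (lab s = Cf True) (op s) a}"

lemma \<mu>_node: "node \<phi> s \<Longrightarrow> \<mu> s a = m s {Ex \<phi> (op s) a}"
proof -
  assume "node \<phi> s"
  then have "(lab s = Cf True) = \<phi>" by (auto simp: node_def)
  then show ?thesis by (simp only: \<mu>_def)
qed

lemma m_letters:
  assumes s: "node \<phi> s" and "finite A"
  shows "m s (Ex \<phi> (op s) ` A) = (\<Sum>a\<in>A. \<mu> s a)"
  using assms(2)
proof (induction A)
  case empty
  then show ?case by (simp add: m_def)
next
  case (insert a A)
  have "m s ({Ex \<phi> (op s) a} \<union> Ex \<phi> (op s) ` A) = \<mu> s a + m s (Ex \<phi> (op s) ` A)"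
    unfolding \<mu>_node[OF s] by (rule m_Un[OF node_R[OF s]]) (use insert in auto)
  with insert show ?case by simp
qed

lemma m_sum:
  assumes s: "node \<phi> s" and \<Lambda>: "\<Lambda> \<inter> range Cf = {}"
  shows "m s \<Lambda> = (\<Sum>a\<in>{a \<in> Alw (op s). Ex \<phi> (op s) a \<in> \<Lambda>}. \<mu> s a)"
proof -
  have "\<Lambda> \<inter> S \<phi> (op s) = Ex \<phi> (op s) ` {a \<in> Alw (op s). Ex \<phi> (op s) a \<in> \<Lambda>}" by (auto simp: S_def)
  then show ?thesis using m_pure[OF s \<Lambda>] m_letters[OF s] finite_Alw by simp
qed

lemma m_lam:
  assumes "node \<phi> s" shows "m s (lam x \<phi>) = (\<Sum>a\<in>{a \<in> Alw (op s). inA x (op s) a}. \<mu> s a)"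
proof -
  have "{a \<in> Alw (op s). Ex \<phi> (op s) a \<in> lam x \<phi>} = {a \<in> Alw (op s). inA x (op s) a}"
    using op(1)[OF assms] by auto
  then show ?thesis using m_sum[OF assms lam_exits] by simp
qed

lemma m_lam':
  assumes "node (\<not> \<phi>) s" shows "m s (lam x \<phi>) = (\<Sum>a\<in>{a \<in> Alw (op s). inB x (op s) a}. \<mu> s a)"
proof -
  have "{a \<in> Alw (op s). Ex (\<not> \<phi>) (op s) a \<in> lam x \<phi>} = {a \<in> Alw (op s). inB x (op s) a}"
    using op(1)[OF assms] by auto
  then show ?thesis using m_sum[OF assms lam_exits] by simp
qed

lemma \<mu>_outside: "node \<phi> s \<Longrightarrow> a \<notin> Alw (op s) \<Longrightarrow> \<mu> s a = 0"
proof -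
  assume s: "node \<phi> s" and a: "a \<notin> Alw (op s)"
  have "{Ex \<phi> (op s) a} \<inter> Lset = {}" using a by (auto simp: Lset_def)
  then show ?thesis using m_Lset[OF node_R[OF s], of "{Ex \<phi> (op s) a}"] \<mu>_node[OF s] by (simp add: m_def)
qed

lemma sum_\<mu>: "node \<phi> s \<Longrightarrow> (\<Sum>a\<in>Alw (op s). \<mu> s a) = 1 - q"
proof -
  assume s: "node \<phi> s"
  have "S \<phi> (op s) = Ex \<phi> (op s) ` Alw (op s)" by (auto simp: S_def)
  then show ?thesis using m_S[OF s] m_letters[OF s finite_Alw] by simp
qed

lemma sum_\<mu>_in:
  assumes s: "node \<phi> s" and "finite A"
  shows "(\<Sum>a\<in>{a \<in> Alw (op s). a \<in> A}. \<mu> s a) = (\<Sum>a\<in>A. \<mu> s a)"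
  by (rule sum.mono_neutral_left) (use assms \<mu>_outside in auto)

lemma \<mu>_bounds: "0 \<le> \<mu> s a" "node \<phi> s \<Longrightarrow> \<mu> s a \<le> 1"
  by (simp_all add: \<mu>_def m_nonneg m_le_1 node_R)

lemma bdd_\<mu>: "bdd \<phi> (\<lambda>t. \<mu> t a)"
  by (rule bddI[of _ _ 1]) (auto simp: \<mu>_bounds)

lemma \<mu>_G: "node \<phi> s \<Longrightarrow> kk < KK \<Longrightarrow> \<mu> s (LG kk) = p\<^sup>2"
proof -
  assume s: "node \<phi> s" and kk: "kk < KK"
  have "m s (lam (CG kk) \<phi>) = (1 - q) * of_rat (cst (CG kk))"
    by (rule con_same[OF s]) (use kk in \<open>auto simp: Cns_def\<close>)
  moreover have "m s (lam (CG kk) \<phi>) = \<mu> s (LG kk)"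
    unfolding m_lam[OF s] using sum_\<mu>_in[OF s, of "{LG kk}"] by simp
  ultimately show ?thesis using q2 by (simp add: of_rat_cst del: cst.simps)
qed

lemma E_cong_Nx: "(\<And>w. w \<in> Nx s \<Longrightarrow> f (last w) = g (last w)) \<Longrightarrow> E s f = E s g"
  unfolding E_def by (rule Bochner_Integration.integral_cong[OF refl]) (auto simp: indicator_def)

abbreviation dir :: "'s \<Rightarrow> nat" where "dir t \<equiv> fst (op t)"
abbreviation loc :: "'s \<Rightarrow> 'l" where "loc t \<equiv> fst (snd (op t))"

lemma opD: "node \<phi> s \<Longrightarrow> op s = (d, l, c) \<Longrightarrow> l \<in> Loc \<and> c < nch l \<and> d < 3"
  using op(1)[of \<phi> s] by (auto simp: Opt_def)

text \<open>\<open>LK e (tg l c e)\<close> is not allowed, so the constant of \<open>CK\<close> must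
  come entirely from the successors. A successor of this kind puts all of its exit mass
  \<open>1 - q\<close> into the counted set, any other puts nothing.\<close>

lemma E_kind:
  assumes s: "node \<phi> s" and w: "op s = (d, l, c)" and e: "e < 3"
  shows "E s (\<lambda>t. if dir t = e \<and> loc t = tg l c e then 1 else 0) = p"
proof -
  let ?x = "CK e (tg l c e)"
  have x: "?x \<in> Cns" using opD[OF s w] tg e by (auto simp: Cns_def)
  have "m s (lam ?x \<phi>) = 0"
    unfolding m_lam[OF s] by (rule sum.neutral) (auto simp: w Alw.simps)
  moreover have "E s (\<lambda>t. m t (lam ?x \<phi>)) = E s (\<lambda>t. (1 - q) * (if dir t = e \<and> loc t = tg l c e then 1 else 0))"
  proof (rule E_cong[OF s])
    fix t assume t: "node (\<not> \<phi>) t"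
    show "m t (lam ?x \<phi>) = (1 - q) * (if dir t = e \<and> loc t = tg l c e then 1 else 0)"
    proof (cases "dir t = e \<and> loc t = tg l c e")
      case True
      then have "{a \<in> Alw (op t). inB ?x (op t) a} = Alw (op t)" by simp
      then show ?thesis unfolding m_lam'[OF t] using sum_\<mu>[OF t] True by simp
    next
      case False
      then have "{a \<in> Alw (op t). inB ?x (op t) a} = {}" by simp
      then show ?thesis unfolding m_lam'[OF t] using False by (simp only: if_False sum.empty mult_zero_right)
    qed
  qed
  ultimately have "(1 - q) * E s (\<lambda>t. if dir t = e \<and> loc t = tg l c e then 1 else 0) =
      (1 - q\<^sup>2) * (p / (1 + q))"
    using con_two_step[OF s x] E_cmult by (simp add: of_rat_cst del: cst.simps)
  also have "(1 - q\<^sup>2) * (p / (1 + q)) = (1 - q) * p"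
    using q2 by (simp add: field_simps power2_eq_square)
  finally show ?thesis using q2 by simp
qed

text \<open>The prescribed kinds of successors take \<open>p\<close> for each of the three
  directions, which is all of \<open>q\<close>; so no passage to another kind of successor is
  left.\<close>

lemma successor_kind:
  assumes s: "node \<phi> s" and w: "op s = (d, l, c)" and v: "v \<in> Nx s"
  shows "dir (last v) < 3 \<and> loc (last v) = tg l c (dir (last v))"
proof -
  let ?i = "\<lambda>e t. if dir t = e \<and> loc t = tg l c e then 1 else (0::real)"
  let ?g = "\<lambda>t. 1 - (?i 0 t + (?i 1 t + ?i 2 t))"
  have b: "bdd (\<not> \<phi>) (?i e)" for e by (rule bddI[of _ _ 1]) simp
  have b12: "bdd (\<not> \<phi>) (\<lambda>t. ?i 1 t + ?i 2 t)" by (rule bdd_add[OF b b])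
  have b012: "bdd (\<not> \<phi>) (\<lambda>t. ?i 0 t + (?i 1 t + ?i 2 t))" by (rule bdd_add[OF b b12])
  have k: "E s (?i 0) = p" "E s (?i 1) = p" "E s (?i 2) = p" by (rule E_kind[OF s w]; simp)+
  have "E s ?g = E s (\<lambda>_. 1) - (E s (?i 0) + (E s (?i 1) + E s (?i 2)))"
    using E_diff[OF s bdd_const b012] E_add[OF s b b12] E_add[OF s b b] by (simp only:)
  also have "\<dots> = 0" unfolding k E_one[OF s] by (simp add: q_def)
  finally have "E s ?g = 0" .
  moreover have "bdd (\<not> \<phi>) ?g" by (rule bdd_diff[OF bdd_const b012])
  moreover have "0 \<le> ?g t" for t by auto
  ultimately have "?g (last v) = 0" using E_zero[OF s _ _ _ v, of ?g] by blast
  then show ?thesis by (auto split: if_splits)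
qed

section \<open>Conditional means over the successors in one direction\<close>

definition Av :: "'s \<Rightarrow> nat \<Rightarrow> ('s \<Rightarrow> real) \<Rightarrow> real" where
  "Av s e g = E s (\<lambda>t. if dir t = e then g t else 0) / p"

lemma Av_one:
  assumes s: "node \<phi> s" and e: "e < 3" shows "Av s e (\<lambda>_. 1) = 1"
proof -
  obtain d l c where w: "op s = (d, l, c)" by (cases "op s")
  have "E s (\<lambda>t. if dir t = e then 1 else 0) = E s (\<lambda>t. if dir t = e \<and> loc t = tg l c e then 1 else 0)"
    by (rule E_cong_Nx) (use successor_kind[OF s w] in auto)
  then show ?thesis using E_kind[OF s w e] p_bounds(1) by (simp add: Av_def)
qed

lemma Av_add: "node \<phi> s \<Longrightarrow> bdd (\<not> \<phi>) f \<Longrightarrow> bdd (\<not> \<phi>) g \<Longrightarrow> Av s e (\<lambda>t. f t + g t) = Av s e f + Av s e g"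
proof -
  assume a: "node \<phi> s" "bdd (\<not> \<phi>) f" "bdd (\<not> \<phi>) g"
  have "E s (\<lambda>t. if dir t = e then f t + g t else 0) =
      E s (\<lambda>t. (if dir t = e then f t else 0) + (if dir t = e then g t else 0))"
    by (rule E_cong_Nx) simp
  then show ?thesis unfolding Av_def
    using E_add[OF a(1) bdd_if[OF a(2)] bdd_if[OF a(3)]] by (simp add: add_divide_distrib)
qed

lemma Av_cmult: "Av s e (\<lambda>t. c * g t) = c * Av s e g"
proof -
  have "E s (\<lambda>t. if dir t = e then c * g t else 0) = E s (\<lambda>t. c * (if dir t = e then g t else 0))"
    by (rule E_cong_Nx) simp
  then show ?thesis unfolding Av_def by (simp add: E_cmult)
qed

lemma Av_const: "node \<phi> s \<Longrightarrow> e < 3 \<Longrightarrow> Av s e (\<lambda>_. c) = c"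
  using Av_cmult[of s e c "\<lambda>_. 1"] Av_one[of \<phi> s e] by simp

lemma Av_mono:
  assumes "node \<phi> s" "bdd (\<not> \<phi>) f" "bdd (\<not> \<phi>) g"
    and "\<And>v. v \<in> Nx s \<Longrightarrow> dir (last v) = e \<Longrightarrow> f (last v) \<le> g (last v)"
  shows "Av s e f \<le> Av s e g"
  unfolding Av_def
  by (intro divide_right_mono E_mono[OF assms(1)] bdd_if assms(2,3)) (use assms(4) p_bounds(1) in auto)

lemma Av_zero:
  assumes "node \<phi> s" "bdd (\<not> \<phi>) g" "\<And>t. node (\<not> \<phi>) t \<Longrightarrow> 0 \<le> g t" "Av s e g = 0"
    and "v \<in> Nx s" "dir (last v) = e"
  shows "g (last v) = 0"
proof -
  have "E s (\<lambda>t. if dir t = e then g t else 0) = 0" using assms(4) p_bounds(1) by (simp add: Av_def)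
  then have "(if dir (last v) = e then g (last v) else 0) = 0"
    by (rule E_zero[OF assms(1) bdd_if[OF assms(2)], rotated]) (use assms(3,5) in auto)
  then show ?thesis using assms(6) by simp
qed

lemma successor_exists:
  assumes "node \<phi> s" "e < 3"
  shows "\<exists>v\<in>Nx s. dir (last v) = e"
proof (rule ccontr)
  assume "\<not> (\<exists>v\<in>Nx s. dir (last v) = e)"
  then have "E s (\<lambda>t. if dir t = e then 1 else 0) = E s (\<lambda>t. 0 * 1)"
    by (intro E_cong_Nx) auto
  then show False using Av_one[OF assms] E_cmult[of s 0] by (simp add: Av_def)
qed

definition X :: "bool \<Rightarrow> nat \<Rightarrow> 's \<Rightarrow> real" where "X b i s = \<mu> s (LB (b, i)) / p"

lemma bdd_X: "bdd \<phi> (X b i)"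
  using bdd_mult[OF bdd_const bdd_\<mu>, of \<phi> "1 / p" "LB (b, i)"] by (simp add: X_def[abs_def])

text \<open>\<open>LN\<close> gets what the successors in direction \<open>e\<close> leave of
  \<open>p\<^sup>2\<close>: they are reached with probability \<open>p\<close>, and each shows the
  register with probability \<open>p\<close> times its component.\<close>

lemma \<mu>_N:
  assumes s: "node \<phi> s" and e: "e < 3" and i: "i < k" and kk: "kk < KK"
  shows "\<mu> s (LN kk e (b, i)) = p\<^sup>2 * (1 - Av s e (X b i))"
proof -
  let ?x = "CN kk e (b, i)"
  have x: "?x \<in> Cns" using e i kk by (auto simp: Cns_def Vt_def)
  have "m s (lam ?x \<phi>) = \<mu> s (LN kk e (b, i))"
    unfolding m_lam[OF s] using sum_\<mu>_in[OF s, of "{LN kk e (b, i)}"] by simp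
  moreover have "E s (\<lambda>t. m t (lam ?x \<phi>)) = E s (\<lambda>t. p * (if dir t = e then X b i t else 0))"
  proof (rule E_cong[OF s])
    fix t assume t: "node (\<not> \<phi>) t"
    show "m t (lam ?x \<phi>) = p * (if dir t = e then X b i t else 0)"
      unfolding m_lam'[OF t] using sum_\<mu>_in[OF t, of "{LB (b, i)}"] p_bounds(1) by (simp add: X_def)
  qed
  moreover have "\<dots> = p\<^sup>2 * Av s e (X b i)"
    unfolding E_cmult Av_def using p_bounds(1) by (simp add: power2_eq_square)
  moreover have "(1 - q\<^sup>2) * of_rat (cst ?x) = p\<^sup>2" using q2 by (simp add: of_rat_cst del: cst.simps)
  ultimately show ?thesis using con_two_step[OF s x] by (simp add: right_diff_distrib)
qed

lemma zero_guard:
  assumes s: "node \<phi> s" and w: "op s = (d, l, c)" and i: "i \<in> gd l c"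
  shows "X b i s = 1"
proof -
  let ?x = "CZ (b, i)"
  have "i < k" using gd opD[OF s w] i by blast
  then have x: "?x \<in> Cns" by (auto simp: Cns_def Vt_def)
  have "m s (lam ?x \<phi>) = (1 - q) * of_rat (cst ?x)" by (rule con_same[OF s x]) simp
  moreover have "m s (lam ?x \<phi>) = \<mu> s (LB (b, i))"
    unfolding m_lam[OF s] using sum_\<mu>_in[OF s, of "{LB (b, i)}"] i by (simp add: w)
  ultimately show ?thesis using q2 p_bounds(1) by (simp add: of_rat_cst X_def del: cst.simps)
qed

text \<open>For a source other than \<open>Zr\<close>, \<open>CR\<close> adds \<open>m\<close>
  copies of the complement of the mean, the present value and \<open>KK - m\<close> padding letters.
  The terms \<open>m * p\<^sup>2\<close> cancel and leave a linear equation between the present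
  value and the mean.\<close>

lemma transfer:
  assumes s: "node \<phi> s" and w: "op s = (d, l, c)" and e: "e < 3" and i: "i < k"
  shows "if sr l c e i = Zr then Av s e (X b i) = 1
    else X b (sreg (sr l c e i)) s = cm b (sr l c e i) * p * Av s e (X b i)"
proof (cases "sr l c e i = Zr")
  case True
  have "LN 0 e (b, i) \<notin> Alw (op s)" using True by (auto simp: w Alw.simps)
  then have "\<mu> s (LN 0 e (b, i)) = 0" by (rule \<mu>_outside[OF s])
  then show ?thesis using True \<mu>_N[OF s e i, of 0 b] p_bounds(1) by (simp add: KK_def)
next
  case False
  let ?x = "CR e (b, i)" and ?s = "sr l c e i"
  let ?m = "cm b ?s" and ?j = "sreg ?s"
  let ?A = "(\<lambda>kk. LN kk e (b, i)) ` {..<?m}" and ?G = "LG ` {..<KK - ?m}"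
  have x: "?x \<in> Cns" using e i by (auto simp: Cns_def Vt_def)
  have "{a \<in> Alw (op s). inA ?x (op s) a} = {a \<in> Alw (op s). a \<in> ?A \<union> ({LB (b, ?j)} \<union> ?G)}"
    using False by (auto simp: w Let_def)
  then have "m s (lam ?x \<phi>) = (\<Sum>a\<in>?A \<union> ({LB (b, ?j)} \<union> ?G). \<mu> s a)"
    unfolding m_lam[OF s] using sum_\<mu>_in[OF s, of "?A \<union> ({LB (b, ?j)} \<union> ?G)"] by simp
  also have "\<dots> = (\<Sum>a\<in>?A. \<mu> s a) + (\<mu> s (LB (b, ?j)) + (\<Sum>a\<in>?G. \<mu> s a))"
  proof -
    have "?A \<inter> ({LB (b, ?j)} \<union> ?G) = {}" "{LB (b, ?j)} \<inter> ?G = {}" by auto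
    then have "sum (\<mu> s) (?A \<union> ({LB (b, ?j)} \<union> ?G)) = sum (\<mu> s) ?A + sum (\<mu> s) ({LB (b, ?j)} \<union> ?G)"
      "sum (\<mu> s) ({LB (b, ?j)} \<union> ?G) = sum (\<mu> s) {LB (b, ?j)} + sum (\<mu> s) ?G"
      by (intro sum.union_disjoint; simp)+
    then show ?thesis by simp
  qed
  also have "(\<Sum>a\<in>?A. \<mu> s a) = (\<Sum>kk<?m. \<mu> s (LN kk e (b, i)))"
    by (subst sum.reindex) (auto simp: inj_on_def)
  also have "\<dots> = (\<Sum>kk<?m. p\<^sup>2 * (1 - Av s e (X b i)))"
    by (intro sum.cong refl \<mu>_N[OF s e i]) (use cm_le[of b ?s] in auto)
  also have "(\<Sum>a\<in>?G. \<mu> s a) = (\<Sum>kk<KK - ?m. \<mu> s (LG kk))"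
    by (subst sum.reindex) (auto simp: inj_on_def)
  also have "\<dots> = (\<Sum>kk<KK - ?m. p\<^sup>2)"
    by (intro sum.cong refl \<mu>_G[OF s]) auto
  also have "\<mu> s (LB (b, ?j)) = p * X b ?j s" using p_bounds(1) by (simp add: X_def)
  finally have "m s (lam ?x \<phi>) = ?m * (p\<^sup>2 * (1 - Av s e (X b i))) + (p * X b ?j s + real (KK - ?m) * p\<^sup>2)"
    by simp
  moreover have "m s (lam ?x \<phi>) = (1 - q) * of_rat (cst ?x)" by (rule con_same[OF s x]) simp
  moreover have "(1 - q) * of_rat (cst ?x) = 4 * p" using q2 by (simp add: of_rat_cst del: cst.simps)
  moreover have "real (KK - ?m) * p\<^sup>2 = 4 * p - ?m * p\<^sup>2"
    using p_eqs(2) cm_le[of b ?s] by (simp add: of_nat_diff left_diff_distrib power2_eq_square flip: mult.assoc)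
  ultimately have "?m * (p\<^sup>2 * (1 - Av s e (X b i))) + (p * X b ?j s + (4 * p - ?m * p\<^sup>2)) = 4 * p"
    by (simp only:)
  then have "p * X b ?j s = p * (?m * p * Av s e (X b i))"
    by (simp add: algebra_simps power2_eq_square)
  then show ?thesis using False p_bounds(1) by simp
qed

end

section \<open>Strategies of the register game\<close>

definition (in game) step :: "'l \<Rightarrow> nat \<Rightarrow> nat \<Rightarrow> (nat \<Rightarrow> nat) \<Rightarrow> nat \<Rightarrow> nat" where
  "step l c e r i = (if i < k then sval (sr l c e i) r else 0)"

definition (in game) moves ::
    "('l \<times> nat \<times> (nat \<Rightarrow> nat)) set \<Rightarrow> (('l \<times> nat \<times> (nat \<Rightarrow> nat)) \<times> ('l \<times> nat \<times> (nat \<Rightarrow> nat))) set" where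
  "moves W = {((l, c, r), (tg l c e, c', step l c e r)) | l c r e c'.
     e < 3 \<and> (l, c, r) \<in> W \<and> (tg l c e, c', step l c e r) \<in> W}"

definition (in game) enabled :: "'l \<Rightarrow> nat \<Rightarrow> (nat \<Rightarrow> nat) \<Rightarrow> bool" where
  "enabled l c r \<longleftrightarrow> l \<in> Loc \<and> c < nch l \<and> (\<forall>i\<in>gd l c. r i = 0) \<and>
     (\<forall>e<3. \<forall>i<k. \<forall>j. sr l c e i = Dec j \<longrightarrow> 0 < r j)"

text \<open>Choices are components of \<open>W\<close>, as states of a model with the same location
  and registers may choose differently. Liveness asks only for some path to choice 0, which is what
  a positive hitting probability guarantees.\<close>

definition (in game) strategy :: "('l \<times> nat \<times> (nat \<Rightarrow> nat)) set \<Rightarrow> bool" where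
  "strategy W \<longleftrightarrow> (\<forall>(l, c, r)\<in>W. enabled l c r \<and>
     (\<forall>e<3. \<exists>c'. (tg l c e, c', step l c e r) \<in> W) \<and>
     (live l \<longrightarrow> (\<exists>r'. ((l, c, r), (l, 0, r')) \<in> (moves W)\<^sup>*)))"

lemma vv_simps: "vv b 0 = 1" "vv b (Suc n) = vv b n / (if b then 2 else 4)" "vv b n > 0"
  by (auto simp: vv_def)

context game_model
begin

declare cm.simps [simp del]

section \<open>Convexity, and exactness of the register values\<close>

lemma variance:
  assumes s: "node \<phi> s" and e: "e < 3" and g: "bdd (\<not> \<phi>) g"
  shows "Av s e (\<lambda>t. (g t - a)\<^sup>2) = Av s e (\<lambda>t. g t * g t) - 2 * a * Av s e g + a * a"
proof -
  have gg: "bdd (\<not> \<phi>) (\<lambda>t. g t * g t)" and ag: "bdd (\<not> \<phi>) (\<lambda>t. (- 2 * a) * g t)"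
    by (intro bdd_mult bdd_const g)+
  have "Av s e (\<lambda>t. (g t - a)\<^sup>2) = Av s e (\<lambda>t. (g t * g t + (- 2 * a) * g t) + a * a)"
    by (rule arg_cong[of _ _ "Av s e"]) (simp add: power2_eq_square algebra_simps)
  also have "\<dots> = Av s e (\<lambda>t. g t * g t) + (- 2 * a) * Av s e g + a * a"
    unfolding Av_add[OF s bdd_add[OF gg ag] bdd_const] Av_add[OF s gg ag] Av_cmult Av_const[OF s e]
    by (rule refl)
  finally show ?thesis by simp
qed

lemma Av_square:
  assumes s: "node \<phi> s" and e: "e < 3" and g: "bdd (\<not> \<phi>) g"
  shows "(Av s e g)\<^sup>2 \<le> Av s e (\<lambda>t. g t * g t)"
proof -
  let ?a = "Av s e g"
  have "bdd (\<not> \<phi>) (\<lambda>t. (g t - ?a)\<^sup>2)"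
    unfolding power2_eq_square by (intro bdd_mult bdd_diff g bdd_const)
  then have "Av s e (\<lambda>_. 0) \<le> Av s e (\<lambda>t. (g t - ?a)\<^sup>2)"
    by (intro Av_mono[OF s]) auto
  then show ?thesis
    unfolding variance[OF s e g] Av_const[OF s e] by (simp add: power2_eq_square)
qed

text \<open>
  In the verifying location every nonzero register is decremented, so if its defect
  \<open>X False - (X True)\<^sup>2\<close> is negative, then some successor has a defect at least 4 times as negative.
  As the defects are bounded, none of them is negative.
\<close>

lemma convex_ver:
  assumes t: "node \<phi> t" "loc t = ver" and i: "i < k"
  shows "(X True i t)\<^sup>2 \<le> X False i t"
proof (rule ccontr)
  define df where "df t = X False i t - (X True i t)\<^sup>2" for t
  define Z where "Z = {df t | t \<phi>. node \<phi> t \<and> loc t = ver}"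
  assume "\<not> ?thesis"
  then have neg: "df t < 0" by (simp add: df_def)
  have X: "0 \<le> X b i t" "node \<phi> t \<Longrightarrow> X b i t \<le> 1 / p" for b t \<phi>
    using \<mu>_bounds p_bounds(1) by (auto simp: X_def divide_le_cancel)
  have lower: "- (1 / p)\<^sup>2 \<le> df t" if "node \<phi> t" for t \<phi>
    using X(1)[of False t] power_mono[OF X(2)[OF that, of True] X(1)[of True t], of 2]
    unfolding df_def by linarith
  then have bb: "bdd_below Z" unfolding Z_def by (intro bdd_belowI[of _ "- (1 / p)\<^sup>2"]) blast
  have in_Z: "df t \<in> Z" using t by (auto simp: Z_def)
  then have I: "Inf Z < 0" using cInf_lower[OF _ bb] neg by fastforce
  then have "Inf Z < Inf Z / 4" by simp
  then obtain z where z: "z \<in> Z" "z < Inf Z / 4" using cInf_lessD[of Z] in_Z by blast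
  then obtain s \<psi> where s: "node \<psi> s" "loc s = ver" "df s < Inf Z / 4" by (auto simp: Z_def)
  obtain d c where w: "op s = (d, ver, c)" using s(2) by (cases "op s") auto
  have c: "c < nch ver" using opD[OF s(1) w] by simp
  have "i \<in> gd ver c \<or> sr ver c 0 i = Dec i" using ver[OF c _ i, of 0] by simp
  then show False
  proof
    assume "i \<in> gd ver c"
    then have "df s = 0" unfolding df_def using zero_guard[OF s(1) w] by simp
    then show False using s(3) I by simp
  next
    assume dec: "sr ver c 0 i = Dec i"
    have tr: "X b i s = (if b then 1 / 2 else 1 / 4) * Av s 0 (X b i)" for b
      using transfer[OF s(1) w, of 0 i b] i dec cm_p(3)[of b i] by simp
    have "Av s 0 (\<lambda>t. X True i t * X True i t) + Inf Z = Av s 0 (\<lambda>t. X True i t * X True i t + Inf Z)"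
      using Av_add[OF s(1) bdd_mult[OF bdd_X bdd_X] bdd_const] Av_const[OF s(1), of 0] by simp
    also have "\<dots> \<le> Av s 0 (X False i)"
    proof (rule Av_mono[OF s(1)])
      fix v assume v: "v \<in> Nx s" "dir (last v) = 0"
      have "loc (last v) = ver" using successor_kind[OF s(1) w v(1)] v(2) ver[OF c, of 0 i] i by simp
      then have "df (last v) \<in> Z" using Nx_node[OF s(1) v(1)] by (auto simp: Z_def)
      then have "Inf Z \<le> df (last v)" by (rule cInf_lower[OF _ bb])
      then show "X True i (last v) * X True i (last v) + Inf Z \<le> X False i (last v)"
        by (simp add: df_def power2_eq_square)
    qed (intro bdd_add bdd_mult bdd_X bdd_const)+
    finally have "(Av s 0 (X True i))\<^sup>2 + Inf Z \<le> Av s 0 (X False i)"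
      using Av_square[OF s(1) _ bdd_X, of 0 True i] by simp
    then have "Inf Z / 4 \<le> df s"
      unfolding df_def tr by (simp add: power_mult_distrib power_divide)
    then show False using s(3) by simp
  qed
qed

text \<open>Outside the verifying location, direction 2 shows both components as means over
  successors in that location, where the inequality holds pointwise; and the square of a mean is at
  most the mean of the squares.\<close>

lemma convex:
  assumes s: "node \<phi> s" and i: "i < k"
  shows "(X True i s)\<^sup>2 \<le> X False i s"
proof (cases "loc s = ver")
  case False
  obtain d l c where w: "op s = (d, l, c)" by (cases "op s")
  have lc: "l \<in> Loc" "c < nch l" "l \<noteq> ver" using opD[OF s w] False w by auto
  note d2 = dir2[OF lc, of i]
  have tr: "X b i s = Av s 2 (X b i)" for b
    using transfer[OF s w, of 2 i b] i d2 cm_p(1)[of b i] by simp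
  have "Av s 2 (\<lambda>t. X True i t * X True i t) \<le> Av s 2 (X False i)"
  proof (rule Av_mono[OF s])
    fix v assume v: "v \<in> Nx s" "dir (last v) = 2"
    have "loc (last v) = ver" using successor_kind[OF s w v(1)] v(2) d2 by simp
    then show "X True i (last v) * X True i (last v) \<le> X False i (last v)"
      using convex_ver[OF Nx_node[OF s v(1)] _ i] by (simp add: power2_eq_square)
  qed (intro bdd_mult bdd_X)+
  then show ?thesis using Av_square[OF s _ bdd_X, of 2 True i] unfolding tr by simp
qed (rule convex_ver[OF s _ i])

definition exact :: "'s \<Rightarrow> (nat \<Rightarrow> nat) \<Rightarrow> bool" where
  "exact s r \<longleftrightarrow> (\<forall>i<k. \<forall>b. X b i s = vv b (r i))"

lemma Av_X_le_1: "node \<phi> s \<Longrightarrow> e < 3 \<Longrightarrow> i < k \<Longrightarrow> Av s e (X b i) \<le> 1"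
proof -
  assume a: "node \<phi> s" "e < 3" "i < k"
  have "0 \<le> p\<^sup>2 * (1 - Av s e (X b i))"
    using \<mu>_N[OF a, of 0 b] \<mu>_bounds(1)[of s "LN 0 e (b, i)"] by (simp add: KK_def)
  then show ?thesis using p_bounds(1) by (simp add: zero_le_mult_iff)
qed

text \<open>A register with value 0 cannot be decremented: its component 1 would require mean 2,
  whereas the complement of a mean is proportional to an exit probability and so nonnegative. This
  is how a decrement tests for a positive value.\<close>

lemma Av_exact:
  assumes s: "node \<phi> s" and w: "op s = (d, l, c)" and r: "exact s r" and e: "e < 3" and i: "i < k"
  shows "Av s e (X b i) = vv b (sval (sr l c e i) r)" "sr l c e i = Dec j \<Longrightarrow> 0 < r j"
proof -
  note tr = transfer[OF s w e i]
  have j: "X b (sreg (sr l c e i)) s = vv b (r (sreg (sr l c e i)))" for b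
    using r sr opD[OF s w] e i by (simp add: exact_def)
  have pos: "0 < r j" if j': "sr l c e i = Dec j" for j
  proof (rule ccontr)
    assume "\<not> 0 < r j"
    then have "Av s e (X True i) = 2" using tr[of True] j[of True] j' cm_p(3)[of True j] by (simp add: vv_simps)
    then show False using Av_X_le_1[OF s e i, of True] by simp
  qed
  show "sr l c e i = Dec j \<Longrightarrow> 0 < r j" by (rule pos)
  show "Av s e (X b i) = vv b (sval (sr l c e i) r)"
  proof (cases "sr l c e i")
    case (Keep x)
    then show ?thesis using tr[of b] j[of b] cm_p(1)[of b x] by simp
  next
    case (Inc x)
    then show ?thesis using tr[of b] j[of b] cm_p(2)[of b x] by (cases b) (simp_all add: vv_simps mult.commute)
  next
    case (Dec x)
    obtain y where "r x = Suc y" using pos[OF Dec] by (cases "r x") auto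
    then show ?thesis using Dec tr[of b] j[of b] cm_p(3)[of b x] by (simp add: vv_simps split: if_splits)
  next
    case Zr
    then show ?thesis using tr[of b] by (simp add: vv_simps)
  qed
qed

lemma exact_step:
  assumes s: "node \<phi> s" and w: "op s = (d, l, c)" and r: "exact s r" and e: "e < 3"
    and v: "v \<in> Nx s" "dir (last v) = e"
  shows "exact (last v) (step l c e r)"
  unfolding exact_def
proof (intro allI impI)
  fix i b assume i: "i < k"
  let ?n = "sval (sr l c e i) r"
  let ?a = "vv True ?n"
  \<comment> \<open>A sum of two nonnegative functions, the defect and the squared distance to the
    intended value. Its mean \<open>y - 2 * a * x + a * a\<close> depends only on the means
    \<open>x\<close> and \<open>y\<close> of the two components, and it is 0 for
    \<open>x = a\<close> and \<open>y = a * a\<close>.\<close>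
  let ?g = "\<lambda>t. (X False i t - X True i t * X True i t) + (X True i t - ?a)\<^sup>2"
  have b1: "bdd (\<not> \<phi>) (\<lambda>t. X False i t - X True i t * X True i t)"
    by (intro bdd_diff bdd_mult bdd_X)
  have b2: "bdd (\<not> \<phi>) (\<lambda>t. (X True i t - ?a)\<^sup>2)"
    unfolding power2_eq_square by (intro bdd_mult bdd_diff bdd_X bdd_const)
  have a2: "vv False ?n = ?a * ?a"
    by (simp add: vv_def flip: power_mult_distrib)
  have dif: "Av s e (\<lambda>t. X False i t - X True i t * X True i t) =
      Av s e (X False i) - Av s e (\<lambda>t. X True i t * X True i t)"
    using Av_add[OF s bdd_X[of _ False i] bdd_mult[OF bdd_const[of _ "- 1"] bdd_mult[OF bdd_X bdd_X]], of e True i True i]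
      Av_cmult[of s e "- 1"] by simp
  have "Av s e ?g = Av s e (X False i) - 2 * ?a * Av s e (X True i) + ?a * ?a"
    unfolding Av_add[OF s b1 b2] dif variance[OF s e bdd_X] by simp
  also have "\<dots> = 0" unfolding Av_exact(1)[OF s w r e i] a2 by simp
  finally have 0: "Av s e ?g = 0" .
  have nn: "0 \<le> X False i t - X True i t * X True i t" if "node \<psi> t" for t \<psi>
    using convex[OF that i] by (simp add: power2_eq_square)
  have "?g (last v) = 0"
    by (rule Av_zero[OF s bdd_add[OF b1 b2] _ 0 v]) (use nn in force)
  then have "X True i (last v) = ?a" "X False i (last v) = ?a * ?a"
    using nn[OF Nx_node[OF s v(1)]] by (simp_all add: add_nonneg_eq_0_iff)
  then show "X b i (last v) = vv b (step l c e r i)"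
    using a2 i by (cases b) (simp_all add: step_def)
qed

section \<open>The strategy read off from a model\<close>

definition Sx :: "('s \<times> 's) set" where "Sx = {(s, last v) | s v \<phi>. node \<phi> s \<and> v \<in> Nx s}"

lemma Sx_node: "(s, t) \<in> Sx\<^sup>* \<Longrightarrow> node \<phi> s \<Longrightarrow> \<exists>\<psi>. node \<psi> t"
proof (induction rule: rtrancl_induct)
  case (step y z)
  then obtain v \<psi> where "node \<psi> y" "v \<in> Nx y" "z = last v" by (auto simp: Sx_def)
  then show ?case using Nx_node by blast
qed blast

text \<open>Otherwise no configuration reachable from \<open>s\<close> spends anything on the exits
  in \<open>stops\<close>, so each inherits its hitting probability from its successors with factor
  \<open>q\<close>. The supremum \<open>B\<close> then satisfies \<open>B \<le> B * q\<close> and is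
  not positive, against the condition for live locations.\<close>

lemma live_path:
  assumes s: "node \<phi> s" and live: "live (loc s)"
  shows "\<exists>t. (s, t) \<in> Sx\<^sup>* \<and> snd (op t) = (loc s, 0)"
proof (rule ccontr)
  assume no: "\<not> ?thesis"
  let ?\<Lambda> = "stops (loc s)" and ?T = "{t. (s, t) \<in> Sx\<^sup>*}"
  have ex: "?\<Lambda> \<inter> range Cf = {}" by (auto simp: stops_def)
  have pos: "h ?\<Lambda> s > 0"
    using node_config[OF s] op[OF s] live hp_h[OF node_R[OF s] lam_subset] hp_h[OF node_R[OF s] stops_subset]
    by (auto simp: config_ok_def)
  define B where "B = (SUP t\<in>?T. h ?\<Lambda> t)"
  have bdd: "bdd_above (h ?\<Lambda> ` ?T)"
    using Sx_node[OF _ s] node_R h_bounds(2) by (intro bdd_aboveI2[of _ _ 1]) blast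
  have le: "h ?\<Lambda> t \<le> B" if "(s, t) \<in> Sx\<^sup>*" for t
    unfolding B_def using that by (intro cSUP_upper[OF _ bdd]) simp
  have "h ?\<Lambda> t \<le> B * q" if t: "(s, t) \<in> Sx\<^sup>*" for t
  proof -
    obtain \<psi> where \<psi>: "node \<psi> t" using Sx_node[OF t s] by blast
    have "{a \<in> Alw (op t). Ex \<psi> (op t) a \<in> ?\<Lambda>} = {}" using no t by (auto simp: stops_def)
    then have "m t ?\<Lambda> = 0" unfolding m_sum[OF \<psi> ex] by (simp only: sum.empty)
    then have "h ?\<Lambda> t = E t (h ?\<Lambda>)" using h_split[OF \<psi> ex] by simp
    also have "\<dots> \<le> E t (\<lambda>_. B)"
    proof (rule E_mono[OF \<psi> bdd_h bdd_const])
      fix v assume "v \<in> Nx t"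
      then have "(t, last v) \<in> Sx" using \<psi> by (auto simp: Sx_def)
      with t have "(s, last v) \<in> Sx\<^sup>*" by (rule rtrancl_into_rtrancl)
      then show "h ?\<Lambda> (last v) \<le> B" by (rule le)
    qed
    also have "\<dots> = B * q" by (rule E_const[OF \<psi>])
    finally show ?thesis .
  qed
  then have "(SUP t\<in>?T. h ?\<Lambda> t) \<le> B * q" by (intro cSUP_least) auto
  then have "B \<le> B * q" by (simp only: B_def)
  then have "B * (1 - q) \<le> 0" by (simp add: algebra_simps)
  then have "B \<le> 0" using q2(3) by (simp add: mult_le_0_iff)
  then show False using pos le[of s] by simp
qed

definition W :: "('l \<times> nat \<times> (nat \<Rightarrow> nat)) set" where
  "W = {(l, c, r). \<exists>\<phi> s d. node \<phi> s \<and> op s = (d, l, c) \<and> exact s r \<and> (\<forall>i\<ge>k. r i = 0)}"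

lemma W_step:
  assumes s: "node \<phi> s" "op s = (d, l, c)" "exact s r" "\<forall>i\<ge>k. r i = 0" and v: "v \<in> Nx s"
  shows "((l, c, r), (loc (last v), snd (snd (op (last v))), step l c (dir (last v)) r)) \<in> moves W"
    "exact (last v) (step l c (dir (last v)) r)" "\<forall>i\<ge>k. step l c e r i = 0"
proof -
  note k = successor_kind[OF s(1,2) v]
  show ex: "exact (last v) (step l c (dir (last v)) r)" "\<forall>i\<ge>k. step l c e r i = 0"
    using exact_step[OF s(1-3) _ v refl] k by (auto simp: step_def)
  have "(l, c, r) \<in> W" unfolding W_def using s by blast
  moreover have "(loc (last v), snd (snd (op (last v))), step l c (dir (last v)) r) \<in> W"
    unfolding W_def mem_Collect_eq prod.case using ex(1) Nx_node[OF s(1) v]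
    by (intro exI conjI) (auto simp: step_def prod_eq_iff)
  ultimately show "((l, c, r), (loc (last v), snd (snd (op (last v))), step l c (dir (last v)) r)) \<in> moves W"
    unfolding moves_def mem_Collect_eq using k by (intro exI[of _ l] exI[of _ c] exI[of _ r]
        exI[of _ "dir (last v)"] exI[of _ "snd (snd (op (last v)))"]) simp
qed

lemma W_path:
  assumes "(s, t) \<in> Sx\<^sup>*" and s: "node \<phi> s" "op s = (d, l, c)" "exact s r" "\<forall>i\<ge>k. r i = 0"
  shows "\<exists>r'. exact t r' \<and> (\<forall>i\<ge>k. r' i = 0) \<and> ((l, c, r), (loc t, snd (snd (op t)), r')) \<in> (moves W)\<^sup>*"
  using assms(1)
proof (induction rule: rtrancl_induct)
  case base
  then show ?case using s by (intro exI[of _ r]) simp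
next
  case (step y z)
  then obtain r' where r': "exact y r'" "\<forall>i\<ge>k. r' i = 0"
    "((l, c, r), (loc y, snd (snd (op y)), r')) \<in> (moves W)\<^sup>*" by blast
  obtain v \<psi> where v: "node \<psi> y" "v \<in> Nx y" "z = last v" using step(2) by (auto simp: Sx_def)
  have w: "op y = (dir y, loc y, snd (snd (op y)))" by simp
  note W_step[OF v(1) w r'(1,2) v(2)]
  with r'(3) show ?case unfolding v(3) by (blast intro: rtrancl_into_rtrancl)
qed

lemma strategy_W: "strategy W"
  unfolding strategy_def
proof (intro ballI, clarify, intro conjI allI impI)
  fix l c r assume "(l, c, r) \<in> W"
  then obtain \<phi> s d where s: "node \<phi> s" and w: "op s = (d, l, c)" and r: "exact s r" "\<forall>i\<ge>k. r i = 0"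
    by (auto simp: W_def)
  have lc: "l \<in> Loc" "c < nch l" using opD[OF s w] by auto
  show "enabled l c r"
    unfolding enabled_def
  proof (intro conjI lc ballI allI impI)
    fix i assume i: "i \<in> gd l c"
    have "i < k" using gd[OF lc] i by blast
    then have "vv True (r i) = 1" using zero_guard[OF s w i, of True] r by (simp add: exact_def)
    then show "r i = 0" using power_inject_exp[of "2::real" "r i" 0] by (simp add: vv_def)
  qed (use Av_exact(2)[OF s w r(1)] in blast)
  show "\<exists>c'. (tg l c e, c', step l c e r) \<in> W" if e: "e < 3" for e
  proof -
    obtain v where v: "v \<in> Nx s" "dir (last v) = e" using successor_exists[OF s e] by blast
    have "loc (last v) = tg l c e" using successor_kind[OF s w v(1)] v(2) by simp
    then show ?thesis using W_step(1)[OF s w r v(1)] v(2) by (auto simp: moves_def)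
  qed
  assume "live l"
  then obtain t where t: "(s, t) \<in> Sx\<^sup>*" "snd (op t) = (l, 0)" using live_path[OF s] w by auto
  then show "\<exists>r'. ((l, c, r), l, 0, r') \<in> (moves W)\<^sup>*" using W_path[OF t(1) s w r] by auto
qed

lemma initial_W: "(ini, 0, \<lambda>i. if i = 0 then n else 0) \<in> W"
proof -
  have sat: "sat M (Atom (atm (Cf False))) s0" "sat M (Pur False (0, ini, 0)) s0"
    "sat M (Finally CEq (1 / 2 ^ (Mx + n)) (Atom (atm (xin True)))) s0"
    "sat M (Finally CEq (1 / 2 ^ (Mx + 2 * n)) (Atom (atm (xin False)))) s0"
    using model by (simp_all add: formula_def base_def)
  have s: "node False s0"
    using sat(1) lab(2)[OF R_s0, of "Cf False"] Cf_in R_s0 by (simp add: node_def)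
  have Opt: "(0, ini, 0) \<in> Opt" using ini by (simp add: Opt_def)
  have w: "op s0 = (0, ini, 0)"
    by (rule op_eq[OF s Opt])
      (use sat(2) hp_h[OF R_s0 lam_subset] in \<open>simp add: sat_Pur\<close>)
  have xin: "xin b \<in> Lset" for b using Opt k by (auto simp: xin_def Lset_def Alw.simps Vt_def)
  have \<mu>: "\<mu> s0 (LB (b, 0)) = hp M {xin b} s0" for b
  proof -
    have ex: "{xin b} \<inter> range Cf = {}" by (auto simp: xin_def)
    \<comment> \<open>All successors have phase \<open>True\<close>, where \<open>Theta\<close>
      rules out \<open>xin\<close>; so nothing is contributed after the first configuration.\<close>
    have "E s0 (h {xin b}) = E s0 (\<lambda>_. 0)"
    proof (rule E_cong[OF s])
      fix t assume t: "node (\<not> False) t"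
      have "hp M {xin b} t = 0" using node_config[OF t] by (simp add: config_ok_def)
      then show "h {xin b} t = 0" using hp_h[OF node_R[OF t], of "{xin b}"] xin by simp
    qed
    then have "h {xin b} s0 = m s0 {xin b}" using h_split[OF s ex] E_const[OF s, of 0] by simp
    then show ?thesis using \<mu>_node[OF s, of "LB (b, 0)"] hp_h[OF R_s0, of "{xin b}"] xin w
      by (simp add: xin_def)
  qed
  have "X b 0 s0 = vv b n" for b
  proof -
    \<comment> \<open>\<open>1 / 2 ^ (Mx + n)\<close> and \<open>1 / 2 ^ (Mx + 2 * n)\<close> are
      \<open>p\<close> times the two components of the value \<open>n\<close>.\<close>
    have "hp M {xin b} s0 = p * vv b n"
      using sat(3,4) by (cases b)
        (simp_all add: sat_Finally_Atom of_rat_divide of_rat_mult of_rat_power p_def vv_def power_add power_mult)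
    then show ?thesis using \<mu>[of b] p_bounds(1) by (simp add: X_def)
  qed
  moreover have "X b i s0 = vv b 0" if "i < k" "i \<noteq> 0" for b i
    using zero_guard[OF s w, of i b] that ini by (simp add: vv_simps)
  ultimately have "exact s0 (\<lambda>i. if i = 0 then n else 0)" by (simp add: exact_def)
  moreover have "\<forall>i\<ge>k. (if i = 0 then n else 0) = 0" using k by simp
  ultimately show ?thesis unfolding W_def using s w by blast
qed

end

theorem (in game) model_imp_strategy:
  assumes "is_model M (formula n)"
  shows "\<exists>W. strategy W \<and> (ini, 0, \<lambda>i. if i = 0 then n else 0) \<in> W"
proof -
  obtain s0 where "markov_chain M" "s0 \<in> states M" "sat M (formula n) s0"
    using assms by (auto simp: is_model_def)
  then interpret game_model Loc nch k ini ver tg sr gd live M s0 n by unfold_locales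
  show ?thesis using strategy_W initial_W by blast
qed

section \<open>From winning strategies to models\<close>

lemma hit_one_step:
  assumes M: "markov_chain M" and s: "s \<in> states M" "\<not> Q s"
    and F: "finite F" "F \<subseteq> states M" "\<And>t. t \<in> states M - F \<Longrightarrow> Prob M s t = 0"
  shows "hit M Q s = (\<Sum>t\<in>F. Prob M s t * hit M Q t)"
proof -
  let ?F = "{t \<in> F. Prob M s t > 0}"
  have nn: "0 \<le> Prob M s t" if "t \<in> F" for t
    using M s F(2) that by (auto simp: markov_chain_def)
  have succ: "t \<in> ?F" if "t \<in> states M" "Prob M s t > 0" for t
    using F(3)[of t] that by fastforce
  have cyl: "\<pi> \<in> cylinder M s [s, t] \<longleftrightarrow> \<pi> \<in> runs M s \<and> \<pi> 1 = t" for \<pi> t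
    by (auto simp: cylinder_def runs_def less_Suc_eq)
  have "ennreal (hit M Q s) =
      (\<integral>\<^sup>+w. ennreal (path_weight M w) * ennreal (hit M Q (last w)) \<partial>count_space ((\<lambda>t. [s, t]) ` ?F))"
  proof (rule hit_decomposition[OF M _ s(1)])
    show "(\<lambda>t. [s, t]) ` ?F \<subseteq> finite_paths M s"
      using s F(2) by (auto simp: finite_paths_def nth_Cons')
    show "disjoint_family_on (cylinder M s) ((\<lambda>t. [s, t]) ` ?F)"
      by (auto simp: disjoint_family_on_def cyl)
    fix \<pi> i assume \<pi>: "\<pi> \<in> runs M s"
    then have "\<pi> 1 \<in> states M" "Prob M s (\<pi> 1) > 0" by (auto simp: runs_def dest: spec[of _ 0])
    then show "\<exists>w\<in>(\<lambda>t. [s, t]) ` ?F. \<pi> \<in> cylinder M s w"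
      using \<pi> succ by (intro bexI[of _ "[s, \<pi> 1]"]) (auto simp: cyl)
  next
    fix w i assume "w \<in> (\<lambda>t. [s, t]) ` ?F" "i < length w - 1"
    then show "\<not> Q (w ! i)" using s(2) by auto
  qed
  also have "\<dots> = (\<Sum>w\<in>(\<lambda>t. [s, t]) ` ?F. ennreal (path_weight M w) * ennreal (hit M Q (last w)))"
    using F(1) by (intro nn_integral_count_space_finite) simp
  also have "\<dots> = (\<Sum>t\<in>?F. ennreal (Prob M s t * hit M Q t))"
    by (subst sum.reindex) (auto simp: inj_on_def path_weight_def ennreal_mult nn intro!: sum.cong)
  also have "\<dots> = ennreal (\<Sum>t\<in>?F. Prob M s t * hit M Q t)"
    by (rule sum_ennreal) (simp add: less_imp_le)
  also have "(\<Sum>t\<in>?F. Prob M s t * hit M Q t) = (\<Sum>t\<in>F. Prob M s t * hit M Q t)"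
    using F(1) nn by (intro sum.mono_neutral_left) (auto simp: order.order_iff_strict)
  finally show ?thesis
    using nn by (subst (asm) ennreal_inj) (auto intro!: sum_nonneg)
qed

lemma reach_absorbing:
  assumes "reach M s t" and abs: "\<And>u. u \<in> states M \<Longrightarrow> Prob M s u > 0 \<Longrightarrow> u = s"
  shows "t = s"
proof -
  obtain w where w: "w \<in> finite_paths M s" "last w = t" using assms(1) by (auto simp: reach_def)
  have "w ! i = s" if "i < length w" for i
    using that
  proof (induction i)
    case 0
    then show ?case using finite_pathsD(2)[OF w(1)] by simp
  next
    case (Suc i)
    then show ?case using finite_pathsD(3,6)[OF w(1)] abs by (metis Suc_lessD)
  qed
  then show ?thesis using w finite_pathsD(1)[OF w(1)] by (simp add: last_conv_nth)
qed

lemma has_sum_finite_support: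
  assumes "finite F" "F \<subseteq> A" "\<And>x. x \<in> A - F \<Longrightarrow> f x = 0" "sum f F = v"
  shows "(f has_sum v) A"
  using has_sum_finite[OF assms(1), of f] assms
  by (subst has_sum_cong_neutral[of F A f f]) auto

lemma sum_image_le:
  fixes f :: "'b \<Rightarrow> real" and B :: real
  assumes "finite I" "\<And>x. x \<in> I \<Longrightarrow> f (g x) \<le> B" "0 \<le> B"
  shows "sum f (g ` I) \<le> card I * B"
proof -
  have "sum f (g ` I) \<le> card (g ` I) * B" using assms by (intro sum_bounded_above) auto
  also have "\<dots> \<le> card I * B" using assms card_image_le by (intro mult_right_mono) auto
  finally show ?thesis .
qed

lemma sum_Un_le:
  fixes f :: "'b \<Rightarrow> real"
  assumes "finite A" "finite B" "\<And>x. 0 \<le> f x"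
  shows "sum f (A \<union> B) \<le> sum f A + sum f B"
  using sum.union_inter[OF assms(1,2), of f] sum_nonneg[of "A \<inter> B" f] assms(3) by simp

datatype 'l st = Cg bool nat 'l "nat \<Rightarrow> nat" | Xt "'l label"

text \<open>In contrast to \<open>strategy\<close>, the choice is a function of location and
  registers; so up to phase and direction, a configuration can itself be a state of the chain.
  Liveness follows the single path of direction 0, which is enough for a positive
  probability.\<close>

locale game_strategy = game Loc nch k ini ver tg sr gd live
  for Loc :: "'l set" and nch k ini ver tg sr gd live +
  fixes W :: "('l \<times> (nat \<Rightarrow> nat)) set" and ch :: "'l \<Rightarrow> (nat \<Rightarrow> nat) \<Rightarrow> nat" and n :: nat
  assumes W: "\<And>l r. (l, r) \<in> W \<Longrightarrow> enabled l (ch l r) r"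
    and W_step: "\<And>l r e. (l, r) \<in> W \<Longrightarrow> e < 3 \<Longrightarrow> (tg l (ch l r) e, step l (ch l r) e r) \<in> W"
    and W_supp: "\<And>l r i. (l, r) \<in> W \<Longrightarrow> k \<le> i \<Longrightarrow> r i = 0"
    and W_live: "\<And>l r. (l, r) \<in> W \<Longrightarrow> live l \<Longrightarrow> \<exists>j r'.
      ((\<lambda>(l, r). (tg l (ch l r) 0, step l (ch l r) 0 r)) ^^ j) (l, r) = (l, r') \<and> ch l r' = 0"
    and W_ini: "(ini, \<lambda>i. if i = 0 then n else 0) \<in> W"
begin

section \<open>The chain of a positional strategy\<close>

definition ow :: "nat \<Rightarrow> 'l \<Rightarrow> (nat \<Rightarrow> nat) \<Rightarrow> 'l opt" where "ow d l r = (d, l, ch l r)"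
definition nl :: "'l \<Rightarrow> (nat \<Rightarrow> nat) \<Rightarrow> nat \<Rightarrow> 'l" where "nl l r e = tg l (ch l r) e"
definition nr :: "'l \<Rightarrow> (nat \<Rightarrow> nat) \<Rightarrow> nat \<Rightarrow> nat \<Rightarrow> nat" where "nr l r e = step l (ch l r) e r"
definition nw :: "'l \<Rightarrow> (nat \<Rightarrow> nat) \<Rightarrow> nat \<Rightarrow> 'l opt" where "nw l r e = ow e (nl l r e) (nr l r e)"

primrec lb :: "'l st \<Rightarrow> 'l label" where "lb (Cg \<phi> d l r) = Cf \<phi>" | "lb (Xt L) = L"

text \<open>The constraints solved for the single letters. The factor \<open>1 - q\<close> in
  \<open>LO\<close> and \<open>LK\<close> is the exit mass of a successor, against which these
  letters are balanced; \<open>LO w\<close> is what remains of \<open>q\<close> when the successor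
  with option \<open>w\<close>, if there is one, has taken its \<open>p\<close>.\<close>

primrec mass0 :: "'l \<Rightarrow> (nat \<Rightarrow> nat) \<Rightarrow> 'l letter \<Rightarrow> real" where
  "mass0 l r (LB v) = p * vv (fst v) (r (snd v))"
| "mass0 l r (LN kk e v) = p\<^sup>2 * (1 - vv (fst v) (nr l r e (snd v)))"
| "mass0 l r (LG kk) = p\<^sup>2"
| "mass0 l r (LO w) = (1 - q) * (q - (if fst w < 3 \<and> nw l r (fst w) = w then p else 0))"
| "mass0 l r (LK e l') = (1 - q) * p"
| "mass0 l r LR = 0"

definition mass :: "nat \<Rightarrow> 'l \<Rightarrow> (nat \<Rightarrow> nat) \<Rightarrow> 'l letter \<Rightarrow> real" where
  "mass d l r a = (if a = LR then 1 - q - (\<Sum>a\<in>Alw (ow d l r). mass0 l r a) else mass0 l r a)"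

fun trans :: "'l st \<Rightarrow> 'l st \<Rightarrow> real" where
  "trans (Cg \<phi> d l r) (Cg \<psi> e l' r') =
     (if \<psi> \<noteq> \<phi> \<and> e < 3 \<and> l' = nl l r e \<and> r' = nr l r e then p else 0)"
| "trans (Cg \<phi> d l r) (Xt (Ex \<psi> w a)) = (if \<psi> = \<phi> \<and> w = ow d l r then mass d l r a else 0)"
| "trans (Cg \<phi> d l r) (Xt (Cf \<psi>)) = 0"
| "trans (Xt L) t = (if t = Xt L then 1 else 0)"

definition N :: "('l st, nat) mc" where
  "N = \<lparr>states = {Cg \<phi> d l r | \<phi> d l r. d < 3 \<and> (l, r) \<in> W} \<union> Xt ` (Lset - range Cf),
     Prob = trans, val = \<lambda>t. {atm (lb t)}\<rparr>"

lemma N_simps [simp]: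
  "Cg \<phi> d l r \<in> states N \<longleftrightarrow> d < 3 \<and> (l, r) \<in> W"
  "Xt L \<in> states N \<longleftrightarrow> L \<in> Lset \<and> L \<notin> range Cf"
  "Prob N = trans" "val N t = {atm (lb t)}"
  by (auto simp: N_def)

lemma W_Opt: "(l, r) \<in> W \<Longrightarrow> d < 3 \<Longrightarrow> ow d l r \<in> Opt"
  using W[of l r] by (simp add: ow_def Opt_def enabled_def)

lemma W_next: "(l, r) \<in> W \<Longrightarrow> e < 3 \<Longrightarrow> (nl l r e, nr l r e) \<in> W"
  using W_step by (simp add: nl_def nr_def)

lemma lb_Lset: "t \<in> states N \<Longrightarrow> lb t \<in> Lset"
  by (cases t) (auto simp: Lset_def)

lemma vv_bounds: "0 < vv b j" "vv b j \<le> 1"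
  by (auto simp: vv_def divide_le_eq)

lemma mass0_nonneg: "0 \<le> mass0 l r a"
  using p_bounds(1) vv_bounds(1)[THEN less_imp_le] vv_bounds(2) q2(3) by (cases a) (auto simp: q_def)

lemma LR_notin: "LR \<in> Alw w" by (cases w) (simp add: Alw.simps)

text \<open>The estimate that dictates \<open>Mx\<close>: each group of letters counts with its
  number times a bound for the mass of one letter.\<close>

lemma mass0_sum: "(\<Sum>a\<in>Alw w. mass0 l r a) \<le> 1 - q"
proof -
  obtain d l0 c where w: "w = (d, l0, c)" by (cases w)
  let ?f = "mass0 l r"
  let ?A1 = "LB ` Vt" and ?A2 = "(\<lambda>(kk, e, v). LN kk e v) ` ({..<KK} \<times> {..<3} \<times> Vt)"
    and ?A3 = "LG ` {..<KK}" and ?A4 = "LO ` Opt" and ?A5 = "(\<lambda>(e, l'). LK e l') ` ({..<3} \<times> Loc)"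
  have fin: "finite ?A1" "finite ?A2" "finite ?A3" "finite ?A4" "finite ?A5"
    using finite_Vt finite_Opt finite_Loc by simp_all
  have card: "card Vt = 2 * k" by (simp add: Vt_def card_cartesian_product)
  have "sum ?f (Alw w) \<le> sum ?f (?A1 \<union> (?A2 \<union> (?A3 \<union> (?A4 \<union> (?A5 \<union> {LR})))))"
  proof (rule sum_mono2)
    have "{LN kk e v | kk e v. kk < KK \<and> e < 3 \<and> v \<in> Vt \<and> sr l0 c e (snd v) \<noteq> Zr} \<subseteq> ?A2"
    proof clarify
      fix kk e v assume "kk < KK" "e < (3::nat)" "v \<in> Vt"
      then show "LN kk e v \<in> ?A2" by (intro image_eqI[of _ _ "(kk, e, v)"]) auto
    qed
    moreover have "{LK e l' | e l'. e < 3 \<and> l' \<in> Loc \<and> l' \<noteq> tg l0 c e} \<subseteq> ?A5"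
    proof clarify
      fix e l' assume "e < (3::nat)" "l' \<in> Loc"
      then show "LK e l' \<in> ?A5" by (intro image_eqI[of _ _ "(e, l')"]) auto
    qed
    ultimately show "Alw w \<subseteq> ?A1 \<union> (?A2 \<union> (?A3 \<union> (?A4 \<union> (?A5 \<union> {LR}))))"
      unfolding w Alw.simps by blast
  qed (use fin mass0_nonneg in simp_all)
  also have "\<dots> \<le> sum ?f ?A1 + (sum ?f ?A2 + (sum ?f ?A3 + (sum ?f ?A4 + (sum ?f ?A5 + sum ?f {LR}))))"
    by (intro order_trans[OF sum_Un_le] add_left_mono fin mass0_nonneg finite_UnI) simp_all
  also have "sum ?f {LR} = 0" by simp
  also have "sum ?f ?A1 \<le> card Vt * p"
    using p_bounds(1) vv_bounds(2) by (intro sum_image_le finite_Vt) (simp_all add: mult_left_le)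
  also have "sum ?f ?A2 \<le> card ({..<KK} \<times> {..<3::nat} \<times> Vt) * p\<^sup>2"
  proof (rule sum_image_le)
    fix x assume "x \<in> {..<KK} \<times> {..<3::nat} \<times> Vt"
    show "?f (case x of (kk, e, v) \<Rightarrow> LN kk e v) \<le> p\<^sup>2"
      using vv_bounds(1)[THEN less_imp_le] p_bounds(1) by (cases x) (simp add: mult_left_le)
  qed (simp_all add: finite_Vt)
  also have "sum ?f ?A3 \<le> card {..<KK} * p\<^sup>2" by (rule sum_image_le) simp_all
  also have "sum ?f ?A4 \<le> card Opt * q"
  proof (rule sum_image_le[OF finite_Opt])
    fix w
    have "mass0 l r (LO w) \<le> 1 * q" unfolding mass0.simps using p_bounds(1,4,5) by (intro mult_mono) (auto simp: q_def)
    then show "mass0 l r (LO w) \<le> q" by simp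
  qed (use p_bounds(5) in simp)
  also have "sum ?f ?A5 \<le> card ({..<3::nat} \<times> Loc) * p"
  proof (rule sum_image_le)
    fix x assume "x \<in> {..<3::nat} \<times> Loc"
    have "(1 - q) * p \<le> 1 * p" using p_bounds(1,5) by (intro mult_right_mono) auto
    then show "?f (case x of (e, l') \<Rightarrow> LK e l') \<le> p" by (cases x) simp
  qed (use finite_Loc p_bounds(1) in simp_all)
  finally have "sum ?f (Alw w) \<le> card Vt * p + (card ({..<KK} \<times> {..<3::nat} \<times> Vt) * p\<^sup>2 +
      (card {..<KK} * p\<^sup>2 + (card Opt * q + (card ({..<3::nat} \<times> Loc) * p + 0))))" by simp
  also have "\<dots> = p * (26 * k + 7 + 3 * card Opt + 3 * card Loc) - q"
  proof -
    have KK: "real KK * p\<^sup>2 = 4 * p" by (simp add: KK_def p_def power_add power2_eq_square)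
    have "card ({..<KK} \<times> {..<3::nat} \<times> Vt) * p\<^sup>2 = (real KK * p\<^sup>2) * (6 * real k)"
      by (simp add: card card_cartesian_product)
    then show ?thesis unfolding KK by (simp add: KK card card_cartesian_product q_def algebra_simps)
  qed
  also have "\<dots> \<le> 1 - q" using p_bounds(2) by simp
  finally show ?thesis .
qed

lemma mass_nonneg: "0 \<le> mass d l r a"
  using mass0_sum[where w = "ow d l r" and l = l and r = r] mass0_nonneg by (simp add: mass_def)

lemma mass_sum: "(\<Sum>a\<in>Alw (ow d l r). mass d l r a) = 1 - q"
proof -
  have "(\<Sum>a\<in>Alw (ow d l r). mass d l r a) = mass d l r LR + (\<Sum>a\<in>Alw (ow d l r) - {LR}. mass d l r a)"
    by (rule sum.remove[OF finite_Alw LR_notin])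
  also have "(\<Sum>a\<in>Alw (ow d l r) - {LR}. mass d l r a) = (\<Sum>a\<in>Alw (ow d l r) - {LR}. mass0 l r a)"
    by (rule sum.cong) (auto simp: mass_def)
  also have "\<dots> = (\<Sum>a\<in>Alw (ow d l r). mass0 l r a)"
    by (rule sum.mono_neutral_left) (auto simp: finite_Alw)
  finally show ?thesis by (simp add: mass_def)
qed

definition succs :: "bool \<Rightarrow> nat \<Rightarrow> 'l \<Rightarrow> (nat \<Rightarrow> nat) \<Rightarrow> 'l st set" where
  "succs \<phi> d l r = (\<lambda>a. Xt (Ex \<phi> (ow d l r) a)) ` Alw (ow d l r) \<union>
     (\<lambda>e. Cg (\<not> \<phi>) e (nl l r e) (nr l r e)) ` {..<3}"

lemma succs:
  assumes "(l, r) \<in> W" "d < 3"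
  shows "finite (succs \<phi> d l r)" "succs \<phi> d l r \<subseteq> states N"
    "\<And>t. t \<in> states N - succs \<phi> d l r \<Longrightarrow> trans (Cg \<phi> d l r) t = 0"
    "(\<Sum>t\<in>succs \<phi> d l r. trans (Cg \<phi> d l r) t * f t) =
       (\<Sum>a\<in>Alw (ow d l r). mass d l r a * f (Xt (Ex \<phi> (ow d l r) a))) +
       (\<Sum>e<3. p * f (Cg (\<not> \<phi>) e (nl l r e) (nr l r e)))"
proof -
  show "finite (succs \<phi> d l r)" by (simp add: succs_def finite_Alw)
  have "Ex \<phi> (ow d l r) a \<in> Lset" if "a \<in> Alw (ow d l r)" for a
    using W_Opt[OF assms] that unfolding Lset_def by blast
  then show "succs \<phi> d l r \<subseteq> states N" using W_next[OF assms(1)] by (auto simp: succs_def)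
  show "trans (Cg \<phi> d l r) t = 0" if t: "t \<in> states N - succs \<phi> d l r" for t
  proof (rule ccontr)
    assume nz: "trans (Cg \<phi> d l r) t \<noteq> 0"
    show False
    proof (cases t)
      case (Cg \<psi> e l' r')
      then have "t \<in> succs \<phi> d l r" using nz by (auto simp: succs_def split: if_splits)
      then show False using t by blast
    next
      case (Xt L)
      show False
      proof (cases L)
        case (Ex \<psi> w a)
        have wa: "\<psi> = \<phi>" "w = ow d l r" using nz Xt Ex by (auto split: if_splits)
        have "a \<in> Alw w" using t Xt Ex by (auto simp: Lset_def)
        then have "t \<in> succs \<phi> d l r" using wa Xt Ex by (auto simp: succs_def)
        then show False using t by blast
      qed (use nz Xt in simp)
    qed
  qed
  have "(\<Sum>t\<in>succs \<phi> d l r. trans (Cg \<phi> d l r) t * f t) =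
      (\<Sum>t\<in>(\<lambda>a. Xt (Ex \<phi> (ow d l r) a)) ` Alw (ow d l r). trans (Cg \<phi> d l r) t * f t) +
      (\<Sum>t\<in>(\<lambda>e. Cg (\<not> \<phi>) e (nl l r e) (nr l r e)) ` {..<3}. trans (Cg \<phi> d l r) t * f t)"
    unfolding succs_def by (rule sum.union_disjoint) (auto simp: finite_Alw)
  then show "(\<Sum>t\<in>succs \<phi> d l r. trans (Cg \<phi> d l r) t * f t) =
       (\<Sum>a\<in>Alw (ow d l r). mass d l r a * f (Xt (Ex \<phi> (ow d l r) a))) +
       (\<Sum>e<3. p * f (Cg (\<not> \<phi>) e (nl l r e) (nr l r e)))"
    by (subst (asm) (1 2) sum.reindex) (auto simp: inj_on_def)
qed

text \<open>Registers from \<open>k\<close> on vanish, so a location and finitely many numbers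
  determine a configuration.\<close>

lemma countable_W: "countable W"
proof (rule countable_subset)
  let ?g = "\<lambda>xs i. if i < length xs then xs ! i else (0::nat)"
  show "W \<subseteq> Loc \<times> range ?g"
  proof (rule subsetI, clarify)
    fix l r assume lr: "(l, r) \<in> W"
    have "r = ?g (map r [0..<k])" using W_supp[OF lr] by (intro ext) (simp add: not_less)
    then have "r \<in> range ?g" by (rule range_eqI)
    then show "l \<in> Loc \<and> r \<in> range ?g" using W[OF lr] by (simp add: enabled_def)
  qed
  show "countable (Loc \<times> range ?g)"
    by (rule countable_SIGMA[OF countable_finite[OF finite_Loc] countable_image[OF countableI_type]])
qed

lemma trans_nonneg: "0 \<le> trans s t"
  by (cases "(s, t)" rule: trans.cases) (auto simp: mass_nonneg p_bounds(1) less_imp_le)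

lemma trans_sum: "s \<in> states N \<Longrightarrow> (trans s has_sum 1) (states N)"
proof (cases s)
  case (Cg \<phi> d l r)
  assume "s \<in> states N"
  then have lr: "(l, r) \<in> W" "d < 3" by (simp_all add: Cg)
  note su = succs[OF lr, where \<phi> = \<phi>]
  have "(\<Sum>t\<in>succs \<phi> d l r. trans (Cg \<phi> d l r) t) = 1"
    using su(4)[of "\<lambda>_. 1"] mass_sum by (simp add: q_def)
  then show ?thesis unfolding Cg by (intro has_sum_finite_support[OF su(1,2,3)])
next
  case (Xt L)
  assume "s \<in> states N"
  then show ?thesis unfolding Xt by (intro has_sum_finite_support[of "{Xt L}"]) auto
qed

lemma markov_N: "markov_chain N"
  unfolding markov_chain_def
proof (intro conjI ballI)
  have "states N = (\<lambda>(\<phi>, d, l, r). Cg \<phi> d l r) ` (UNIV \<times> {..<3} \<times> W) \<union> Xt ` (Lset - range Cf)"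
    by (force simp: N_def)
  then show "countable (states N)"
    using countable_W finite_Lset by (auto intro: countable_finite)
  fix s assume s: "s \<in> states N"
  show "(Prob N s has_sum 1) (states N)" using trans_sum[OF s] by simp
  fix t assume t: "t \<in> states N"
  show "0 \<le> Prob N s t" by (simp add: trans_nonneg)
  have "(trans s has_sum trans s t) {t}" using has_sum_finite[of "{t}" "trans s"] by simp
  then show "Prob N s t \<le> 1"
    using has_sum_mono2[OF _ trans_sum[OF s], of "{t}" "trans s t"] t trans_nonneg by simp
qed

section \<open>Hitting probabilities as solutions of linear equations\<close>

definition f :: "'l label set \<Rightarrow> 'l st \<Rightarrow> real" where "f \<Lambda> = hit N (\<lambda>t. lb t \<in> \<Lambda>)"

lemma hp_f: "s \<in> states N \<Longrightarrow> \<Lambda> \<subseteq> Lset \<Longrightarrow> hp N \<Lambda> s = f \<Lambda> s"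
  unfolding hp_def f_def
proof (rule hit_cong)
  fix u assume "reach N s u" "\<Lambda> \<subseteq> Lset"
  then have "lb u \<in> Lset" "\<forall>L\<in>\<Lambda>. L \<in> Lset" using lb_Lset[OF reach_states] by auto
  then show "(\<exists>L\<in>\<Lambda>. atm L \<in> val N u) \<longleftrightarrow> lb u \<in> \<Lambda>" using atm_inj by auto
qed

lemma reach_Xt: "reach N (Xt L) t \<Longrightarrow> t = Xt L"
  by (erule reach_absorbing) (simp split: if_splits)

lemma f_Xt: "Xt L \<in> states N \<Longrightarrow> f \<Lambda> (Xt L) = (if L \<in> \<Lambda> then 1 else 0)"
proof -
  assume s: "Xt L \<in> states N"
  show ?thesis
  proof (cases "L \<in> \<Lambda>")
    case True
    then show ?thesis unfolding f_def using hit_now[OF markov_N s] by simp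
  next
    case False
    have "\<forall>t. reach N (Xt L) t \<longrightarrow> lb t \<notin> \<Lambda>" using reach_Xt[of L] False by (metis lb.simps(2))
    then show ?thesis unfolding f_def using hit_eq_0_iff[OF markov_N s] False by simp
  qed
qed

definition ms :: "'l label set \<Rightarrow> bool \<Rightarrow> nat \<Rightarrow> 'l \<Rightarrow> (nat \<Rightarrow> nat) \<Rightarrow> real" where
  "ms \<Lambda> \<phi> d l r = (\<Sum>a\<in>{a \<in> Alw (ow d l r). Ex \<phi> (ow d l r) a \<in> \<Lambda>}. mass d l r a)"

lemma f_Cg:
  assumes lr: "(l, r) \<in> W" "d < 3" and \<Lambda>: "Cf \<phi> \<notin> \<Lambda>"
  shows "f \<Lambda> (Cg \<phi> d l r) = ms \<Lambda> \<phi> d l r + p * (\<Sum>e<3. f \<Lambda> (Cg (\<not> \<phi>) e (nl l r e) (nr l r e)))"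
proof -
  note su = succs[OF lr, where \<phi> = \<phi>]
  have "f \<Lambda> (Cg \<phi> d l r) = (\<Sum>t\<in>succs \<phi> d l r. trans (Cg \<phi> d l r) t * f \<Lambda> t)"
    unfolding f_def using hit_one_step[OF markov_N _ _ su(1,2), of "Cg \<phi> d l r" "\<lambda>t. lb t \<in> \<Lambda>"] su(3) lr \<Lambda> by simp
  also have "\<dots> = (\<Sum>a\<in>Alw (ow d l r). mass d l r a * f \<Lambda> (Xt (Ex \<phi> (ow d l r) a))) +
       (\<Sum>e<3. p * f \<Lambda> (Cg (\<not> \<phi>) e (nl l r e) (nr l r e)))"
    by (rule su(4))
  also have "(\<Sum>a\<in>Alw (ow d l r). mass d l r a * f \<Lambda> (Xt (Ex \<phi> (ow d l r) a))) =
      (\<Sum>a\<in>Alw (ow d l r). if Ex \<phi> (ow d l r) a \<in> \<Lambda> then mass d l r a else 0)"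
  proof (rule sum.cong[OF refl])
    fix a assume "a \<in> Alw (ow d l r)"
    then have "Xt (Ex \<phi> (ow d l r) a) \<in> states N" using su(2) unfolding succs_def by blast
    then show "mass d l r a * f \<Lambda> (Xt (Ex \<phi> (ow d l r) a)) = (if Ex \<phi> (ow d l r) a \<in> \<Lambda> then mass d l r a else 0)"
      using f_Xt by simp
  qed
  also have "\<dots> = ms \<Lambda> \<phi> d l r"
    unfolding ms_def using finite_Alw by (simp add: sum.If_cases Int_def)
  finally show ?thesis by (simp add: sum_distrib_left)
qed

lemma f_bounds: "0 \<le> f \<Lambda> s" "s \<in> states N \<Longrightarrow> f \<Lambda> s \<le> 1"
  unfolding f_def by (auto intro: hit_le_1[OF markov_N])

text \<open>The equations of \<open>f_Cg\<close> have only one bounded solution, as \<open>q < 1\<close>.\<close>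

lemma f_unique:
  assumes \<Lambda>: "\<Lambda> \<inter> range Cf = {}"
    and g: "\<And>\<phi> d l r. (l, r) \<in> W \<Longrightarrow> d < 3 \<Longrightarrow>
      g (Cg \<phi> d l r) = ms \<Lambda> \<phi> d l r + p * (\<Sum>e<3. g (Cg (\<not> \<phi>) e (nl l r e) (nr l r e)))"
    and bound: "\<And>\<phi> d l r. (l, r) \<in> W \<Longrightarrow> d < 3 \<Longrightarrow> \<bar>g (Cg \<phi> d l r)\<bar> \<le> B"
    and lr: "(l, r) \<in> W" "d < 3"
  shows "f \<Lambda> (Cg \<phi> d l r) = g (Cg \<phi> d l r)"
proof -
  let ?C = "{Cg \<phi> d l r | \<phi> d l r. d < 3 \<and> (l, r) \<in> W}"
  define D where "D = (SUP s\<in>?C. \<bar>f \<Lambda> s - g s\<bar>)"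
  have C: "Cg \<phi> d l r \<in> ?C" using lr by blast
  have bdd: "bdd_above ((\<lambda>s. \<bar>f \<Lambda> s - g s\<bar>) ` ?C)"
  proof (rule bdd_aboveI2)
    fix s assume "s \<in> ?C"
    then obtain \<phi> d l r where s: "s = Cg \<phi> d l r" "(l, r) \<in> W" "d < 3" by blast
    then have "\<bar>g s\<bar> \<le> B" "\<bar>f \<Lambda> s\<bar> \<le> 1" using bound f_bounds(1)[of \<Lambda> s] f_bounds(2)[of s \<Lambda>] by auto
    then show "\<bar>f \<Lambda> s - g s\<bar> \<le> 1 + B" by linarith
  qed
  have le: "\<bar>f \<Lambda> (Cg \<phi> d l r) - g (Cg \<phi> d l r)\<bar> \<le> D" if "(l, r) \<in> W" "d < 3" for \<phi> d l r
    unfolding D_def using that by (intro cSUP_upper[OF _ bdd]) blast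
  have "\<bar>f \<Lambda> s - g s\<bar> \<le> q * D" if sC: "s \<in> ?C" for s
  proof -
    obtain \<phi> d l r where s: "s = Cg \<phi> d l r" and lr: "(l, r) \<in> W" "d < 3" using sC by blast
    let ?s = "\<lambda>e. Cg (\<not> \<phi>) e (nl l r e) (nr l r e)"
    have \<phi>: "Cf \<phi> \<notin> \<Lambda>" using \<Lambda> by blast
    have "f \<Lambda> s - g s = p * (\<Sum>e<3. f \<Lambda> (?s e) - g (?s e))"
      unfolding s f_Cg[OF lr \<phi>] g[OF lr] by (simp add: sum_subtractf right_diff_distrib)
    then have 1: "\<bar>f \<Lambda> s - g s\<bar> = p * \<bar>\<Sum>e<3. f \<Lambda> (?s e) - g (?s e)\<bar>"
      using p_bounds(1) by (simp add: abs_mult)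
    have "\<bar>\<Sum>e<3. f \<Lambda> (?s e) - g (?s e)\<bar> \<le> (\<Sum>e<3. \<bar>f \<Lambda> (?s e) - g (?s e)\<bar>)"
      by (rule sum_abs)
    also have "\<dots> \<le> (\<Sum>e<(3::nat). D)"
      by (rule sum_mono, rule le) (simp_all add: W_next[OF lr(1)])
    finally have "\<bar>\<Sum>e<3. f \<Lambda> (?s e) - g (?s e)\<bar> \<le> 3 * D" by simp
    from mult_left_mono[OF this, of p] show ?thesis unfolding 1 using p_bounds(1) by (simp add: q_def)
  qed
  then have "(SUP s\<in>?C. \<bar>f \<Lambda> s - g s\<bar>) \<le> q * D" by (intro cSUP_least) (use C in blast)+
  then have "D \<le> q * D" by (simp only: D_def)
  then have "D * (1 - q) \<le> 0" by (simp add: algebra_simps)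
  then have "D \<le> 0" using q2(3) by (simp add: mult_le_0_iff)
  then show ?thesis using le[OF lr, of \<phi>] by simp
qed

end

context game_strategy
begin

declare cm.simps [simp del] cst.simps [simp del]

section \<open>The chain satisfies the constraints\<close>

definition mA :: "'l con \<Rightarrow> nat \<Rightarrow> 'l \<Rightarrow> (nat \<Rightarrow> nat) \<Rightarrow> real" where
  "mA x d l r = (\<Sum>a\<in>{a \<in> Alw (ow d l r). inA x (ow d l r) a}. mass d l r a)"
definition mB :: "'l con \<Rightarrow> nat \<Rightarrow> 'l \<Rightarrow> (nat \<Rightarrow> nat) \<Rightarrow> real" where
  "mB x d l r = (\<Sum>a\<in>{a \<in> Alw (ow d l r). inB x (ow d l r) a}. mass d l r a)"

lemma ms_lam:
  assumes "(l, r) \<in> W" "d < 3"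
  shows "ms (lam x \<phi>) \<psi> d l r = (if \<psi> = \<phi> then mA x d l r else mB x d l r)"
  unfolding ms_def mA_def mB_def using W_Opt[OF assms] by simp

lemma mB_bounds: "0 \<le> mB x d l r" "mB x d l r \<le> 1"
proof -
  show "0 \<le> mB x d l r" unfolding mB_def by (intro sum_nonneg mass_nonneg)
  have "mB x d l r \<le> (\<Sum>a\<in>Alw (ow d l r). mass d l r a)"
    unfolding mB_def by (intro sum_mono2 finite_Alw) (auto simp: mass_nonneg)
  then show "mB x d l r \<le> 1" using mass_sum[of d l r] p_bounds(5) by simp
qed

lemma sum_single: "(\<Sum>a\<in>{a \<in> Alw w. a = b}. g a) = (if b \<in> Alw w then g b else (0::real))"
proof -
  have "{a \<in> Alw w. a = b} = (if b \<in> Alw w then {b} else {})" by auto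
  then show ?thesis by simp
qed

lemma mass_simps [simp]:
  "mass d l r (LB v) = p * vv (fst v) (r (snd v))"
  "mass d l r (LN kk e v) = p\<^sup>2 * (1 - vv (fst v) (nr l r e (snd v)))"
  "mass d l r (LG kk) = p\<^sup>2"
  "mass d l r (LO w) = (1 - q) * (q - (if fst w < 3 \<and> nw l r (fst w) = w then p else 0))"
  "mass d l r (LK e l') = (1 - q) * p"
  by (simp_all add: mass_def)

lemma sum_dir: "e < 3 \<Longrightarrow> (\<Sum>e'<3. if e' = e then g e' else 0) = (g e :: real)" for e :: nat
  by (simp add: sum.delta)

lemma ow_sel: "fst (ow d l r) = d" "fst (snd (ow d l r)) = l"
  by (simp_all add: ow_def)

lemma nr_val: "i < k \<Longrightarrow> nr l r e i = sval (sr l (ch l r) e i) r"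
  by (simp add: nr_def step_def)

lemma vv_sval:
  assumes lr: "(l, r) \<in> W" and e: "e < 3" and i: "i < k" and x: "sr l (ch l r) e i = x" "x \<noteq> Zr"
  shows "vv b (r (sreg x)) = cm b x * p * vv b (sval x r)"
proof (cases x)
  case (Dec j)
  then have "0 < r j" using W[OF lr] x e i by (auto simp: enabled_def)
  then obtain y where "r j = Suc y" by (cases "r j") auto
  then show ?thesis using cm_p(3)[of b j] Dec by (simp add: vv_simps)
qed (use x cm_p in \<open>simp_all add: vv_simps\<close>)

lemma Alw_iff:
  "LG kk \<in> Alw w \<longleftrightarrow> kk < KK" "LB v \<in> Alw w \<longleftrightarrow> v \<in> Vt" "LO u \<in> Alw w \<longleftrightarrow> u \<in> Opt"
  "LN kk e v \<in> Alw (d', l', c) \<longleftrightarrow> kk < KK \<and> e < 3 \<and> v \<in> Vt \<and> sr l' c e (snd v) \<noteq> Zr"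
  "LK e l'' \<in> Alw (d', l', c) \<longleftrightarrow> e < 3 \<and> l'' \<in> Loc \<and> l'' \<noteq> tg l' c e"
proof -
  obtain d l c where w: "w = (d, l, c)" by (cases w)
  show "LG kk \<in> Alw w \<longleftrightarrow> kk < KK" "LB v \<in> Alw w \<longleftrightarrow> v \<in> Vt" "LO u \<in> Alw w \<longleftrightarrow> u \<in> Opt"
    unfolding w Alw.simps by blast+
  show "LN kk e v \<in> Alw (d', l', c) \<longleftrightarrow> kk < KK \<and> e < 3 \<and> v \<in> Vt \<and> sr l' c e (snd v) \<noteq> Zr" for c
    unfolding Alw.simps by blast
  show "LK e l'' \<in> Alw (d', l', c) \<longleftrightarrow> e < 3 \<and> l'' \<in> Loc \<and> l'' \<noteq> tg l' c e" for c
    unfolding Alw.simps by blast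
qed

text \<open>The local form of a constraint, free of infinite series: a configuration and its
  successors together provide \<open>1 - q\<^sup>2\<close> times the constant. If both phases count
  the same letters, it suffices that every configuration provides \<open>1 - q\<close> times the
  constant, since \<open>(1 - q) * (1 + q) = 1 - q\<^sup>2\<close>.\<close>

lemma identity:
  assumes x: "x \<in> Cns" and lr: "(l, r) \<in> W" and d: "d < 3"
  shows "mA x d l r + p * (\<Sum>e<3. mB x e (nl l r e) (nr l r e)) = (1 - q\<^sup>2) * of_rat (cst x)"
proof -
  let ?w = "ow d l r"
  have same: ?thesis if eq: "\<And>w a. inB x w a = inA x w a"
    and m: "\<And>d l r. (l, r) \<in> W \<Longrightarrow> d < 3 \<Longrightarrow> mA x d l r = (1 - q) * of_rat (cst x)"
  proof -
    have "mB x e (nl l r e) (nr l r e) = (1 - q) * of_rat (cst x)" if "e < 3" for e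
      using m[OF W_next[OF lr that] that] by (simp add: mA_def mB_def eq)
    then have "(\<Sum>e<3. mB x e (nl l r e) (nr l r e)) = (\<Sum>e<(3::nat). (1 - q) * of_rat (cst x))"
      by (intro sum.cong) auto
    then have S: "(\<Sum>e<3. mB x e (nl l r e) (nr l r e)) = 3 * ((1 - q) * of_rat (cst x))" by simp
    show ?thesis unfolding S m[OF lr d] by (simp add: q_def algebra_simps power2_eq_square)
  qed
  have all: "(\<Sum>a\<in>{a \<in> Alw (ow d l r). P}. mass d l r a) = (if P then 1 - q else 0)" for P d l r
    using mass_sum[of d l r] by simp
  have q: "1 + q \<noteq> 0" "1 - q \<noteq> 0" "1 - q\<^sup>2 = (1 - q) * (1 + q)"
    using q2 by (auto simp: power2_eq_square algebra_simps)
  note in_Alw = Alw_iff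
  from x consider (CE) b where "x = CE b"
    | (CN) kk e b i where "x = CN kk e (b, i)" "kk < KK" "e < 3" "i < k"
    | (CO) u where "x = CO u" "u \<in> Opt" | (CK) e l' where "x = CK e l'" "e < 3" "l' \<in> Loc"
    | (CG) kk where "x = CG kk" "kk < KK" | (CR) e b i where "x = CR e (b, i)" "e < 3" "i < k"
    | (CZ) b i where "x = CZ (b, i)" "i < k"
    unfolding Cns_def Vt_def by blast
  then show ?thesis
  proof cases
    case CE
    have "(1 - q\<^sup>2) * of_rat (cst x) = (if b then 1 - q else q * (1 - q))"
      using q by (auto simp: CE of_rat_cst)
    moreover have "mA x d l r = (if b then 1 - q else 0)" "mB x d' l' r' = (if \<not> b then 1 - q else 0)" for d' l' r'
      unfolding mA_def mB_def CE inA.simps inB.simps all by (rule refl)+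
    ultimately show ?thesis by (simp add: q_def)
  next
    case CN
    have 1: "mA x d l r = p\<^sup>2 * (1 - vv b (nr l r e i))"
      unfolding mA_def CN inA.simps sum_single using CN nr_val
      by (auto simp: ow_def in_Alw Vt_def vv_simps)
    have "mB x e' l' r' = (if e' = e then p * vv b (r' i) else 0)" for e' l' r'
    proof (cases "e' = e")
      case True
      then have "mB x e' l' r' = (\<Sum>a\<in>{a \<in> Alw (ow e' l' r'). a = LB (b, i)}. mass e' l' r' a)"
        unfolding mB_def CN inB.simps ow_sel by simp
      then show ?thesis unfolding sum_single using CN True by (simp add: in_Alw Vt_def)
    qed (simp add: mB_def CN ow_sel)
    then have "(\<Sum>e<3. mB x e (nl l r e) (nr l r e)) = p * vv b (nr l r e i)"
      using CN by (simp add: sum_dir)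
    moreover have "(1 - q\<^sup>2) * of_rat (cst x) = p\<^sup>2" using q2(1) by (simp add: CN of_rat_cst)
    ultimately show ?thesis unfolding 1 by (simp add: power2_eq_square algebra_simps)
  next
    case CO
    have 1: "mA x d l r = (1 - q) * (q - (if fst u < 3 \<and> nw l r (fst u) = u then p else 0))"
      unfolding mA_def CO inA.simps sum_single using CO by (simp add: in_Alw)
    have "mB x e (nl l r e) (nr l r e) = (if e = fst u then (if nw l r (fst u) = u then 1 - q else 0) else 0)" for e
      unfolding mB_def CO inB.simps all using ow_sel(1)[of e] by (auto simp: nw_def)
    then have "(\<Sum>e<3. mB x e (nl l r e) (nr l r e)) = (if nw l r (fst u) = u then 1 - q else 0)"
      using sum_dir[of "fst u" "\<lambda>_. if nw l r (fst u) = u then 1 - q else 0"] CO by (auto simp: Opt_def)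
    moreover have "fst u < 3" using CO by (auto simp: Opt_def)
    moreover have "(1 - q\<^sup>2) * of_rat (cst x) = (1 - q) * q"
      unfolding q(3) using q(1) by (simp add: CO of_rat_cst)
    ultimately show ?thesis unfolding 1 by (simp add: algebra_simps)
  next
    case CK
    have 1: "mA x d l r = (if l' \<noteq> nl l r e then (1 - q) * p else 0)"
      unfolding mA_def CK inA.simps sum_single using CK by (simp add: in_Alw ow_def nl_def)
    have "mB x e' (nl l r e') (nr l r e') = (if e' = e then (if l' = nl l r e then 1 - q else 0) else 0)" for e'
      unfolding mB_def CK inB.simps all ow_sel by auto
    then have "(\<Sum>e<3. mB x e (nl l r e) (nr l r e)) = (if l' = nl l r e then 1 - q else 0)"
      using sum_dir[of e "\<lambda>_. if l' = nl l r e then 1 - q else 0"] CK by simp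
    then show ?thesis unfolding 1 using q by (simp add: CK of_rat_cst)
  next
    case CG
    show ?thesis
    proof (rule same)
      show "mA x d l r = (1 - q) * of_rat (cst x)" for d l r
        unfolding mA_def CG inA.simps sum_single using CG q by (simp add: in_Alw of_rat_cst)
    qed (simp add: CG)
  next
    case CR
    show ?thesis
    proof (rule same)
      fix d :: nat and l r assume lr: "(l, r) \<in> W" and d: "d < 3"
      let ?s = "sr l (ch l r) e i"
      let ?m = "cm b ?s" and ?j = "sreg ?s"
      let ?G = "LG ` {..<KK - ?m}"
      have KK: "real KK * p\<^sup>2 = 4 * p" using p_eqs(2) by (simp add: power2_eq_square flip: mult.assoc)
      have T: "(1 - q) * of_rat (cst x) = 4 * p" using q by (simp add: CR of_rat_cst)
      have G: "sum (mass d l r) ?G = real (KK - ?m) * p\<^sup>2"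
        by (subst sum.reindex) (auto simp: inj_on_def)
      show "mA x d l r = (1 - q) * of_rat (cst x)"
      proof (cases "?s = Zr")
        case True
        then have "{a \<in> Alw (ow d l r). inA x (ow d l r) a} = ?G"
          by (auto simp: CR ow_def Let_def in_Alw cm.simps)
        then show ?thesis unfolding T mA_def using G True KK by (simp add: cm.simps)
      next
        case False
        let ?A = "(\<lambda>kk. LN kk e (b, i)) ` {..<?m}"
        have "?j < k" using W[OF lr] CR sr by (auto simp: enabled_def)
        then have "{a \<in> Alw (ow d l r). inA x (ow d l r) a} = ?A \<union> ({LB (b, ?j)} \<union> ?G)"
          using False CR cm_le[of b ?s] by (auto simp: ow_def Let_def in_Alw Vt_def)
        then have "mA x d l r = sum (mass d l r) (?A \<union> ({LB (b, ?j)} \<union> ?G))" by (simp only: mA_def)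
        also have "\<dots> = sum (mass d l r) ?A + (sum (mass d l r) {LB (b, ?j)} + sum (mass d l r) ?G)"
          by (subst sum.union_disjoint; (subst sum.union_disjoint)?) auto
        also have "sum (mass d l r) ?A = ?m * (p\<^sup>2 * (1 - vv b (sval ?s r)))"
          using nr_val CR by (subst sum.reindex) (auto simp: inj_on_def)
        also have "sum (mass d l r) {LB (b, ?j)} = p * (?m * p * vv b (sval ?s r))"
          using vv_sval[OF lr CR(2,3) refl False] by simp
        also have "sum (mass d l r) ?G = 4 * p - ?m * p\<^sup>2"
          unfolding G using KK cm_le[of b ?s] by (simp add: of_nat_diff left_diff_distrib)
        finally show ?thesis unfolding T by (simp add: power2_eq_square algebra_simps)
      qed
    qed (simp add: CR)
  next
    case CZ
    show ?thesis
    proof (rule same)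
      fix d :: nat and l r assume lr: "(l, r) \<in> W" and d: "d < 3"
      have T: "(1 - q) * of_rat (cst x) = p" using q by (simp add: CZ of_rat_cst)
      show "mA x d l r = (1 - q) * of_rat (cst x)"
      proof (cases "i \<in> gd l (ch l r)")
        case True
        have 0: "r i = 0" using W[OF lr] True by (simp add: enabled_def)
        have "{a \<in> Alw (ow d l r). inA x (ow d l r) a} = {LB (b, i)}"
          using True CZ(2) by (auto simp: CZ(1) ow_def in_Alw Vt_def)
        then have "mA x d l r = mass d l r (LB (b, i))" by (simp add: mA_def)
        then show ?thesis unfolding T using 0 by (simp add: vv_simps)
      next
        case False
        have "{a \<in> Alw (ow d l r). inA x (ow d l r) a} = LG ` {..<2 ^ Mx}"
          using False p_eqs(4) by (auto simp: CZ ow_def in_Alw)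
        then have "mA x d l r = (\<Sum>kk<(2::nat) ^ Mx. p\<^sup>2)"
          unfolding mA_def by (simp only:) (subst sum.reindex; auto simp: inj_on_def)
        also have "\<dots> = (real (2 ^ Mx) * p) * p" by (simp add: power2_eq_square)
        finally show ?thesis unfolding T p_eqs(1) by simp
      qed
    qed (simp add: CZ)
  qed
qed

text \<open>The candidate \<open>g\<close> is constant in the phase of the constraint; in the other
  phase it is the local contribution plus \<open>q\<close> times that constant. By
  \<open>identity\<close> it solves the equations of the hitting probabilities, and
  \<open>f_unique\<close> identifies the two.\<close>

lemma f_lam:
  assumes x: "x \<in> Cns" and lr: "(l, r) \<in> W" "d < 3"
  shows "f (lam x \<psi>) (Cg \<phi> d l r) = (if \<phi> = \<psi> then of_rat (cst x) else mB x d l r + q * of_rat (cst x))"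
proof -
  let ?T = "of_rat (cst x) :: real"
  define g where "g s = (case s of Cg \<phi> d l r \<Rightarrow> if \<phi> = \<psi> then ?T else mB x d l r + q * ?T | Xt _ \<Rightarrow> 0)"
    for s :: "'l st"
  have g: "g (Cg \<phi> d l r) = (if \<phi> = \<psi> then ?T else mB x d l r + q * ?T)" for \<phi> d l r
    by (simp add: g_def)
  have "f (lam x \<psi>) (Cg \<phi> d l r) = g (Cg \<phi> d l r)"
  proof (rule f_unique[OF lam_exits _ _ lr])
    fix \<phi> d l r assume lr: "(l, r) \<in> W" "d < (3::nat)"
    show "\<bar>g (Cg \<phi> d l r)\<bar> \<le> 1 + \<bar>?T\<bar> + \<bar>q * ?T\<bar>"
    proof (cases "\<phi> = \<psi>")
      case False
      have "\<bar>mB x d l r\<bar> \<le> 1" using mB_bounds[of x d l r] by simp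
      then have "\<bar>mB x d l r + q * ?T\<bar> \<le> 1 + \<bar>?T\<bar> + \<bar>q * ?T\<bar>"
        using abs_triangle_ineq[of "mB x d l r" "q * ?T"] abs_ge_zero[of ?T] by linarith
      then show ?thesis using False by (simp only: g if_False)
    next
      case True
      have "\<bar>?T\<bar> \<le> 1 + \<bar>?T\<bar> + \<bar>q * ?T\<bar>" using abs_ge_zero[of "q * ?T"] by linarith
      then show ?thesis using True by (simp only: g if_True simp_thms)
    qed
    show "g (Cg \<phi> d l r) = ms (lam x \<psi>) \<phi> d l r + p * (\<Sum>e<3. g (Cg (\<not> \<phi>) e (nl l r e) (nr l r e)))"
    proof (cases "\<phi> = \<psi>")
      case True
      have "(\<Sum>e<3. g (Cg (\<not> \<phi>) e (nl l r e) (nr l r e))) =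
          (\<Sum>e<3. mB x e (nl l r e) (nr l r e)) + 3 * (q * ?T)"
        unfolding g using True by (simp add: sum.distrib)
      then show ?thesis
        using identity[OF x lr] True unfolding ms_lam[OF lr]
        by (simp add: g q_def algebra_simps power2_eq_square)
    next
      case False
      then have "(\<not> \<phi>) = \<psi>" by blast
      then show ?thesis using False unfolding ms_lam[OF lr] g by (simp add: q_def)
    qed
  qed
  then show ?thesis by (simp add: g)
qed

text \<open>The successors contribute \<open>q * (q / (1 + q))\<close> in any case; the exit mass
  \<open>1 - q\<close> of the configuration itself is added exactly if it plays
  \<open>w\<close>.\<close>

lemma f_pur:
  assumes w: "w \<in> Opt" and lr: "(l, r) \<in> W" "d < 3"
  shows "f (lam (CO w) (\<not> \<phi>)) (Cg \<phi> d l r) = 1 / (1 + q) \<longleftrightarrow> w = ow d l r"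
proof -
  have "CO w \<in> Cns" using w by (auto simp: Cns_def)
  moreover have "mB (CO w) d l r = (if w = ow d l r then 1 - q else 0)"
    unfolding mB_def inB.simps using mass_sum[of d l r] by auto
  ultimately have "f (lam (CO w) (\<not> \<phi>)) (Cg \<phi> d l r) =
      (if w = ow d l r then 1 - q else 0) + q * (q / (1 + q))"
    using f_lam[OF _ lr] by (simp add: of_rat_cst)
  moreover have "(1 - q) + q * (q / (1 + q)) = 1 / (1 + q)"
    using q2 by (simp add: field_simps power2_eq_square)
  ultimately show ?thesis using q2 by auto
qed

lemma ini_ch: "(ini, r) \<in> W \<Longrightarrow> ch ini r = 0"
  using W[of ini r] ini by (simp add: enabled_def)

text \<open>The target of a move is never \<open>ini\<close>, so the exits \<open>xin\<close> are
  only hit directly, from a configuration of phase \<open>False\<close> at \<open>ini\<close> with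
  direction 0.\<close>

lemma f_xin:
  assumes lr: "(l, r) \<in> W" "d < 3"
  shows "f {xin b} (Cg \<phi> d l r) = (if \<not> \<phi> \<and> d = 0 \<and> l = ini then p * vv b (r 0) else 0)"
proof -
  define g where "g s = (case s of Cg \<phi> d l r \<Rightarrow> if \<not> \<phi> \<and> d = 0 \<and> l = ini then p * vv b (r 0) else 0
    | Xt _ \<Rightarrow> 0)" for s :: "'l st"
  have g: "g (Cg \<phi> d l r) = (if \<not> \<phi> \<and> d = 0 \<and> l = ini then p * vv b (r 0) else 0)" for \<phi> d l r
    by (simp add: g_def)
  have "f {xin b} (Cg \<phi> d l r) = g (Cg \<phi> d l r)"
  proof (rule f_unique[OF _ _ _ lr])
    show "{xin b} \<inter> range Cf = {}" by (auto simp: xin_def)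
    fix \<phi> d l r assume lr: "(l, r) \<in> W" "d < (3::nat)"
    show "\<bar>g (Cg \<phi> d l r)\<bar> \<le> p"
      unfolding g using p_bounds(1) vv_bounds(1)[of b "r 0"] vv_bounds(2)[of b "r 0"] by (simp add: abs_mult)
    have "nl l r e \<noteq> ini" if "e < 3" for e
      using tg[of l "ch l r" e] W[OF lr(1)] that by (simp add: nl_def enabled_def)
    then have "(\<Sum>e<3. g (Cg (\<not> \<phi>) e (nl l r e) (nr l r e))) = 0"
      by (intro sum.neutral) (simp add: g)
    moreover have "ms {xin b} \<phi> d l r = g (Cg \<phi> d l r)"
    proof (cases "\<not> \<phi> \<and> d = 0 \<and> l = ini")
      case True
      then have "{a \<in> Alw (ow d l r). Ex \<phi> (ow d l r) a \<in> {xin b}} = {LB (b, 0)}"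
        using ini_ch lr k by (auto simp: xin_def ow_def Alw.simps Vt_def)
      then show ?thesis using True by (simp add: ms_def g)
    next
      case False
      then have "{a \<in> Alw (ow d l r). Ex \<phi> (ow d l r) a \<in> {xin b}} = {}"
        by (auto simp: xin_def ow_def)
      then show ?thesis unfolding ms_def g using False by (simp only: sum.empty if_False)
    qed
    ultimately show "g (Cg \<phi> d l r) = ms {xin b} \<phi> d l r + p * (\<Sum>e<3. g (Cg (\<not> \<phi>) e (nl l r e) (nr l r e)))"
      by simp
  qed
  then show ?thesis by (simp add: g)
qed

lemma reach_iterate:
  assumes lr: "(l, r) \<in> W" "d < 3"
  shows "((\<lambda>(l, r). (tg l (ch l r) 0, step l (ch l r) 0 r)) ^^ j) (l, r) = (l', r') \<Longrightarrow>
    \<exists>\<psi> d'. d' < 3 \<and> (l', r') \<in> W \<and> reach N (Cg \<phi> d l r) (Cg \<psi> d' l' r')"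
proof (induction j arbitrary: l' r')
  case 0
  then show ?case using lr reach_refl[of "Cg \<phi> d l r" N] by auto
next
  case (Suc j)
  obtain l1 r1 where 1: "((\<lambda>(l, r). (tg l (ch l r) 0, step l (ch l r) 0 r)) ^^ j) (l, r) = (l1, r1)"
    by (cases "((\<lambda>(l, r). (tg l (ch l r) 0, step l (ch l r) 0 r)) ^^ j) (l, r)")
  obtain \<psi> d' where d': "d' < 3" "(l1, r1) \<in> W" "reach N (Cg \<phi> d l r) (Cg \<psi> d' l1 r1)"
    using Suc.IH[OF 1] by blast
  have eq: "l' = nl l1 r1 0" "r' = nr l1 r1 0" using Suc.prems 1 by (simp_all add: nl_def nr_def)
  have W': "(l', r') \<in> W" using W_next[OF d'(2), of 0] eq by simp
  have "reach N (Cg \<psi> d' l1 r1) (Cg (\<not> \<psi>) 0 l' r')"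
    by (rule reach_step) (use d' W' eq p_bounds(1) in simp_all)
  then show ?case using reach_trans[OF d'(3)] W' by (intro exI[of _ "\<not> \<psi>"] exI[of _ 0]) simp
qed

lemma f_stops:
  assumes lr: "(l, r) \<in> W" "d < 3" and live: "live l"
  shows "f (stops l) (Cg \<phi> d l r) > 0"
proof -
  obtain j r' where j: "((\<lambda>(l, r). (tg l (ch l r) 0, step l (ch l r) 0 r)) ^^ j) (l, r) = (l, r')" "ch l r' = 0"
    using W_live[OF lr(1) live] by blast
  obtain \<psi> d' where d': "d' < 3" "(l, r') \<in> W" "reach N (Cg \<phi> d l r) (Cg \<psi> d' l r')"
    using reach_iterate[OF lr j(1)] by blast
  \<comment> \<open>\<open>LG 0\<close> is allowed for every option and has the positive mass
    \<open>p\<^sup>2\<close>, so through it each configuration with choice 0 at \<open>l\<close>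
    reaches \<open>stops l\<close>.\<close>
  let ?L = "Ex \<psi> (d', l, 0) (LG 0)"
  have w: "ow d' l r' = (d', l, 0)" using j(2) by (simp add: ow_def)
  have Opt: "(d', l, 0) \<in> Opt" using W_Opt[OF d'(2,1)] w by simp
  have G: "LG 0 \<in> Alw (d', l, 0)" by (simp add: Alw.simps KK_def)
  have "?L \<in> Lset" using Opt G unfolding Lset_def by blast
  then have "reach N (Cg \<psi> d' l r') (Xt ?L)"
    by (intro reach_step) (use d' w p_bounds(1) in auto)
  then have "reach N (Cg \<phi> d l r) (Xt ?L)" by (rule reach_trans[OF d'(3)])
  moreover have "lb (Xt ?L) \<in> stops l" using Opt G by (auto simp: stops_def)
  ultimately show ?thesis unfolding f_def by (rule hit_pos[OF markov_N])
qed

lemma f_Cf: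
  assumes lr: "(l, r) \<in> W" "d < 3"
  shows "f {Cf (\<not> \<phi>)} (Cg \<phi> d l r) = q"
proof -
  have "f {Cf (\<not> \<phi>)} (Cg (\<not> \<phi>) e (nl l r e) (nr l r e)) = 1" if "e < 3" for e
    unfolding f_def by (rule hit_now[OF markov_N]) (use W_next[OF lr(1) that] that in simp_all)
  then have "(\<Sum>e<3. f {Cf (\<not> \<phi>)} (Cg (\<not> \<phi>) e (nl l r e) (nr l r e))) = (\<Sum>e<(3::nat). 1)"
    by (intro sum.cong) auto
  moreover have "ms {Cf (\<not> \<phi>)} \<phi> d l r = 0" by (simp add: ms_def)
  ultimately show ?thesis using f_Cg[OF lr, of \<phi> "{Cf (\<not> \<phi>)}"] by (simp add: q_def)
qed

lemma config_ok_N: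
  assumes lr: "(l, r) \<in> W" "d < 3"
  shows "config_ok N \<phi> (Cg \<phi> d l r)"
proof -
  have s: "Cg \<phi> d l r \<in> states N" using lr by simp
  have w: "ow d l r \<in> Opt" by (rule W_Opt[OF lr])
  have xin: "xin b \<in> Lset" for b
  proof -
    have "(0, ini, 0) \<in> Opt" using ini by (simp add: Opt_def)
    moreover have "LB (b, 0) \<in> Alw (0, ini, 0)" using k by (simp add: Alw.simps Vt_def)
    ultimately show ?thesis unfolding xin_def Lset_def by blast
  qed
  have hp: "hp N (lam x \<psi>) (Cg \<phi> d l r) = f (lam x \<psi>) (Cg \<phi> d l r)"
    "hp N (stops l') (Cg \<phi> d l r) = f (stops l') (Cg \<phi> d l r)"
    "hp N {Cf \<psi>} (Cg \<phi> d l r) = f {Cf \<psi>} (Cg \<phi> d l r)"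
    "hp N {xin b} (Cg \<phi> d l r) = f {xin b} (Cg \<phi> d l r)" for x \<psi> l' b
    using hp_f[OF s] lam_subset stops_subset xin by (simp_all add: Lset_def)
  show ?thesis
    unfolding config_ok_def hp
  proof (intro conjI ballI impI allI)
    show "f {Cf (\<not> \<phi>)} (Cg \<phi> d l r) = q" by (rule f_Cf[OF lr])
    show "f (lam x \<phi>) (Cg \<phi> d l r) = of_rat (cst x)" if "x \<in> Cns" for x
      using f_lam[OF that lr] by simp
    show "\<exists>w\<in>Opt. f (lam (CO w) (\<not> \<phi>)) (Cg \<phi> d l r) = 1 / (1 + q)"
      using f_pur[OF w lr] w by blast
    show "f (stops (fst (snd v))) (Cg \<phi> d l r) > 0"
      if "v \<in> Opt" "live (fst (snd v))" "f (lam (CO v) (\<not> \<phi>)) (Cg \<phi> d l r) = 1 / (1 + q)" for v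
      using that f_pur[OF that(1) lr] f_stops[OF lr] by (simp add: ow_def)
    show "f {xin b} (Cg \<phi> d l r) = 0" if \<phi> for b
      using f_xin[OF lr] that by simp
  qed
qed

lemma Theta_N:
  assumes t: "t \<in> states N"
  shows "sat N Theta t"
  unfolding sat_Theta[OF markov_N t]
proof (intro conjI ballI allI impI)
  show "\<exists>L\<in>Lset. atm L \<in> val N t \<and> (\<forall>L'\<in>Lset. atm L' \<in> val N t \<longrightarrow> L' = L)"
    using lb_Lset[OF t] atm_inj by (intro bexI[of _ "lb t"]) auto
  fix L u assume L: "L \<in> Lset - range Cf" "atm L \<in> val N t" and u: "reach N t u"
  have "L = lb t" using L lb_Lset[OF t] atm_inj by simp
  then have "t = Xt L" using L by (cases t) auto
  then have "u = Xt L" using reach_Xt u by blast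
  then show "atm L \<in> val N u" by simp
next
  fix \<phi> assume "atm (Cf \<phi>) \<in> val N t"
  then have \<phi>: "lb t = Cf \<phi>" using lb_Lset[OF t] atm_inj[of "Cf \<phi>" "lb t"] by (simp add: Lset_def)
  show "config_ok N \<phi> t"
  proof (cases t)
    case (Cg \<psi> d l r)
    then show ?thesis using config_ok_N t \<phi> by simp
  next
    case (Xt L)
    then show ?thesis using t \<phi> by auto
  qed
qed

lemma is_model_N: "is_model N (formula n)"
proof -
  let ?r = "\<lambda>i. if i = 0 then n else 0"
  let ?s = "Cg False 0 ini ?r"
  have s: "?s \<in> states N" using W_ini by simp
  have xin: "xin b \<in> Lset" for b
  proof -
    have "(0, ini, 0) \<in> Opt" using ini by (simp add: Opt_def)
    moreover have "LB (b, 0) \<in> Alw (0, ini, 0)" using k by (simp add: Alw.simps Vt_def)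
    ultimately show ?thesis unfolding xin_def Lset_def by blast
  qed
  have "sat N (Globally CEq 1 Theta) ?s"
    unfolding sat_AG[OF markov_N s] by (intro allI impI Theta_N) (rule reach_states)
  moreover have "ow 0 ini ?r = (0, ini, 0)" using ini_ch[OF W_ini] by (simp add: ow_def)
  then have "sat N (Pur False (0, ini, 0)) ?s"
    using f_pur[OF _ W_ini, of "(0, ini, 0)" 0 False] W_Opt[OF W_ini, of 0] hp_f[OF s lam_subset]
    by (simp add: sat_Pur)
  moreover have "hp N {xin b} ?s = p * vv b n" for b
    using hp_f[OF s, of "{xin b}"] xin f_xin[OF W_ini, of 0] by simp
  then have "sat N (Finally CEq (1 / 2 ^ (Mx + n)) (Atom (atm (xin True)))) ?s"
    "sat N (Finally CEq (1 / 2 ^ (Mx + 2 * n)) (Atom (atm (xin False)))) ?s"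
    by (simp_all add: sat_Finally_Atom of_rat_divide of_rat_mult of_rat_power p_def vv_def power_add power_mult)
  ultimately show ?thesis
    unfolding is_model_def formula_def base_def using markov_N s by (intro conjI bexI[of _ ?s]) simp_all
qed

lemma finite_N: "finite W \<Longrightarrow> finite (states N)"
proof -
  assume "finite W"
  moreover have "states N = (\<lambda>(\<phi>, d, l, r). Cg \<phi> d l r) ` (UNIV \<times> {..<3} \<times> W) \<union> Xt ` (Lset - range Cf)"
    by (force simp: N_def)
  ultimately show ?thesis using finite_Lset by simp
qed

end

section \<open>Alternating register programs\<close>

datatype cmd =
    Clear nat | Copy nat nat | Incr nat | Decr nat | Test nat
  | Choose "cmd list" "cmd list" | Check "cmd list" | Guess nat
  | Loop nat "cmd list" | Forever "cmd list"

type_synonym env = "nat \<Rightarrow> nat"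

text \<open>
  A location of a program is the list of the commands that remain to be executed. \<open>Choose\<close> branches
  existentially, \<open>Check\<close> universally, and \<open>Guess i\<close> increases register \<open>i\<close> by an arbitrary number.
  \<open>ok W \<Phi>\<close> is the condition on a configuration for \<open>W\<close> to be closed under the moves of a winning
  strategy, except that \<open>Forever\<close> is governed by \<open>\<Phi>\<close>.
\<close>

fun ok :: "(cmd list \<times> env) set \<Rightarrow> (cmd list \<Rightarrow> env \<Rightarrow> bool) \<Rightarrow> cmd list \<Rightarrow> env \<Rightarrow> bool" where
  "ok W \<Phi> [] r \<longleftrightarrow> True"
| "ok W \<Phi> (Clear i # ks) r \<longleftrightarrow> (ks, r(i := 0)) \<in> W"
| "ok W \<Phi> (Copy i j # ks) r \<longleftrightarrow> (ks, r(i := r j)) \<in> W"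
| "ok W \<Phi> (Incr i # ks) r \<longleftrightarrow> (ks, r(i := Suc (r i))) \<in> W"
| "ok W \<Phi> (Decr i # ks) r \<longleftrightarrow> 0 < r i \<and> (ks, r(i := r i - 1)) \<in> W"
| "ok W \<Phi> (Test i # ks) r \<longleftrightarrow> r i = 0 \<and> (ks, r) \<in> W"
| "ok W \<Phi> (Choose a b # ks) r \<longleftrightarrow> (a @ ks, r) \<in> W \<or> (b @ ks, r) \<in> W"
| "ok W \<Phi> (Check a # ks) r \<longleftrightarrow> (a, r) \<in> W \<and> (ks, r) \<in> W"
| "ok W \<Phi> (Guess i # ks) r \<longleftrightarrow>
     (\<exists>v. (ks, r(i := r i + v)) \<in> W \<and> (\<forall>j\<le>v. (Guess i # ks, r(i := r i + j)) \<in> W))"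
| "ok W \<Phi> (Loop i a # ks) r \<longleftrightarrow>
     (if r i = 0 then (ks, r) \<in> W else (a @ Loop i a # ks, r(i := r i - 1)) \<in> W)"
| "ok W \<Phi> (Forever a # ks) r \<longleftrightarrow> \<Phi> a r"

definition closed :: "(cmd list \<times> env) set \<Rightarrow> bool" where
  "closed V \<longleftrightarrow> (\<forall>(l, r)\<in>V. ok V (\<lambda>a r. (a @ [Forever a], r) \<in> V) l r)"

text \<open>An upper bound for the locations that arise while \<open>cs\<close> is executed before
  \<open>ks\<close>. The recursion descends in \<open>cs\<close> alone, so the set is finite
  although loops unfold. \<open>Check\<close> starts its argument with no continuation, and
  \<open>Forever\<close> forgets what follows it.\<close>

fun conts :: "cmd list \<Rightarrow> cmd list \<Rightarrow> cmd list set" where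
  "conts [] ks = {}"
| "conts (Choose a b # cs) ks = {Choose a b # cs @ ks} \<union> conts a (cs @ ks) \<union> conts b (cs @ ks) \<union> conts cs ks"
| "conts (Check a # cs) ks = {Check a # cs @ ks} \<union> conts a [] \<union> conts cs ks"
| "conts (Loop i a # cs) ks = {Loop i a # cs @ ks} \<union> conts a (Loop i a # cs @ ks) \<union> conts cs ks"
| "conts (Forever a # cs) ks = {Forever a # cs @ ks, [Forever a]} \<union> conts a [Forever a] \<union> conts cs ks"
| "conts (c # cs) ks = {c # cs @ ks} \<union> conts cs ks"

fun maxreg :: "cmd list \<Rightarrow> nat" where
  "maxreg [] = 0"
| "maxreg (Choose a b # cs) = max (max (maxreg a) (maxreg b)) (maxreg cs)"
| "maxreg (Check a # cs) = max (maxreg a) (maxreg cs)"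
| "maxreg (Loop i a # cs) = max i (max (maxreg a) (maxreg cs))"
| "maxreg (Forever a # cs) = max (maxreg a) (maxreg cs)"
| "maxreg (Copy i j # cs) = max (max i j) (maxreg cs)"
| "maxreg (Clear i # cs) = max i (maxreg cs)"
| "maxreg (Incr i # cs) = max i (maxreg cs)"
| "maxreg (Decr i # cs) = max i (maxreg cs)"
| "maxreg (Test i # cs) = max i (maxreg cs)"
| "maxreg (Guess i # cs) = max i (maxreg cs)"

fun succ :: "cmd list \<Rightarrow> cmd list set" where
  "succ [] = {[]}"
| "succ (Choose a b # ks) = {a @ ks, b @ ks}"
| "succ (Check a # ks) = {a, ks}"
| "succ (Guess i # ks) = {ks, Guess i # ks}"
| "succ (Loop i a # ks) = {ks, a @ Loop i a # ks}"
| "succ (Forever a # ks) = {a @ [Forever a]}"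
| "succ (c # ks) = {ks}"

lemma finite_conts: "finite (conts cs ks)"
  by (induction cs ks rule: conts.induct) auto

lemma append_in_conts: "cs @ ks \<in> insert ks (conts cs ks)"
  by (cases "(cs, ks)" rule: conts.cases) auto

lemma succ_conts: "l \<in> conts cs ks \<Longrightarrow> succ l \<subseteq> conts cs ks \<union> {ks, []}"
proof (induction cs ks rule: conts.induct)
  case (2 a b cs ks)
  then show ?case
    using append_in_conts[of a "cs @ ks"] append_in_conts[of b "cs @ ks"] append_in_conts[of cs ks] by auto
next
  case (3 a cs ks)
  then show ?case using append_in_conts[of a "[]"] append_in_conts[of cs ks] by auto
next
  case (4 i a cs ks)
  then show ?case using append_in_conts[of a "Loop i a # cs @ ks"] append_in_conts[of cs ks] by auto
next
  case (5 a cs ks)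
  then show ?case using append_in_conts[of a "[Forever a]"] append_in_conts[of cs ks] by auto
qed (use append_in_conts in fastforce)+

lemma maxreg_append: "maxreg (a @ b) = max (maxreg a) (maxreg b)"
  by (induction a rule: maxreg.induct) auto

lemma maxreg_conts: "l \<in> conts cs ks \<Longrightarrow> maxreg l \<le> max (maxreg cs) (maxreg ks)"
  by (induction cs ks arbitrary: l rule: conts.induct) (fastforce simp: maxreg_append)+

definition locs :: "cmd list \<Rightarrow> cmd list set" where "locs c = insert [] (conts c [])"

lemma finite_locs: "finite (locs c)" by (simp add: locs_def finite_conts)

lemma locs_self: "c \<in> locs c" using append_in_conts[of c "[]"] by (simp add: locs_def)

lemma succ_locs: "l \<in> locs c \<Longrightarrow> succ l \<subseteq> locs c"
  using succ_conts[of l c "[]"] by (auto simp: locs_def)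

lemma maxreg_locs: "l \<in> locs c \<Longrightarrow> maxreg l \<le> maxreg c"
  using maxreg_conts[of l c "[]"] by (auto simp: locs_def)

section \<open>The game of a program\<close>

datatype lc = Ini | Ver | Prog "cmd list"

text \<open>Directions 0 and 1 differ only for \<open>Check\<close>; all other commands send both to
  the same place. For \<open>Guess\<close> and \<open>Loop\<close>, choice 0 leaves the
  command.\<close>

fun ptg :: "cmd list \<Rightarrow> nat \<Rightarrow> nat \<Rightarrow> cmd list" where
  "ptg [] c e = []"
| "ptg (Choose a b # ks) c e = (if c = 0 then a @ ks else b @ ks)"
| "ptg (Check a # ks) c e = (if e = 0 then a else ks)"
| "ptg (Guess i # ks) c e = (if c = 0 then ks else Guess i # ks)"
| "ptg (Loop i a # ks) c e = (if c = 0 then ks else a @ Loop i a # ks)"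
| "ptg (Forever a # ks) c e = a @ [Forever a]"
| "ptg (x # ks) c e = ks"

fun psr :: "cmd list \<Rightarrow> nat \<Rightarrow> nat \<Rightarrow> src" where
  "psr (Clear i # ks) c i' = (if i' = i then Zr else Keep i')"
| "psr (Copy i j # ks) c i' = (if i' = i then Keep j else Keep i')"
| "psr (Incr i # ks) c i' = (if i' = i then Inc i else Keep i')"
| "psr (Decr i # ks) c i' = (if i' = i then Dec i else Keep i')"
| "psr (Guess i # ks) c i' = (if i' = i \<and> c \<noteq> 0 then Inc i else Keep i')"
| "psr (Loop i a # ks) c i' = (if i' = i \<and> c \<noteq> 0 then Dec i else Keep i')"
| "psr l c i' = Keep i'"

fun pgd :: "cmd list \<Rightarrow> nat \<Rightarrow> nat set" where
  "pgd (Test i # ks) c = {i}"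
| "pgd (Loop i a # ks) c = (if c = 0 then {i} else {})"
| "pgd l c = {}"

fun pch :: "cmd list \<Rightarrow> nat" where
  "pch (Choose a b # ks) = 2"
| "pch (Guess i # ks) = 2"
| "pch (Loop i a # ks) = 2"
| "pch l = 1"

fun plive :: "cmd list \<Rightarrow> bool" where
  "plive (Guess i # ks) = True"
| "plive l = False"

lemma ptg_succ: "ptg l c e \<in> succ l"
  by (cases "(l, c, e)" rule: ptg.cases) auto

lemma psr_maxreg: "sreg (psr l c i) \<le> max (maxreg l) i"
  by (cases "(l, c, i)" rule: psr.cases) auto

lemma pgd_maxreg: "i \<in> pgd l c \<Longrightarrow> i \<le> maxreg l"
  by (cases "(l, c)" rule: pgd.cases) (auto split: if_splits)

locale program =
  fixes prog :: "cmd list"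
begin

definition "kr = Suc (maxreg prog)"
definition "Lc = insert Ini (insert Ver (Prog ` locs prog))"
text \<open>A choice in \<open>Ver\<close> is the code of the set of registers claimed to be zero;
  \<open>vch\<close> exceeds all these codes.\<close>

definition "vch = Suc (Max (set_encode ` Pow {..<kr}))"

primrec nch :: "lc \<Rightarrow> nat" where
  "nch Ini = 1" | "nch Ver = vch" | "nch (Prog l) = pch l"

primrec tg :: "lc \<Rightarrow> nat \<Rightarrow> nat \<Rightarrow> lc" where
  "tg Ini c e = (if e = 2 then Ver else Prog prog)"
| "tg Ver c e = Ver"
| "tg (Prog l) c e = (if e = 2 then Ver else Prog (ptg l c e))"

primrec gd :: "lc \<Rightarrow> nat \<Rightarrow> nat set" where
  "gd Ini c = {1..<kr}" | "gd Ver c = set_decode c \<inter> {..<kr}" | "gd (Prog l) c = pgd l c"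

primrec sr :: "lc \<Rightarrow> nat \<Rightarrow> nat \<Rightarrow> nat \<Rightarrow> src" where
  "sr Ini c e i = Keep i"
| "sr Ver c e i = (if i \<in> set_decode c then Keep i else Dec i)"
| "sr (Prog l) c e i = (if e = 2 then Keep i else psr l c i)"

primrec live :: "lc \<Rightarrow> bool" where
  "live Ini = False" | "live Ver = False" | "live (Prog l) = plive l"

sublocale game Lc nch kr Ini Ver tg sr gd live
proof unfold_locales
  fix l c e i assume l: "l \<in> Lc" "c < nch l" "e < (3::nat)"
  show "tg l c e \<in> Lc - {Ini}"
  proof (cases l)
    case (Prog x)
    then have "x \<in> locs prog" using l(1) by (auto simp: Lc_def)
    then have "ptg x c e \<in> locs prog" using succ_locs ptg_succ by blast
    then show ?thesis by (simp add: Prog Lc_def)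
  qed (simp_all add: Lc_def locs_self)
  assume i: "i < kr"
  show "sreg (sr l c e i) < kr"
  proof (cases l)
    case (Prog x)
    then have "maxreg x < kr" using l maxreg_locs[of x prog] by (auto simp: Lc_def kr_def)
    then show ?thesis using Prog psr_maxreg[of x c i] i by auto
  qed (use i in auto)
next
  fix l c assume l: "l \<in> Lc" "c < nch l"
  show "gd l c \<subseteq> {..<kr}"
  proof (cases l)
    case (Prog x)
    then have "maxreg x < kr" using l maxreg_locs[of x prog] by (auto simp: Lc_def kr_def)
    then show ?thesis using Prog pgd_maxreg[of _ x c] by fastforce
  qed auto
next
  fix l c i assume "l \<in> Lc" "c < nch l" "l \<noteq> Ver"
  then show "tg l c 2 = Ver \<and> sr l c 2 i = Keep i" by (cases l) auto
qed (use finite_locs in \<open>auto simp: Lc_def kr_def\<close>)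

definition r0 :: "nat \<Rightarrow> env" where "r0 n = (\<lambda>i. if i = 0 then n else 0)"

definition supp :: "env \<Rightarrow> bool" where "supp r \<longleftrightarrow> (\<forall>i\<ge>kr. r i = 0)"

lemma supp_r0: "supp (r0 n)" by (simp add: supp_def r0_def kr_def)

lemma supp_step: "supp (step l c e r)" by (simp add: supp_def step_def)

lemma step_Prog:
  assumes "supp r" "e \<noteq> 2" "maxreg l < kr"
  shows "step (Prog l) c e r = (\<lambda>i. sval (psr l c i) r)"
proof
  fix i
  have "sval (psr l c i) r = 0" if "kr \<le> i"
    using that assms by (cases "(l, c, i)" rule: psr.cases) (auto simp: supp_def)
  then show "step (Prog l) c e r i = sval (psr l c i) r" using assms by (simp add: step_def)
qed

subsection \<open>Strategies of the game yield closed sets\<close>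

lemma strategyD:
  assumes "strategy W" "(l, c, r) \<in> W"
  shows "enabled l c r" "e < 3 \<Longrightarrow> \<exists>c'. (tg l c e, c', step l c e r) \<in> W"
    "live l \<Longrightarrow> \<exists>r'. ((l, c, r), (l, 0, r')) \<in> (moves W)\<^sup>*"
  using assms unfolding strategy_def by blast+

definition VW :: "(lc \<times> nat \<times> env) set \<Rightarrow> (cmd list \<times> env) set" where
  "VW W = {(l, r). supp r \<and> (\<exists>c. (Prog l, c, r) \<in> W)}"

lemma VW_step:
  assumes W: "strategy W" and lr: "(Prog l, c, r) \<in> W" "supp r" and e: "e < 2"
  shows "(ptg l c e, \<lambda>i. sval (psr l c i) r) \<in> VW W"
proof -
  have "Prog l \<in> Lc" using strategyD(1)[OF W lr(1)] by (simp add: enabled_def)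
  then have "l \<in> locs prog" by (auto simp: Lc_def)
  then have m: "maxreg l < kr" using maxreg_locs[of l prog] by (simp add: kr_def)
  show ?thesis
    using strategyD(2)[OF W lr(1), of e] step_Prog[OF lr(2) _ m, of e c] supp_step[of "Prog l" c e r] e
    by (auto simp: VW_def)
qed

text \<open>Liveness provides a path to choice 0, and \<open>Inv\<close> follows it. As long as the
  path stays at the guess, it counts the increments of register \<open>i\<close>. The path may also
  leave the guess earlier, which proves the claim at once, or turn to \<open>Ver\<close>, from which
  it never returns.\<close>

lemma VW_Guess:
  assumes W: "strategy W" and lr: "(Prog (Guess i # ks), c0, r) \<in> W" "supp r"
  shows "ok (VW W) \<Phi> (Guess i # ks) r"
proof -
  let ?l = "Prog (Guess i # ks)" and ?r = "\<lambda>v. r(i := r i + v)"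
  let ?A = "\<lambda>v. \<forall>j\<le>v. (Guess i # ks, ?r j) \<in> VW W"
  let ?done = "\<exists>v. (ks, ?r v) \<in> VW W \<and> ?A v"
  define Inv where "Inv y \<longleftrightarrow> (\<exists>v c. y = (?l, c, ?r v) \<and> (?l, c, ?r v) \<in> W \<and> supp (?r v) \<and> ?A v) \<or>
    ?done \<or> fst y = Ver" for y
  have stop: "(ks, ?r v) \<in> VW W" if "(?l, 0, ?r v) \<in> W" "supp (?r v)" for v
    using VW_step[OF W that, of 0] by (simp add: fun_upd_def)
  have Inv: "((?l, c0, r), y) \<in> (moves W)\<^sup>* \<Longrightarrow> Inv y" for y
  proof (induction rule: rtrancl_induct)
    case base
    have "(Guess i # ks, r) \<in> VW W" using lr by (auto simp: VW_def)
    then show ?case unfolding Inv_def using lr by (intro disjI1 exI[of _ 0] exI[of _ c0]) auto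
  next
    case (step y z)
    obtain l c r1 e c' where yz: "y = (l, c, r1)" "z = (tg l c e, c', step l c e r1)" "e < 3"
      "(l, c, r1) \<in> W" "(tg l c e, c', step l c e r1) \<in> W"
      using step(2) by (auto simp: moves_def)
    consider v where "l = ?l" "r1 = ?r v" "supp (?r v)" "?A v" | ?done | "l = Ver"
      using step(3) yz(1) by (auto simp: Inv_def)
    then show ?case
    proof cases
      case 1
      show ?thesis
      proof (cases "c = 0")
        case True
        then have "(ks, ?r v) \<in> VW W" using stop 1 yz(4) by simp
        then show ?thesis unfolding Inv_def using 1(4) by blast
      next
        case c: False
        show ?thesis
        proof (cases "e = 2")
          case True
          then show ?thesis unfolding Inv_def using yz(2) 1 by simp
        next
          case False
          have W': "(?l, c, ?r v) \<in> W" using yz(4) 1 by simp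
          have "?l \<in> Lc" using strategyD(1)[OF W W'] by (simp add: enabled_def)
          then have m: "maxreg (Guess i # ks) < kr" using maxreg_locs[of "Guess i # ks" prog]
            by (auto simp: Lc_def kr_def)
          have st: "step ?l c e (?r v) = ?r (Suc v)"
            using step_Prog[OF 1(3) False m, of c] c by (auto simp: fun_upd_def)
          have "supp (?r (Suc v))" using supp_step[of ?l c e "?r v"] st by simp
          moreover have in_W: "(?l, c', ?r (Suc v)) \<in> W" using yz(5) 1 c False st by simp
          ultimately have "(Guess i # ks, ?r (Suc v)) \<in> VW W" by (auto simp: VW_def)
          then have "?A (Suc v)" using 1(4) by (auto simp: le_Suc_eq)
          then show ?thesis
            unfolding Inv_def using yz(2) 1 c False st in_W \<open>supp (?r (Suc v))\<close>
            by (intro disjI1 exI[of _ "Suc v"] exI[of _ c']) simp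
        qed
      qed
    next
      case 2
      then show ?thesis by (simp add: Inv_def)
    next
      case 3
      then show ?thesis by (simp add: Inv_def yz)
    qed
  qed
  obtain r' where "((?l, c0, r), (?l, 0, r')) \<in> (moves W)\<^sup>*"
    using strategyD(3)[OF W lr(1)] by auto
  from Inv[OF this] have ?done
    unfolding Inv_def using stop by auto
  then show ?thesis by simp
qed

lemma closed_VW:
  assumes W: "strategy W"
  shows "closed (VW W)"
  unfolding closed_def
proof (rule ballI, clarify)
  fix l r assume "(l, r) \<in> VW W"
  then obtain c where lr: "(Prog l, c, r) \<in> W" "supp r" by (auto simp: VW_def)
  have en: "\<forall>i\<in>pgd l c. r i = 0" "c < pch l" and
    dec: "\<And>i j. i < kr \<Longrightarrow> psr l c i = Dec j \<Longrightarrow> 0 < r j"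
    using strategyD(1)[OF W lr(1)] by (auto simp: enabled_def dest: spec[of _ 0])
  have "Prog l \<in> Lc" using strategyD(1)[OF W lr(1)] by (simp add: enabled_def)
  then have m: "maxreg l < kr" using maxreg_locs[of l prog] by (auto simp: Lc_def kr_def)
  have st: "(ptg l c e, \<lambda>i. sval (psr l c i) r) \<in> VW W" if "e < 2" for e
    using VW_step[OF W lr that] .
  note s0 = st[of 0, simplified] and s1 = st[of 1, simplified]
  show "ok (VW W) (\<lambda>a r. (a @ [Forever a], r) \<in> VW W) l r"
  proof (cases l)
    case (Cons x ks)
    show ?thesis
    proof (cases x)
      case (Clear i)
      have "(\<lambda>i'. sval (psr l c i') r) = r(i := 0)" by (auto simp: Cons Clear)
      then show ?thesis using s0 by (simp add: Cons Clear)
    next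
      case (Copy i j)
      have "(\<lambda>i'. sval (psr l c i') r) = r(i := r j)" by (auto simp: Cons Copy)
      then show ?thesis using s0 by (simp add: Cons Copy)
    next
      case (Incr i)
      have "(\<lambda>i'. sval (psr l c i') r) = r(i := Suc (r i))" by (auto simp: Cons Incr)
      then show ?thesis using s0 by (simp add: Cons Incr)
    next
      case (Decr i)
      have "(\<lambda>i'. sval (psr l c i') r) = r(i := r i - 1)" by (auto simp: Cons Decr)
      moreover have "0 < r i" using dec[of i i] m by (simp add: Cons Decr)
      ultimately show ?thesis using s0 by (simp add: Cons Decr)
    next
      case (Loop i a)
      show ?thesis
      proof (cases "c = 0")
        case True
        then have "r i = 0" using en by (simp add: Cons Loop)
        then show ?thesis using s0 True by (simp add: Cons Loop)
      next
        case False
        have "(\<lambda>i'. sval (psr l c i') r) = r(i := r i - 1)" using False by (auto simp: Cons Loop)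
        moreover have "0 < r i" using dec[of i i] m False by (simp add: Cons Loop)
        ultimately show ?thesis using s0 False by (simp add: Cons Loop)
      qed
    next
      case (Guess i)
      then show ?thesis using VW_Guess[OF W] lr Cons by blast
    next
      case (Choose a b)
      then show ?thesis using s0 by (auto simp: Cons split: if_splits)
    next
      case (Check a)
      then show ?thesis using s0 s1 by (simp add: Cons)
    next
      case (Test i)
      then show ?thesis using s0 en by (simp add: Cons)
    next
      case (Forever a)
      then show ?thesis using s0 by (simp add: Cons)
    qed
  qed simp
qed

theorem satisfiable_imp_closed:
  assumes "satisfiable (formula n)"
  shows "\<exists>V. closed V \<and> (prog, r0 n) \<in> V"
proof -
  obtain M :: "(nat, nat) mc" where "is_model M (formula n)" using assms by (auto simp: satisfiable_def)
  then obtain W where W: "strategy W" "(Ini, 0, r0 n) \<in> W"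
    using model_imp_strategy[of M n] by (auto simp: r0_def)
  obtain c' where c': "(Prog prog, c', step Ini 0 0 (r0 n)) \<in> W" using strategyD(2)[OF W, of 0] by auto
  have "0 < kr" by (simp add: kr_def)
  then have "step Ini 0 0 (r0 n) = r0 n" by (auto simp: step_def r0_def)
  then have "(prog, r0 n) \<in> VW W" using c' supp_r0 by (auto simp: VW_def)
  then show ?thesis using closed_VW[OF W(1)] by blast
qed

subsection \<open>Closed sets yield strategies of the game\<close>

context
  fixes V :: "(cmd list \<times> env) set"
  assumes V: "closed V"
begin

text \<open>Choices have to be positional. Therefore \<open>Guess\<close> ends at the first value
  for which the continuation belongs to \<open>V\<close>, and in \<open>Ver\<close> precisely the
  registers with value 0 are named.\<close>

primrec chs :: "lc \<Rightarrow> env \<Rightarrow> nat" where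
  "chs Ini r = 0"
| "chs Ver r = set_encode {i. i < kr \<and> r i = 0}"
| "chs (Prog l) r = (case l of Choose a b # ks \<Rightarrow> if (a @ ks, r) \<in> V then 0 else 1
     | Guess i # ks \<Rightarrow> if (ks, r) \<in> V then 0 else 1
     | Loop i a # ks \<Rightarrow> if r i = 0 then 0 else 1 | _ \<Rightarrow> 0)"

definition U :: "nat \<Rightarrow> (lc \<times> env) set" where
  "U n = insert (Ini, r0 n) {(Prog l, r) | l r. (l, r) \<in> V \<and> l \<in> locs prog \<and> supp r}"

text \<open>Besides the configurations of the program, the strategy needs those of
  \<open>Ver\<close>, where \<open>j\<close> rounds lower all registers by \<open>j\<close>, but not
  below 0. Nothing changes once \<open>j\<close> has reached the sum of the registers, so finitely
  many \<open>j\<close> suffice, and a finite \<open>V\<close> gives a finite strategy.\<close>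

definition WV :: "nat \<Rightarrow> (lc \<times> env) set" where
  "WV n = U n \<union> (\<lambda>((l, r), j). (Ver, \<lambda>i. r i - j)) ` (SIGMA z:U n. {..\<Sum>i<kr. snd z i})"

lemma V_ok: "(l, r) \<in> V \<Longrightarrow> ok V (\<lambda>a r. (a @ [Forever a], r) \<in> V) l r"
  using V by (auto simp: closed_def)

lemma V_next:
  assumes lr: "(l, r) \<in> V" and e: "e < 2"
  shows "(ptg l (chs (Prog l) r) e, \<lambda>i. sval (psr l (chs (Prog l) r) i) r) \<in> V"
    "chs (Prog l) r < pch l" "\<forall>i\<in>pgd l (chs (Prog l) r). r i = 0"
    "psr l (chs (Prog l) r) i = Dec j \<Longrightarrow> 0 < r j"
proof -
  note o = V_ok[OF lr]
  have "(ptg l (chs (Prog l) r) e, \<lambda>i. sval (psr l (chs (Prog l) r) i) r) \<in> V \<and>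
    chs (Prog l) r < pch l \<and> (\<forall>i\<in>pgd l (chs (Prog l) r). r i = 0) \<and>
    (\<forall>i j. psr l (chs (Prog l) r) i = Dec j \<longrightarrow> 0 < r j)"
  proof (cases l)
    case (Cons x ks)
    show ?thesis
    proof (cases x)
      case (Clear i)
      have "(\<lambda>i'. sval (psr l c i') r) = r(i := 0)" for c by (auto simp: Cons Clear)
      then show ?thesis using o by (simp add: Cons Clear)
    next
      case (Copy i j)
      have "(\<lambda>i'. sval (psr l c i') r) = r(i := r j)" for c by (auto simp: Cons Copy)
      then show ?thesis using o by (simp add: Cons Copy)
    next
      case (Incr i)
      have "(\<lambda>i'. sval (psr l c i') r) = r(i := Suc (r i))" for c by (auto simp: Cons Incr)
      then show ?thesis using o by (simp add: Cons Incr)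
    next
      case (Decr i)
      have "(\<lambda>i'. sval (psr l c i') r) = r(i := r i - 1)" for c by (auto simp: Cons Decr)
      then show ?thesis using o by (simp add: Cons Decr)
    next
      case (Loop i a)
      have "(\<lambda>i'. sval (psr l (Suc c) i') r) = r(i := r i - 1)" "(\<lambda>i'. sval (psr l 0 i') r) = r" for c
        by (auto simp: Cons Loop)
      then show ?thesis using o by (auto simp: Cons Loop)
    next
      case (Guess i)
      obtain v where v: "(ks, r(i := r i + v)) \<in> V" "\<forall>j\<le>v. (Guess i # ks, r(i := r i + j)) \<in> V"
        using o by (auto simp: Cons Guess)
      have "(\<lambda>i'. sval (psr l (Suc c) i') r) = r(i := Suc (r i))" "(\<lambda>i'. sval (psr l 0 i') r) = r" for c
        by (auto simp: Cons Guess)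
      moreover have "(Guess i # ks, r(i := Suc (r i))) \<in> V" if "(ks, r) \<notin> V"
      proof -
        have "1 \<le> v" using v(1) that by (cases v) auto
        then show ?thesis using v(2)[rule_format, of 1] by simp
      qed
      ultimately show ?thesis by (auto simp: Cons Guess)
    next
      case (Choose a b)
      then show ?thesis using o by (auto simp: Cons)
    next
      case (Check a)
      then show ?thesis using o by (simp add: Cons)
    next
      case (Test i)
      then show ?thesis using o by (simp add: Cons)
    next
      case (Forever a)
      then show ?thesis using o by (simp add: Cons)
    qed
  qed (use lr in simp)
  then show "(ptg l (chs (Prog l) r) e, \<lambda>i. sval (psr l (chs (Prog l) r) i) r) \<in> V"
    "chs (Prog l) r < pch l" "\<forall>i\<in>pgd l (chs (Prog l) r). r i = 0"
    "psr l (chs (Prog l) r) i = Dec j \<Longrightarrow> 0 < r j" by blast+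
qed

lemma U_supp: "(l, r) \<in> U n \<Longrightarrow> supp r"
  using supp_r0 by (auto simp: U_def)

lemma WV_supp: "(l, r) \<in> WV n \<Longrightarrow> supp r"
  using U_supp by (fastforce simp: WV_def supp_def)

lemma WV_U: "(l, r) \<in> WV n \<Longrightarrow> l \<noteq> Ver \<Longrightarrow> (l, r) \<in> U n"
  by (auto simp: WV_def)

lemma WV_Ver: "(l, r) \<in> U n \<Longrightarrow> (Ver, \<lambda>i. r i - j) \<in> WV n"
proof -
  assume lr: "(l, r) \<in> U n"
  let ?B = "\<Sum>i<kr. r i"
  have "r i \<le> ?B" if "i < kr" for i using that by (intro member_le_sum) auto
  moreover have "r i = 0" if "kr \<le> i" for i using U_supp[OF lr] that by (simp add: supp_def)
  ultimately have "r i \<le> ?B" for i by (cases "i < kr") auto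
  then have le: "r i \<le> ?B" for i .
  have "r i - j = r i - min j ?B" for i using le[of i] by (cases "j \<le> ?B") (auto simp: min_def)
  then have "(\<lambda>i. r i - j) = (\<lambda>i. r i - min j ?B)" by (rule ext)
  moreover have "(Ver, \<lambda>i. r i - min j ?B) \<in> WV n"
    unfolding WV_def using lr by (intro UnI2 image_eqI[of _ _ "((l, r), min j ?B)"]) auto
  ultimately show ?thesis by simp
qed

lemma WV_step:
  assumes lr: "(l, r) \<in> WV n" and P: "(prog, r0 n) \<in> V" and e: "e < 3"
  shows "(tg l (chs l r) e, step l (chs l r) e r) \<in> WV n" "enabled l (chs l r) r"
proof -
  have sup: "supp r" by (rule WV_supp[OF lr])
  have "(tg l (chs l r) e, step l (chs l r) e r) \<in> WV n \<and> enabled l (chs l r) r"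
  proof (cases l)
    case Ini
    then have r: "r = r0 n" using WV_U[OF lr] by (auto simp: U_def)
    have k0: "0 < kr" by (simp add: kr_def)
    then have st: "step Ini c e r = r" for c unfolding r by (auto simp: step_def r0_def)
    have "(Prog prog, r) \<in> WV n" using P locs_self sup r by (auto simp: WV_def U_def)
    moreover have "(Ver, r) \<in> WV n" using WV_Ver[of Ini r n 0] r by (simp add: U_def)
    moreover have "Ini \<in> Lc" by (simp add: Lc_def)
    then have "enabled Ini 0 r" by (simp add: enabled_def r r0_def)
    ultimately show ?thesis using Ini st by simp
  next
    case Ver
    let ?Z = "{i. i < kr \<and> r i = 0}"
    have Z: "set_decode (set_encode ?Z) = ?Z" by (rule set_encode_inverse) simp
    have st: "step Ver (chs Ver r) e r = (\<lambda>i. r i - 1)"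
      using sup by (auto simp: step_def Z supp_def not_less)
    obtain l0 r1 j where 0: "(l0, r1) \<in> U n" "r = (\<lambda>i. r1 i - j)"
    proof -
      from lr[unfolded Ver WV_def] consider "(Ver, r) \<in> U n"
        | l0 r1 j where "(l0, r1) \<in> U n" "r = (\<lambda>i. r1 i - j)" by auto
      then show thesis
      proof cases
        case 1
        then show thesis by (auto simp: U_def)
      qed (rule that)
    qed
    have "(\<lambda>i. r i - 1) = (\<lambda>i. r1 i - Suc j)" unfolding 0 by auto
    then have "(Ver, \<lambda>i. r i - 1) \<in> WV n" using WV_Ver[OF 0(1), of "Suc j"] by simp
    moreover have "enabled Ver (chs Ver r) r"
    proof -
      have "set_encode ?Z \<le> Max (set_encode ` Pow {..<kr})"
        by (rule Max_ge) (auto intro!: imageI)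
      then have "set_encode ?Z < vch" by (simp add: vch_def)
      moreover have "Ver \<in> Lc" by (simp add: Lc_def)
      ultimately show ?thesis by (auto simp: enabled_def Z)
    qed
    ultimately show ?thesis using Ver st by simp
  next
    case (Prog x)
    then have x: "(x, r) \<in> V" "x \<in> locs prog" using WV_U[OF lr] by (auto simp: U_def)
    have m: "maxreg x < kr" using maxreg_locs[OF x(2)] by (simp add: kr_def)
    have "l \<in> Lc" using x(2) by (simp add: Lc_def Prog)
    then have en: "enabled l (chs l r) r"
      using V_next(2,3)[OF x(1), of 0] V_next(4)[OF x(1), of 0]
      by (auto simp: enabled_def Prog simp del: chs.simps split: if_splits)
    show ?thesis
    proof (cases "e = 2")
      case True
      have "step l (chs l r) e r = r"
        using sup True by (auto simp: Prog step_def supp_def not_less simp del: chs.simps)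
      moreover have "(Ver, r) \<in> WV n" using WV_Ver[of l r n 0] WV_U[OF lr] Prog by simp
      ultimately show ?thesis using en True by (simp add: Prog del: chs.simps)
    next
      case False
      then have "e < 2" using e by simp
      note nx = V_next(1)[OF x(1) this]
      have st: "step l (chs l r) e r = (\<lambda>i. sval (psr x (chs (Prog x) r) i) r)"
        using step_Prog[OF sup False m] by (simp add: Prog del: chs.simps)
      have "ptg x (chs (Prog x) r) e \<in> locs prog" using succ_locs[OF x(2)] ptg_succ by blast
      moreover have "supp (step l (chs l r) e r)" by (rule supp_step)
      ultimately have "(Prog (ptg x (chs (Prog x) r) e), step l (chs l r) e r) \<in> WV n"
        using nx unfolding st by (auto simp: WV_def U_def simp del: chs.simps)
      then show ?thesis using en False by (simp add: Prog del: chs.simps)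
    qed
  qed
  then show "(tg l (chs l r) e, step l (chs l r) e r) \<in> WV n" "enabled l (chs l r) r" by blast+
qed

text \<open>Induction on the distance \<open>v\<close> to a value at which the continuation lies in
  \<open>V\<close>; \<open>chs\<close> stops there or earlier.\<close>

lemma WV_live:
  assumes P: "(prog, r0 n) \<in> V"
  shows "(Prog (Guess i # ks), r) \<in> WV n \<Longrightarrow> (ks, r(i := r i + v)) \<in> V \<Longrightarrow>
    \<exists>j r'. ((\<lambda>(l, r). (tg l (chs l r) 0, step l (chs l r) 0 r)) ^^ j) (Prog (Guess i # ks), r) =
      (Prog (Guess i # ks), r') \<and> chs (Prog (Guess i # ks)) r' = 0"
proof (induction v arbitrary: r)
  case 0
  then show ?case by (intro exI[of _ 0] exI[of _ r]) simp
next
  case (Suc v)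
  let ?l = "Prog (Guess i # ks)" and ?f = "\<lambda>(l, r). (tg l (chs l r) 0, step l (chs l r) 0 r)"
  show ?case
  proof (cases "(ks, r) \<in> V")
    case True
    then show ?thesis by (intro exI[of _ 0] exI[of _ r]) simp
  next
    case False
    have x: "Guess i # ks \<in> locs prog" using WV_U[OF Suc.prems(1)] by (auto simp: U_def)
    have m: "maxreg (Guess i # ks) < kr" using maxreg_locs[OF x] by (simp add: kr_def)
    have "step ?l (chs ?l r) 0 r = r(i := Suc (r i))"
      using step_Prog[OF WV_supp[OF Suc.prems(1)] _ m, of 0] False by (auto simp: fun_upd_def)
    then have f: "?f (?l, r) = (?l, r(i := Suc (r i)))" using False by simp
    then have "(?l, r(i := Suc (r i))) \<in> WV n" using WV_step(1)[OF Suc.prems(1) P, of 0] by simp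
    moreover have "(ks, (r(i := Suc (r i)))(i := (r(i := Suc (r i))) i + v)) \<in> V"
    proof -
      have "(r(i := Suc (r i)))(i := (r(i := Suc (r i))) i + v) = r(i := r i + Suc v)" by (rule ext) simp
      then show ?thesis using Suc.prems(2) by (simp only:)
    qed
    ultimately obtain j r' where
      "(?f ^^ j) (?l, r(i := Suc (r i))) = (?l, r')" "chs ?l r' = 0" using Suc.IH by blast
    then show ?thesis using f by (intro exI[of _ "Suc j"] exI[of _ r']) (simp only: funpow_Suc_right o_apply)
  qed
qed

lemma finite_WV: "finite V \<Longrightarrow> finite (WV n)"
proof -
  assume V: "finite V"
  have "{(Prog l, r) | l r. (l, r) \<in> V \<and> l \<in> locs prog \<and> supp r} \<subseteq> (\<lambda>(l, r). (Prog l, r)) ` V" by force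
  then have "finite (U n)" unfolding U_def using V finite_subset by blast
  then show ?thesis unfolding WV_def by (intro finite_UnI finite_imageI finite_SigmaI) simp_all
qed

lemma closed_strategy:
  assumes P: "(prog, r0 n) \<in> V"
  shows "game_strategy Lc nch kr Ini Ver tg sr gd live (WV n) chs n"
proof unfold_locales
  fix l r assume lr: "(l, r) \<in> WV n"
  show "enabled l (chs l r) r" using WV_step(2)[OF lr P, of 0] by simp
  show "(tg l (chs l r) e, step l (chs l r) e r) \<in> WV n" if "e < 3" for e
    by (rule WV_step(1)[OF lr P that])
  show "r i = 0" if "kr \<le> i" for i using WV_supp[OF lr] that by (simp add: supp_def)
  assume "live l"
  then obtain x where x: "l = Prog x" "plive x" by (cases l) auto
  then obtain i ks where l: "l = Prog (Guess i # ks)" by (cases x rule: plive.cases) auto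
  have "(Guess i # ks, r) \<in> V" using WV_U[OF lr] l by (auto simp: U_def)
  then obtain v where v: "(ks, r(i := r i + v)) \<in> V" using V_ok by fastforce
  show "\<exists>j r'. ((\<lambda>(l, r). (tg l (chs l r) 0, step l (chs l r) 0 r)) ^^ j) (l, r) = (l, r') \<and> chs l r' = 0"
    unfolding l by (rule WV_live[OF P _ v]) (use lr l in simp)
next
  show "(Ini, \<lambda>i. if i = 0 then n else 0) \<in> WV n" by (auto simp: WV_def U_def r0_def)
qed

theorem closed_imp_satisfiable:
  assumes P: "(prog, r0 n) \<in> V"
  shows "satisfiable (formula n)" "finite V \<Longrightarrow> finitely_satisfiable (formula n)"
proof -
  interpret G: game_strategy Lc nch kr Ini Ver tg sr gd live "WV n" chs n
    by (rule closed_strategy[OF P])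
  show "satisfiable (formula n)" by (rule satisfiableI[OF G.is_model_N])
  show "finitely_satisfiable (formula n)" if "finite V"
    by (rule finitely_satisfiableI[OF G.is_model_N G.finite_N[OF finite_WV[OF that]]])
qed

end

end

section \<open>Evaluation of bounded formulae by programs\<close>

lemma ok_mono:
  assumes "ok W \<Phi> l r" "W \<subseteq> W'" "\<And>a r. \<Phi> a r \<Longrightarrow> \<Phi>' a r"
  shows "ok W' \<Phi>' l r"
proof (cases "(W, \<Phi>, l, r)" rule: ok.cases)
  case (9 W0 \<Phi>0 i ks r0)
  then show ?thesis using assms by auto (meson subsetD)
qed (use assms in \<open>auto split: if_splits\<close>)

section \<open>Winning positions of programs\<close>

definition good :: "(cmd list \<Rightarrow> env \<Rightarrow> bool) \<Rightarrow> (cmd list \<times> env) set \<Rightarrow> bool" where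
  "good \<Phi> W \<longleftrightarrow> (\<forall>(l, r)\<in>W. ok W \<Phi> l r)"

text \<open>The meaning of \<open>Forever\<close> is a parameter, so that the body of an outer loop
  can be evaluated before the loop itself. \<open>fin\<close> asks for a finite strategy; the
  equations below are the same for both values of \<open>fin\<close>, which is why the evaluation of
  a formula succeeds with a finite strategy whenever it succeeds at all.\<close>

definition win :: "bool \<Rightarrow> (cmd list \<Rightarrow> env \<Rightarrow> bool) \<Rightarrow> cmd list \<Rightarrow> env \<Rightarrow> bool" where
  "win fin \<Phi> l r \<longleftrightarrow> (\<exists>W. (fin \<longrightarrow> finite W) \<and> good \<Phi> W \<and> (l, r) \<in> W)"

lemma good_Un: "good \<Phi> W \<Longrightarrow> good \<Phi> W' \<Longrightarrow> good \<Phi> (W \<union> W')"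
  unfolding good_def by (blast intro: ok_mono)

lemma good_insert: "good \<Phi> W \<Longrightarrow> ok W \<Phi> l r \<Longrightarrow> good \<Phi> (insert (l, r) W)"
  unfolding good_def by (blast intro: ok_mono)

lemma winI: "(fin \<longrightarrow> finite W) \<Longrightarrow> good \<Phi> W \<Longrightarrow> ok W \<Phi> l r \<Longrightarrow> win fin \<Phi> l r"
  unfolding win_def using good_insert by (intro exI[of _ "insert (l, r) W"]) auto

lemma win_ok:
  assumes "win fin \<Phi> l r"
  obtains W where "fin \<longrightarrow> finite W" "good \<Phi> W" "ok W \<Phi> l r"
    "\<And>l' r'. (l', r') \<in> W \<Longrightarrow> win fin \<Phi> l' r'"
  using assms unfolding win_def good_def by blast

lemma win1:
  assumes "win fin \<Phi> l' r'" "\<And>W. (l', r') \<in> W \<Longrightarrow> ok W \<Phi> l r"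
  shows "win fin \<Phi> l r"
  using assms winI unfolding win_def by blast

lemma win_Nil [simp]: "win fin \<Phi> [] r"
  by (rule winI[of _ "{}"]) (auto simp: good_def)

lemma win_step:
  assumes "\<And>W. ok W \<Phi> l r \<longleftrightarrow> P \<and> (l', r') \<in> W"
  shows "win fin \<Phi> l r \<longleftrightarrow> P \<and> win fin \<Phi> l' r'"
proof
  assume "win fin \<Phi> l r"
  then show "P \<and> win fin \<Phi> l' r'" by (rule win_ok) (use assms in blast)
next
  assume "P \<and> win fin \<Phi> l' r'"
  then show "win fin \<Phi> l r" using win1 assms by blast
qed

lemma win_Clear [simp]: "win fin \<Phi> (Clear i # ks) r \<longleftrightarrow> win fin \<Phi> ks (r(i := 0))"
  using win_step[where P = True] by simp

lemma win_Copy [simp]: "win fin \<Phi> (Copy i j # ks) r \<longleftrightarrow> win fin \<Phi> ks (r(i := r j))"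
  using win_step[where P = True] by simp

lemma win_Incr [simp]: "win fin \<Phi> (Incr i # ks) r \<longleftrightarrow> win fin \<Phi> ks (r(i := Suc (r i)))"
  using win_step[where P = True] by simp

lemma win_Decr [simp]: "win fin \<Phi> (Decr i # ks) r \<longleftrightarrow> 0 < r i \<and> win fin \<Phi> ks (r(i := r i - 1))"
  by (rule win_step) simp

lemma win_Test [simp]: "win fin \<Phi> (Test i # ks) r \<longleftrightarrow> r i = 0 \<and> win fin \<Phi> ks r"
  by (rule win_step) simp

lemma win_Choose [simp]:
  "win fin \<Phi> (Choose a b # ks) r \<longleftrightarrow> win fin \<Phi> (a @ ks) r \<or> win fin \<Phi> (b @ ks) r"
proof
  assume "win fin \<Phi> (Choose a b # ks) r"
  then show "win fin \<Phi> (a @ ks) r \<or> win fin \<Phi> (b @ ks) r" by (rule win_ok) auto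
next
  assume "win fin \<Phi> (a @ ks) r \<or> win fin \<Phi> (b @ ks) r"
  then show "win fin \<Phi> (Choose a b # ks) r"
    using win1[where l = "Choose a b # ks" and l' = "a @ ks"]
      win1[where l = "Choose a b # ks" and l' = "b @ ks"] by auto
qed

lemma win_Forever [simp]: "win fin \<Phi> (Forever a # ks) r \<longleftrightarrow> \<Phi> a r"
proof
  assume "\<Phi> a r"
  then show "win fin \<Phi> (Forever a # ks) r" by (intro winI[of _ "{}"]) (auto simp: good_def)
next
  assume "win fin \<Phi> (Forever a # ks) r"
  then show "\<Phi> a r" by (rule win_ok) simp
qed

lemma win_Check [simp]: "win fin \<Phi> (Check a # ks) r \<longleftrightarrow> win fin \<Phi> a r \<and> win fin \<Phi> ks r"
proof
  assume "win fin \<Phi> a r \<and> win fin \<Phi> ks r"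
  then obtain W W' where "fin \<longrightarrow> finite W" "good \<Phi> W" "(a, r) \<in> W"
    "fin \<longrightarrow> finite W'" "good \<Phi> W'" "(ks, r) \<in> W'" by (auto simp: win_def)
  then show "win fin \<Phi> (Check a # ks) r" by (intro winI[of _ "W \<union> W'"] good_Un) auto
next
  assume "win fin \<Phi> (Check a # ks) r"
  then show "win fin \<Phi> a r \<and> win fin \<Phi> ks r" by (rule win_ok) auto
qed

lemma win_Loop:
  "win fin \<Phi> (Loop i a # ks) r \<longleftrightarrow>
    (if r i = 0 then win fin \<Phi> ks r else win fin \<Phi> (a @ Loop i a # ks) (r(i := r i - 1)))"
proof (cases "r i = 0")
  case True
  then show ?thesis using win_step[where P = True and l = "Loop i a # ks"] by simp
next
  case False
  then show ?thesis using win_step[where P = True and l = "Loop i a # ks"] by simp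
qed

lemma win_Guess [simp]: "win fin \<Phi> (Guess i # ks) r \<longleftrightarrow> (\<exists>v. win fin \<Phi> ks (r(i := r i + v)))"
proof
  assume "\<exists>v. win fin \<Phi> ks (r(i := r i + v))"
  then obtain v W where W: "fin \<longrightarrow> finite W" "good \<Phi> W" "(ks, r(i := r i + v)) \<in> W"
    by (auto simp: win_def)
  \<comment> \<open>The intermediate positions of the guess are added to the strategy that follows
    it; from position \<open>j\<close>, there are \<open>v - j\<close> increments left.\<close>
  let ?W = "W \<union> (\<lambda>j. (Guess i # ks, r(i := r i + j))) ` {..v}"
  have "ok ?W \<Phi> l s" if "(l, s) \<in> ?W" for l s
  proof (rule UnE[OF that])
    assume "(l, s) \<in> W"
    then have "ok W \<Phi> l s" using W by (auto simp: good_def)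
    then show ?thesis by (rule ok_mono) auto
  next
    assume "(l, s) \<in> (\<lambda>j. (Guess i # ks, r(i := r i + j))) ` {..v}"
    then obtain j where ls: "(l, s) = (Guess i # ks, r(i := r i + j))" and "j \<in> {..v}"
      by (rule imageE)
    then have j: "j \<le> v" "l = Guess i # ks" "s = r(i := r i + j)" by (simp_all del: fun_upd_apply)
    have "(ks, s(i := s i + (v - j))) \<in> ?W" using W(3) j by simp
    moreover have "(Guess i # ks, s(i := s i + j')) \<in> ?W" if "j' \<le> v - j" for j'
      using j that by (intro UnI2 image_eqI[of _ _ "j + j'"]) (auto simp: add.assoc)
    ultimately show ?thesis unfolding j(2) by auto
  qed
  then have "good \<Phi> ?W" by (auto simp: good_def)
  moreover have "(Guess i # ks, r) \<in> ?W" by (intro UnI2 image_eqI[of _ _ 0]) auto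
  ultimately show "win fin \<Phi> (Guess i # ks) r" using W(1) unfolding win_def by (intro exI[of _ ?W]) auto
next
  assume "win fin \<Phi> (Guess i # ks) r"
  then show "\<exists>v. win fin \<Phi> ks (r(i := r i + v))" by (rule win_ok) auto
qed

section \<open>Arithmetic and bounded formulae\<close>

lemma win_loop_incr:
  "i \<noteq> d \<Longrightarrow> win fin \<Phi> (Loop i [Incr d] # ks) r \<longleftrightarrow> win fin \<Phi> ks (r(i := 0, d := r d + r i))"
proof (induction "r i" arbitrary: r)
  case 0
  then have "r(i := 0, d := r d + r i) = r" by auto
  with 0 show ?case using win_Loop[where i = i and r = r] by (metis)
next
  case (Suc n)
  let ?r = "r(i := r i - 1, d := Suc (r d))"
  have "n = ?r i" using Suc by simp
  note IH = Suc.hyps(1)[of ?r, OF this Suc.prems]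
  have "?r(i := 0, d := ?r d + ?r i) = r(i := 0, d := r d + r i)" using Suc by auto
  then show ?case using IH Suc by (subst win_Loop) simp
qed

lemma win_loop_decr:
  "i \<noteq> d \<Longrightarrow> win fin \<Phi> (Loop i [Decr d] # ks) r \<longleftrightarrow> r i \<le> r d \<and> win fin \<Phi> ks (r(i := 0, d := r d - r i))"
proof (induction "r i" arbitrary: r)
  case 0
  then have "r(i := 0, d := r d - r i) = r" by auto
  with 0 show ?case using win_Loop[where i = i and r = r] by (metis le0)
next
  case (Suc n)
  let ?r = "r(i := r i - 1, d := r d - 1)"
  have "n = ?r i" using Suc by simp
  note IH = Suc.hyps(1)[of ?r, OF this Suc.prems]
  have "?r(i := 0, d := ?r d - ?r i) = r(i := 0, d := r d - r i)" using Suc by auto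
  then show ?case using IH Suc by (subst win_Loop) auto
qed

text \<open>\<open>e\<close> is cleared only if the body of the loop is executed at least once;
  hence the case distinction.\<close>

lemma win_loop_mult:
  assumes "distinct [i, e, f, d]"
  shows "win fin \<Phi> (Loop i [Copy e f, Loop e [Incr d]] # ks) r \<longleftrightarrow>
    win fin \<Phi> ks (if r i = 0 then r else r(i := 0, e := 0, d := r d + r i * r f))"
proof (induction "r i" arbitrary: r)
  case 0
  then show ?case by (simp add: win_Loop)
next
  case (Suc n)
  let ?r = "r(i := r i - 1, e := 0, d := r d + r f)"
  have *: "i \<noteq> e" "i \<noteq> f" "i \<noteq> d" "e \<noteq> f" "e \<noteq> d" "f \<noteq> d" using assms by auto
  have "n = ?r i" using Suc * by simp
  note IH = Suc.hyps(1)[of ?r, OF this]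
  have 1: "(r(i := r i - 1, e := r f))(e := 0, d := (r(i := r i - 1, e := r f)) d + (r(i := r i - 1, e := r f)) e) = ?r"
    using * by auto
  have 2: "(if ?r i = 0 then ?r else ?r(i := 0, e := 0, d := ?r d + ?r i * ?r f)) =
      r(i := 0, e := 0, d := r d + r i * r f)"
    using * Suc.hyps(2)[symmetric] by (auto simp: fun_eq_iff)
  have "win fin \<Phi> (Loop i [Copy e f, Loop e [Incr d]] # ks) r \<longleftrightarrow>
      win fin \<Phi> (Loop i [Copy e f, Loop e [Incr d]] # ks) ?r"
    using Suc.hyps(2) * 1 by (subst win_Loop) (simp add: win_loop_incr fun_upd_twist)
  also have "\<dots> \<longleftrightarrow> win fin \<Phi> ks (r(i := 0, e := 0, d := r d + r i * r f))"
    using IH unfolding 2 .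
  finally show ?case using Suc.hyps(2) by simp
qed

text \<open>The value is left in register \<open>d\<close>. The registers above \<open>d\<close> are
  scratch, so the variables of the term have to lie below \<open>d\<close>.\<close>

primrec ev :: "tm \<Rightarrow> nat \<Rightarrow> cmd list" where
  "ev (TVar x) d = [Copy d x]"
| "ev TZero d = [Clear d]"
| "ev (TSuc t) d = ev t d @ [Incr d]"
| "ev (TAdd t u) d = ev t d @ ev u (Suc d) @ [Loop (Suc d) [Incr d]]"
| "ev (TMul t u) d = ev t d @ ev u (Suc d) @
     [Copy (d + 2) d, Clear d, Loop (Suc d) [Copy (d + 3) (d + 2), Loop (d + 3) [Incr d]]]"

lemma tm_val_cong: "(\<And>x. x \<in> tm_vars t \<Longrightarrow> e x = e' x) \<Longrightarrow> tm_val e t = tm_val e' t"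
  by (induction t) auto

lemma win_ev:
  "\<forall>x\<in>tm_vars t. x < d \<Longrightarrow>
    \<exists>r'. (\<forall>i<d. r' i = r i) \<and> r' d = tm_val r t \<and> (\<forall>ks. win fin \<Phi> (ev t d @ ks) r \<longleftrightarrow> win fin \<Phi> ks r')"
proof (induction t arbitrary: d r)
  case (TVar x)
  show ?case
  proof (intro exI[of _ "r(d := r x)"] conjI allI)
    show "win fin \<Phi> (ev (TVar x) d @ ks) r \<longleftrightarrow> win fin \<Phi> ks (r(d := r x))" for ks
      by (simp del: fun_upd_apply)
  qed simp_all
next
  case TZero
  show ?case
  proof (intro exI[of _ "r(d := 0)"] conjI allI)
    show "win fin \<Phi> (ev TZero d @ ks) r \<longleftrightarrow> win fin \<Phi> ks (r(d := 0))" for ks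
      by (simp del: fun_upd_apply)
  qed simp_all
next
  case (TSuc t)
  then have "\<forall>x\<in>tm_vars t. x < d" by simp
  from TSuc.IH[OF this] obtain r' where r': "\<forall>i<d. r' i = r i" "r' d = tm_val r t"
    "\<forall>ks. win fin \<Phi> (ev t d @ ks) r \<longleftrightarrow> win fin \<Phi> ks r'" by blast
  show ?case
  proof (intro exI[of _ "r'(d := Suc (r' d))"] conjI allI)
    show "win fin \<Phi> (ev (TSuc t) d @ ks) r \<longleftrightarrow> win fin \<Phi> ks (r'(d := Suc (r' d)))" for ks
      using r'(3) by (simp del: fun_upd_apply)
  qed (use r' in simp_all)
next
  case (TAdd t u)
  have v: "\<forall>x\<in>tm_vars t. x < d" "\<forall>x\<in>tm_vars u. x < Suc d" "\<forall>x\<in>tm_vars u. x < d" using TAdd.prems by (simp_all add: less_SucI)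
  obtain r1 where r1: "\<forall>i<d. r1 i = r i" "r1 d = tm_val r t"
    "\<forall>ks. win fin \<Phi> (ev t d @ ks) r \<longleftrightarrow> win fin \<Phi> ks r1" using TAdd.IH(1)[OF v(1)] by blast
  obtain r2 where r2: "\<forall>i<Suc d. r2 i = r1 i" "r2 (Suc d) = tm_val r1 u"
    "\<forall>ks. win fin \<Phi> (ev u (Suc d) @ ks) r1 \<longleftrightarrow> win fin \<Phi> ks r2" using TAdd.IH(2)[OF v(2)] by blast
  have "tm_val r1 u = tm_val r u" using v(3) r1(1) by (intro tm_val_cong) blast
  note u = this
  let ?r = "r2(Suc d := 0, d := r2 d + r2 (Suc d))"
  show ?case
  proof (intro exI[of _ ?r] conjI allI)
    show "win fin \<Phi> (ev (TAdd t u) d @ ks) r \<longleftrightarrow> win fin \<Phi> ks ?r" for ks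
      using r1(3) r2(3) by (simp add: win_loop_incr del: fun_upd_apply)
  qed (use r1 r2 u in simp_all)
next
  case (TMul t u)
  have v: "\<forall>x\<in>tm_vars t. x < d" "\<forall>x\<in>tm_vars u. x < Suc d" "\<forall>x\<in>tm_vars u. x < d" using TMul.prems by (simp_all add: less_SucI)
  obtain r1 where r1: "\<forall>i<d. r1 i = r i" "r1 d = tm_val r t"
    "\<forall>ks. win fin \<Phi> (ev t d @ ks) r \<longleftrightarrow> win fin \<Phi> ks r1" using TMul.IH(1)[OF v(1)] by blast
  obtain r2 where r2: "\<forall>i<Suc d. r2 i = r1 i" "r2 (Suc d) = tm_val r1 u"
    "\<forall>ks. win fin \<Phi> (ev u (Suc d) @ ks) r1 \<longleftrightarrow> win fin \<Phi> ks r2" using TMul.IH(2)[OF v(2)] by blast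
  have u: "tm_val r1 u = tm_val r u" using v(3) r1(1) by (intro tm_val_cong) blast
  define r3 where "r3 = r2(d + 2 := r2 d, d := 0)"
  define r4 where "r4 = (if r3 (Suc d) = 0 then r3
    else r3(Suc d := 0, d + 3 := 0, d := r3 d + r3 (Suc d) * r3 (d + 2)))"
  have "r4 i = r i" if "i < d" for i using that r1(1) r2(1) by (auto simp: r4_def r3_def)
  moreover have "r4 d = tm_val r (TMul t u)" using r1 r2 u by (auto simp: r4_def r3_def)
  moreover have "win fin \<Phi> (ev (TMul t u) d @ ks) r \<longleftrightarrow> win fin \<Phi> ks r4" for ks
  proof -
    have "win fin \<Phi> (ev (TMul t u) d @ ks) r \<longleftrightarrow>
        win fin \<Phi> (Loop (Suc d) [Copy (d + 3) (d + 2), Loop (d + 3) [Incr d]] # ks) r3"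
      using r1(3) r2(3) by (simp add: r3_def)
    also have "\<dots> \<longleftrightarrow> win fin \<Phi> ks r4"
      unfolding r4_def by (rule win_loop_mult) simp
    finally show ?thesis .
  qed
  ultimately show ?case by blast
qed

primrec nvars :: "so_fm \<Rightarrow> nat set" where
  "nvars (FEq t u) = tm_vars t \<union> tm_vars u"
| "nvars (FLess t u) = tm_vars t \<union> tm_vars u"
| "nvars (FIn t X) = tm_vars t"
| "nvars (FNot \<phi>) = nvars \<phi>"
| "nvars (FAnd \<phi> \<psi>) = nvars \<phi> \<union> nvars \<psi>"
| "nvars (FExN x \<phi>) = insert x (nvars \<phi>)"
| "nvars (FExS X \<phi>) = nvars \<phi>"

lemma finite_tm_vars: "finite (tm_vars t)" by (induction t) auto

lemma finite_nvars: "finite (nvars \<phi>)" by (induction \<phi>) (auto simp: finite_tm_vars)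

lemma num_fv_nvars: "num_fv \<phi> \<subseteq> nvars \<phi>" by (induction \<phi>) auto

lemma holds_cong:
  "(\<And>x. x \<in> num_fv \<phi> \<Longrightarrow> e x = e' x) \<Longrightarrow> (\<And>X. X \<in> set_fv \<phi> \<Longrightarrow> E X = E' X) \<Longrightarrow>
    holds \<phi> e E \<longleftrightarrow> holds \<phi> e' E'"
proof (induction \<phi> arbitrary: e e' E E')
  case (FEq t u)
  then show ?case using tm_val_cong[of t e e'] tm_val_cong[of u e e'] by simp
next
  case (FLess t u)
  then show ?case using tm_val_cong[of t e e'] tm_val_cong[of u e e'] by simp
next
  case (FIn t X)
  then show ?case using tm_val_cong[of t e e'] by simp
next
  case (FNot \<phi>)
  then show ?case by (metis holds.simps(4) num_fv.simps(4) set_fv.simps(4))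
next
  case (FAnd \<phi> \<psi>)
  have "holds \<phi> e E = holds \<phi> e' E'" by (rule FAnd.IH(1)) (use FAnd.prems in auto)
  moreover have "holds \<psi> e E = holds \<psi> e' E'" by (rule FAnd.IH(2)) (use FAnd.prems in auto)
  ultimately show ?case by simp
next
  case (FExN x \<phi>)
  have "holds \<phi> (e(x := n)) E = holds \<phi> (e'(x := n)) E'" for n
    by (rule FExN.IH) (use FExN.prems in auto)
  then show ?case by simp
next
  case (FExS X \<phi>)
  have "holds \<phi> e (E(X := A)) = holds \<phi> e' (E'(X := A))" for A
    by (rule FExS.IH) (use FExS.prems in auto)
  then show ?case by simp
qed

text \<open>
  \<open>tr s b \<phi>\<close> succeeds iff the truth value of \<open>\<phi>\<close> is \<open>b\<close>; the registers from \<open>s\<close> on are scratch.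
  A negated bounded quantifier is checked instance by instance, so the program terminates.
\<close>

primrec tr :: "nat \<Rightarrow> bool \<Rightarrow> so_fm \<Rightarrow> cmd list" where
  "tr s b (FEq t u) = ev t s @ ev u (Suc s) @
     (if b then [Loop s [Decr (Suc s)], Test (Suc s)]
      else [Choose [Loop s [Decr (Suc s)], Decr (Suc s)] [Loop (Suc s) [Decr s], Decr s]])"
| "tr s b (FLess t u) = ev t s @ ev u (Suc s) @
     (if b then [Loop s [Decr (Suc s)], Decr (Suc s)] else [Loop (Suc s) [Decr s]])"
| "tr s b (FIn t X) = []"
| "tr s b (FNot \<phi>) = tr s (\<not> b) \<phi>"
| "tr s b (FAnd \<phi> \<psi>) = (if b then Check (tr s b \<phi>) # tr s b \<psi> else [Choose (tr s b \<phi>) (tr s b \<psi>)])"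
| "tr s b (FExN x \<phi>) = (if b then Clear x # Guess x # tr s b \<phi>
     else case \<phi> of FAnd (FLess _ t) _ \<Rightarrow> ev t s @ [Clear x, Loop s [Check (tr s b \<phi>), Incr x]] | _ \<Rightarrow> [])"
| "tr s b (FExS X \<phi>) = []"

lemma win_two_ev:
  assumes "\<forall>x\<in>tm_vars t \<union> tm_vars u. x < s"
  obtains r' where "r' s = tm_val r t" "r' (Suc s) = tm_val r u"
    "\<And>ks. win fin \<Phi> (ev t s @ ev u (Suc s) @ ks) r \<longleftrightarrow> win fin \<Phi> ks r'"
proof -
  obtain r1 where r1: "\<forall>i<s. r1 i = r i" "r1 s = tm_val r t"
    "\<forall>ks. win fin \<Phi> (ev t s @ ks) r \<longleftrightarrow> win fin \<Phi> ks r1" using win_ev[of t s r fin \<Phi>] assms by blast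
  have "\<forall>x\<in>tm_vars u. x < Suc s" using assms by (metis UnCI less_SucI)
  then obtain r2 where r2: "\<forall>i<Suc s. r2 i = r1 i" "r2 (Suc s) = tm_val r1 u"
    "\<forall>ks. win fin \<Phi> (ev u (Suc s) @ ks) r1 \<longleftrightarrow> win fin \<Phi> ks r2" using win_ev[of u "Suc s" r1 fin \<Phi>] by blast
  have "tm_val r1 u = tm_val r u" using assms r1(1) by (intro tm_val_cong) blast
  then show thesis using r1 r2 by (intro that[of r2]) auto
qed

lemma win_tr_FEq:
  assumes "\<forall>x\<in>tm_vars t \<union> tm_vars u. x < s"
  shows "win fin \<Phi> (tr s b (FEq t u)) r \<longleftrightarrow> (tm_val r t = tm_val r u) = b"
proof -
  obtain r' where r': "r' s = tm_val r t" "r' (Suc s) = tm_val r u"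
    "\<And>ks. win fin \<Phi> (ev t s @ ev u (Suc s) @ ks) r \<longleftrightarrow> win fin \<Phi> ks r'"
    using win_two_ev[OF assms] by metis
  show ?thesis using r'(1,2) by (cases b) (auto simp: r'(3) win_loop_decr)
qed

lemma win_tr_FLess:
  assumes "\<forall>x\<in>tm_vars t \<union> tm_vars u. x < s"
  shows "win fin \<Phi> (tr s b (FLess t u)) r \<longleftrightarrow> (tm_val r t < tm_val r u) = b"
proof -
  obtain r' where r': "r' s = tm_val r t" "r' (Suc s) = tm_val r u"
    "\<And>ks. win fin \<Phi> (ev t s @ ev u (Suc s) @ ks) r \<longleftrightarrow> win fin \<Phi> ks r'"
    using win_two_ev[OF assms] by metis
  show ?thesis using r'(1,2) by (cases b) (auto simp: r'(3) win_loop_decr)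
qed

text \<open>\<open>c\<close> may overwrite the loop counter, but it runs in a branch of its own,
  started by \<open>Check\<close>, and the main branch keeps its registers. The condition on
  \<open>P\<close> says that the test depends only on registers below the scratch area, so the
  counter does not influence it.\<close>

lemma win_all_loop:
  assumes s: "s \<noteq> x" and c: "\<And>r. win fin \<Phi> c r \<longleftrightarrow> P r"
    and P: "\<And>r r'. (\<And>i. i < s \<Longrightarrow> r i = r' i) \<Longrightarrow> P r \<longleftrightarrow> P r'"
  shows "x < s \<Longrightarrow> win fin \<Phi> [Loop s [Check c, Incr x]] r \<longleftrightarrow> (\<forall>v<r s. P (r(x := r x + v)))"
proof (induction "r s" arbitrary: r)
  case 0
  then show ?case by (simp add: win_Loop)
next
  case (Suc n)
  let ?r = "r(s := r s - 1)" and ?r' = "r(s := r s - 1, x := Suc (r x))"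
  have n: "n = ?r' s" using Suc s by simp
  have "win fin \<Phi> [Loop s [Check c, Incr x]] r \<longleftrightarrow> P ?r \<and> win fin \<Phi> [Loop s [Check c, Incr x]] ?r'"
    using Suc.hyps(2) s c by (subst win_Loop) simp
  also have "P ?r \<longleftrightarrow> P (r(x := r x + 0))" by (rule P) auto
  also have "win fin \<Phi> [Loop s [Check c, Incr x]] ?r' \<longleftrightarrow> (\<forall>v<?r' s. P (?r'(x := ?r' x + v)))"
    by (rule Suc.hyps(1)[of ?r', OF n Suc.prems])
  also have "\<dots> \<longleftrightarrow> (\<forall>v<n. P (r(x := r x + Suc v)))"
  proof -
    have "P (?r'(x := ?r' x + v)) \<longleftrightarrow> P (r(x := r x + Suc v))" for v by (rule P) auto
    then show ?thesis unfolding n[symmetric] by simp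
  qed
  also have "P (r(x := r x + 0)) \<and> (\<forall>v<n. P (r(x := r x + Suc v))) \<longleftrightarrow> (\<forall>v<Suc n. P (r(x := r x + v)))"
    using All_less_Suc2[of n "\<lambda>v. P (r(x := r x + v))"] by simp
  finally show ?case unfolding Suc.hyps(2) .
qed

lemma win_tr:
  assumes "bounded_fm \<phi>" "set_fv \<phi> = {}" "\<forall>x\<in>nvars \<phi>. x < s"
  shows "win fin \<Phi> (tr s b \<phi>) r \<longleftrightarrow> holds \<phi> r E = b"
  using assms
proof (induction arbitrary: r b rule: bounded_fm.induct)
  case (1 t u)
  then show ?case using win_tr_FEq[of t u s] by simp
next
  case (2 t u)
  then show ?case using win_tr_FLess[of t u s] by simp
next
  case (6 \<phi> x t)
  let ?\<psi> = "FAnd (FLess (TVar x) t) \<phi>"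
  have vars: "\<forall>y\<in>tm_vars (TVar x) \<union> tm_vars t. y < s" "\<forall>y\<in>tm_vars t. y < s" "x < s" using 6 by auto
  have IH: "win fin \<Phi> (tr s b ?\<psi>) r \<longleftrightarrow> holds ?\<psi> r E = b" for r b
  proof -
    have "win fin \<Phi> (tr s b \<phi>) r \<longleftrightarrow> holds \<phi> r E = b" for r b
      using 6 by simp
    moreover have "win fin \<Phi> (tr s b (FLess (TVar x) t)) r \<longleftrightarrow> (r x < tm_val r t) = b" for b
      using win_tr_FLess[OF vars(1)] by simp
    ultimately show ?thesis by (cases b) (auto simp del: tr.simps(2))
  qed
  have fresh: "tm_val (r(x := v)) t = tm_val r t" for r v using 6 by (intro tm_val_cong) auto
  show ?case
  proof (cases b)
    case True
    have "win fin \<Phi> (tr s b (FExN x ?\<psi>)) r \<longleftrightarrow> (\<exists>v. win fin \<Phi> (tr s True ?\<psi>) (r(x := v)))"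
      using True by (simp del: tr.simps(5))
    then show ?thesis using True unfolding IH by simp
  next
    case False
    obtain r' where r': "\<forall>i<s. r' i = r i" "r' s = tm_val r t"
      "\<forall>ks. win fin \<Phi> (ev t s @ ks) r \<longleftrightarrow> win fin \<Phi> ks r'" using win_ev[OF vars(2)] by blast
    have cong: "holds ?\<psi> r1 E \<longleftrightarrow> holds ?\<psi> r2 E" if "\<And>i. i < s \<Longrightarrow> r1 i = r2 i" for r1 r2
    proof (rule holds_cong)
      have "num_fv ?\<psi> \<subseteq> nvars (FExN x ?\<psi>)" using num_fv_nvars[of ?\<psi>] by auto
      then show "r1 y = r2 y" if "y \<in> num_fv ?\<psi>" for y
        using 6(5) that \<open>\<And>i. i < s \<Longrightarrow> r1 i = r2 i\<close> by (meson subsetD)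
    qed (use 6(4) in auto)
    have "win fin \<Phi> (tr s b (FExN x ?\<psi>)) r \<longleftrightarrow>
        win fin \<Phi> (ev t s @ [Clear x, Loop s [Check (tr s False ?\<psi>), Incr x]]) r"
      using False by (simp del: tr.simps(5))
    also have "\<dots> \<longleftrightarrow> win fin \<Phi> [Loop s [Check (tr s False ?\<psi>), Incr x]] (r'(x := 0))"
      using r'(3) by (simp del: tr.simps(5))
    also have "\<dots> \<longleftrightarrow> (\<forall>v<(r'(x := 0)) s. \<not> holds ?\<psi> ((r'(x := 0))(x := (r'(x := 0)) x + v)) E)"
    proof (rule win_all_loop[OF _ _ _ vars(3)])
      show "win fin \<Phi> (tr s False ?\<psi>) r \<longleftrightarrow> \<not> holds ?\<psi> r E" for r unfolding IH by simp
      show "\<not> holds ?\<psi> r1 E \<longleftrightarrow> \<not> holds ?\<psi> r2 E" if "\<And>i. i < s \<Longrightarrow> r1 i = r2 i" for r1 r2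
        using cong[of r1 r2] that by blast
    qed (use vars(3) in simp)
    also have "\<dots> \<longleftrightarrow> (\<forall>v<tm_val r t. \<not> holds ?\<psi> (r(x := v)) E)"
    proof -
      have "holds ?\<psi> (r'(x := v)) E \<longleftrightarrow> holds ?\<psi> (r(x := v)) E" for v
        by (rule cong) (use r'(1) in auto)
      moreover have "(r'(x := 0)) s = tm_val r t" using r'(2) vars(3) by simp
      ultimately show ?thesis by simp
    qed
    also have "\<dots> \<longleftrightarrow> \<not> holds (FExN x ?\<psi>) r E" by (auto simp: fresh)
    finally show ?thesis using False by simp
  qed
qed auto

lemma win_tr_Sigma01:
  assumes "Sigma01_fm \<phi>" "set_fv \<phi> = {}" "\<forall>x\<in>nvars \<phi>. x < s"
  shows "win fin \<Phi> (tr s True \<phi>) r \<longleftrightarrow> holds \<phi> r E"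
  using assms
proof (induction arbitrary: r rule: Sigma01_fm.induct)
  case (1 \<phi>)
  then show ?case using win_tr[of \<phi> s fin \<Phi> True r E] by simp
qed auto

abbreviation start :: "nat \<Rightarrow> env" where
  "start n \<equiv> \<lambda>i. if i = 0 then n else 0"

lemma ex_register_bound: "\<exists>s. \<forall>x\<in>nvars \<phi>. x < s"
  using finite_nat_bounded[OF finite_nvars[of \<phi>]] by blast

text \<open>\<open>win_tr_Sigma01\<close> holds for both values of \<open>fin\<close> and for any
  meaning of \<open>Forever\<close>. So membership provides a finite strategy, and conversely an
  arbitrary closed set is a winning strategy for the \<open>Forever\<close> that it determines
  itself, which implies membership.\<close>

theorem Sigma01_program:
  assumes "A \<in> Sigma01"
  obtains prog where
    "\<And>n. n \<in> A \<Longrightarrow> \<exists>V. finite V \<and> closed V \<and> (prog, start n) \<in> V"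
    "\<And>n V. closed V \<Longrightarrow> (prog, start n) \<in> V \<Longrightarrow> n \<in> A"
proof -
  obtain \<phi> where \<phi>: "Sigma01_fm \<phi>" "num_fv \<phi> \<subseteq> {0}" "set_fv \<phi> = {}"
    and A: "A = {n. holds \<phi> (\<lambda>_. n) (\<lambda>_. {})}"
    using assms by (auto simp: Sigma01_def definable_by_def)
  obtain s where s: "\<forall>x\<in>nvars \<phi>. x < s" using ex_register_bound by blast
  have A_iff: "n \<in> A \<longleftrightarrow> holds \<phi> (start n) (\<lambda>_. {})" for n
    unfolding A mem_Collect_eq by (rule holds_cong) (use \<phi>(2) in auto)
  note tr = win_tr_Sigma01[OF \<phi>(1,3) s, where E = "\<lambda>_. {}"]
  show thesis
  proof (rule that[of "tr s True \<phi>"])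
    fix n assume "n \<in> A"
    then have "win True (\<lambda>_ _. False) (tr s True \<phi>) (start n)" using tr A_iff by blast
    then obtain W where W: "finite W" "good (\<lambda>_ _. False) W" "(tr s True \<phi>, start n) \<in> W"
      unfolding win_def by blast
    have "closed W" unfolding closed_def
    proof clarify
      fix l r assume "(l, r) \<in> W"
      then have "ok W (\<lambda>_ _. False) l r" using W(2) by (auto simp: good_def)
      then show "ok W (\<lambda>a r. (a @ [Forever a], r) \<in> W) l r" by (rule ok_mono) auto
    qed
    then show "\<exists>V. finite V \<and> closed V \<and> (tr s True \<phi>, start n) \<in> V" using W by blast
  next
    fix n V assume "closed V" "(tr s True \<phi>, start n) \<in> V"
    then have "win False (\<lambda>a r. (a @ [Forever a], r) \<in> V) (tr s True \<phi>) (start n)"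
      unfolding win_def good_def closed_def by blast
    then show "n \<in> A" using tr A_iff by blast
  qed
qed


section \<open>A normal form for \<open>\<Sigma>\<^sup>1\<^sub>1\<close> formulae\<close>

text \<open>Formulae are numbered through countability. The numbers of the finitely many subformulae
  enter the matrix as numerals, so no arithmetic of syntax is required.\<close>

instance tm :: countable by countable_datatype
instance so_fm :: countable by countable_datatype

text \<open>All quantified sets are collected in one assignment. Agreement is demanded for the free
  set variables only, so a variable bound by the prefix, even repeatedly, may be reassigned.\<close>

lemma strip_set_quantifiers:
  assumes "Sigma11_fm \<phi>"
  shows "\<exists>\<alpha>. arithmetical_fm \<alpha> \<and> num_fv \<alpha> = num_fv \<phi> \<and>
    (\<forall>e E. holds \<phi> e E \<longleftrightarrow> (\<exists>E'. (\<forall>X\<in>set_fv \<phi>. E' X = E X) \<and> holds \<alpha> e E'))"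
  using assms
proof (induction rule: Sigma11_fm.induct)
  case (1 \<phi>)
  have "holds \<phi> e E \<longleftrightarrow> (\<exists>E'. (\<forall>X\<in>set_fv \<phi>. E' X = E X) \<and> holds \<phi> e E')" for e E
    using holds_cong[of \<phi> e e E] by metis
  then show ?case using 1 by blast
next
  case (2 \<phi> X)
  then obtain \<alpha> where \<alpha>: "arithmetical_fm \<alpha>" "num_fv \<alpha> = num_fv \<phi>"
    "\<And>e E. holds \<phi> e E \<longleftrightarrow> (\<exists>E'. (\<forall>Y\<in>set_fv \<phi>. E' Y = E Y) \<and> holds \<alpha> e E')" by metis
  have "holds (FExS X \<phi>) e E \<longleftrightarrow> (\<exists>E'. (\<forall>Y\<in>set_fv (FExS X \<phi>). E' Y = E Y) \<and> holds \<alpha> e E')" for e E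
  proof
    assume "holds (FExS X \<phi>) e E"
    then obtain A E' where "\<forall>Y\<in>set_fv \<phi>. E' Y = (E(X := A)) Y" "holds \<alpha> e E'"
      unfolding holds.simps \<alpha>(3) by blast
    then show "\<exists>E'. (\<forall>Y\<in>set_fv (FExS X \<phi>). E' Y = E Y) \<and> holds \<alpha> e E'" by (intro exI[of _ E']) auto
  next
    assume "\<exists>E'. (\<forall>Y\<in>set_fv (FExS X \<phi>). E' Y = E Y) \<and> holds \<alpha> e E'"
    then obtain E' where E': "\<forall>Y\<in>set_fv (FExS X \<phi>). E' Y = E Y" "holds \<alpha> e E'" by blast
    then have "\<forall>Y\<in>set_fv \<phi>. E' Y = (E(X := E' X)) Y" by auto
    then show "holds (FExS X \<phi>) e E" using E'(2) unfolding holds.simps \<alpha>(3) by blast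
  qed
  then show ?case using \<alpha>(1,2) by (intro exI[of _ \<alpha>]) simp
qed

section \<open>Coding of assignments and truth claims\<close>

definition pj :: "nat \<Rightarrow> nat \<Rightarrow> nat" where
  "pj a b = (a + b) * (a + b) + a"

definition pit :: "tm \<Rightarrow> tm \<Rightarrow> tm" where
  "pit t u = TAdd (TMul (TAdd t u) (TAdd t u)) t"

lemma pit [simp]: "tm_val r (pit t u) = pj (tm_val r t) (tm_val r u)"
  "tm_vars (pit t u) = tm_vars t \<union> tm_vars u"
  by (auto simp: pit_def pj_def)

lemma pj_le: "a \<le> pj a b" "b \<le> pj a b"
proof -
  have "b \<le> (a + b) * (a + b)" by (rule le_trans[OF _ le_square]) simp
  then show "b \<le> pj a b" by (simp add: pj_def)
qed (simp add: pj_def)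

text \<open>\<open>pj a b\<close> lies between the squares of \<open>a + b\<close> and of
  \<open>a + b + 1\<close>, so it determines \<open>a + b\<close> and then \<open>a\<close>. Being a
  polynomial, this pairing is available as a term, without auxiliary quantifiers.\<close>

lemma pj_inject: "pj a b = pj c d \<longleftrightarrow> a = c \<and> b = d"
proof
  have less: "pj a b < pj c d" if "a + b < c + d" for a b c d
  proof -
    have "pj a b < (a + b + 1) * (a + b + 1)" by (simp add: pj_def)
    also have "\<dots> \<le> (c + d) * (c + d)" using that by (intro mult_mono) auto
    also have "\<dots> \<le> pj c d" by (simp add: pj_def)
    finally show ?thesis .
  qed
  assume eq: "pj a b = pj c d"
  then have "a + b = c + d" using less[of a b c d] less[of c d a b] by (metis less_irrefl nat_neq_iff)
  with eq show "a = c \<and> b = d" by (simp add: pj_def)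
qed simp

primrec num :: "nat \<Rightarrow> tm" where
  "num 0 = TZero" | "num (Suc k) = TSuc (num k)"

lemma num [simp]: "tm_val r (num k) = k" "tm_vars (num k) = {}"
  by (induction k) auto

primrec tsub :: "(nat \<Rightarrow> tm) \<Rightarrow> tm \<Rightarrow> tm" where
  "tsub S (TVar x) = S x"
| "tsub S TZero = TZero"
| "tsub S (TSuc t) = TSuc (tsub S t)"
| "tsub S (TAdd t u) = TAdd (tsub S t) (tsub S u)"
| "tsub S (TMul t u) = TMul (tsub S t) (tsub S u)"

lemma tsub [simp]:
  "tm_val r (tsub S t) = tm_val (\<lambda>x. tm_val r (S x)) t" "tm_vars (tsub S t) = (\<Union>x\<in>tm_vars t. tm_vars (S x))"
  by (induction t) auto

primrec cv :: "nat \<Rightarrow> (nat \<Rightarrow> nat) \<Rightarrow> nat" where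
  "cv 0 e = 0" | "cv (Suc k) e = pj (e k) (cv k e)"

primrec cvt :: "nat \<Rightarrow> (nat \<Rightarrow> tm) \<Rightarrow> tm" where
  "cvt 0 S = TZero" | "cvt (Suc k) S = pit (S k) (cvt k S)"

lemma cvt [simp]:
  "tm_val r (cvt k S) = cv k (\<lambda>x. tm_val r (S x))" "tm_vars (cvt k S) = (\<Union>x<k. tm_vars (S x))"
  by (induction k) (auto simp: lessThan_Suc)

lemma cv_le: "j < k \<Longrightarrow> e j \<le> cv k e"
  by (induction k) (auto simp: less_Suc_eq intro: pj_le le_trans[OF _ pj_le(2)])

lemma cv_inject: "cv k e = cv k e' \<longleftrightarrow> (\<forall>j<k. e j = e' j)"
  by (induction k) (auto simp: less_Suc_eq pj_inject)

text \<open>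
  A function \<open>h\<close> codes a set assignment together with a system of truth claims closed under
  Hintikka's rules: \<open>code N \<phi> b e\<close> with a positive value claims that \<open>\<phi>\<close> has truth value \<open>b\<close> under
  \<open>e\<close>, the value being a witness, and \<open>scode X a\<close> with a positive value puts \<open>a\<close> into the set \<open>X\<close>.
\<close>

definition code :: "nat \<Rightarrow> so_fm \<Rightarrow> bool \<Rightarrow> (nat \<Rightarrow> nat) \<Rightarrow> nat" where
  "code N \<phi> b e = pj (to_nat (Inl (\<phi>, b) :: (so_fm \<times> bool) + nat)) (cv N e)"

definition scode :: "nat \<Rightarrow> nat \<Rightarrow> nat" where
  "scode X a = pj (to_nat (Inr X :: (so_fm \<times> bool) + nat)) a"

definition codet :: "nat \<Rightarrow> so_fm \<Rightarrow> bool \<Rightarrow> (nat \<Rightarrow> tm) \<Rightarrow> tm" where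
  "codet N \<phi> b S = pit (num (to_nat (Inl (\<phi>, b) :: (so_fm \<times> bool) + nat))) (cvt N S)"

definition scodet :: "nat \<Rightarrow> tm \<Rightarrow> tm" where
  "scodet X t = pit (num (to_nat (Inr X :: (so_fm \<times> bool) + nat))) t"

lemma codet [simp]:
  "tm_val r (codet N \<phi> b S) = code N \<phi> b (\<lambda>x. tm_val r (S x))"
  "tm_vars (codet N \<phi> b S) = (\<Union>x<N. tm_vars (S x))"
  "tm_val r (scodet X t) = scode X (tm_val r t)"
  "tm_vars (scodet X t) = tm_vars t"
  by (simp_all add: codet_def code_def scodet_def scode_def)

lemma code_inject:
  "code N \<phi> b e = code N \<psi> c e' \<longleftrightarrow> \<phi> = \<psi> \<and> b = c \<and> (\<forall>j<N. e j = e' j)"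
  "scode X a = scode Y a' \<longleftrightarrow> X = Y \<and> a = a'"
  "code N \<phi> b e \<noteq> scode X a"
  by (auto simp: code_def scode_def pj_inject cv_inject)

text \<open>A code dominates the entries of its assignment; this bounds the quantifiers over
  assignments in the matrix.\<close>

lemma code_ge: "j < N \<Longrightarrow> e j \<le> code N \<phi> b e"
  unfolding code_def using cv_le pj_le(2) le_trans by blast

declare bounded_fm.intros(1-5) [simp]

definition fimp :: "so_fm \<Rightarrow> so_fm \<Rightarrow> so_fm" where
  "fimp \<phi> \<psi> = FNot (FAnd \<phi> (FNot \<psi>))"

definition lit :: "bool \<Rightarrow> so_fm \<Rightarrow> so_fm" where
  "lit b \<phi> = (if b then \<phi> else FNot \<phi>)"

definition fall :: "nat \<Rightarrow> tm \<Rightarrow> so_fm \<Rightarrow> so_fm" where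
  "fall x t \<phi> = FNot (FExN x (FAnd (FLess (TVar x) t) (FNot \<phi>)))"

lemma connectives [simp]:
  "holds (fimp \<phi> \<psi>) r E \<longleftrightarrow> (holds \<phi> r E \<longrightarrow> holds \<psi> r E)"
  "holds (lit b \<phi>) r E \<longleftrightarrow> holds \<phi> r E = b"
  "num_fv (fimp \<phi> \<psi>) = num_fv \<phi> \<union> num_fv \<psi>" "set_fv (fimp \<phi> \<psi>) = set_fv \<phi> \<union> set_fv \<psi>"
  "num_fv (lit b \<phi>) = num_fv \<phi>" "set_fv (lit b \<phi>) = set_fv \<phi>"
  "bounded_fm \<phi> \<Longrightarrow> bounded_fm \<psi> \<Longrightarrow> bounded_fm (fimp \<phi> \<psi>)"
  "bounded_fm \<phi> \<Longrightarrow> bounded_fm (lit b \<phi>)"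
  by (auto simp: fimp_def lit_def intro!: bounded_fm.intros)

lemma fall [simp]:
  "x \<notin> tm_vars t \<Longrightarrow> holds (fall x t \<phi>) r E \<longleftrightarrow> (\<forall>v<tm_val r t. holds \<phi> (r(x := v)) E)"
  "num_fv (fall x t \<phi>) = tm_vars t - {x} \<union> (num_fv \<phi> - {x})"
  "set_fv (fall x t \<phi>) = set_fv \<phi>"
  "x \<notin> tm_vars t \<Longrightarrow> bounded_fm \<phi> \<Longrightarrow> bounded_fm (fall x t \<phi>)"
proof -
  assume x: "x \<notin> tm_vars t"
  have "tm_val (r(x := v)) t = tm_val r t" for v by (rule tm_val_cong) (use x in auto)
  then show "holds (fall x t \<phi>) r E \<longleftrightarrow> (\<forall>v<tm_val r t. holds \<phi> (r(x := v)) E)" by (auto simp: fall_def)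
qed (auto simp: fall_def intro!: bounded_fm.intros)

primrec balls :: "nat \<Rightarrow> so_fm \<Rightarrow> so_fm" where
  "balls 0 \<phi> = \<phi>" | "balls (Suc k) \<phi> = fall (k + 6) (TSuc (TVar 1)) (balls k \<phi>)"

lemma balls_syntax:
  "set_fv (balls k \<phi>) = set_fv \<phi>" "bounded_fm \<phi> \<Longrightarrow> bounded_fm (balls k \<phi>)"
  "num_fv (balls k \<phi>) \<subseteq> {1} \<union> (num_fv \<phi> - {6..<k + 6})"
  by (induction k) auto

lemma holds_balls:
  "holds (balls k \<phi>) r E \<longleftrightarrow>
    (\<forall>r'. (\<forall>v. v \<notin> {6..<k + 6} \<longrightarrow> r' v = r v) \<and> (\<forall>j<k. r' (j + 6) \<le> r 1) \<longrightarrow> holds \<phi> r' E)"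
proof (induction k arbitrary: r)
  case 0
  have "(\<forall>v. r' v = r v) \<longleftrightarrow> r' = r" for r' by auto
  then show ?case by simp
next
  case (Suc k)
  have "holds (balls (Suc k) \<phi>) r E \<longleftrightarrow> (\<forall>v\<le>r 1. holds (balls k \<phi>) (r(k + 6 := v)) E)"
    by (simp add: less_Suc_eq_le)
  also have "\<dots> \<longleftrightarrow> (\<forall>r'. (\<forall>v. v \<notin> {6..<Suc k + 6} \<longrightarrow> r' v = r v) \<and> (\<forall>j<Suc k. r' (j + 6) \<le> r 1) \<longrightarrow> holds \<phi> r' E)"
    (is "?L \<longleftrightarrow> ?R")
  proof (intro iffI allI impI)
    fix r' assume L: ?L and r': "(\<forall>v. v \<notin> {6..<Suc k + 6} \<longrightarrow> r' v = r v) \<and> (\<forall>j<Suc k. r' (j + 6) \<le> r 1)"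
    then have "holds (balls k \<phi>) (r(k + 6 := r' (k + 6))) E" by blast
    moreover have "\<forall>v. v \<notin> {6..<k + 6} \<longrightarrow> r' v = (r(k + 6 := r' (k + 6))) v"
      using r' by auto
    moreover have "\<forall>j<k. r' (j + 6) \<le> (r(k + 6 := r' (k + 6))) 1" using r' by simp
    ultimately show "holds \<phi> r' E" unfolding Suc by blast
  next
    fix v assume R: ?R and v: "v \<le> r 1"
    show "holds (balls k \<phi>) (r(k + 6 := v)) E" unfolding Suc
    proof (intro allI impI)
      fix r' assume r': "(\<forall>w. w \<notin> {6..<k + 6} \<longrightarrow> r' w = (r(k + 6 := v)) w) \<and>
        (\<forall>j<k. r' (j + 6) \<le> (r(k + 6 := v)) 1)"
      then have "r' (k + 6) = v" by simp
      moreover have "r' w = r w" if "w \<notin> {6..<Suc k + 6}" for w using r' that by auto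
      ultimately show "holds \<phi> r' E" using R r' v by (auto simp: less_Suc_eq)
    qed
  qed
  finally show ?case .
qed

definition sv :: "nat \<Rightarrow> tm" where "sv x = TVar (x + 6)"

text \<open>Variables 3 and 4 stand for an arbitrary argument of \<open>h\<close> and its value, so
  taken over all arguments this demands a positive value at the code.\<close>

definition req :: "nat \<Rightarrow> so_fm \<Rightarrow> bool \<Rightarrow> (nat \<Rightarrow> tm) \<Rightarrow> so_fm" where
  "req N \<phi> b S = fimp (FEq (TVar 3) (codet N \<phi> b S)) (FLess TZero (TVar 4))"

text \<open>
  In the clauses, the variables 1 and 2 are an argument of \<open>h\<close> and its value, 3 and 4 are another
  such pair, 5 is the instance of a quantified variable, and \<open>x + 6\<close> stands for the variable \<open>x\<close>.
\<close>

primrec cls :: "nat \<Rightarrow> so_fm \<Rightarrow> bool \<Rightarrow> so_fm" where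
  "cls N (FEq t u) b = lit b (FEq (tsub sv t) (tsub sv u))"
| "cls N (FLess t u) b = lit b (FLess (tsub sv t) (tsub sv u))"
| "cls N (FIn t X) b = fimp (FEq (TVar 3) (scodet X (tsub sv t))) (lit b (FLess TZero (TVar 4)))"
| "cls N (FNot \<phi>) b = req N \<phi> (\<not> b) sv"
| "cls N (FAnd \<phi> \<psi>) b = (if b then FAnd (req N \<phi> True sv) (req N \<psi> True sv)
     else FAnd (fimp (FEq (TVar 2) (num 1)) (req N \<phi> False sv))
               (fimp (FNot (FEq (TVar 2) (num 1))) (req N \<psi> False sv)))"
| "cls N (FExN x \<phi>) b = (if b then fimp (FEq (TVar 2) (TSuc (TVar 5))) (req N \<phi> True (sv(x := TVar 5)))
     else req N \<phi> False (sv(x := TVar 5)))"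
| "cls N (FExS X \<phi>) b = FEq TZero TZero"

definition clause :: "nat \<Rightarrow> so_fm \<Rightarrow> bool \<Rightarrow> so_fm" where
  "clause N \<phi> b = fimp (FAnd (FEq (TVar 1) (codet N \<phi> b sv)) (FLess TZero (TVar 2))) (cls N \<phi> b)"

primrec subs :: "so_fm \<Rightarrow> so_fm list" where
  "subs (FEq t u) = [FEq t u]"
| "subs (FLess t u) = [FLess t u]"
| "subs (FIn t X) = [FIn t X]"
| "subs (FNot \<phi>) = FNot \<phi> # subs \<phi>"
| "subs (FAnd \<phi> \<psi>) = FAnd \<phi> \<psi> # subs \<phi> @ subs \<psi>"
| "subs (FExN x \<phi>) = FExN x \<phi> # subs \<phi>"
| "subs (FExS X \<phi>) = FExS X \<phi> # subs \<phi>"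

lemma subs_nvars: "\<psi> \<in> set (subs \<phi>) \<Longrightarrow> nvars \<psi> \<subseteq> nvars \<phi>" by (induction \<phi>) auto

lemma subs_arithmetical: "arithmetical_fm \<phi> \<Longrightarrow> \<psi> \<in> set (subs \<phi>) \<Longrightarrow> arithmetical_fm \<psi>"
  by (induction arbitrary: \<psi> rule: arithmetical_fm.induct) (auto intro: arithmetical_fm.intros)

definition clauses :: "nat \<Rightarrow> so_fm list \<Rightarrow> so_fm" where
  "clauses N \<phi>s = foldr (\<lambda>\<phi> \<psi>. FAnd (FAnd (clause N \<phi> True) (clause N \<phi> False)) \<psi>) \<phi>s (FEq TZero TZero)"

lemma holds_clauses: "holds (clauses N \<phi>s) r E \<longleftrightarrow> (\<forall>\<phi>\<in>set \<phi>s. \<forall>b. holds (clause N \<phi> b) r E)"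
  by (induction \<phi>s) (auto simp: clauses_def all_bool_eq)

lemma req_syntax [simp]:
  "set_fv (req N \<phi> b S) = {}" "bounded_fm (req N \<phi> b S)"
  "num_fv (req N \<phi> b S) = {3, 4} \<union> (\<Union>x<N. tm_vars (S x))"
  by (auto simp: req_def intro: bounded_fm.intros)

lemma cls_syntax:
  assumes "nvars \<phi> \<subseteq> {..<N}"
  shows "set_fv (cls N \<phi> b) = {}" "bounded_fm (cls N \<phi> b)"
    "num_fv (cls N \<phi> b) \<subseteq> {1..5} \<union> {6..<N + 6}"
proof -
  show "set_fv (cls N \<phi> b) = {}" by (cases \<phi>) auto
  show "bounded_fm (cls N \<phi> b)" by (cases \<phi>) (auto intro: bounded_fm.intros)
  have sv: "tm_vars (sv x) = {x + 6}" for x by (simp add: sv_def)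
  have upd: "(\<Union>x<N. tm_vars ((sv(y := TVar 5)) x)) \<subseteq> {5} \<union> {6..<N + 6}" for y
    by (auto simp: sv split: if_splits)
  have tm: "tm_vars (tsub sv t) \<subseteq> {6..<N + 6}" if "tm_vars t \<subseteq> {..<N}" for t
    using that by (auto simp: sv)
  have rq: "num_fv (req N \<psi> c sv) \<subseteq> {1..5} \<union> {6..<N + 6}" for \<psi> c by (auto simp: sv)
  have rq': "num_fv (req N \<psi> c (sv(y := TVar 5))) \<subseteq> {1..5} \<union> {6..<N + 6}" for \<psi> c y
    using upd[of y] by (auto split: if_splits)
  show "num_fv (cls N \<phi> b) \<subseteq> {1..5} \<union> {6..<N + 6}"
  proof (cases \<phi>)
    case (FEq t u)
    then show ?thesis using assms tm[of t] tm[of u] by auto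
  next
    case (FLess t u)
    then show ?thesis using assms tm[of t] tm[of u] by auto
  next
    case (FIn t X)
    then show ?thesis using assms tm[of t] by auto
  next
    case (FNot \<psi>)
    then show ?thesis using rq by simp
  next
    case (FAnd \<psi> \<psi>')
    then show ?thesis using rq by simp
  next
    case (FExN x \<psi>)
    then show ?thesis using rq' by simp
  qed simp
qed

lemma clause_syntax:
  assumes "nvars \<phi> \<subseteq> {..<N}"
  shows "set_fv (clause N \<phi> b) = {}" "bounded_fm (clause N \<phi> b)"
    "num_fv (clause N \<phi> b) \<subseteq> {1..5} \<union> {6..<N + 6}"
  using cls_syntax[OF assms, of b]
  by (auto simp: clause_def sv_def intro: bounded_fm.intros)

lemma clauses_syntax:
  assumes "\<And>\<phi>. \<phi> \<in> set \<phi>s \<Longrightarrow> nvars \<phi> \<subseteq> {..<N}"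
  shows "set_fv (clauses N \<phi>s) = {}" "bounded_fm (clauses N \<phi>s)"
    "num_fv (clauses N \<phi>s) \<subseteq> {1..5} \<union> {6..<N + 6}"
  using assms by (induction \<phi>s) (use clause_syntax in \<open>auto simp: clauses_def intro!: bounded_fm.intros\<close>)

text \<open>An instance of a quantified variable is at most the code of the claim about it, so
  variable 5 is bounded by variable 3; the entries of the assignment are at most the code of the
  claim at hand, so they are bounded by variable 1. Only the two arguments of \<open>h\<close>
  remain to be quantified without bound.\<close>

definition hintikka :: "nat \<Rightarrow> so_fm \<Rightarrow> so_fm" where
  "hintikka N \<alpha> = FAnd (req N \<alpha> True (\<lambda>_. TVar 0)) (fall 5 (TSuc (TVar 3)) (balls N (clauses N (subs \<alpha>))))"

lemma hintikka_syntax: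
  assumes "nvars \<alpha> \<subseteq> {..<N}"
  shows "set_fv (hintikka N \<alpha>) = {}" "bounded_fm (hintikka N \<alpha>)" "num_fv (hintikka N \<alpha>) \<subseteq> {0..4}"
proof -
  have sub: "nvars \<phi> \<subseteq> {..<N}" if "\<phi> \<in> set (subs \<alpha>)" for \<phi> using subs_nvars[OF that] assms by simp
  note cl = clauses_syntax[of "subs \<alpha>", OF sub]
  show "set_fv (hintikka N \<alpha>) = {}" "bounded_fm (hintikka N \<alpha>)"
    using cl(1,2) by (auto simp: hintikka_def req_def balls_syntax intro!: bounded_fm.intros)
  have "num_fv (balls N (clauses N (subs \<alpha>))) \<subseteq> {1..5}"
    using balls_syntax(3)[of N "clauses N (subs \<alpha>)"] cl(3) by auto
  then show "num_fv (hintikka N \<alpha>) \<subseteq> {0..4}" by (auto simp: hintikka_def req_def split: if_splits)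
qed

lemma holds_hintikka:
  "holds (hintikka N \<alpha>) r E \<longleftrightarrow> (r 3 = code N \<alpha> True (\<lambda>_. r 0) \<longrightarrow> 0 < r 4) \<and>
    (\<forall>r'. (\<forall>v<5. r' v = r v) \<and> (\<forall>v\<ge>N + 6. r' v = r v) \<and> r' 5 \<le> r 3 \<and> (\<forall>j<N. r' (j + 6) \<le> r 1) \<longrightarrow>
      (\<forall>\<phi>\<in>set (subs \<alpha>). \<forall>b. holds (clause N \<phi> b) r' E))"
proof -
  let ?C = "clauses N (subs \<alpha>)"
  have "(\<forall>z<Suc (r 3). holds (balls N ?C) (r(5 := z)) E) \<longleftrightarrow>
    (\<forall>r'. (\<forall>v<5. r' v = r v) \<and> (\<forall>v\<ge>N + 6. r' v = r v) \<and> r' 5 \<le> r 3 \<and> (\<forall>j<N. r' (j + 6) \<le> r 1) \<longrightarrow> holds ?C r' E)"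
    (is "?L \<longleftrightarrow> ?R")
  proof (intro iffI allI impI)
    fix r' assume L: ?L and r': "(\<forall>v<5. r' v = r v) \<and> (\<forall>v\<ge>N + 6. r' v = r v) \<and> r' 5 \<le> r 3 \<and> (\<forall>j<N. r' (j + 6) \<le> r 1)"
    then have "holds (balls N ?C) (r(5 := r' 5)) E" by auto
    moreover have "\<forall>v. v \<notin> {6..<N + 6} \<longrightarrow> r' v = (r(5 := r' 5)) v"
    proof (intro allI impI)
      fix v assume "v \<notin> {6..<N + 6}"
      then have "v < 5 \<or> v = 5 \<or> N + 6 \<le> v" by auto
      then show "r' v = (r(5 := r' 5)) v" using r' by auto
    qed
    moreover have "\<forall>j<N. r' (j + 6) \<le> (r(5 := r' 5)) 1" using r' by simp
    ultimately show "holds ?C r' E" unfolding holds_balls by blast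
  next
    fix z assume R: ?R and z: "z < Suc (r 3)"
    show "holds (balls N ?C) (r(5 := z)) E" unfolding holds_balls
    proof (intro allI impI)
      fix r' assume r': "(\<forall>v. v \<notin> {6..<N + 6} \<longrightarrow> r' v = (r(5 := z)) v) \<and> (\<forall>j<N. r' (j + 6) \<le> (r(5 := z)) 1)"
      then have "\<forall>v<5. r' v = r v" "\<forall>v\<ge>N + 6. r' v = r v" "r' 5 = z" by auto
      then show "holds ?C r' E" using R r' z by auto
    qed
  qed
  then show ?thesis by (simp add: hintikka_def req_def holds_clauses)
qed

text \<open>The value of a claim tells why it is true: for a false conjunction which side fails (1
  for the first, 2 for the second), for a true existential formula the witness plus 1. The shift
  reserves 0 for claims that are not made.\<close>

definition wit :: "so_fm \<Rightarrow> bool \<Rightarrow> (nat \<Rightarrow> nat) \<Rightarrow> (nat \<Rightarrow> nat set) \<Rightarrow> nat" where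
  "wit \<phi> b e E = (case (\<phi>, b) of
     (FAnd \<psi> _, False) \<Rightarrow> if holds \<psi> e E then 2 else 1
   | (FExN x \<psi>, True) \<Rightarrow> Suc (SOME z. holds \<psi> (e(x := z)) E)
   | _ \<Rightarrow> 1)"

lemma wit_cong:
  assumes "\<forall>x\<in>nvars \<phi>. e x = e' x"
  shows "wit \<phi> b e E = wit \<phi> b e' E"
proof -
  have "holds \<psi> (e(x := z)) E = holds \<psi> (e'(x := z)) E" if "\<phi> = FExN x \<psi>" for x \<psi> z
    by (rule holds_cong) (use assms that num_fv_nvars[of \<psi>] in auto)
  moreover have "holds \<psi> e E = holds \<psi> e' E" if "\<phi> = FAnd \<psi> \<psi>'" for \<psi> \<psi>'
    by (rule holds_cong) (use assms that num_fv_nvars[of \<psi>] in auto)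
  ultimately show ?thesis unfolding wit_def by (auto split: so_fm.splits bool.splits)
qed

lemma clause_complete:
  assumes "arithmetical_fm \<phi>" "nvars \<phi> \<subseteq> {..<N}"
    and h: "\<And>\<phi> b e. nvars \<phi> \<subseteq> {..<N} \<Longrightarrow> h (code N \<phi> b e) = (if holds \<phi> e E = b then wit \<phi> b e E else 0)"
      "\<And>X a. h (scode X a) = (if a \<in> E X then 1 else 0)"
    and r: "r 2 = h (r 1)" "r 4 = h (r 3)"
  shows "holds (clause N \<phi> b) r F"
proof -
  define e where "e = (\<lambda>x. r (x + 6))"
  have sv: "(\<lambda>x. tm_val r (sv x)) = e" "(\<lambda>x. tm_val r (if x = y then TVar 5 else sv x)) = e(y := r 5)" for y
    by (auto simp: sv_def e_def)
  have req: "holds (req N \<psi> c S) r F" if "holds \<psi> (\<lambda>x. tm_val r (S x)) E = c" "nvars \<psi> \<subseteq> {..<N}" for \<psi> c S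
  proof -
    have "0 < wit \<psi> c (\<lambda>x. tm_val r (S x)) E" by (auto simp: wit_def split: so_fm.splits bool.splits)
    then show ?thesis using that r(2) h(1)[of \<psi> c "\<lambda>x. tm_val r (S x)"] by (simp add: req_def)
  qed
  have "holds (cls N \<phi> b) r F" if "r 1 = code N \<phi> b e" "0 < r 2"
  proof -
    have val: "holds \<phi> e E = b" "r 2 = wit \<phi> b e E" using that r(1) h(1)[OF assms(2), of b e] by (auto split: if_splits)
    show ?thesis using assms(1)
    proof cases
      case (3 t X)
      then show ?thesis using val(1) r(2) h(2)[of X "tm_val e t"] sv by auto
    next
      case (4 \<psi>)
      then show ?thesis using val(1) req[of \<psi> sv "\<not> b"] assms(2) sv(1) by (cases b) simp_all
    next
      case (5 \<psi> \<psi>')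
      show ?thesis
      proof (cases b)
        case True
        then show ?thesis using 5 val(1) req[of \<psi> sv True] req[of \<psi>' sv True] assms(2) sv by simp
      next
        case False
        then have "r 2 = (if holds \<psi> e E then 2 else 1)" using val(2) 5 by (simp add: wit_def)
        then show ?thesis using False 5 val(1) req[of \<psi> sv False] req[of \<psi>' sv False] assms(2) sv by auto
      qed
    next
      case (6 \<psi> x)
      show ?thesis
      proof (cases b)
        case True
        then have "\<exists>z. holds \<psi> (e(x := z)) E" using val(1) 6 by simp
        moreover have "r 2 = Suc (SOME z. holds \<psi> (e(x := z)) E)" using val(2) 6 True by (simp add: wit_def)
        ultimately have "holds \<psi> (e(x := r 5)) E" if "r 2 = Suc (r 5)" using that someI_ex by (metis nat.inject)
        then show ?thesis using True 6 req[of \<psi> "sv(x := TVar 5)" True] assms(2) by (auto simp: sv(2))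
      next
        case False
        then show ?thesis using 6 val(1) req[of \<psi> "sv(x := TVar 5)" False] assms(2) by (auto simp: sv(2))
      qed
    qed (use val(1) sv in simp_all)
  qed
  then show ?thesis by (simp add: clause_def sv)
qed

text \<open>Induction on the formula for both truth values at once, as negation exchanges them. A
  clause is instantiated with the code of the claim as the first argument of \<open>h\<close> and
  the code of the claim it calls for as the second; \<open>code_ge\<close> provides the
  bounds.\<close>

lemma clause_sound:
  assumes "arithmetical_fm \<phi>" "nvars \<phi> \<subseteq> {..<N}"
    and "\<And>r \<psi> b. r 2 = h (r 1) \<Longrightarrow> r 4 = h (r 3) \<Longrightarrow> r 5 \<le> r 3 \<Longrightarrow> (\<forall>j<N. r (j + 6) \<le> r 1) \<Longrightarrow>
      \<psi> \<in> set (subs \<phi>) \<Longrightarrow> holds (clause N \<psi> b) r F"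
    and "0 < h (code N \<phi> b e)"
  shows "holds \<phi> e (\<lambda>X. {a. 0 < h (scode X a)}) = b"
  using assms
proof (induction arbitrary: b e rule: arithmetical_fm.induct)
  let ?r = "\<lambda>i j z e v. if v = Suc 0 then i else if v = 2 then h i else if v = 3 then j else if v = 4 then h j
    else if v = 5 then z else e (v - 6)"
  have sv: "(\<lambda>x. tm_val (?r i j z e) (sv x)) = e"
    "(\<lambda>x. tm_val (?r i j z e) (if x = y then TVar 5 else sv x)) = e(y := z)" for i j z y and e :: env
    by (auto simp: sv_def)
  have step: "holds (cls N \<psi> b) (?r (code N \<psi> b e) j z e) F"
    if cl: "\<And>r \<psi> b. r 2 = h (r 1) \<Longrightarrow> r 4 = h (r 3) \<Longrightarrow> r 5 \<le> r 3 \<Longrightarrow> (\<forall>j<N. r (j + 6) \<le> r 1) \<Longrightarrow>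
      \<psi> \<in> set (subs \<phi>) \<Longrightarrow> holds (clause N \<psi> b) r F" and "0 < h (code N \<psi> b e)" "z \<le> j" "\<psi> \<in> set (subs \<phi>)"
    for \<phi> \<psi> b e j z
  proof -
    have "holds (clause N \<psi> b) (?r (code N \<psi> b e) j z e) F"
      by (rule cl) (use that code_ge[of _ N e \<psi> b] in auto)
    then show ?thesis using that(2) by (simp add: clause_def sv)
  qed
  {
    case (1 t u)
    then show ?case using step[where \<phi> = "FEq t u" and z = 0 and j = 0, OF 1(2,3)] by (simp add: sv)
  next
    case (2 t u)
    then show ?case using step[where \<phi> = "FLess t u" and z = 0 and j = 0, OF 2(2,3)] by (simp add: sv)
  next
    case (3 t X)
    then show ?case using step[where \<phi> = "FIn t X" and z = 0 and j = "scode X (tm_val e t)", OF 3(2,3)] by (simp add: sv)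
  next
    case (4 \<phi>)
    have "0 < h (code N \<phi> (\<not> b) e)"
      using step[where \<phi> = "FNot \<phi>" and z = 0 and j = "code N \<phi> (\<not> b) e", OF 4(4,5)] by (simp add: sv req_def)
    then show ?case using 4 by simp
  next
    case (5 \<phi> \<psi>)
    have IH: "0 < h (code N \<phi> b e) \<Longrightarrow> holds \<phi> e (\<lambda>X. {a. 0 < h (scode X a)}) = b"
      "0 < h (code N \<psi> b e) \<Longrightarrow> holds \<psi> e (\<lambda>X. {a. 0 < h (scode X a)}) = b"
      using 5 by simp_all
    show ?case
    proof (cases b)
      case True
      then show ?thesis using IH step[where \<phi> = "FAnd \<phi> \<psi>" and z = 0 and j = "code N \<phi> b e", OF 5(6,7)] step[where \<phi> = "FAnd \<phi> \<psi>" and z = 0 and j = "code N \<psi> b e", OF 5(6,7)]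
        by (simp add: sv req_def)
    next
      case False
      then have "0 < h (code N \<phi> b e) \<or> 0 < h (code N \<psi> b e)"
        using step[where \<phi> = "FAnd \<phi> \<psi>" and z = 0 and j = "code N \<phi> b e", OF 5(6,7)] step[where \<phi> = "FAnd \<phi> \<psi>" and z = 0 and j = "code N \<psi> b e", OF 5(6,7)]
        by (auto simp: sv req_def)
      then show ?thesis using IH False by auto
    qed
  next
    case (6 \<phi> x)
    have x: "x < N" using 6(3) by simp
    have IH: "0 < h (code N \<phi> b e) \<Longrightarrow> holds \<phi> e (\<lambda>X. {a. 0 < h (scode X a)}) = b" for e
      using 6 by simp
    have z: "z \<le> code N \<phi> b (e(x := z))" for z using code_ge[OF x, of "e(x := z)" \<phi> b] by simp
    show ?case
    proof (cases b)
      case True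
      define z where "z = h (code N (FExN x \<phi>) b e) - 1"
      then have "h (code N (FExN x \<phi>) b e) = Suc z" using 6(5) by simp
      then have "0 < h (code N \<phi> b (e(x := z)))"
        using step[where \<phi> = "FExN x \<phi>", OF 6(4,5) z[of z]] True by (auto simp: sv req_def)
      then show ?thesis using IH True by auto
    next
      case False
      have "0 < h (code N \<phi> b (e(x := z)))" for z
        using step[where \<phi> = "FExN x \<phi>", OF 6(4,5) z[of z]] False by (auto simp: sv req_def)
      then show ?thesis using IH False by auto
    qed
  }
qed

text \<open>Variables above 4 repeat the last value; they are not free in the matrix.\<close>

definition quint :: "nat \<Rightarrow> nat \<Rightarrow> nat \<Rightarrow> nat \<Rightarrow> nat \<Rightarrow> env" where
  "quint n i u j w = (\<lambda>v. [n, i, u, j, w] ! min v 4)"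

theorem Sigma11_normal_form:
  assumes "A \<in> Sigma11"
  obtains Q where "bounded_fm Q" "set_fv Q = {}" "num_fv Q \<subseteq> {0..4}"
    "\<And>n. n \<in> A \<longleftrightarrow> (\<exists>h. \<forall>i j. holds Q (quint n i (h i) j (h j)) (\<lambda>_. {}))"
proof -
  obtain \<phi> where \<phi>: "Sigma11_fm \<phi>" "num_fv \<phi> \<subseteq> {0}" "set_fv \<phi> = {}"
    and A: "A = {n. holds \<phi> (\<lambda>_. n) (\<lambda>_. {})}"
    using assms by (auto simp: Sigma11_def definable_by_def)
  obtain \<alpha> where \<alpha>: "arithmetical_fm \<alpha>" "num_fv \<alpha> \<subseteq> {0}"
    and A': "\<And>n. n \<in> A \<longleftrightarrow> (\<exists>E. holds \<alpha> (\<lambda>_. n) E)"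
    using strip_set_quantifiers[OF \<phi>(1)] \<phi>(2,3) unfolding A by auto
  obtain N where N: "nvars \<alpha> \<subseteq> {..<N}" using ex_register_bound[of \<alpha>] by blast
  have sub: "nvars \<psi> \<subseteq> {..<N}" "arithmetical_fm \<psi>" if "\<psi> \<in> set (subs \<alpha>)" for \<psi>
    using subs_nvars[OF that] subs_arithmetical[OF \<alpha>(1) that] N by auto
  have "n \<in> A \<longleftrightarrow> (\<exists>h. \<forall>i j. holds (hintikka N \<alpha>) (quint n i (h i) j (h j)) (\<lambda>_. {}))" for n
  proof
    assume "n \<in> A"
    then obtain E where E: "holds \<alpha> (\<lambda>_. n) E" using A' by blast
    \<comment> \<open>The code determines \<open>\<phi>\<close>, \<open>b\<close> and the values of
      \<open>e\<close> below \<open>N\<close>, and truth and witness depend on nothing else; so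
      there is only one possible value for \<open>u\<close>.\<close>
    define h where "h i = (if \<exists>\<phi> b e. nvars \<phi> \<subseteq> {..<N} \<and> i = code N \<phi> b e \<and> holds \<phi> e E = b
      then (SOME u. \<exists>\<phi> b e. nvars \<phi> \<subseteq> {..<N} \<and> i = code N \<phi> b e \<and> u = wit \<phi> b e E)
      else if \<exists>X a. i = scode X a \<and> a \<in> E X then 1 else 0)" for i
    have h1: "h (code N \<phi> b e) = (if holds \<phi> e E = b then wit \<phi> b e E else 0)"
      if v: "nvars \<phi> \<subseteq> {..<N}" for \<phi> b e
    proof -
      have eq: "holds \<phi> e' E = holds \<phi> e E \<and> wit \<phi> b e' E = wit \<phi> b e E" if "\<forall>j<N. e j = e' j" for e'
      proof
        show "holds \<phi> e' E = holds \<phi> e E"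
          by (rule holds_cong) (use that v num_fv_nvars[of \<phi>] in auto)
        show "wit \<phi> b e' E = wit \<phi> b e E" by (rule wit_cong) (use that v in auto)
      qed
      have "(\<exists>\<phi>' b' e'. nvars \<phi>' \<subseteq> {..<N} \<and> code N \<phi> b e = code N \<phi>' b' e' \<and> holds \<phi>' e' E = b') \<longleftrightarrow>
          holds \<phi> e E = b" unfolding code_inject using v eq by blast
      moreover have "(\<exists>\<phi>' b' e'. nvars \<phi>' \<subseteq> {..<N} \<and> code N \<phi> b e = code N \<phi>' b' e' \<and> u = wit \<phi>' b' e' E) \<longleftrightarrow>
          u = wit \<phi> b e E" for u unfolding code_inject using v eq by blast
      ultimately show ?thesis unfolding h_def using code_inject(3) by simp
    qed
    have h2: "h (scode X a) = (if a \<in> E X then 1 else 0)" for X a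
      unfolding h_def using code_inject(3)[symmetric] by (simp add: code_inject(2))
    have "holds (hintikka N \<alpha>) (quint n i (h i) j (h j)) (\<lambda>_. {})" for i j
      unfolding holds_hintikka
    proof (intro conjI impI allI ballI)
      assume "quint n i (h i) j (h j) 3 = code N \<alpha> True (\<lambda>_. quint n i (h i) j (h j) 0)"
      then have "h j = wit \<alpha> True (\<lambda>_. n) E" using h1[OF N, of True "\<lambda>_. n"] E by (simp add: quint_def)
      then show "0 < quint n i (h i) j (h j) 4"
        by (auto simp: quint_def wit_def split: so_fm.splits bool.splits)
    next
      fix r \<psi> b
      assume r: "(\<forall>v<5. r v = quint n i (h i) j (h j) v) \<and>
        (\<forall>v\<ge>N + 6. r v = quint n i (h i) j (h j) v) \<and>
        r 5 \<le> quint n i (h i) j (h j) 3 \<and> (\<forall>k<N. r (k + 6) \<le> quint n i (h i) j (h j) 1)"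
        and \<psi>: "\<psi> \<in> set (subs \<alpha>)"
      have "r 1 = i" "r 2 = h i" "r 3 = j" "r 4 = h j" using r by (simp_all add: quint_def)
      then show "holds (clause N \<psi> b) r (\<lambda>_. {})"
        using clause_complete[OF sub(2)[OF \<psi>] sub(1)[OF \<psi>] h1 h2, of r] by simp
    qed
    then show "\<exists>h. \<forall>i j. holds (hintikka N \<alpha>) (quint n i (h i) j (h j)) (\<lambda>_. {})" by blast
  next
    assume "\<exists>h. \<forall>i j. holds (hintikka N \<alpha>) (quint n i (h i) j (h j)) (\<lambda>_. {})"
    then obtain h where Q: "\<And>i j. holds (hintikka N \<alpha>) (quint n i (h i) j (h j)) (\<lambda>_. {})" by blast
    let ?c = "code N \<alpha> True (\<lambda>_. n)"
    have root: "0 < h ?c" using Q[of 0 ?c] unfolding holds_hintikka by (simp add: quint_def)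
    have "holds \<alpha> (\<lambda>_. n) (\<lambda>X. {a. 0 < h (scode X a)}) = True"
    proof (rule clause_sound[where h = h and F = "\<lambda>_. {}", OF \<alpha>(1) N _ root])
      fix r :: env and \<psi> b
      assume r: "r 2 = h (r 1)" "r 4 = h (r 3)" "r 5 \<le> r 3" "\<forall>j<N. r (j + 6) \<le> r 1"
        and \<psi>: "\<psi> \<in> set (subs \<alpha>)"
      let ?q = "quint n (r 1) (h (r 1)) (r 3) (h (r 3))"
      \<comment> \<open>The matrix quantifies over assignments that agree with \<open>?q\<close> off
        the variables of the clauses. Changing \<open>r\<close> there makes it such an assignment
        and does not affect the clause.\<close>
      define r' where "r' = (\<lambda>v. if v = 0 \<or> N + 6 \<le> v then ?q v else r v)"
      have "\<forall>v<5. r' v = ?q v"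
      proof (intro allI impI)
        fix v :: nat assume "v < 5"
        then have "v = 0 \<or> v = 1 \<or> v = 2 \<or> v = 3 \<or> v = 4" by arith
        then show "r' v = ?q v" using r by (auto simp: r'_def quint_def)
      qed
      moreover have "\<forall>v\<ge>N + 6. r' v = ?q v" "r' 5 \<le> ?q 3" "\<forall>k<N. r' (k + 6) \<le> ?q 1"
        using r by (simp_all add: r'_def quint_def)
      ultimately have cl: "holds (clause N \<psi> b) r' (\<lambda>_. {})"
        using Q[of "r 1" "r 3"] \<psi> unfolding holds_hintikka by blast
      have "holds (clause N \<psi> b) r (\<lambda>_. {}) \<longleftrightarrow> holds (clause N \<psi> b) r' (\<lambda>_. {})"
        by (rule holds_cong) (use clause_syntax(3)[OF sub(1)[OF \<psi>], of b] in \<open>auto simp: r'_def\<close>)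
      then show "holds (clause N \<psi> b) r (\<lambda>_. {})" using cl by simp
    qed
    then show "n \<in> A" using A' by blast
  qed
  with hintikka_syntax[OF N] show thesis by (intro that[of "hintikka N \<alpha>"]) auto
qed

section \<open>Programs for \<open>\<Sigma>\<^sup>1\<^sub>1\<close> sets\<close>

text \<open>
  The program guesses the values \<open>h 0\<close>, \<open>h 1\<close>, ... one after the other and keeps all of them as a
  stack in a single register; after each guess, it checks the matrix for all pairs of arguments
  guessed so far by popping two copies of the stack.
\<close>

primrec hist :: "(nat \<Rightarrow> nat) \<Rightarrow> nat \<Rightarrow> nat" where
  "hist h 0 = 0" | "hist h (Suc m) = pj (h m) (hist h m)"

text \<open>Unpairing by guessing: both components are guessed and their pair is compared with
  register \<open>T\<close>; by injectivity only the right guess survives.\<close>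

definition pop :: "nat \<Rightarrow> nat \<Rightarrow> nat \<Rightarrow> cmd list" where
  "pop s u T = [Clear u, Guess u, Clear 9, Guess 9,
     Check (tr s True (FEq (TVar T) (pit (TVar u) (TVar 9)))), Copy T 9]"

definition pops :: "nat \<Rightarrow> cmd list \<Rightarrow> nat \<Rightarrow> nat \<Rightarrow> nat \<Rightarrow> nat \<Rightarrow> nat \<Rightarrow> cmd list" where
  "pops s c i u T m H = [Copy i m, Copy T H, Loop i (pop s u T @ [Check c])]"

lemma win_pop:
  assumes "u < s" "T < s" "9 < s" "distinct [u, T, 9]"
  shows "win fin \<Phi> (pop s u T @ ks) r \<longleftrightarrow>
    (\<exists>a b. r T = pj a b \<and> win fin \<Phi> ks (r(u := a, 9 := b, T := b)))"
proof -
  have "win fin \<Phi> (tr s True (FEq (TVar T) (pit (TVar u) (TVar 9)))) r' \<longleftrightarrow> r' T = pj (r' u) (r' 9)" for r'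
    using assms by (subst win_tr_FEq) auto
  then show ?thesis using assms unfolding pop_def by (simp del: tr.simps)
qed

text \<open>\<open>Loop\<close> decrements its counter before the body, so the counter is
  \<open>m\<close> at the moment when \<open>h m\<close> is popped from
  \<open>hist h (Suc m)\<close>.\<close>

lemma win_pop_loop:
  assumes "u < s" "T < s" "9 < s" "distinct [i, u, T, 9]" "r T = hist h (r i)"
  shows "win fin \<Phi> [Loop i (pop s u T @ [Check c])] r \<longleftrightarrow>
    (\<forall>k<r i. win fin \<Phi> c (r(i := k, u := h k, 9 := hist h k, T := hist h k)))"
  using assms(5)
proof (induction "r i" arbitrary: r)
  case 0
  then show ?case by (simp add: win_Loop)
next
  case (Suc m)
  have d: "u \<noteq> T" "u \<noteq> 9" "T \<noteq> 9" "i \<noteq> u" "i \<noteq> T" "i \<noteq> 9" using assms(4) by auto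
  define r' where "r' = r(i := m, u := h m, 9 := hist h m, T := hist h m)"
  have rT: "(r(i := r i - 1)) T = pj (h m) (hist h m)" using Suc d by (simp flip: Suc.hyps(2))
  have ri: "r i - 1 = m" "r i \<noteq> 0" using Suc.hyps(2) by simp_all
  have "win fin \<Phi> [Loop i (pop s u T @ [Check c])] r \<longleftrightarrow>
      win fin \<Phi> ((pop s u T @ [Check c]) @ [Loop i (pop s u T @ [Check c])]) (r(i := r i - 1))"
    using ri(2) by (subst win_Loop) simp
  also have "\<dots> \<longleftrightarrow> win fin \<Phi> ([Check c, Loop i (pop s u T @ [Check c])]) r'"
    unfolding append_assoc append.simps win_pop[OF assms(1-3) distinct_tl[OF assms(4), simplified list.sel]] rT pj_inject
    by (simp add: r'_def ri(1)[simplified])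
  also have "\<dots> \<longleftrightarrow> win fin \<Phi> c r' \<and> win fin \<Phi> [Loop i (pop s u T @ [Check c])] r'"
    by simp
  also have "win fin \<Phi> [Loop i (pop s u T @ [Check c])] r' \<longleftrightarrow>
      (\<forall>k<r' i. win fin \<Phi> c (r'(i := k, u := h k, 9 := hist h k, T := hist h k)))"
    by (rule Suc.hyps(1)) (use d in \<open>simp_all add: r'_def\<close>)
  also have "\<dots> \<longleftrightarrow> (\<forall>k<m. win fin \<Phi> c (r(i := k, u := h k, 9 := hist h k, T := hist h k)))"
  proof -
    have "r'(i := k, u := h k, 9 := hist h k, T := hist h k) = r(i := k, u := h k, 9 := hist h k, T := hist h k)" for k
      by (auto simp: r'_def)
    moreover have "r' i = m" using d by (simp add: r'_def)
    ultimately show ?thesis by simp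
  qed
  finally show ?case unfolding Suc.hyps(2)[symmetric] r'_def All_less_Suc by blast
qed

lemma win_pops:
  assumes "u < s" "T < s" "9 < s" "distinct [i, u, T, 9]" "m \<notin> {i, T}" "H \<notin> {i, T}" "r H = hist h (r m)"
  shows "win fin \<Phi> (pops s c i u T m H) r \<longleftrightarrow>
    (\<forall>k<r m. win fin \<Phi> c (r(i := k, u := h k, 9 := hist h k, T := hist h k)))"
proof -
  let ?r = "r(i := r m, T := r H)"
  have d: "u \<noteq> T" "u \<noteq> 9" "T \<noteq> 9" "i \<noteq> u" "i \<noteq> T" "i \<noteq> 9" using assms(4) by auto
  have "win fin \<Phi> (pops s c i u T m H) r \<longleftrightarrow> win fin \<Phi> [Loop i (pop s u T @ [Check c])] ?r"
    using assms(6) d by (simp add: pops_def)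
  also have "\<dots> \<longleftrightarrow> (\<forall>k<?r i. win fin \<Phi> c (?r(i := k, u := h k, 9 := hist h k, T := hist h k)))"
    by (rule win_pop_loop[OF assms(1-4)]) (use assms(7) d in simp)
  also have "\<dots> \<longleftrightarrow> (\<forall>k<r m. win fin \<Phi> c (r(i := k, u := h k, 9 := hist h k, T := hist h k)))"
  proof -
    have "?r(i := k, u := h k, 9 := hist h k, T := hist h k) = r(i := k, u := h k, 9 := hist h k, T := hist h k)" for k
      by auto
    moreover have "?r i = r m" using d by simp
    ultimately show ?thesis by simp
  qed
  finally show ?thesis .
qed

text \<open>Registers 0 to 4 hold the arguments of the matrix, 5 the number of values guessed, 6 the
  stack, and 7 and 8 the two copies being popped; 9 and, in \<open>body\<close>, also 10 are
  auxiliary.\<close>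

definition checks :: "nat \<Rightarrow> so_fm \<Rightarrow> cmd list" where
  "checks s Q = pops s (pops s (tr s True Q) 3 4 8 5 6) 1 2 7 5 6"

lemma win_checks:
  assumes Q: "bounded_fm Q" "set_fv Q = {}" "num_fv Q \<subseteq> {0..4}" "\<forall>x\<in>nvars Q. x < s"
    and s: "9 < s" and r: "r 6 = hist h (r 5)"
  shows "win fin \<Phi> (checks s Q) r \<longleftrightarrow>
    (\<forall>i<r 5. \<forall>j<r 5. holds Q (quint (r 0) i (h i) j (h j)) (\<lambda>_. {}))"
proof -
  let ?r = "\<lambda>i. r(1 := i, 2 := h i, 9 := hist h i, 7 := hist h i)"
  have "win fin \<Phi> (pops s (tr s True Q) 3 4 8 5 6) (?r i) \<longleftrightarrow>
      (\<forall>j<r 5. holds Q (quint (r 0) i (h i) j (h j)) (\<lambda>_. {}))" for i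
  proof -
    have "holds Q ((?r i)(3 := j, 4 := h j, 9 := hist h j, 8 := hist h j)) (\<lambda>_. {}) \<longleftrightarrow>
        holds Q (quint (r 0) i (h i) j (h j)) (\<lambda>_. {})" for j
    proof (rule holds_cong)
      fix x assume "x \<in> num_fv Q"
      then have "x = 0 \<or> x = 1 \<or> x = 2 \<or> x = 3 \<or> x = 4" using Q(3) by auto
      then show "((?r i)(3 := j, 4 := h j, 9 := hist h j, 8 := hist h j)) x = quint (r 0) i (h i) j (h j) x"
        by (auto simp: quint_def)
    qed simp
    moreover have "win fin \<Phi> (pops s (tr s True Q) 3 4 8 5 6) (?r i) \<longleftrightarrow>
        (\<forall>j<(?r i) 5. win fin \<Phi> (tr s True Q) ((?r i)(3 := j, 4 := h j, 9 := hist h j, 8 := hist h j)))"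
      by (rule win_pops) (use s r in simp_all)
    ultimately show ?thesis using win_tr[OF Q(1,2,4), where b = True and E = "\<lambda>_. {}"] by simp
  qed
  moreover have "win fin \<Phi> (checks s Q) r \<longleftrightarrow>
      (\<forall>i<r 5. win fin \<Phi> (pops s (tr s True Q) 3 4 8 5 6) (?r i))"
    unfolding checks_def by (rule win_pops) (use s r in simp_all)
  ultimately show ?thesis by simp
qed

definition body :: "nat \<Rightarrow> so_fm \<Rightarrow> cmd list" where
  "body s Q = [Clear 9, Guess 9, Copy 10 6, Clear 6, Guess 6,
     Check (tr s True (FEq (TVar 6) (pit (TVar 9) (TVar 10)))), Incr 5, Check (checks s Q)]"

lemma win_body:
  assumes "10 < s"
  shows "win fin \<Phi> (body s Q @ ks) r \<longleftrightarrow> (\<exists>v. let r' = r(9 := v, 10 := r 6, 6 := pj v (r 6), 5 := Suc (r 5)) in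
    win fin \<Phi> (checks s Q) r' \<and> win fin \<Phi> ks r')"
proof -
  have "win fin \<Phi> (tr s True (FEq (TVar 6) (pit (TVar 9) (TVar 10)))) r' \<longleftrightarrow> r' 6 = pj (r' 9) (r' 10)" for r'
    using assms by (subst win_tr_FEq) auto
  then have "win fin \<Phi> (body s Q @ ks) r \<longleftrightarrow> (\<exists>v w. w = pj v (r 6) \<and>
    win fin \<Phi> (checks s Q) (r(9 := v, 10 := r 6, 6 := w, 5 := Suc (r 5))) \<and>
    win fin \<Phi> ks (r(9 := v, 10 := r 6, 6 := w, 5 := Suc (r 5))))"
    unfolding body_def by (simp del: tr.simps add: fun_upd_apply)
  then show ?thesis by (simp add: Let_def)
qed

theorem Sigma11_program:
  assumes "A \<in> Sigma11"
  obtains prog where "\<And>n. n \<in> A \<longleftrightarrow> (\<exists>V. closed V \<and> (prog, start n) \<in> V)"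
proof -
  obtain Q where Q: "bounded_fm Q" "set_fv Q = {}" "num_fv Q \<subseteq> {0..4}"
    and A: "\<And>n. n \<in> A \<longleftrightarrow> (\<exists>h. \<forall>i j. holds Q (quint n i (h i) j (h j)) (\<lambda>_. {}))"
    using Sigma11_normal_form[OF assms] by metis
  obtain s0 where s0: "\<forall>x\<in>nvars Q. x < s0" using ex_register_bound by blast
  define s where "s = max 11 s0"
  have s: "\<forall>x\<in>nvars Q. x < s" "9 < s" "10 < s" using s0 by (auto simp: s_def)
  note checks = win_checks[OF Q s(1,2)]
  let ?b = "body s Q"
  show thesis
  proof (rule that[of "[Forever ?b]"], rule iffI)
    fix n assume "n \<in> A"
    then obtain h where h: "\<And>i j. holds Q (quint n i (h i) j (h j)) (\<lambda>_. {})" using A by blast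
    \<comment> \<open>Invariant of the outer loop: the stack in register 6 consists of the first
      \<open>r 5\<close> values of one fixed function \<open>h\<close>.\<close>
    define \<Phi> where "\<Phi> = (\<lambda>a (r :: env). a = ?b \<and> r 0 = n \<and> r 6 = hist h (r 5))"
    define V where "V = {(l, r). win False \<Phi> l r}"
    have \<Phi>: "(a @ [Forever a], r) \<in> V" if "\<Phi> a r" for a r
    proof -
      have ab: "a = ?b" and r: "r 0 = n" "r 6 = hist h (r 5)" using that by (simp_all add: \<Phi>_def)
      let ?r = "r(9 := h (r 5), 10 := r 6, 6 := pj (h (r 5)) (r 6), 5 := Suc (r 5))"
      have r': "?r 0 = n" "?r 6 = hist h (?r 5)" using r by simp_all
      have "win False \<Phi> (checks s Q) ?r" using checks[of ?r h] h r' by simp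
      moreover have "win False \<Phi> [Forever a] ?r" using r' ab by (simp add: \<Phi>_def)
      ultimately have "win False \<Phi> (body s Q @ [Forever a]) r" unfolding win_body[OF s(3)] Let_def by blast
      then show ?thesis using ab by (simp add: V_def)
    qed
    have "ok V (\<lambda>a r. (a @ [Forever a], r) \<in> V) l r" if "(l, r) \<in> V" for l r
    proof -
      obtain W where W: "good \<Phi> W" "(l, r) \<in> W" using \<open>(l, r) \<in> V\<close> unfolding V_def win_def by blast
      then have "ok W \<Phi> l r" by (auto simp: good_def)
      moreover have "W \<subseteq> V" using W(1) unfolding V_def win_def by blast
      ultimately show ?thesis by (rule ok_mono) (rule \<Phi>)
    qed
    then have "closed V" by (auto simp: closed_def)
    moreover have "([Forever ?b], start n) \<in> V" by (simp add: V_def \<Phi>_def)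
    ultimately show "\<exists>V. closed V \<and> ([Forever ?b], start n) \<in> V" by blast
  next
    fix n assume "\<exists>V. closed V \<and> ([Forever ?b], start n) \<in> V"
    then obtain V where V: "closed V" "([Forever ?b], start n) \<in> V" by blast
    define \<Phi> where "\<Phi> = (\<lambda>a r. (a @ [Forever a], r) \<in> V)"
    have win: "win False \<Phi> l r" if "(l, r) \<in> V" for l r
      using V(1) that unfolding win_def good_def closed_def \<Phi>_def by blast
    define P where "P = (\<lambda>(m :: nat) (r :: env). \<Phi> ?b r \<and> r 0 = n \<and> r 5 = m)"
    define R where "R = (\<lambda>(m :: nat) (r :: env) (r' :: env). win False \<Phi> (checks s Q) r' \<and> (\<exists>v. r' 6 = pj v (r 6)))"
    \<comment> \<open>Dependent choice picks one infinite sequence of rounds. Each round pushes a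
      value on the stack of the round before, so the guesses along the sequence are the values of a
      single function.\<close>
    have "\<exists>f. \<forall>m. P m (f m) \<and> R m (f m) (f (Suc m)) \<and> (m = 0 \<longrightarrow> f m 6 = 0)"
    proof -
      have "\<exists>f. (\<forall>m. (P m (f m) \<and> (m = 0 \<longrightarrow> f m 6 = 0)) \<and> R m (f m) (f (Suc m)))"
      proof (rule dependent_nat_choice)
        have "\<Phi> ?b (start n)" using win[OF V(2)] by simp
        then show "\<exists>r. P 0 r \<and> (0 = 0 \<longrightarrow> r 6 = 0)" by (intro exI[of _ "start n"]) (simp add: P_def)
      next
        fix r m assume r: "P m r \<and> (m = 0 \<longrightarrow> r 6 = 0)"
        then have "win False \<Phi> (?b @ [Forever ?b]) r" using win by (simp add: P_def \<Phi>_def)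
        then obtain v where v: "win False \<Phi> (checks s Q) (r(9 := v, 10 := r 6, 6 := pj v (r 6), 5 := Suc (r 5)))"
          "\<Phi> ?b (r(9 := v, 10 := r 6, 6 := pj v (r 6), 5 := Suc (r 5)))"
          unfolding win_body[OF s(3)] Let_def win_Forever by blast
        then show "\<exists>r'. (P (Suc m) r' \<and> (Suc m = 0 \<longrightarrow> r' 6 = 0)) \<and> R m r r'"
          using r by (intro exI[of _ "r(9 := v, 10 := r 6, 6 := pj v (r 6), 5 := Suc (r 5))"])
            (simp add: P_def R_def pj_inject)
      qed
      then show ?thesis by blast
    qed
    then obtain f where f: "\<And>m. P m (f m)" "\<And>m. R m (f m) (f (Suc m))" "f 0 6 = 0" by metis
    have "\<forall>m. \<exists>v. f (Suc m) 6 = pj v (f m 6)" using f(2) by (auto simp: R_def)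
    then obtain h where h: "\<And>m. f (Suc m) 6 = pj (h m) (f m 6)" by metis
    have hist: "f m 6 = hist h m" for m by (induction m) (simp_all add: f(3) h)
    have "holds Q (quint n i (h i) j (h j)) (\<lambda>_. {})" for i j
    proof -
      \<comment> \<open>In this round the stack contains both \<open>h i\<close> and
        \<open>h j\<close> for the first time, so the matrix is checked for this pair.\<close>
      let ?m = "Suc (max i j)"
      have "f ?m 0 = n" "f ?m 5 = ?m" using f(1)[of ?m] by (simp_all add: P_def)
      moreover have "win False \<Phi> (checks s Q) (f ?m)" using f(2)[of "max i j"] by (simp add: R_def)
      ultimately show ?thesis using checks[of "f ?m" h] hist[of ?m] by (metis less_Suc_eq_le max.cobounded1 max.cobounded2)
    qed
    then show "n \<in> A" using A by blast
  qed
qed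

section \<open>Computability of the reduction\<close>

definition computable :: "nat \<Rightarrow> (nat list \<Rightarrow> nat) \<Rightarrow> bool" where
  "computable k f \<longleftrightarrow> (\<exists>c. \<forall>xs. length xs = k \<longrightarrow> computes c xs (f xs))"

lemma computable_proj: "i < k \<Longrightarrow> computable k (\<lambda>xs. xs ! i)"
  unfolding computable_def by (blast intro: computes.intros(3))

lemma computable_comp:
  assumes "computable 1 (\<lambda>xs. f (xs ! 0))" "computable k a"
  shows "computable k (\<lambda>xs. f (a xs))"
proof -
  obtain c d where c: "\<And>xs. length xs = 1 \<Longrightarrow> computes c xs (f (xs ! 0))"
    and d: "\<And>xs. length xs = k \<Longrightarrow> computes d xs (a xs)"
    using assms unfolding computable_def by blast
  have "computes (Comp c [d]) xs (f (a xs))" if "length xs = k" for xs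
    by (rule computes.intros(4)[where ys = "[a xs]"]) (use c[of "[a xs]"] d[OF that] in auto)
  then show ?thesis unfolding computable_def by blast
qed

lemma computable_comp2:
  assumes "computable 2 (\<lambda>xs. f (xs ! 0) (xs ! 1))" "computable k a" "computable k b"
  shows "computable k (\<lambda>xs. f (a xs) (b xs))"
proof -
  obtain c d e where c: "\<And>xs. length xs = 2 \<Longrightarrow> computes c xs (f (xs ! 0) (xs ! 1))"
    and d: "\<And>xs. length xs = k \<Longrightarrow> computes d xs (a xs)"
    and e: "\<And>xs. length xs = k \<Longrightarrow> computes e xs (b xs)"
    using assms unfolding computable_def by blast
  have "computes (Comp c [d, e]) xs (f (a xs) (b xs))" if "length xs = k" for xs
    by (rule computes.intros(4)[where ys = "[a xs, b xs]"])
      (use c[of "[a xs, b xs]"] d[OF that] e[OF that] in auto)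
  then show ?thesis unfolding computable_def by blast
qed

lemma computable_Suc: "computable k a \<Longrightarrow> computable k (\<lambda>xs. Suc (a xs))"
proof (rule computable_comp[where f = Suc])
  have "computes Succ xs (Suc (xs ! 0))" if "length xs = 1" for xs
    using that computes.intros(2) by (cases xs) auto
  then show "computable 1 (\<lambda>xs. Suc (xs ! 0))" unfolding computable_def by blast
qed

lemma computable_const: "computable k (\<lambda>_. m)"
proof (induction m)
  case 0
  show ?case unfolding computable_def by (blast intro: computes.intros(1))
next
  case (Suc m)
  then show ?case by (rule computable_Suc)
qed

lemma computable_rec:
  assumes f0: "computable k (\<lambda>xs. f 0 xs)"
    and fSuc: "computable (k + 2) (\<lambda>xs. g (xs ! 0) (xs ! 1) (drop 2 xs))"
      "\<And>n xs. length xs = k \<Longrightarrow> f (Suc n) xs = g n (f n xs) xs"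
  shows "computable (Suc k) (\<lambda>xs. f (hd xs) (tl xs))"
proof -
  obtain c where c: "\<And>xs. length xs = k \<Longrightarrow> computes c xs (f 0 xs)"
    using f0 unfolding computable_def by blast
  obtain d where d: "\<And>xs. length xs = k + 2 \<Longrightarrow> computes d xs (g (xs ! 0) (xs ! 1) (drop 2 xs))"
    using fSuc(1) unfolding computable_def by blast
  have rec: "computes (PrimRec c d) (n # xs) (f n xs)" if xs: "length xs = k" for n xs
  proof (induction n)
    case 0
    show ?case using c[OF xs] by (rule computes.intros(5))
  next
    case (Suc n)
    have "computes d (n # f n xs # xs) (f (Suc n) xs)"
      using d[of "n # f n xs # xs"] fSuc(2) xs by simp
    with Suc show ?case by (rule computes.intros(6))
  qed
  have "computes (PrimRec c d) xs (f (hd xs) (tl xs))" if "length xs = Suc k" for xs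
    using that rec by (cases xs) auto
  then show ?thesis unfolding computable_def by blast
qed

lemma computable_rec1:
  assumes "computable 2 (\<lambda>xs. g (xs ! 0) (xs ! 1))" "\<And>n. f (Suc n) = g n (f n)"
  shows "computable 1 (\<lambda>xs. f (xs ! 0))"
proof -
  have "computable (Suc 0) (\<lambda>xs. f (hd xs))"
    using computable_rec[of 0 "\<lambda>n _. f n" "\<lambda>n y _. g n y"] assms computable_const
    by (simp add: numeral_2_eq_2)
  moreover have "hd xs = xs ! 0" if "length xs = Suc 0" for xs :: "nat list"
    using that by (cases xs) auto
  ultimately show ?thesis unfolding computable_def by auto
qed

lemma computable_add: "computable k a \<Longrightarrow> computable k b \<Longrightarrow> computable k (\<lambda>xs. a xs + b xs)"
proof (rule computable_comp2[where f = "(+)"])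
  have "computable (Suc 1) (\<lambda>xs. hd xs + tl xs ! 0)"
    using computable_rec[of 1 "\<lambda>n xs. n + xs ! 0" "\<lambda>n y xs. Suc y"]
      computable_proj[of 0 1] computable_Suc[OF computable_proj[of 1 3]]
    by (simp add: numeral_3_eq_3)
  moreover have "hd xs + tl xs ! 0 = xs ! 0 + xs ! 1" if "length xs = 2" for xs :: "nat list"
    using that by (cases xs) auto
  ultimately show "computable 2 (\<lambda>xs. xs ! 0 + xs ! 1)" unfolding computable_def by (auto simp: numeral_2_eq_2)
qed

lemma computable_power2: "computable k a \<Longrightarrow> computable k (\<lambda>xs. 2 ^ a xs)"
proof (rule computable_comp[where f = "\<lambda>n. 2 ^ n"])
  show "computable 1 (\<lambda>xs. 2 ^ (xs ! 0))"
    by (rule computable_rec1[where f = "\<lambda>n. 2 ^ n" and g = "\<lambda>n y. y + y"])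
      (auto intro!: computable_add computable_proj)
qed

lemma computable_prod_encode:
  assumes "computable k a" "computable k b"
  shows "computable k (\<lambda>xs. prod_encode (a xs, b xs))"
proof -
  have "computable 1 (\<lambda>xs. triangle (xs ! 0))"
    by (rule computable_rec1[where g = "\<lambda>n y. y + Suc n"])
      (auto intro!: computable_add computable_Suc computable_proj)
  then have "computable k (\<lambda>xs. triangle (a xs + b xs))"
    by (rule computable_comp) (rule computable_add[OF assms])
  then show ?thesis unfolding prod_encode_def by (auto intro!: computable_add assms)
qed

text \<open>A rational is coded by its reduced numerator and denominator, and a nonnegative integer
  \<open>z\<close> has the code \<open>2 * z\<close>.\<close>

lemma rat_code_power2: "rat_code (1 / 2 ^ a) = prod_encode (2, 2 ^ Suc a)"
proof -
  have "quotient_of (1 / 2 ^ a) = (1, 2 ^ a)"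
  proof -
    have "1 / 2 ^ a = Fract 1 (2 ^ a)" by (simp add: Fract_of_int_quotient)
    then show ?thesis by (simp add: quotient_of_Fract Rat.normalize_def)
  qed
  moreover have "int_encode 1 = 2" by (simp add: int_encode_def sum_encode_def)
  moreover have "int_encode (2 ^ a) = 2 ^ Suc a"
    by (simp add: int_encode_def sum_encode_def nat_power_eq)
  ultimately show ?thesis by (simp add: rat_code_def)
qed

lemma (in game) computable_formula: "total_computable (\<lambda>n. pctl_code (formula n))"
proof -
  have "computable 1 (\<lambda>xs. pctl_code (formula (xs ! 0)))"
    \<comment> \<open>Apart from the two rationals, the code is built from constants such as
      \<open>pctl_code base\<close>; the unspecified order of the conjunctions in
      \<open>base\<close> is the same for all \<open>n\<close>.\<close>
    unfolding formula_def pctl_code.simps rat_code_power2 mult_2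
    by (intro computable_prod_encode computable_const computable_power2 computable_Suc
        computable_add computable_proj) simp_all
  then obtain c where c: "\<And>xs. length xs = 1 \<Longrightarrow> computes c xs (pctl_code (formula (xs ! 0)))"
    unfolding computable_def by blast
  have "computes c [n] (pctl_code (formula n))" for n using c[of "[n]"] by simp
  then show ?thesis unfolding total_computable_def by blast
qed

lemma in_FG_SAT: "fg_formula \<phi> \<Longrightarrow> pctl_code \<phi> \<in> FG_SAT \<longleftrightarrow> satisfiable \<phi>"
  by (auto simp: FG_SAT_def inj_pctl_code)

lemma in_FG_FINSAT: "fg_formula \<phi> \<Longrightarrow> pctl_code \<phi> \<in> FG_FINSAT \<longleftrightarrow> finitely_satisfiable \<phi>"
  by (auto simp: FG_FINSAT_def inj_pctl_code)

lemma finitely_satisfiable_imp_satisfiable: "finitely_satisfiable \<phi> \<Longrightarrow> satisfiable \<phi>"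
  by (auto simp: finitely_satisfiable_def satisfiable_def)

theorem theorem2:
  shows "hard_for Sigma11 FG_SAT \<and> hard_for Sigma01 FG_FINSAT"
proof
  show "hard_for Sigma11 FG_SAT" unfolding hard_for_def
  proof
    fix A assume "A \<in> Sigma11"
    then obtain prog where A: "\<And>n. n \<in> A \<longleftrightarrow> (\<exists>V. closed V \<and> (prog, start n) \<in> V)"
      using Sigma11_program by metis
    interpret program prog .
    have "n \<in> A \<longleftrightarrow> pctl_code (formula n) \<in> FG_SAT" for n
      unfolding in_FG_SAT[OF fg_base] A r0_def[symmetric]
      using satisfiable_imp_closed[of n] closed_imp_satisfiable(1) by blast
    then show "many_one_reducible A FG_SAT"
      using computable_formula unfolding many_one_reducible_def by blast
  qed
next
  show "hard_for Sigma01 FG_FINSAT" unfolding hard_for_def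
  proof
    fix A assume "A \<in> Sigma01"
    then obtain prog where A: "\<And>n. n \<in> A \<Longrightarrow> \<exists>V. finite V \<and> closed V \<and> (prog, start n) \<in> V"
      "\<And>n V. closed V \<Longrightarrow> (prog, start n) \<in> V \<Longrightarrow> n \<in> A"
      using Sigma01_program by metis
    interpret program prog .
    have "n \<in> A \<longleftrightarrow> pctl_code (formula n) \<in> FG_FINSAT" for n
      unfolding in_FG_FINSAT[OF fg_base]
    proof
      assume "n \<in> A"
      then show "finitely_satisfiable (formula n)"
        using A(1)[of n] closed_imp_satisfiable(2) unfolding r0_def by blast
    next
      \<comment> \<open>Already satisfiability provides a closed set, and by \<open>A(2)\<close>
        every closed set that contains the start certifies membership.\<close>
      assume "finitely_satisfiable (formula n)"
      then show "n \<in> A"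
        using satisfiable_imp_closed[of n] finitely_satisfiable_imp_satisfiable A(2)
        unfolding r0_def by blast
    qed
    then show "many_one_reducible A FG_FINSAT"
      using computable_formula unfolding many_one_reducible_def by blast
  qed
qed

end
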